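(* Let $\mathcal{S}\subset\mathbb{R}^m$ be a locally compact semialgebraic set, let $\mathcal{Q}\subset\mathbb{R}^n$ be a Nash manifold with (divisorial) corners and let $f:\mathcal{S}\to\mathcal{Q}$ be a continuous semialgebraic map. Then for every strictly positive continuous semialgebraic function $\varepsilon:\mathcal{S}\to\mathbb{R}$ there exists a Nash map $g:\mathcal{S}\to\mathcal{Q}$ with $\|f(x)-g(x)\|<\varepsilon(x)$ for all $x\in\mathcal{S}$.
   Context: A Nash map on a semialgebraic set $\mathcal{S}$ is the restriction to $\mathcal{S}$ of a $C^\infty$ semialgebraic map defined on an open semialgebraic neighborhood of $\mathcal{S}$. A Nash manifold with corners is a semialgebraic set that is a $C^\infty$ submanifold with corners of $\mathbb{R}^n$; $\partial\mathcal{Q}$ is the set of its non-smooth points. Standing assumption (divisorial corners): there is a Nash manifold $M\subset\mathbb{R}^n$ of the same dimension containing $\mathcal{Q}$ as a closed subset such that the smallest Nash subset of $M$ containing $\partial\mathcal{Q}$ is a Nash normal-crossings divisor of $M$ (its irreducible components are codimension-one Nash submanifolds meeting transversally). *)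

theory Defs
  imports "HOL-Analysis.Analysis"
begin

inductive_set poly_fun :: "('a::euclidean_space \<Rightarrow> real) set" where
  const: "(\<lambda>x. c) \<in> poly_fun"
| coord: "b \<in> Basis \<Longrightarrow> (\<lambda>x. x \<bullet> b) \<in> poly_fun"
| add: "p \<in> poly_fun \<Longrightarrow> q \<in> poly_fun \<Longrightarrow> (\<lambda>x. p x + q x) \<in> poly_fun"
| mult: "p \<in> poly_fun \<Longrightarrow> q \<in> poly_fun \<Longrightarrow> (\<lambda>x. p x * q x) \<in> poly_fun"

inductive semialgebraic :: "'a::euclidean_space set \<Rightarrow> bool" where
  pos: "p \<in> poly_fun \<Longrightarrow> semialgebraic {x. p x > 0}"
| zero: "p \<in> poly_fun \<Longrightarrow> semialgebraic {x. p x = 0}"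
| union: "semialgebraic A \<Longrightarrow> semialgebraic B \<Longrightarrow> semialgebraic (A \<union> B)"
| compl: "semialgebraic A \<Longrightarrow> semialgebraic (- A)"

definition semialgebraic_map ::
  "'a::euclidean_space set \<Rightarrow> ('a \<Rightarrow> 'b::euclidean_space) \<Rightarrow> bool" where
  "semialgebraic_map S f \<longleftrightarrow> semialgebraic {(x, f x) | x. x \<in> S}"

inductive_set iter_partials ::
  "('a::euclidean_space \<Rightarrow> 'b::real_normed_vector) \<Rightarrow> ('a \<Rightarrow> 'b) set" for f where
  base: "f \<in> iter_partials f"
| step: "g \<in> iter_partials f \<Longrightarrow> i \<in> Basis \<Longrightarrow>
         (\<lambda>x. frechet_derivative g (at x) i) \<in> iter_partials f"

text \<open>f is C-infinity on the open set U: all iterated partial derivatives exist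
  and are (Frechet) differentiable, hence continuous, on U.\<close>
definition smooth_on ::
  "'a::euclidean_space set \<Rightarrow> ('a \<Rightarrow> 'b::real_normed_vector) \<Rightarrow> bool" where
  "smooth_on U f \<longleftrightarrow> open U \<and> (\<forall>g \<in> iter_partials f. g differentiable_on U)"

definition smooth_diffeo ::
  "'a::euclidean_space set \<Rightarrow> 'a set \<Rightarrow> ('a \<Rightarrow> 'a) \<Rightarrow> bool" where
  "smooth_diffeo U V \<phi> \<longleftrightarrow> smooth_on U \<phi> \<and> \<phi> ` U = V \<and>
     (\<exists>\<psi>. smooth_on V \<psi> \<and> (\<forall>x\<in>U. \<psi> (\<phi> x) = x) \<and> (\<forall>y\<in>V. \<phi> (\<psi> y) = y))"

definition corner_model :: "'a::euclidean_space set \<Rightarrow> 'a set \<Rightarrow> 'a set" where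
  "corner_model B C = {y \<in> span B. \<forall>b\<in>C. 0 \<le> y \<bullet> b}"

definition submanifold_with_corners :: "nat \<Rightarrow> 'a::euclidean_space set \<Rightarrow> bool" where
  "submanifold_with_corners d Q \<longleftrightarrow>
     (\<forall>p\<in>Q. \<exists>U V \<phi> B C. open U \<and> p \<in> U \<and> smooth_diffeo U V \<phi> \<and>
        B \<subseteq> Basis \<and> card B = d \<and> C \<subseteq> B \<and> \<phi> ` (Q \<inter> U) = V \<inter> corner_model B C)"

definition submanifold :: "nat \<Rightarrow> 'a::euclidean_space set \<Rightarrow> bool" where
  "submanifold d M \<longleftrightarrow>
     (\<forall>p\<in>M. \<exists>U V \<phi> B. open U \<and> p \<in> U \<and> smooth_diffeo U V \<phi> \<and>
        B \<subseteq> Basis \<and> card B = d \<and> \<phi> ` (M \<inter> U) = V \<inter> span B)"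

definition nonsmooth_points :: "'a::euclidean_space set \<Rightarrow> 'a set" where
  "nonsmooth_points Q = {p \<in> Q. \<not> (\<exists>U d. open U \<and> p \<in> U \<and> submanifold d (Q \<inter> U))}"

definition nash_map_on ::
  "'a::euclidean_space set \<Rightarrow> ('a \<Rightarrow> 'b::euclidean_space) \<Rightarrow> bool" where
  "nash_map_on S g \<longleftrightarrow> (\<exists>U G. open U \<and> semialgebraic U \<and> S \<subseteq> U \<and>
      smooth_on U G \<and> semialgebraic_map U G \<and> (\<forall>x\<in>S. G x = g x))"

definition nash_manifold :: "nat \<Rightarrow> 'a::euclidean_space set \<Rightarrow> bool" where
  "nash_manifold d M \<longleftrightarrow> semialgebraic M \<and> submanifold d M"

definition nash_manifold_with_corners :: "nat \<Rightarrow> 'a::euclidean_space set \<Rightarrow> bool" where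
  "nash_manifold_with_corners d Q \<longleftrightarrow> semialgebraic Q \<and> submanifold_with_corners d Q"

definition nash_subset :: "'a::euclidean_space set \<Rightarrow> 'a set \<Rightarrow> bool" where
  "nash_subset M Z \<longleftrightarrow> (\<exists>h :: 'a \<Rightarrow> real. nash_map_on M h \<and> Z = {x \<in> M. h x = 0})"

definition nash_irreducible :: "'a::euclidean_space set \<Rightarrow> 'a set \<Rightarrow> bool" where
  "nash_irreducible M Y \<longleftrightarrow> nash_subset M Y \<and> Y \<noteq> {} \<and>
     (\<forall>Y1 Y2. nash_subset M Y1 \<longrightarrow> nash_subset M Y2 \<longrightarrow> Y = Y1 \<union> Y2 \<longrightarrow> Y = Y1 \<or> Y = Y2)"

definition nash_components :: "'a::euclidean_space set \<Rightarrow> 'a set \<Rightarrow> 'a set set" where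
  "nash_components M Z = {Y. Y \<subseteq> Z \<and> nash_irreducible M Y \<and>
      (\<forall>Y'. Y \<subseteq> Y' \<longrightarrow> Y' \<subseteq> Z \<longrightarrow> nash_irreducible M Y' \<longrightarrow> Y' = Y)}"

definition tangent_space :: "'a::euclidean_space set \<Rightarrow> 'a \<Rightarrow> 'a set" where
  "tangent_space N x = {v. \<exists>\<gamma> e. e > 0 \<and> \<gamma> 0 = x \<and> (\<forall>t. \<bar>t\<bar> < e \<longrightarrow> \<gamma> t \<in> N) \<and>
       (\<gamma> has_vector_derivative v) (at 0)}"

text \<open>Nash normal-crossings divisor of the d-dimensional Nash manifold M: the
  irreducible components are codimension-one Nash submanifolds meeting transversally.\<close>
definition nash_normal_crossings :: "nat \<Rightarrow> 'a::euclidean_space set \<Rightarrow> 'a set \<Rightarrow> bool" where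
  "nash_normal_crossings d M Z \<longleftrightarrow> nash_subset M Z \<and>
     (\<forall>Y \<in> nash_components M Z. submanifold (d - 1) Y) \<and>
     (\<forall>x\<in>M. \<forall>\<F>. finite \<F> \<longrightarrow> \<F> \<subseteq> {Y \<in> nash_components M Z. x \<in> Y} \<longrightarrow>
         dim (tangent_space M x \<inter> (\<Inter>Y\<in>\<F>. tangent_space Y x)) = d - card \<F>)"

definition divisorial_corners :: "nat \<Rightarrow> 'a::euclidean_space set \<Rightarrow> bool" where
  "divisorial_corners d Q \<longleftrightarrow> (\<exists>M Z. nash_manifold d M \<and> Q \<subseteq> M \<and> closedin (top_of_set M) Q \<and>
      nash_subset M Z \<and> nonsmooth_points Q \<subseteq> Z \<and>
      (\<forall>Z'. nash_subset M Z' \<longrightarrow> nonsmooth_points Q \<subseteq> Z' \<longrightarrow> Z \<subseteq> Z') \<and>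
      nash_normal_crossings d M Z)"

end

theory Submission
  imports Defs "HOL-Computational_Algebra.Polynomial"
begin

text \<open>After adding the coordinate \<open>1 / \<nu>\<close>, where \<open>\<nu>\<close> is a Nash minorant of the distance to
  \<open>closure S - S\<close>, the set \<open>S\<close> may be assumed closed. Continuous semialgebraic functions on closed
  sets are uniform limits of Nash functions, with an error controlled by the weights
  \<open>1 / (k (1 + |x|\<^sup>2)\<^sup>k)\<close>: by stratification and gluing one reduces to a root of a polynomial with
  polynomial coefficients of constant degree and constant signs of its derivatives, which is found
  between two Nash barriers by smoothing. Let \<open>\<pi>\<close> be the nearest point retraction to \<open>M\<close>.
  At each point of \<open>Q\<close> the directions pointing strictly into \<open>\<pi>\<^sup>-\<^sup>1(Q)\<close> form an open convex
  cone, so they admit a continuous semialgebraic selection \<open>w\<close> along \<open>f\<close>. For small \<open>\<delta> > 0\<close> the map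
  \<open>f + \<delta> w\<close> has a definite distance from the complement of \<open>\<pi>\<^sup>-\<^sup>1(Q)\<close>; a Nash map \<open>g\<close>
  close enough to it gives \<open>\<pi> \<circ> g\<close>.\<close>

section \<open>Polynomial functions and semialgebraic sets\<close>

text \<open>Tolerances are measured by the weights \<open>wt k\<close>. On a closed set the
  Lojasiewicz inequality bounds every positive continuous semialgebraic function below by one of
  them, so approximation is only needed for a countable family of explicit Nash functions, stable
  under products; this is what closedness of the domain buys. The pieces of a stratification meet
  along their boundaries, where Nash functions cannot be glued. So every gluing argument works with
  closed subsets: an approximation that is good on a closed piece fails only on a closed set
  disjoint from it, and two disjoint closed sets are separated by a Nash step function. The push
  along \<open>w\<close> is forced by the boundary of \<open>Q\<close>: where \<open>f\<close>
  touches it, an approximation of \<open>f\<close> followed by the retraction stays in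
  \<open>M\<close> but may leave \<open>Q\<close>. Quantifier elimination is obtained by counting:
  the number of roots of a polynomial inside a semialgebraic set is expressed by one-sided germs at
  roots of polynomials of lower degree, so that an induction on the degree closes.\<close>

lemma poly_fun_uminus: "p \<in> poly_fun \<Longrightarrow> (\<lambda>x. - p x) \<in> poly_fun"
 using poly_fun.mult[OF poly_fun.const[of "-1"], of p] by simp

lemma poly_fun_diff: "p \<in> poly_fun \<Longrightarrow> q \<in> poly_fun \<Longrightarrow> (\<lambda>x. p x - q x) \<in> poly_fun"
 using poly_fun.add[OF _ poly_fun_uminus, of p q] by simp

lemma poly_fun_power: "p \<in> poly_fun \<Longrightarrow> (\<lambda>x. p x ^ n) \<in> poly_fun"
 by (induction n) (auto intro: poly_fun.intros)

lemma poly_fun_sum: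
 "finite I \<Longrightarrow> (\<And>i. i \<in> I \<Longrightarrow> p i \<in> poly_fun) \<Longrightarrow> (\<lambda>x. \<Sum>i\<in>I. p i x) \<in> poly_fun"
 by (induction I rule: finite_induct) (auto intro: poly_fun.intros)

lemma poly_fun_inner: "(\<lambda>x. x \<bullet> v) \<in> poly_fun"
proof -
 have "(\<lambda>x. \<Sum>b\<in>Basis. (x \<bullet> b) * (v \<bullet> b)) \<in> poly_fun"
  by (intro poly_fun_sum poly_fun.intros) auto
 then show ?thesis by (simp flip: euclidean_inner)
qed

definition poly_map :: "('a::euclidean_space \<Rightarrow> 'b::euclidean_space) \<Rightarrow> bool" where
 "poly_map g \<longleftrightarrow> (\<forall>b\<in>Basis. (\<lambda>x. g x \<bullet> b) \<in> poly_fun)"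

lemma poly_map_real [simp]: "poly_map (g :: _ \<Rightarrow> real) \<longleftrightarrow> g \<in> poly_fun"
 by (simp add: poly_map_def)

lemma poly_map_inner: "poly_map g \<Longrightarrow> (\<lambda>x. g x \<bullet> v) \<in> poly_fun"
proof -
 assume g: "poly_map g"
 have "(\<lambda>x. \<Sum>b\<in>Basis. (g x \<bullet> b) * (v \<bullet> b)) \<in> poly_fun"
  using g by (intro poly_fun_sum poly_fun.intros) (auto simp: poly_map_def)
 then show ?thesis by (simp flip: euclidean_inner)
qed

lemma poly_fun_compose: "p \<in> poly_fun \<Longrightarrow> poly_map g \<Longrightarrow> (\<lambda>x. p (g x)) \<in> poly_fun"
 by (induction rule: poly_fun.induct) (auto intro: poly_fun.intros simp: poly_map_def)

lemma poly_map_linear: assumes "linear g" shows "poly_map g"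
 unfolding poly_map_def
proof
 fix b :: 'b assume "b \<in> Basis"
 have "(\<lambda>x. g x \<bullet> b) = (\<lambda>x. x \<bullet> adjoint g b)"
  using adjoint_works[OF assms] by (auto simp: fun_eq_iff inner_commute)
 then show "(\<lambda>x. g x \<bullet> b) \<in> poly_fun" by (simp add: poly_fun_inner)
qed

lemma poly_map_Pair: "poly_map f \<Longrightarrow> poly_map g \<Longrightarrow> poly_map (\<lambda>x. (f x, g x))"
 by (auto simp: poly_map_def Basis_prod_def)

lemma poly_map_id: "poly_map (\<lambda>x. x)"
 by (auto simp: poly_map_def intro: poly_fun.intros)

lemma poly_map_const: "poly_map (\<lambda>x. c)"
 by (auto simp: poly_map_def intro: poly_fun.intros)

lemma poly_map_fst: "poly_map f \<Longrightarrow> poly_map (\<lambda>x. fst (f x))"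
 unfolding poly_map_def
proof
 fix b :: 'b assume f: "\<forall>b\<in>Basis. (\<lambda>x. f x \<bullet> b) \<in> poly_fun" and b: "b \<in> Basis"
 then have "(\<lambda>x. f x \<bullet> (b, 0)) \<in> poly_fun" by (auto simp: Basis_prod_def)
 then show "(\<lambda>x. fst (f x) \<bullet> b) \<in> poly_fun" by (simp add: inner_prod_def)
qed

lemma poly_map_snd: "poly_map f \<Longrightarrow> poly_map (\<lambda>x. snd (f x))"
 unfolding poly_map_def
proof
 fix b :: 'c assume f: "\<forall>b\<in>Basis. (\<lambda>x. f x \<bullet> b) \<in> poly_fun" and b: "b \<in> Basis"
 then have "(\<lambda>x. f x \<bullet> (0, b)) \<in> poly_fun" by (auto simp: Basis_prod_def)
 then show "(\<lambda>x. snd (f x) \<bullet> b) \<in> poly_fun" by (simp add: inner_prod_def)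
qed

lemma poly_map_add: "poly_map f \<Longrightarrow> poly_map g \<Longrightarrow> poly_map (\<lambda>x. f x + g x)"
 by (auto simp: poly_map_def inner_add_left intro: poly_fun.intros)

lemma poly_map_scaleR: "f \<in> poly_fun \<Longrightarrow> poly_map g \<Longrightarrow> poly_map (\<lambda>x. f x *\<^sub>R g x)"
 by (auto simp: poly_map_def intro: poly_fun.intros)

lemma semialgebraic_Int:
 assumes "semialgebraic A" "semialgebraic B" shows "semialgebraic (A \<inter> B)"
proof -
 have "A \<inter> B = - (- A \<union> - B)" by auto
 then show ?thesis using assms by (simp only:) (intro semialgebraic.intros)
qed

lemma semialgebraic_empty: "semialgebraic {}"
 using semialgebraic.pos[OF poly_fun.const[of "0"]] by simp

lemma semialgebraic_UNIV: "semialgebraic UNIV"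
 using semialgebraic.compl[OF semialgebraic_empty] by simp

lemma semialgebraic_Diff: "semialgebraic A \<Longrightarrow> semialgebraic B \<Longrightarrow> semialgebraic (A - B)"
 by (simp add: Diff_eq semialgebraic_Int semialgebraic.compl)

lemma semialgebraic_UN:
 "finite I \<Longrightarrow> (\<And>i. i \<in> I \<Longrightarrow> semialgebraic (A i)) \<Longrightarrow> semialgebraic (\<Union>i\<in>I. A i)"
 by (induction I rule: finite_induct) (auto intro: semialgebraic.intros semialgebraic_empty)

lemma semialgebraic_vimage:
 assumes "semialgebraic A" "poly_map g" shows "semialgebraic {x. g x \<in> A}"
 using assms(1)
proof induction
 case (pos p) then show ?case
  using semialgebraic.pos[OF poly_fun_compose[OF _ assms(2)]] by simp
next
 case (zero p) then show ?case
  using semialgebraic.zero[OF poly_fun_compose[OF _ assms(2)]] by simp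
next
 case (union A B) then show ?case
  using semialgebraic.union[of "{x. g x \<in> A}" "{x. g x \<in> B}"] by (simp add: Collect_disj_eq)
next
 case (compl A) then show ?case
  using semialgebraic.compl[of "{x. g x \<in> A}"] by (simp add: Collect_neg_eq)
qed

lemma semialgebraic_conj:
 "semialgebraic {x. P x} \<Longrightarrow> semialgebraic {x. Q x} \<Longrightarrow> semialgebraic {x. P x \<and> Q x}"
 by (simp add: Collect_conj_eq semialgebraic_Int)

lemma semialgebraic_disj:
 "semialgebraic {x. P x} \<Longrightarrow> semialgebraic {x. Q x} \<Longrightarrow> semialgebraic {x. P x \<or> Q x}"
 by (simp add: Collect_disj_eq semialgebraic.union)

lemma semialgebraic_neg: "semialgebraic {x. P x} \<Longrightarrow> semialgebraic {x. \<not> P x}"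
 by (simp add: Collect_neg_eq semialgebraic.compl)

lemma semialgebraic_Collect_const: "semialgebraic {x. c}"
 by (cases c) (auto simp: semialgebraic_empty semialgebraic_UNIV)

lemma semialgebraic_imp:
 "semialgebraic {x. P x} \<Longrightarrow> semialgebraic {x. Q x} \<Longrightarrow> semialgebraic {x. P x \<longrightarrow> Q x}"
 unfolding imp_conv_disj by (intro semialgebraic_disj semialgebraic_neg)

section \<open>Polynomials with polynomial coefficients\<close>

text \<open>The bound \<open>n\<close> is uniform, but the degree may drop at single points
  \<open>x\<close>; where a leading coefficient vanishes, the arguments below pass to a
  truncation.\<close>

definition pdeg :: "nat \<Rightarrow> ('a::euclidean_space \<Rightarrow> real poly) set" where
 "pdeg n = {P. (\<forall>i. (\<lambda>x. coeff (P x) i) \<in> poly_fun) \<and> (\<forall>x. degree (P x) \<le> n)}"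

lemma pdeg_coeff: "P \<in> pdeg n \<Longrightarrow> (\<lambda>x. coeff (P x) i) \<in> poly_fun"
 by (simp add: pdeg_def)

lemma pdeg_degree: "P \<in> pdeg n \<Longrightarrow> degree (P x) \<le> n"
 by (simp add: pdeg_def)

lemma pdeg_mono: "P \<in> pdeg n \<Longrightarrow> n \<le> m \<Longrightarrow> P \<in> pdeg m"
 by (auto simp: pdeg_def intro: order_trans)

lemma pdeg_add: "P \<in> pdeg n \<Longrightarrow> Q \<in> pdeg n \<Longrightarrow> (\<lambda>x. P x + Q x) \<in> pdeg n"
 by (auto simp: pdeg_def intro: poly_fun.intros degree_add_le)

lemma pdeg_diff: "P \<in> pdeg n \<Longrightarrow> Q \<in> pdeg n \<Longrightarrow> (\<lambda>x. P x - Q x) \<in> pdeg n"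
 by (auto simp: pdeg_def intro: poly_fun_diff degree_diff_le)

lemma pdeg_uminus: "P \<in> pdeg n \<Longrightarrow> (\<lambda>x. - P x) \<in> pdeg n"
 by (auto simp: pdeg_def intro: poly_fun_uminus)

lemma pdeg_smult: "c \<in> poly_fun \<Longrightarrow> P \<in> pdeg n \<Longrightarrow> (\<lambda>x. smult (c x) (P x)) \<in> pdeg n"
 by (auto simp: pdeg_def intro: poly_fun.intros order_trans[OF degree_smult_le])

lemma pdeg_mult: "P \<in> pdeg n \<Longrightarrow> Q \<in> pdeg m \<Longrightarrow> (\<lambda>x. P x * Q x) \<in> pdeg (n + m)"
 by (auto simp: pdeg_def coeff_mult intro!: poly_fun.mult poly_fun_sum
    order_trans[OF degree_mult_le add_mono])

lemma pdeg_monom: "c \<in> poly_fun \<Longrightarrow> (\<lambda>x. monom (c x) n) \<in> pdeg n"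
 unfolding pdeg_def
proof (safe)
 show "(\<lambda>x. coeff (monom (c x) n) i) \<in> poly_fun" if "c \<in> poly_fun" for i
  using that by (cases "n = i") (auto intro: poly_fun.intros)
qed (simp add: degree_monom_le)

lemma pdeg_pderiv: "P \<in> pdeg n \<Longrightarrow> (\<lambda>x. pderiv (P x)) \<in> pdeg (n - 1)"
 by (auto simp: pdeg_def coeff_pderiv degree_pderiv intro!: poly_fun.intros diff_le_mono)

lemma pdeg_truncate:
 assumes P: "P \<in> pdeg (Suc n)"
 shows "(\<lambda>x. P x - monom (coeff (P x) (Suc n)) (Suc n)) \<in> pdeg n"
proof -
 have "(\<lambda>x. P x - monom (coeff (P x) (Suc n)) (Suc n)) \<in> pdeg (Suc n)"
  by (intro pdeg_diff P pdeg_monom pdeg_coeff[OF P])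
 moreover have "degree (P x - monom (coeff (P x) (Suc n)) (Suc n)) \<le> n" for x
 proof (rule degree_le, safe)
  fix i assume "n < i"
  then show "coeff (P x - monom (coeff (P x) (Suc n)) (Suc n)) i = 0"
   using pdeg_degree[OF P, of x] by (cases "i = Suc n") (auto simp: coeff_eq_0)
 qed
 ultimately show ?thesis by (auto simp: pdeg_def)
qed

lemma poly_altdef_bound:
 fixes p :: "real poly"
 shows "degree p \<le> n \<Longrightarrow> poly p x = (\<Sum>i\<le>n. coeff p i * x ^ i)"
 unfolding poly_altdef by (rule sum.mono_neutral_left[OF _ _ ballI]) (auto simp: coeff_eq_0)

lemma pdeg_eval:
 assumes "P \<in> pdeg n"
 shows "(\<lambda>z::'a::euclidean_space \<times> real. poly (P (fst z)) (snd z)) \<in> poly_fun"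
proof -
 have "poly (P x) y = (\<Sum>i\<le>n. coeff (P x) i * y ^ i)" for x y
  using pdeg_degree[OF assms, of x] by (simp add: poly_altdef_bound)
 moreover have "(\<lambda>z::'a \<times> real. \<Sum>i\<le>n. coeff (P (fst z)) i * snd z ^ i) \<in> poly_fun"
  using poly_fun_compose[OF pdeg_coeff[OF assms] poly_map_fst[OF poly_map_id]]
   poly_map_snd[OF poly_map_id, where ?'c=real]
  by (intro poly_fun_sum poly_fun.mult poly_fun_power) auto
 ultimately show ?thesis by simp
qed

text \<open>Singling out the last variable turns polynomial sign conditions into conditions on
  univariate polynomials that depend on \<open>x\<close>.\<close>

lemma poly_fun_pdeg:
 assumes "p \<in> (poly_fun :: ('a::euclidean_space \<times> real \<Rightarrow> real) set)"
 obtains P n where "P \<in> pdeg n" "\<And>x y. p (x, y) = poly (P x) y"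
proof -
 have "\<exists>P n. P \<in> pdeg n \<and> (\<forall>x y. p (x, y) = poly (P x) y)" using assms
 proof induction
  case (const c)
  have "(\<lambda>_. [:c:]) \<in> pdeg 0"
   using pdeg_monom[OF poly_fun.const, of c 0] by (simp add: monom_0)
  then show ?case by (intro exI[of _ "\<lambda>_. [:c:]"] exI[of _ 0]) auto
 next
  case (coord b)
  then consider u where "u \<in> Basis" "b = (u, 0)" | "b = (0, 1)"
   by (auto simp: Basis_prod_def)
  then show ?case
  proof cases
   case 1
   have "(\<lambda>x. [:x \<bullet> u:]) \<in> pdeg 0"
    using pdeg_monom[OF poly_fun.coord, of u 0] 1 by (simp add: monom_0)
   then show ?thesis using 1
    by (intro exI[of _ "\<lambda>x. [:x \<bullet> u:]"] exI[of _ 0]) auto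
  next
   case 2
   have "(\<lambda>x. monom 1 1) \<in> pdeg 1"
    by (intro pdeg_monom poly_fun.const)
   then show ?thesis using 2
    by (intro exI[of _ "\<lambda>x. monom 1 1"] exI[of _ 1]) (auto simp: poly_monom)
  qed
 next
  case (add p q)
  then obtain P n Q m where *: "P \<in> pdeg n" "\<forall>x y. p (x, y) = poly (P x) y"
   "Q \<in> pdeg m" "\<forall>x y. q (x, y) = poly (Q x) y" by blast
  then have "(\<lambda>x. P x + Q x) \<in> pdeg (n + m)"
   using pdeg_add[OF pdeg_mono[of P n "n+m"] pdeg_mono[of Q m "n+m"]] by simp
  then show ?case using * by (metis poly_add)
 next
  case (mult p q)
  then obtain P n Q m where *: "P \<in> pdeg n" "\<forall>x y. p (x, y) = poly (P x) y"
   "Q \<in> pdeg m" "\<forall>x y. q (x, y) = poly (Q x) y" by blast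
  then show ?case using pdeg_mult by (metis poly_mult)
 qed
 then show thesis using that by blast
qed

lemma semialgebraic_eval_pos: "P \<in> pdeg n \<Longrightarrow> semialgebraic {(x, y). poly (P x) y > 0}"
 using semialgebraic.pos[OF pdeg_eval] by (simp add: case_prod_beta')

lemma semialgebraic_eval_zero: "P \<in> pdeg n \<Longrightarrow> semialgebraic {(x, y). poly (P x) y = 0}"
 using semialgebraic.zero[OF pdeg_eval] by (simp add: case_prod_beta')

lemma semialgebraic_cylinder: "semialgebraic A \<Longrightarrow> semialgebraic {(x, y). x \<in> A}"
 using semialgebraic_vimage[OF _ poly_map_fst[OF poly_map_id]] by (simp add: case_prod_beta')

lemma semialgebraic_pdeg_nonzero:
 assumes P: "P \<in> pdeg n" shows "semialgebraic {x. P x \<noteq> 0}"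
proof -
 have "P x \<noteq> 0 \<longleftrightarrow> (\<exists>i\<le>n. coeff (P x) i \<noteq> 0)" for x
  using pdeg_degree[OF P, of x] by (metis coeff_0 leading_coeff_0_iff)
 then have "{x. P x \<noteq> 0} = (\<Union>i\<in>{..n}. {x. coeff (P x) i \<noteq> 0})" by auto
 then show ?thesis
  by (auto intro!: semialgebraic_UN semialgebraic_neg semialgebraic.zero pdeg_coeff[OF P])
qed

section \<open>One-sided neighbourhoods\<close>

lemma poly_const_sign:
 fixes p :: "real poly"
 assumes "\<And>y. a < y \<Longrightarrow> y < b \<Longrightarrow> poly p y \<noteq> 0" "a < u" "u < b" "a < v" "v < b"
 shows "sgn (poly p u) = sgn (poly p v)"
proof (rule ccontr)
 assume ne: "sgn (poly p u) \<noteq> sgn (poly p v)"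
 have nz: "poly p u \<noteq> 0" "poly p v \<noteq> 0" using assms by auto
 have lt: "\<exists>r>a. r < b \<and> poly p r = 0"
  if "s < t" "a < s" "t < b" "sgn (poly p s) \<noteq> sgn (poly p t)" "poly p s \<noteq> 0" "poly p t \<noteq> 0" for s t
 proof -
  have "poly p s * poly p t < 0"
   using that by (auto simp: sgn_if mult_less_0_iff split: if_splits)
  then obtain r where "s < r" "r < t" "poly p r = 0" using poly_IVT[OF \<open>s < t\<close>, of p] by blast
  then show ?thesis using that by (intro exI[of _ r]) auto
 qed
 have "u \<noteq> v" using ne by auto
 then show False using lt[of u v] lt[of v u] assms ne nz by (metis linorder_less_linear)
qed

lemma poly_eventually_no_root_right:
 fixes p :: "real poly" assumes "p \<noteq> 0"
 obtains b where "a < b" "\<And>y. a < y \<Longrightarrow> y < b \<Longrightarrow> poly p y \<noteq> 0"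
proof -
 have fin: "finite {y. poly p y = 0}" using assms by (rule poly_roots_finite)
 define R where "R = {y. poly p y = 0 \<and> a < y}"
 have finR: "finite R" unfolding R_def using fin by (rule rev_finite_subset) auto
 show thesis
 proof (cases "R = {}")
  case True
  then show ?thesis using that[of "a+1"] by (auto simp: R_def)
 next
  case False
  have "Min R \<in> R" using finR False by (rule Min_in)
  then have "a < Min R" by (simp add: R_def)
  moreover have "poly p y \<noteq> 0" if "a < y" "y < Min R" for y
   using that Min_le[OF finR, of y] by (auto simp: R_def)
  ultimately show ?thesis using that by blast
 qed
qed

lemma poly_right_dichotomy:
 fixes p :: "real poly"
 shows "(\<forall>\<^sub>F y in at_right a. poly p y > 0) \<or> (\<forall>\<^sub>F y in at_right a. poly p y = 0) \<or>
     (\<forall>\<^sub>F y in at_right a. poly p y < 0)"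
proof (cases "p = 0")
 case False
 obtain b where b: "a < b" "\<And>y. a < y \<Longrightarrow> y < b \<Longrightarrow> poly p y \<noteq> 0"
  using poly_eventually_no_root_right[OF False] by blast
 define m where "m = (a + b)/2"
 have m: "a < m" "m < b" using b by (auto simp: m_def)
 have *: "sgn (poly p y) = sgn (poly p m)" if "a < y" "y < b" for y
  using poly_const_sign[OF b(2)] that m by blast
 consider "poly p m > 0" | "poly p m < 0" using b(2)[OF m] by linarith
 then show ?thesis
 proof cases
  case 1
  then have "\<forall>y>a. y < b \<longrightarrow> poly p y > 0" using * by (metis sgn_1_pos)
  then show ?thesis using b(1) by (auto simp: eventually_at_right_field)
 next
  case 2
  then have "\<forall>y>a. y < b \<longrightarrow> poly p y < 0" using * by (metis sgn_1_neg)
  then show ?thesis using b(1) by (auto simp: eventually_at_right_field)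
 qed
qed auto

lemma eventually_at_right_contr:
 "(\<forall>\<^sub>F y in at_right (a::real). P y) \<Longrightarrow> (\<forall>\<^sub>F y in at_right a. \<not> P y) \<Longrightarrow> False"
 using eventually_conj[of P "at_right a" "\<lambda>y. \<not> P y"] by (simp add: trivial_limit_at_right_real)

text \<open>By the mean value theorem the sign just to the right of a zero is that of the derivative
  there. Iterating this replaces a condition on a right germ by sign conditions at \<open>a\<close>
  itself.\<close>

lemma poly_right_pos_iff:
 fixes p :: "real poly"
 shows "(\<forall>\<^sub>F y in at_right a. poly p y > 0) \<longleftrightarrow>
   poly p a > 0 \<or> (poly p a = 0 \<and> (\<forall>\<^sub>F y in at_right a. poly (pderiv p) y > 0))"
proof -
 have cont: "(poly p \<longlongrightarrow> poly p a) (at_right a)"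
  by (intro tendsto_intros)
 have 1: ?thesis if "poly p a > 0"
  using order_tendstoD(1)[OF cont that] that by simp
 have 2: ?thesis if "poly p a < 0"
 proof -
  have "\<forall>\<^sub>F y in at_right a. \<not> poly p y > 0"
   using order_tendstoD(2)[OF cont that] by (rule eventually_mono) auto
  then show ?thesis using that eventually_at_right_contr[of "\<lambda>y. poly p y > 0"] by auto
 qed
 have 3: ?thesis if z: "poly p a = 0"
 proof -
  have mvt: "\<exists>z. a < z \<and> z < y \<and> poly p y = (y - a) * poly (pderiv p) z" if "a < y" for y
   using poly_MVT[OF that, of p] z by auto
  have I: "\<forall>\<^sub>F y in at_right a. poly p y > 0" if "\<forall>\<^sub>F y in at_right a. poly (pderiv p) y > 0"
  proof -
   from that obtain b where b: "a < b" "\<forall>y>a. y < b \<longrightarrow> poly (pderiv p) y > 0"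
    by (auto simp: eventually_at_right_field)
   have "\<forall>y>a. y < b \<longrightarrow> poly p y > 0"
    using mvt b(2) by (metis diff_gt_0_iff_gt less_trans mult_pos_pos)
   then show ?thesis using b(1) by (auto simp: eventually_at_right_field)
  qed
  have J: "\<forall>\<^sub>F y in at_right a. \<not> poly p y > 0" if "\<forall>\<^sub>F y in at_right a. poly (pderiv p) y \<le> 0"
  proof -
   from that obtain b where b: "a < b" "\<forall>y>a. y < b \<longrightarrow> poly (pderiv p) y \<le> 0"
    by (auto simp: eventually_at_right_field)
   have "\<not> poly p y > 0" if "a < y" "y < b" for y
   proof -
    obtain z where "a < z" "z < y" "poly p y = (y - a) * poly (pderiv p) z"
     using mvt[OF \<open>a < y\<close>] by blast
    then show ?thesis using b(2) that
     by (simp add: mult_nonneg_nonpos not_less)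
   qed
   then show ?thesis using b(1) by (auto simp: eventually_at_right_field)
  qed
  show ?thesis
  proof (cases "\<forall>\<^sub>F y in at_right a. poly (pderiv p) y > 0")
   case True then show ?thesis using I z by simp
  next
   case False
   then have "\<forall>\<^sub>F y in at_right a. poly (pderiv p) y \<le> 0"
    using poly_right_dichotomy[of "pderiv p" a] by (elim disjE; force elim: eventually_mono)
   then show ?thesis
    using J False z eventually_at_right_contr[of "\<lambda>y. poly p y > 0" a] by auto
  qed
 qed
 show ?thesis using 1 2 3 by linarith
qed

text \<open>Only the last coordinate moves: this set and the next three record one-sided germs of
  the fibres of \<open>A\<close>, the data from which roots are counted.\<close>

definition rt_nbhd :: "('a \<times> real) set \<Rightarrow> ('a \<times> real) set" where
 "rt_nbhd A = {(x, a). \<forall>\<^sub>F y in at_right a. (x, y) \<in> A}"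

definition lt_nbhd :: "('a \<times> real) set \<Rightarrow> ('a \<times> real) set" where
 "lt_nbhd A = {(x, a). \<forall>\<^sub>F y in at_left a. (x, y) \<in> A}"

definition top_nbhd :: "('a \<times> real) set \<Rightarrow> 'a set" where
 "top_nbhd A = {x. \<forall>\<^sub>F y in at_top. (x, y) \<in> A}"

definition bot_nbhd :: "('a \<times> real) set \<Rightarrow> 'a set" where
 "bot_nbhd A = {x. \<forall>\<^sub>F y in at_bot. (x, y) \<in> A}"

text \<open>Induction on the degree bound: \<open>poly_right_pos_iff\<close> trades the germ for a
  sign at \<open>a\<close> and the germ of the derivative.\<close>

lemma semialgebraic_rt_nbhd_pos:
 "P \<in> pdeg n \<Longrightarrow> semialgebraic {(x, a). \<forall>\<^sub>F y in at_right a. poly (P x) y > 0}"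
proof (induction n arbitrary: P)
 case 0
 have "(\<forall>\<^sub>F y in at_right a. poly (P x) y > 0) \<longleftrightarrow> poly (P x) a > 0" for x a
 proof -
  obtain c where "P x = [:c:]"
   using pdeg_degree[OF 0, of x] by (auto elim: degree_eq_zeroE)
  then show ?thesis by (simp add: trivial_limit_at_right_real)
 qed
 then show ?case using semialgebraic_eval_pos[OF 0] by simp
next
 case (Suc n)
 have "(\<lambda>x. pderiv (P x)) \<in> pdeg n" using pdeg_pderiv[OF Suc.prems] by simp
 note IH = Suc.IH[OF this]
 have "{(x, a). \<forall>\<^sub>F y in at_right a. poly (P x) y > 0} =
   {(x, a). poly (P x) a > 0} \<union>
   ({(x, a). poly (P x) a = 0} \<inter> {(x, a). \<forall>\<^sub>F y in at_right a. poly (pderiv (P x)) y > 0})"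
  by (subst poly_right_pos_iff) auto
 then show ?case
  using semialgebraic_eval_pos[OF Suc.prems] semialgebraic_eval_zero[OF Suc.prems] IH
  by (simp only:) (intro semialgebraic.union semialgebraic_Int)
qed

text \<open>Germs commute with unions and complements only for sets that do not oscillate at
  \<open>a\<close>, so the induction has to carry the dichotomy along with semialgebraicity.\<close>

lemma rt_nbhd:
 fixes A :: "('a::euclidean_space \<times> real) set"
 assumes "semialgebraic A"
 shows "semialgebraic (rt_nbhd A) \<and>
  (\<forall>x a. (\<forall>\<^sub>F y in at_right a. (x, y) \<in> A) \<or> (\<forall>\<^sub>F y in at_right a. (x, y) \<notin> A))"
 using assms
proof induction
 case (pos p)
 obtain P n where P: "P \<in> pdeg n" "\<And>x y. p (x, y) = poly (P x) y"
  using poly_fun_pdeg[OF pos] by blast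
 have "(\<forall>\<^sub>F y in at_right a. poly (P x) y > 0) \<or> (\<forall>\<^sub>F y in at_right a. \<not> poly (P x) y > 0)" for x a
  using poly_right_dichotomy[of "P x" a]
  by (elim disjE) (simp_all, auto elim: eventually_mono intro!: disjI2)
 then show ?case
  using semialgebraic_rt_nbhd_pos[OF P(1)] P(2) by (simp add: rt_nbhd_def)
next
 case (zero p)
 obtain P n where P: "P \<in> pdeg n" "\<And>x y. p (x, y) = poly (P x) y"
  using poly_fun_pdeg[OF zero] by blast
 have "(\<forall>\<^sub>F y in at_right a. poly (P x) y = 0) \<longleftrightarrow> P x = 0" for x a
 proof
  assume ev: "\<forall>\<^sub>F y in at_right a. poly (P x) y = 0"
  show "P x = 0"
  proof (rule ccontr)
   assume "P x \<noteq> 0"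
   then obtain b where "a < b" "\<And>y. a < y \<Longrightarrow> y < b \<Longrightarrow> poly (P x) y \<noteq> 0"
    using poly_eventually_no_root_right by blast
   then have "\<forall>\<^sub>F y in at_right a. poly (P x) y \<noteq> 0" by (auto simp: eventually_at_right_field)
   then show False using ev eventually_at_right_contr by blast
  qed
 qed auto
 moreover have "(\<forall>\<^sub>F y in at_right a. poly (P x) y = 0) \<or> (\<forall>\<^sub>F y in at_right a. poly (P x) y \<noteq> 0)" for x a
  using poly_right_dichotomy[of "P x" a]
 proof (elim disjE)
  assume "\<forall>\<^sub>F y in at_right a. poly (P x) y > 0"
  then have "\<forall>\<^sub>F y in at_right a. poly (P x) y \<noteq> 0" by eventually_elim auto
  then show ?thesis by blast
 next
  assume "\<forall>\<^sub>F y in at_right a. poly (P x) y < 0"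
  then have "\<forall>\<^sub>F y in at_right a. poly (P x) y \<noteq> 0" by eventually_elim auto
  then show ?thesis by blast
 qed blast
 moreover have "semialgebraic {x. P x = 0}"
  using semialgebraic_neg[OF semialgebraic_pdeg_nonzero[OF P(1)]] by simp
 ultimately show ?case
  using semialgebraic_cylinder[of "{x. P x = 0}"] P(2) by (simp add: rt_nbhd_def)
next
 case (union A B)
 have *: "(\<forall>\<^sub>F y in at_right a. (x, y) \<in> A \<union> B) \<longleftrightarrow>
  (\<forall>\<^sub>F y in at_right a. (x, y) \<in> A) \<or> (\<forall>\<^sub>F y in at_right a. (x, y) \<in> B)" for x a
 proof
  assume AB: "\<forall>\<^sub>F y in at_right a. (x, y) \<in> A \<union> B"
  show "(\<forall>\<^sub>F y in at_right a. (x, y) \<in> A) \<or> (\<forall>\<^sub>F y in at_right a. (x, y) \<in> B)"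
  proof (cases "\<forall>\<^sub>F y in at_right a. (x, y) \<in> A")
   case False
   then have "\<forall>\<^sub>F y in at_right a. (x, y) \<notin> A" using union by blast
   with AB have "\<forall>\<^sub>F y in at_right a. (x, y) \<in> B" by eventually_elim auto
   then show ?thesis by blast
  qed auto
 qed (auto elim: eventually_mono)
 have "rt_nbhd (A \<union> B) = rt_nbhd A \<union> rt_nbhd B"
  unfolding rt_nbhd_def using * by auto
 moreover have "(\<forall>\<^sub>F y in at_right a. (x, y) \<in> A \<union> B) \<or> (\<forall>\<^sub>F y in at_right a. (x, y) \<notin> A \<union> B)" for x a
 proof (cases "(\<forall>\<^sub>F y in at_right a. (x, y) \<in> A) \<or> (\<forall>\<^sub>F y in at_right a. (x, y) \<in> B)")
  case False
  then have "\<forall>\<^sub>F y in at_right a. (x, y) \<notin> A" "\<forall>\<^sub>F y in at_right a. (x, y) \<notin> B" using union by blast+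
  then have "\<forall>\<^sub>F y in at_right a. (x, y) \<notin> A \<union> B" by eventually_elim auto
  then show ?thesis by blast
 qed (use * in blast)
 ultimately show ?case using union by (auto intro: semialgebraic.union)
next
 case (compl A)
 have "rt_nbhd (- A) = - rt_nbhd A"
 proof -
  have "(\<forall>\<^sub>F y in at_right a. (x, y) \<in> - A) \<longleftrightarrow> \<not> (\<forall>\<^sub>F y in at_right a. (x, y) \<in> A)" for x a
   using compl eventually_at_right_contr[of "\<lambda>y. (x, y) \<in> A" a] by auto
  then show ?thesis unfolding rt_nbhd_def by auto
 qed
 then show ?case using compl by (auto intro: semialgebraic.compl)
qed

lemma semialgebraic_rt_nbhd: "semialgebraic A \<Longrightarrow> semialgebraic (rt_nbhd A)"
 using rt_nbhd by blast

lemma semialgebraic_reflect: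
 "semialgebraic A \<Longrightarrow> semialgebraic {(x, y::real). (x, - y) \<in> A}"
proof -
 have "poly_map (\<lambda>z::'a \<times> real. (fst z, - snd z))"
  by (intro poly_map_linear) (auto simp: linear_iff)
 then show "semialgebraic A \<Longrightarrow> semialgebraic {(x, y::real). (x, - y) \<in> A}"
  using semialgebraic_vimage[of A "\<lambda>z. (fst z, - snd z)"] by (simp add: case_prod_beta')
qed

lemma semialgebraic_lt_nbhd: assumes "semialgebraic A" shows "semialgebraic (lt_nbhd A)"
proof -
 have "lt_nbhd A = {(x, a). (x, - a) \<in> rt_nbhd {(x, y). (x, - y) \<in> A}}"
  by (simp add: lt_nbhd_def rt_nbhd_def eventually_at_left_to_right)
 then show ?thesis
  using semialgebraic_reflect[OF semialgebraic_rt_nbhd[OF semialgebraic_reflect[OF assms]]] by simp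
qed

text \<open>The substitution \<open>y = 1 / s\<close> turns germs at infinity into right germs at 0.
  Multiplying by \<open>s ^ n > 0\<close> clears denominators and keeps signs.\<close>

lemma semialgebraic_inversion:
 fixes A :: "('a::euclidean_space \<times> real) set"
 assumes "semialgebraic A"
 shows "semialgebraic {(x, s). s > 0 \<and> (x, inverse s) \<in> A}"
 using assms
proof induction
 have s: "(\<lambda>z::'a \<times> real. snd z) \<in> poly_fun"
  using poly_map_snd[OF poly_map_id, where ?'c=real] by simp
 have h: "semialgebraic {(x::'a, s::real). s > 0}"
  using semialgebraic.pos[OF s] by (simp add: case_prod_beta')
 have q: "\<exists>q. q \<in> poly_fun \<and> (\<exists>n. \<forall>x s. s > 0 \<longrightarrow> q (x::'a, s) = s ^ n * p (x, inverse s))"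
  if p: "p \<in> poly_fun" for p
 proof -
  obtain P n where P: "P \<in> pdeg n" "\<And>x y. p (x, y) = poly (P x) y"
   using poly_fun_pdeg[OF p] by blast
  \<comment> \<open>The polynomial with its coefficients in reverse order.\<close>
  define q where "q = (\<lambda>z::'a \<times> real. \<Sum>i\<le>n. coeff (P (fst z)) i * snd z ^ (n - i))"
  have "q \<in> poly_fun" unfolding q_def
   using poly_fun_compose[OF pdeg_coeff[OF P(1)] poly_map_fst[OF poly_map_id]] s
   by (intro poly_fun_sum poly_fun.mult poly_fun_power) auto
  moreover have "q (x, s) = s ^ n * p (x, inverse s)" if "s > 0" for x s
  proof -
   have "p (x, inverse s) = (\<Sum>i\<le>n. coeff (P x) i * inverse s ^ i)"
    using pdeg_degree[OF P(1), of x] by (simp add: P(2) poly_altdef_bound)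
   moreover have "s ^ n * (coeff (P x) i * inverse s ^ i) = coeff (P x) i * s ^ (n - i)" if "i \<le> n" for i
    using that \<open>s > 0\<close> by (simp add: power_diff field_simps)
   ultimately show ?thesis unfolding q_def fst_conv snd_conv sum_distrib_left
    by (simp only: sum_distrib_left) (rule sum.cong, simp, metis atMost_iff)
  qed
  ultimately show ?thesis by blast
 qed
 {
  case (pos p)
  then obtain q n where "q \<in> poly_fun" "\<forall>x s. s > 0 \<longrightarrow> q (x, s) = s ^ n * p (x, inverse s)"
   using q by blast
  then have "{(x, s). s > 0 \<and> (x, inverse s) \<in> {z. p z > 0}} = {(x, s). s > 0} \<inter> {z. q z > 0}"
   by (auto simp: zero_less_mult_iff)
  then show ?case using h semialgebraic.pos[OF \<open>q \<in> poly_fun\<close>] by (simp add: semialgebraic_Int)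
 next
  case (zero p)
  then obtain q n where "q \<in> poly_fun" "\<forall>x s. s > 0 \<longrightarrow> q (x, s) = s ^ n * p (x, inverse s)"
   using q by blast
  then have "{(x, s). s > 0 \<and> (x, inverse s) \<in> {z. p z = 0}} = {(x, s). s > 0} \<inter> {z. q z = 0}"
   by auto
  then show ?case using h semialgebraic.zero[OF \<open>q \<in> poly_fun\<close>] by (simp add: semialgebraic_Int)
 next
  case (union A B)
  have "{(x, s). s > 0 \<and> (x, inverse s) \<in> A \<union> B} =
   {(x, s). s > 0 \<and> (x, inverse s) \<in> A} \<union> {(x, s). s > 0 \<and> (x, inverse s) \<in> B}" by auto
  then show ?case using union by (simp add: semialgebraic.union)
 next
  case (compl A)
  have "{(x, s). s > 0 \<and> (x, inverse s) \<in> - A} =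
   {(x, s). s > 0} - {(x, s). s > 0 \<and> (x, inverse s) \<in> A}" by auto
  then show ?case using compl h by (simp add: semialgebraic_Diff)
 }
qed

lemma semialgebraic_top_nbhd:
 fixes A :: "('a::euclidean_space \<times> real) set"
 assumes "semialgebraic A"
 shows "semialgebraic (top_nbhd A)"
  and "(\<forall>\<^sub>F y in at_top. (x, y) \<in> A) \<or> (\<forall>\<^sub>F y in at_top. (x, y) \<notin> A)"
proof -
 let ?I = "{(x, s). s > 0 \<and> (x, inverse s) \<in> A}"
 have pos: "\<forall>\<^sub>F s in at_right (0::real). s > 0" by (simp add: eventually_at_right_less)
 have *: "(\<forall>\<^sub>F y in at_top. (x, y) \<in> A) \<longleftrightarrow> (\<forall>\<^sub>F s in at_right 0. (x, s) \<in> ?I)" for x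
 proof -
  have "(\<forall>\<^sub>F s in at_right 0. (x, inverse s) \<in> A) \<longleftrightarrow> (\<forall>\<^sub>F s in at_right 0. (x, s) \<in> ?I)"
  proof
   assume "\<forall>\<^sub>F s in at_right 0. (x, inverse s) \<in> A"
   with pos show "\<forall>\<^sub>F s in at_right 0. (x, s) \<in> ?I" by eventually_elim auto
  next
   assume "\<forall>\<^sub>F s in at_right 0. (x, s) \<in> ?I"
   then show "\<forall>\<^sub>F s in at_right 0. (x, inverse s) \<in> A" by eventually_elim auto
  qed
  then show ?thesis unfolding eventually_at_top_to_right .
 qed
 have "top_nbhd A = {x. (x, 0) \<in> rt_nbhd ?I}"
  using * by (simp add: top_nbhd_def rt_nbhd_def)
 moreover have "poly_map (\<lambda>x::'a. (x, 0::real))"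
  by (intro poly_map_Pair poly_map_id poly_map_const)
 ultimately show "semialgebraic (top_nbhd A)"
  using semialgebraic_vimage[OF semialgebraic_rt_nbhd[OF semialgebraic_inversion[OF assms]]] by simp
 have "(\<forall>\<^sub>F s in at_right 0. (x, s) \<in> ?I) \<or> (\<forall>\<^sub>F s in at_right 0. (x, s) \<notin> ?I)"
  using rt_nbhd[OF semialgebraic_inversion[OF assms]] by blast
 then show "(\<forall>\<^sub>F y in at_top. (x, y) \<in> A) \<or> (\<forall>\<^sub>F y in at_top. (x, y) \<notin> A)"
 proof
  assume "\<forall>\<^sub>F s in at_right 0. (x, s) \<notin> ?I"
  with pos have "\<forall>\<^sub>F s in at_right 0. (x, inverse s) \<notin> A" by eventually_elim auto
  then show ?thesis by (simp add: eventually_at_top_to_right)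
 qed (use * in blast)
qed

lemma semialgebraic_bot_nbhd:
 fixes A :: "('a::euclidean_space \<times> real) set"
 assumes "semialgebraic A"
 shows "semialgebraic (bot_nbhd A)"
  and "(\<forall>\<^sub>F y in at_bot. (x, y) \<in> A) \<or> (\<forall>\<^sub>F y in at_bot. (x, y) \<notin> A)"
proof -
 have *: "(\<forall>\<^sub>F y in at_bot. P y) \<longleftrightarrow> (\<forall>\<^sub>F y in at_top. P (- y))" for P :: "real \<Rightarrow> bool"
  unfolding at_bot_mirror eventually_filtermap ..
 show "semialgebraic (bot_nbhd A)"
  using semialgebraic_top_nbhd(1)[OF semialgebraic_reflect[OF assms]]
  by (simp add: bot_nbhd_def top_nbhd_def *)
 show "(\<forall>\<^sub>F y in at_bot. (x, y) \<in> A) \<or> (\<forall>\<^sub>F y in at_bot. (x, y) \<notin> A)"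
  using semialgebraic_top_nbhd(2)[OF semialgebraic_reflect[OF assms], of x] by (simp add: *)
qed

section \<open>Counting roots and the Tarski--Seidenberg theorem\<close>

definition ev_ind :: "(real \<Rightarrow> bool) \<Rightarrow> real filter \<Rightarrow> int" where
 "ev_ind P F = of_bool (eventually P F)"

text \<open>Roots of \<open>p\<close> between consecutive roots of \<open>pderiv p\<close> are detected by the sign of \<open>p * pderiv p\<close>
 near the two end points; this reduces counting roots of \<open>p\<close> to lower degree.\<close>
lemma interval_root_count:
 fixes p :: "real poly"
 assumes ab: "a < b" and nz: "\<And>y. a < y \<Longrightarrow> y < b \<Longrightarrow> poly (pderiv p) y \<noteq> 0"
  and A: "{a<..<b} \<subseteq> A \<or> {a<..<b} \<inter> A = {}"
 shows "int (card {y \<in> {a<..<b}. y \<in> A \<and> poly p y = 0}) =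
  ev_ind (\<lambda>y. y \<in> A \<and> poly p y * poly (pderiv p) y < 0) (at_right a)
  + ev_ind (\<lambda>y. y \<in> A \<and> poly p y * poly (pderiv p) y > 0) (at_left b)
  - ev_ind (\<lambda>y. y \<in> A) (at_right a)"
proof -
 have evr: "ev_ind P (at_right a) = of_bool Q"
  if "a < c" "c \<le> b" "\<And>y. a < y \<Longrightarrow> y < c \<Longrightarrow> P y = Q" for P Q c
 proof (cases Q)
  case True
  then have "\<forall>\<^sub>F y in at_right a. P y" using that by (auto simp: eventually_at_right_field)
  then show ?thesis using True by (simp add: ev_ind_def)
 next
  case False
  then have "\<forall>\<^sub>F y in at_right a. \<not> P y" using that by (auto simp: eventually_at_right_field)
  then show ?thesis using False eventually_at_right_contr by (auto simp: ev_ind_def)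
 qed
 have evl: "ev_ind P (at_left b) = of_bool Q"
  if "a \<le> c" "c < b" "\<And>y. c < y \<Longrightarrow> y < b \<Longrightarrow> P y = Q" for P Q c
 proof (cases Q)
  case True
  then have "\<forall>\<^sub>F y in at_left b. P y" using that by (auto simp: eventually_at_left_field)
  then show ?thesis using True by (simp add: ev_ind_def)
 next
  case False
  then have "\<forall>\<^sub>F y in at_left b. \<not> P y" using that by (auto simp: eventually_at_left_field)
  then have "\<not> (\<forall>\<^sub>F y in at_left b. P y)"
   using eventually_conj[of P "at_left b" "\<lambda>y. \<not> P y"] by (auto simp: trivial_limit_at_left_real)
  then show ?thesis using False by (simp add: ev_ind_def)
 qed
 show ?thesis
 proof (cases "{a<..<b} \<subseteq> A")
  case False
  then have disj: "{a<..<b} \<inter> A = {}" using A by blast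
  have "y \<notin> A" if "a < y" "y < b" for y
   using disj that by (metis IntI empty_iff greaterThanLessThan_iff)
  then have "{y \<in> {a<..<b}. y \<in> A \<and> poly p y = 0} = {}" by auto
  moreover have "ev_ind (\<lambda>y. y \<in> A \<and> poly p y * poly (pderiv p) y < 0) (at_right a) = of_bool False"
    "ev_ind (\<lambda>y. y \<in> A) (at_right a) = of_bool False"
    "ev_ind (\<lambda>y. y \<in> A \<and> poly p y * poly (pderiv p) y > 0) (at_left b) = of_bool False"
   using ab \<open>\<And>y. a < y \<Longrightarrow> y < b \<Longrightarrow> y \<notin> A\<close>
   by (intro evr[of b] evl[of a]; auto)+
  ultimately show ?thesis by (simp only: card.empty) simp
 next
  case True
  have inA: "y \<in> A" if "a < y" "y < b" for y using True that by auto
  have A1: "ev_ind (\<lambda>y. y \<in> A) (at_right a) = of_bool True"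
   using ab inA by (intro evr[of b]) auto
  define m where "m = (a + b)/2"
  have m: "a < m" "m < b" using ab by (auto simp: m_def)
  have sg: "sgn (poly (pderiv p) y) = sgn (poly (pderiv p) m)" if "a < y" "y < b" for y
   using poly_const_sign[of a b "pderiv p" y m] nz that m by blast
  have prod: "\<exists>z. u < z \<and> z < v \<and> poly p v - poly p u = (v - u) * poly (pderiv p) z" if "u < v" for u v
   using poly_MVT[OF that, of p] by blast
  \<comment> \<open>The direction of monotonicity: \<open>?s * p\<close> increases on the interval
    and has the sign of \<open>p * pderiv p\<close>. So \<open>p\<close> has a root exactly if
    \<open>?s * p\<close> is negative near the left end and positive near the right end.\<close>
  let ?s = "sgn (poly (pderiv p) m)"
  have s1: "?s = 1 \<or> ?s = -1" using nz[OF m] by (auto simp: sgn_if)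
  have inc: "?s * poly p u < ?s * poly p v" if uv: "u < v" "a < u" "v < b" for u v
  proof -
   obtain z where z: "u < z" "z < v" "poly p v - poly p u = (v - u) * poly (pderiv p) z"
    using prod[OF uv(1)] by blast
   have "?s * poly (pderiv p) z > 0"
    using sg[of z] z uv nz[of z] by (metis abs_sgn less_trans mult.commute zero_less_abs_iff)
   then have "?s * (poly p v - poly p u) > 0" using z(3) uv(1)
    by (simp add: mult.left_commute)
   then show ?thesis by (simp add: algebra_simps)
  qed
  have sgp: "poly p y * poly (pderiv p) y < 0 \<longleftrightarrow> ?s * poly p y < 0"
   "poly p y * poly (pderiv p) y > 0 \<longleftrightarrow> ?s * poly p y > 0" if "a < y" "y < b" for y
   using sg[OF that] nz[OF that] s1
   by (auto simp: sgn_if mult_less_0_iff zero_less_mult_iff split: if_splits)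
  show ?thesis
  proof (cases "\<exists>r. a < r \<and> r < b \<and> poly p r = 0")
   case True
   then obtain r where r: "a < r" "r < b" "poly p r = 0" by blast
   have "{y \<in> {a<..<b}. y \<in> A \<and> poly p y = 0} = {r}"
   proof -
    have un: "y = r" if "a < y" "y < b" "poly p y = 0" for y
     using inc[of r y] inc[of y r] r that by (cases y r rule: linorder_cases) auto
    show ?thesis
    proof (intro equalityI subsetI)
     fix y assume "y \<in> {y \<in> {a<..<b}. y \<in> A \<and> poly p y = 0}"
     then show "y \<in> {r}" using un[of y] by simp
    qed (use r inA[of r] in simp)
   qed
   moreover have "ev_ind (\<lambda>y. y \<in> A \<and> poly p y * poly (pderiv p) y < 0) (at_right a) = of_bool True"
    using r inA sgp(1) inc[of _ r] by (intro evr[of r]) auto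
   moreover have "ev_ind (\<lambda>y. y \<in> A \<and> poly p y * poly (pderiv p) y > 0) (at_left b) = of_bool True"
    using r inA sgp(2) inc[of r] by (intro evl[of r]) auto
   ultimately show ?thesis using A1 by simp
  next
   case False
   have sgp': "sgn (poly p y) = sgn (poly p m)" if "a < y" "y < b" for y
    using poly_const_sign[of a b p y m] False that m by blast
   have pm: "poly p m \<noteq> 0" using False m by blast
   have "{y \<in> {a<..<b}. y \<in> A \<and> poly p y = 0} = {}" using False by auto
   moreover have "ev_ind (\<lambda>y. y \<in> A \<and> poly p y * poly (pderiv p) y < 0) (at_right a) = of_bool (?s * poly p m < 0)"
   proof (rule evr[of b])
    fix y assume y: "a < y" "y < b"
    show "(y \<in> A \<and> poly p y * poly (pderiv p) y < 0) = (?s * poly p m < 0)"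
     using inA[OF y] sgp[OF y] sgp'[OF y] s1 by (auto simp: sgn_if split: if_splits)
   qed (use ab in auto)
   moreover have "ev_ind (\<lambda>y. y \<in> A \<and> poly p y * poly (pderiv p) y > 0) (at_left b) = of_bool (?s * poly p m > 0)"
   proof (rule evl[of a])
    fix y assume y: "a < y" "y < b"
    show "(y \<in> A \<and> poly p y * poly (pderiv p) y > 0) = (?s * poly p m > 0)"
     using inA[OF y] sgp[OF y] sgp'[OF y] s1 by (auto simp: sgn_if split: if_splits)
   qed (use ab in auto)
   \<comment> \<open>Without a root exactly one of the two end indicators is 1, and the subtracted
     indicator of \<open>A\<close> cancels it.\<close>
   moreover have "of_bool (?s * poly p m < 0) + of_bool (?s * poly p m > 0) = (1::int)"
    using pm s1 by auto
   ultimately show ?thesis using A1 by (simp only: card.empty) simp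
  qed
 qed
qed

text \<open>Cut the interval at the least point of \<open>E\<close> and add up
  \<open>interval_root_count\<close> over the pieces: each point of \<open>E\<close> is the right
  end of one piece and the left end of the next. Constancy of \<open>A\<close> is asked only on
  intervals that avoid \<open>E\<close>.\<close>

lemma punctured_root_count:
 fixes p :: "real poly" and E :: "real set"
 assumes "finite E" "a < b" "E \<subseteq> {a<..<b}"
  and "\<And>y. y \<in> {a<..<b} - E \<Longrightarrow> poly (pderiv p) y \<noteq> 0" and "p \<noteq> 0"
  and "\<And>c d. a \<le> c \<Longrightarrow> d \<le> b \<Longrightarrow> {c<..<d} \<inter> E = {} \<Longrightarrow> {c<..<d} \<subseteq> A \<or> {c<..<d} \<inter> A = {}"
 shows "int (card {y \<in> {a<..<b} - E. y \<in> A \<and> poly p y = 0}) =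
  ev_ind (\<lambda>y. y \<in> A \<and> poly p y * poly (pderiv p) y < 0) (at_right a)
  + ev_ind (\<lambda>y. y \<in> A \<and> poly p y * poly (pderiv p) y > 0) (at_left b)
  - ev_ind (\<lambda>y. y \<in> A) (at_right a)
  + (\<Sum>e\<in>E. ev_ind (\<lambda>y. y \<in> A \<and> poly p y * poly (pderiv p) y < 0) (at_right e)
    + ev_ind (\<lambda>y. y \<in> A \<and> poly p y * poly (pderiv p) y > 0) (at_left e)
    - ev_ind (\<lambda>y. y \<in> A) (at_right e))"
 using assms
proof (induction E arbitrary: a rule: finite_linorder_min_induct)
 case empty
 have "int (card {y \<in> {a<..<b}. y \<in> A \<and> poly p y = 0}) =
  ev_ind (\<lambda>y. y \<in> A \<and> poly p y * poly (pderiv p) y < 0) (at_right a)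
  + ev_ind (\<lambda>y. y \<in> A \<and> poly p y * poly (pderiv p) y > 0) (at_left b)
  - ev_ind (\<lambda>y. y \<in> A) (at_right a)"
  using empty by (intro interval_root_count) auto
 then show ?case by simp
next
 case (insert e E)
 have e: "a < e" "e < b" "e \<notin> E" using insert by auto
 have lE: "y \<notin> E" if "y \<le> e" for y using insert.hyps(2) that by (metis not_le)
 have 1: "int (card {y \<in> {a<..<e}. y \<in> A \<and> poly p y = 0}) =
  ev_ind (\<lambda>y. y \<in> A \<and> poly p y * poly (pderiv p) y < 0) (at_right a)
  + ev_ind (\<lambda>y. y \<in> A \<and> poly p y * poly (pderiv p) y > 0) (at_left e)
  - ev_ind (\<lambda>y. y \<in> A) (at_right a)"
 proof (rule interval_root_count[OF e(1)])
  show "poly (pderiv p) y \<noteq> 0" if "a < y" "y < e" for y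
   using insert.prems(3)[of y] lE[of y] that e by simp
  show "{a<..<e} \<subseteq> A \<or> {a<..<e} \<inter> A = {}"
  proof (rule insert.prems(5))
   show "{a<..<e} \<inter> insert e E = {}" using lE by auto
  qed (use e in auto)
 qed
 have 2: "int (card {y \<in> {e<..<b} - E. y \<in> A \<and> poly p y = 0}) =
  ev_ind (\<lambda>y. y \<in> A \<and> poly p y * poly (pderiv p) y < 0) (at_right e)
  + ev_ind (\<lambda>y. y \<in> A \<and> poly p y * poly (pderiv p) y > 0) (at_left b)
  - ev_ind (\<lambda>y. y \<in> A) (at_right e)
  + (\<Sum>e\<in>E. ev_ind (\<lambda>y. y \<in> A \<and> poly p y * poly (pderiv p) y < 0) (at_right e)
    + ev_ind (\<lambda>y. y \<in> A \<and> poly p y * poly (pderiv p) y > 0) (at_left e)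
    - ev_ind (\<lambda>y. y \<in> A) (at_right e))"
 proof (rule insert.IH[OF e(2)])
  show "E \<subseteq> {e<..<b}" using insert by auto
  show "poly (pderiv p) y \<noteq> 0" if "y \<in> {e<..<b} - E" for y
   using insert.prems(3)[of y] that e by auto
  show "{c<..<d} \<subseteq> A \<or> {c<..<d} \<inter> A = {}" if "e \<le> c" "d \<le> b" "{c<..<d} \<inter> E = {}" for c d
  proof (rule insert.prems(5))
   show "{c<..<d} \<inter> insert e E = {}" using that by auto
  qed (use that e in auto)
 qed (rule insert.prems)
 have fin: "finite {y. poly p y = 0}" using \<open>p \<noteq> 0\<close> by (rule poly_roots_finite)
 have "{y \<in> {a<..<b} - insert e E. y \<in> A \<and> poly p y = 0} =
   {y \<in> {a<..<e}. y \<in> A \<and> poly p y = 0} \<union> {y \<in> {e<..<b} - E. y \<in> A \<and> poly p y = 0}"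
  (is "?l = ?r")
 proof (rule set_eqI)
  fix y
  consider "y < e" | "y = e" | "e < y" by linarith
  then show "y \<in> ?l \<longleftrightarrow> y \<in> ?r"
   by cases (use e lE[of y] in auto)
 qed
 moreover have "card ({y \<in> {a<..<e}. y \<in> A \<and> poly p y = 0} \<union> {y \<in> {e<..<b} - E. y \<in> A \<and> poly p y = 0})
  = card {y \<in> {a<..<e}. y \<in> A \<and> poly p y = 0} + card {y \<in> {e<..<b} - E. y \<in> A \<and> poly p y = 0}"
  by (rule card_Un_disjoint) (auto intro: finite_subset[OF _ fin])
 ultimately show ?case using 1 2 insert.hyps(1) e(3) by simp
qed

section \<open>Integer-valued functions with finitely many semialgebraic level sets\<close>

definition sa_count :: "('a::euclidean_space \<Rightarrow> int) \<Rightarrow> bool" where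
 "sa_count N \<longleftrightarrow> finite (range N) \<and> (\<forall>k. semialgebraic {x. N x = k})"

lemma sa_count_of_bool: assumes "semialgebraic {x. P x}" shows "sa_count (\<lambda>x. of_bool (P x))"
 unfolding sa_count_def
proof (intro conjI allI)
 show "finite (range (\<lambda>x. of_bool (P x) :: int))"
  by (rule finite_subset[of _ "{0, 1}"]) auto
 fix k :: int
 have "{x. (of_bool (P x) :: int) = k} = (if k = 1 then {x. P x} else if k = 0 then - {x. P x} else {})"
  by (auto simp: of_bool_def split: if_splits)
 then show "semialgebraic {x. (of_bool (P x) :: int) = k}"
  using assms by (simp add: semialgebraic_empty semialgebraic.compl)
qed

lemma sa_count_const: "sa_count (\<lambda>x. c)"
 unfolding sa_count_def by (auto intro: semialgebraic_Collect_const simp del: Collect_const)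

lemma sa_count_add: assumes "sa_count N" "sa_count M" shows "sa_count (\<lambda>x. N x + M x)"
 unfolding sa_count_def
proof (intro conjI allI)
 have "range (\<lambda>x. N x + M x) \<subseteq> (\<lambda>(i, j). i + j) ` (range N \<times> range M)" by auto
 then show "finite (range (\<lambda>x. N x + M x))"
  by (rule finite_subset) (use assms in \<open>auto simp: sa_count_def\<close>)
 fix k
 have "{x. N x + M x = k} = (\<Union>i\<in>range N. {x. N x = i} \<inter> {x. M x = k - i})" by auto
 also have "semialgebraic \<dots>"
  using assms by (intro semialgebraic_UN semialgebraic_Int) (auto simp: sa_count_def)
 finally show "semialgebraic {x. N x + M x = k}" .
qed

lemma sa_count_uminus: assumes "sa_count N" shows "sa_count (\<lambda>x. - N x)"
 unfolding sa_count_def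
proof (intro conjI allI)
 have "range (\<lambda>x. - N x) = uminus ` range N" by auto
 then show "finite (range (\<lambda>x. - N x))" using assms by (auto simp: sa_count_def)
 fix k
 have "{x. - N x = k} = {x. N x = - k}" by auto
 then show "semialgebraic {x. - N x = k}" using assms by (simp add: sa_count_def)
qed

lemma sa_count_diff: "sa_count N \<Longrightarrow> sa_count M \<Longrightarrow> sa_count (\<lambda>x. N x - M x)"
 using sa_count_add[OF _ sa_count_uminus, of N M] by simp

lemma sa_count_if:
 assumes "semialgebraic {x. P x}" "sa_count N" "sa_count M"
 shows "sa_count (\<lambda>x. if P x then N x else M x)"
 unfolding sa_count_def
proof (intro conjI allI)
 have "range (\<lambda>x. if P x then N x else M x) \<subseteq> range N \<union> range M" by auto
 then show "finite (range (\<lambda>x. if P x then N x else M x))"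
  by (rule finite_subset) (use assms in \<open>auto simp: sa_count_def\<close>)
 fix k
 have "{x. (if P x then N x else M x) = k} = ({x. P x} \<inter> {x. N x = k}) \<union> (- {x. P x} \<inter> {x. M x = k})"
  by auto
 also have "semialgebraic \<dots>" using assms
  by (intro semialgebraic.union semialgebraic_Int semialgebraic.compl) (auto simp: sa_count_def)
 finally show "semialgebraic {x. (if P x then N x else M x) = k}" .
qed

lemma sa_count_nonzero: "sa_count N \<Longrightarrow> semialgebraic {x. N x \<noteq> 0}"
 by (intro semialgebraic_neg) (auto simp: sa_count_def)

text \<open>The value 0 at a zero polynomial is a convention: there every point of the fibre of
  \<open>A\<close> would count as a root.\<close>

definition root_count :: "('a::euclidean_space \<Rightarrow> real poly) \<Rightarrow> ('a \<times> real) set \<Rightarrow> 'a \<Rightarrow> int" where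
 "root_count e A x = (if e x = 0 then 0 else int (card {y. poly (e x) y = 0 \<and> (x, y) \<in> A}))"

definition root_set :: "('a::euclidean_space \<Rightarrow> real poly) list \<Rightarrow> 'a \<Rightarrow> real set" where
 "root_set L x = (\<Union>q\<in>set L. {y. q x \<noteq> 0 \<and> poly (q x) y = 0})"

lemma finite_root_set:
 fixes L :: "('a::euclidean_space \<Rightarrow> real poly) list"
 shows "finite (root_set L x)"
proof -
 have "finite {y. q x \<noteq> 0 \<and> poly (q x) y = 0}" for q :: "'a \<Rightarrow> real poly"
  using poly_roots_finite[of "q x"] by (cases "q x = 0") auto
 then show ?thesis unfolding root_set_def by blast
qed

lemma semialgebraic_root_set:
 assumes "set L \<subseteq> (\<Union>n. pdeg n)" shows "semialgebraic {(x, y). y \<in> root_set L x}"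
proof -
 have "{(x, y). y \<in> root_set L x} =
  (\<Union>q\<in>set L. {(x, y). x \<in> {x. q x \<noteq> 0}} \<inter> {(x, y). poly (q x) y = 0})"
  by (auto simp: root_set_def)
 also have "semialgebraic \<dots>"
  using assms
  by (intro semialgebraic_UN semialgebraic_Int semialgebraic_cylinder)
   (auto intro: semialgebraic_eval_zero semialgebraic_pdeg_nonzero)
 finally show ?thesis .
qed

text \<open>The first hypothesis is the induction hypothesis of the counting theorem. Roots shared
  by several polynomials must count once, so the roots of \<open>q\<close> are counted only on
  \<open>A\<close> minus the roots of the rest of the list.\<close>

lemma sa_count_root_set:
 fixes L :: "('a::euclidean_space \<Rightarrow> real poly) list"
 assumes "\<And>(e :: 'a \<Rightarrow> real poly) A. e \<in> pdeg n \<Longrightarrow> semialgebraic A \<Longrightarrow> sa_count (root_count e A)"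
  and "set L \<subseteq> pdeg n" "semialgebraic A"
 shows "sa_count (\<lambda>x. int (card {y \<in> root_set L x. (x, y) \<in> A}))"
 using assms(2)
proof (induction L)
 case Nil
 then show ?case by (simp add: root_set_def sa_count_const)
next
 case (Cons q L)
 let ?B = "A - {(x, y). y \<in> root_set L x}"
 have B: "semialgebraic ?B"
  using Cons.prems assms(3) by (intro semialgebraic_Diff semialgebraic_root_set) auto
 have "int (card {y \<in> root_set (q # L) x. (x, y) \<in> A}) =
   root_count q ?B x + int (card {y \<in> root_set L x. (x, y) \<in> A})" for x
 proof (cases "q x = 0")
  case True
  then have "root_set (q # L) x = root_set L x" by (auto simp: root_set_def)
  then show ?thesis using True by (simp add: root_count_def)
 next
  case False
  have "{y \<in> root_set (q # L) x. (x, y) \<in> A} =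
   {y. poly (q x) y = 0 \<and> (x, y) \<in> ?B} \<union> {y \<in> root_set L x. (x, y) \<in> A}"
   using False by (auto simp: root_set_def)
  moreover have "card ({y. poly (q x) y = 0 \<and> (x, y) \<in> ?B} \<union> {y \<in> root_set L x. (x, y) \<in> A}) =
    card {y. poly (q x) y = 0 \<and> (x, y) \<in> ?B} + card {y \<in> root_set L x. (x, y) \<in> A}"
   using finite_root_set[of L x] poly_roots_finite[OF False]
   by (intro card_Un_disjoint) auto
  ultimately show ?thesis using False by (simp add: root_count_def)
 qed
 then show ?case
  using sa_count_add[OF assms(1)[OF _ B] Cons.IH, of q] Cons.prems by simp
qed

text \<open>The consequence wanted is that a fibre of \<open>A\<close> is constant on each interval
  without roots from the list. Polynomials that vanish identically at \<open>x\<close> do no harm,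
  their sign being constant.\<close>

definition determined_by :: "('a::euclidean_space \<times> real) set \<Rightarrow> ('a \<Rightarrow> real poly) list \<Rightarrow> bool" where
 "determined_by A L \<longleftrightarrow> (\<forall>x y y'. (\<forall>q\<in>set L. sgn (poly (q x) y) = sgn (poly (q x) y')) \<longrightarrow>
   ((x, y) \<in> A \<longleftrightarrow> (x, y') \<in> A))"

lemma determined_by_interval_iff:
 assumes "determined_by A L" "{c<..<d} \<inter> root_set L x = {}"
  and "c < y" "y < d" "c < y'" "y' < d"
 shows "(x, y) \<in> A \<longleftrightarrow> (x, y') \<in> A"
proof -
 have "sgn (poly (q x) y) = sgn (poly (q x) y')"
  if "y \<in> {c<..<d}" "y' \<in> {c<..<d}" "q \<in> set L" for y y' q
 proof (cases "q x = 0")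
  case False
  then show ?thesis using assms(2) that
   by (intro poly_const_sign[of c d]) (auto simp: root_set_def)
 qed simp
 then show ?thesis
  using assms unfolding determined_by_def by (metis greaterThanLessThan_iff)
qed

lemma determined_by_interval:
 assumes "determined_by A L" "{c<..<d} \<inter> root_set L x = {}"
 shows "{c<..<d} \<subseteq> {y. (x, y) \<in> A} \<or> {c<..<d} \<inter> {y. (x, y) \<in> A} = {}"
proof (cases "\<exists>y. c < y \<and> y < d \<and> (x, y) \<in> A")
 case True
 then obtain y where "c < y" "y < d" "(x, y) \<in> A" by blast
 then have "(x, z) \<in> A" if "c < z" "z < d" for z
  using determined_by_interval_iff[OF assms, of y z] that by simp
 then show ?thesis by auto
qed auto

lemma determined_by_append:
 "determined_by A L \<or> determined_by A M \<Longrightarrow> determined_by A (L @ M)"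
 unfolding determined_by_def set_append ball_Un by blast

lemma determined_by_Un: "determined_by A L \<Longrightarrow> determined_by B L \<Longrightarrow> determined_by (A \<union> B) L"
 unfolding determined_by_def by (metis Un_iff)

lemma determined_by_compl: "determined_by A L \<Longrightarrow> determined_by (- A) L"
 unfolding determined_by_def by (metis Compl_iff)

lemma semialgebraic_determined:
 fixes A :: "('a::euclidean_space \<times> real) set"
 assumes "semialgebraic A"
 obtains L where "set L \<subseteq> (\<Union>n. pdeg n)" "determined_by A L"
proof -
 have "\<exists>L. set L \<subseteq> (\<Union>n. pdeg n) \<and> determined_by A L" using assms
 proof induction
  case (pos p)
  obtain P n where P: "P \<in> pdeg n" "\<And>x y. p (x, y) = poly (P x) y"
   using poly_fun_pdeg[OF pos] by blast
  have "determined_by {z. p z > 0} [P]"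
   by (auto simp: determined_by_def P(2)) (metis sgn_1_pos)+
  then show ?case using P(1) by (intro exI[of _ "[P]"]) auto
 next
  case (zero p)
  obtain P n where P: "P \<in> pdeg n" "\<And>x y. p (x, y) = poly (P x) y"
   using poly_fun_pdeg[OF zero] by blast
  have "determined_by {z. p z = 0} [P]"
   by (auto simp: determined_by_def P(2)) (metis sgn_0_0)+
  then show ?case using P(1) by (intro exI[of _ "[P]"]) auto
 next
  case (union A B)
  then obtain L M where "set L \<subseteq> (\<Union>n. pdeg n)" "determined_by A L"
   "set M \<subseteq> (\<Union>n. pdeg n)" "determined_by B M" by blast
  then show ?case
   by (intro exI[of _ "L @ M"]) (auto intro: determined_by_Un determined_by_append)
 next
  case (compl A)
  then show ?case using determined_by_compl by blast
 qed
 then show thesis using that by blast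
qed

text \<open>Pseudo-division by \<open>e\<close>. The leading coefficient enters with an even power,
  so where it is nonzero, \<open>P\<close> and \<open>R\<close> have the same sign at the roots of
  \<open>e\<close>.\<close>

lemma pseudo_reduce:
 assumes e: "e \<in> pdeg (Suc d)" and P: "P \<in> pdeg n"
 obtains R k where "R \<in> pdeg d"
  "\<And>x y. poly (e x) y = 0 \<Longrightarrow> poly (R x) y = coeff (e x) (Suc d) ^ (2 * k) * poly (P x) y"
proof -
 have "\<exists>R k. R \<in> pdeg d \<and> (\<forall>x y. poly (e x) y = 0 \<longrightarrow>
   poly (R x) y = coeff (e x) (Suc d) ^ (2 * k) * poly (P x) y)" using P
 proof (induction n arbitrary: P)
  case 0
  then show ?case by (intro exI[of _ P] exI[of _ 0]) (auto intro: pdeg_mono)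
 next
  case (Suc n)
  show ?case
  proof (cases "Suc n \<le> d")
   case True
   then show ?thesis using Suc.prems by (intro exI[of _ P] exI[of _ 0]) (auto intro: pdeg_mono)
  next
   case False
   then have nd: "n - d + Suc d = Suc n" by simp
   define c where "c x = coeff (e x) (Suc d)" for x
   define a where "a x = coeff (P x) (Suc n)" for x
   have c: "c \<in> poly_fun" and a: "a \<in> poly_fun"
    using pdeg_coeff[OF e, of "Suc d"] pdeg_coeff[OF Suc.prems, of "Suc n"]
    by (auto simp: c_def[abs_def] a_def[abs_def])
   \<comment> \<open>Multiplying by \<open>c x\<close> twice rather than once keeps the accumulated
     factor a square.\<close>
   define P1 where "P1 x = smult (c x * c x) (P x) - monom (c x * a x) (n - d) * e x" for x
   have "P1 \<in> pdeg (Suc n)"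
   proof -
    have "(\<lambda>x. monom (c x * a x) (n - d) * e x) \<in> pdeg (n - d + Suc d)"
     by (intro pdeg_mult pdeg_monom e poly_fun.mult c a)
    then show ?thesis unfolding P1_def[abs_def] nd
     by (intro pdeg_diff pdeg_smult poly_fun.mult c Suc.prems)
   qed
   moreover have "coeff (P1 x) (Suc n) = 0" for x
   proof -
    have "coeff (monom (c x * a x) (n - d) * e x) (Suc n) = c x * a x * c x"
     using False by (simp add: coeff_monom_mult c_def Suc_diff_le)
    then show ?thesis by (simp add: P1_def a_def)
   qed
   ultimately have "P1 \<in> pdeg n"
    using pdeg_truncate[of P1 n] by simp
   then obtain R k where R: "R \<in> pdeg d"
    "\<forall>x y. poly (e x) y = 0 \<longrightarrow> poly (R x) y = coeff (e x) (Suc d) ^ (2 * k) * poly (P1 x) y"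
    using Suc.IH by blast
   have "poly (R x) y = coeff (e x) (Suc d) ^ (2 * Suc k) * poly (P x) y" if "poly (e x) y = 0" for x y
    using R(2) that by (simp add: P1_def c_def power2_eq_square mult_ac)
   then show ?thesis using R(1) by blast
  qed
 qed
 then show thesis using that by blast
qed

text \<open>Among the roots of \<open>e\<close> the set \<open>A\<close> may be replaced by one
  described in degree at most \<open>d\<close>, below that of \<open>e\<close>. Otherwise the
  degrees of the polynomials describing \<open>A\<close> would block the induction on the degree of
  \<open>e\<close>.\<close>

lemma semialgebraic_reduce:
 fixes A :: "('a::euclidean_space \<times> real) set"
 assumes e: "e \<in> pdeg (Suc d)" and A: "semialgebraic A"
 obtains L B where "set L \<subseteq> pdeg d" "semialgebraic B" "determined_by B L"
  "\<And>x y. poly (e x) y = 0 \<Longrightarrow> coeff (e x) (Suc d) \<noteq> 0 \<Longrightarrow> (x, y) \<in> A \<longleftrightarrow> (x, y) \<in> B"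
proof -
 have "\<exists>L B. set L \<subseteq> pdeg d \<and> semialgebraic B \<and> determined_by B L \<and>
  (\<forall>x y. poly (e x) y = 0 \<longrightarrow> coeff (e x) (Suc d) \<noteq> 0 \<longrightarrow> ((x, y) \<in> A \<longleftrightarrow> (x, y) \<in> B))" using A
 proof induction
  case (pos p)
  obtain P n where P: "P \<in> pdeg n" "\<And>x y. p (x, y) = poly (P x) y"
   using poly_fun_pdeg[OF pos] by blast
  obtain R k where R: "R \<in> pdeg d"
   "\<And>x y. poly (e x) y = 0 \<Longrightarrow> poly (R x) y = coeff (e x) (Suc d) ^ (2 * k) * poly (P x) y"
   using pseudo_reduce[OF e P(1)] by blast
  have "determined_by {(x, y). poly (R x) y > 0} [R]"
   by (auto simp: determined_by_def) (metis sgn_1_pos)+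
  moreover have "p (x, y) > 0 \<longleftrightarrow> poly (R x) y > 0"
   if "poly (e x) y = 0" "coeff (e x) (Suc d) \<noteq> 0" for x y
   using R(2)[OF that(1)] that(2) P(2) by (simp add: power_mult zero_less_mult_iff)
  ultimately show ?case using R(1) semialgebraic_eval_pos[OF R(1)]
   by (intro exI[of _ "[R]"] exI[of _ "{(x, y). poly (R x) y > 0}"]) auto
 next
  case (zero p)
  obtain P n where P: "P \<in> pdeg n" "\<And>x y. p (x, y) = poly (P x) y"
   using poly_fun_pdeg[OF zero] by blast
  obtain R k where R: "R \<in> pdeg d"
   "\<And>x y. poly (e x) y = 0 \<Longrightarrow> poly (R x) y = coeff (e x) (Suc d) ^ (2 * k) * poly (P x) y"
   using pseudo_reduce[OF e P(1)] by blast
  have "determined_by {(x, y). poly (R x) y = 0} [R]"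
   by (auto simp: determined_by_def) (metis sgn_0_0)+
  moreover have "p (x, y) = 0 \<longleftrightarrow> poly (R x) y = 0"
   if "poly (e x) y = 0" "coeff (e x) (Suc d) \<noteq> 0" for x y
   using R(2)[OF that(1)] that(2) P(2) by simp
  ultimately show ?case using R(1) semialgebraic_eval_zero[OF R(1)]
   by (intro exI[of _ "[R]"] exI[of _ "{(x, y). poly (R x) y = 0}"]) auto
 next
  case (union A A')
  then obtain L B L' B' where *: "set L \<subseteq> pdeg d" "semialgebraic B" "determined_by B L"
   "\<forall>x y. poly (e x) y = 0 \<longrightarrow> coeff (e x) (Suc d) \<noteq> 0 \<longrightarrow> ((x, y) \<in> A \<longleftrightarrow> (x, y) \<in> B)"
   "set L' \<subseteq> pdeg d" "semialgebraic B'" "determined_by B' L'"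
   "\<forall>x y. poly (e x) y = 0 \<longrightarrow> coeff (e x) (Suc d) \<noteq> 0 \<longrightarrow> ((x, y) \<in> A' \<longleftrightarrow> (x, y) \<in> B')"
   by blast
  have "determined_by (B \<union> B') (L @ L')"
   using * by (intro determined_by_Un determined_by_append) auto
  then show ?case using *
   by (intro exI[of _ "L @ L'"] exI[of _ "B \<union> B'"]) (simp add: semialgebraic.union)
 next
  case (compl A)
  then obtain L B where *: "set L \<subseteq> pdeg d" "semialgebraic B" "determined_by B L"
   "\<forall>x y. poly (e x) y = 0 \<longrightarrow> coeff (e x) (Suc d) \<noteq> 0 \<longrightarrow> ((x, y) \<in> A \<longleftrightarrow> (x, y) \<in> B)"
   by blast
  then show ?case
   by (intro exI[of _ L] exI[of _ "- B"]) (simp add: semialgebraic.compl determined_by_compl)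
 qed
 then show thesis using that by blast
qed

text \<open>Far enough out, the germ at an end point agrees with the germ at infinity. This and its
  mirror image remove the choice of \<open>a\<close> and \<open>b\<close> from the root
  count.\<close>

lemma ev_ind_right_bot:
 assumes "(\<forall>\<^sub>F y in at_bot. P y) \<or> (\<forall>\<^sub>F y in at_bot. \<not> P y)"
 obtains N :: real where "\<And>a. a < N \<Longrightarrow> ev_ind P (at_right a) = of_bool (\<forall>\<^sub>F y in at_bot. P y)"
proof -
 from assms obtain N Q where N: "\<And>y. y < N \<Longrightarrow> P y = Q" and Q: "Q = (\<forall>\<^sub>F y in at_bot. P y)"
 proof (elim disjE)
  assume ev: "\<forall>\<^sub>F y in at_bot. P y"
  then obtain N where "\<And>y. y < N \<Longrightarrow> P y" by (auto simp: eventually_at_bot_dense)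
  then show thesis using that[of N True] ev by simp
 next
  assume ev: "\<forall>\<^sub>F y in at_bot. \<not> P y"
  then obtain N where "\<And>y. y < N \<Longrightarrow> \<not> P y" by (auto simp: eventually_at_bot_dense)
  moreover have "\<not> (\<forall>\<^sub>F y in at_bot. P y)"
   using eventually_conj[OF ev, of P] by (auto simp: trivial_limit_at_bot_linorder)
  ultimately show thesis using that[of N False] by simp
 qed
 have "eventually P (at_right a) = Q" if "a < N" for a
 proof -
  have "\<forall>\<^sub>F y in at_right a. y < N" using that
   by (auto simp: eventually_at_right_field)
  then have ev: "\<forall>\<^sub>F y in at_right a. P y = Q" by eventually_elim (rule N)
  show ?thesis
  proof (cases Q)
   case False
   then have "\<forall>\<^sub>F y in at_right a. \<not> P y" using ev by simp
   then show ?thesis using False eventually_at_right_contr by blast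
  qed (use ev in auto)
 qed
 then show thesis using that[of N] Q by (simp add: ev_ind_def)
qed

lemma ev_ind_left_top:
 assumes "(\<forall>\<^sub>F y in at_top. P y) \<or> (\<forall>\<^sub>F y in at_top. \<not> P y)"
 obtains N :: real where "\<And>a. a > N \<Longrightarrow> ev_ind P (at_left a) = of_bool (\<forall>\<^sub>F y in at_top. P y)"
proof -
 from assms obtain N Q where N: "\<And>y. y > N \<Longrightarrow> P y = Q" and Q: "Q = (\<forall>\<^sub>F y in at_top. P y)"
 proof (elim disjE)
  assume ev: "\<forall>\<^sub>F y in at_top. P y"
  then obtain N where "\<And>y. y > N \<Longrightarrow> P y" by (auto simp: eventually_at_top_dense)
  then show thesis using that[of N True] ev by simp
 next
  assume ev: "\<forall>\<^sub>F y in at_top. \<not> P y"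
  then obtain N where "\<And>y. y > N \<Longrightarrow> \<not> P y" by (auto simp: eventually_at_top_dense)
  moreover have "\<not> (\<forall>\<^sub>F y in at_top. P y)"
   using eventually_conj[OF ev, of P] by (auto simp: trivial_limit_at_top_linorder)
  ultimately show thesis using that[of N False] by simp
 qed
 have "eventually P (at_left a) = Q" if "a > N" for a
 proof -
  have "\<forall>\<^sub>F y in at_left a. y > N" using that
   by (auto simp: eventually_at_left_field)
  then have ev: "\<forall>\<^sub>F y in at_left a. P y = Q" by eventually_elim (rule N)
  show ?thesis
  proof (cases Q)
   case False
   then have "\<forall>\<^sub>F y in at_left a. \<not> P y" using ev by simp
   then show ?thesis using False eventually_conj[of P "at_left a" "\<lambda>y. \<not> P y"]
    by (auto simp: trivial_limit_at_left_real)
  qed (use ev in auto)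
 qed
 then show thesis using that[of N] Q by (simp add: ev_ind_def)
qed

text \<open>By \<open>semialgebraic_reduce\<close> the set \<open>A\<close> may be taken constant
  between the roots of a list \<open>L\<close>. Then \<open>punctured_root_count\<close>, cut at the
  roots of \<open>L\<close> and of the derivative, expresses the count by germs at the cutting
  points and at infinity. The cutting polynomials all have degree at most \<open>d\<close>, so the
  induction hypothesis counts these germs.\<close>

lemma sa_count_root_count:
 fixes e :: "'a::euclidean_space \<Rightarrow> real poly"
 shows "e \<in> pdeg d \<Longrightarrow> semialgebraic A \<Longrightarrow> sa_count (root_count e A)"
proof (induction d arbitrary: e A)
 case 0
 have "root_count e A x = 0" for x
 proof -
  obtain c where "e x = [:c:]"
   using pdeg_degree[OF 0(1), of x] by (auto elim: degree_eq_zeroE)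
  then show ?thesis by (auto simp: root_count_def)
 qed
 then have "root_count e A = (\<lambda>x. 0)" by auto
 then show ?case by (simp add: sa_count_const)
next
 case (Suc d)
 obtain L B where LB: "set L \<subseteq> pdeg d" "semialgebraic B" "determined_by B L"
  "\<And>x y. poly (e x) y = 0 \<Longrightarrow> coeff (e x) (Suc d) \<noteq> 0 \<Longrightarrow> (x, y) \<in> A \<longleftrightarrow> (x, y) \<in> B"
  using semialgebraic_reduce[OF Suc.prems] by blast
 define e' where "e' x = pderiv (e x)" for x
 have e': "e' \<in> pdeg d" using pdeg_pderiv[OF Suc.prems(1)] by (simp add: e'_def[abs_def])
 define L' where "L' = e' # L"
 have L': "set L' \<subseteq> pdeg d" "determined_by B L'"
  using LB(1,3) e' unfolding L'_def determined_by_def by auto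
 define Bm where "Bm = B \<inter> {(x, y). poly (- (e x * e' x)) y > 0}"
 define Bp where "Bp = B \<inter> {(x, y). poly (e x * e' x) y > 0}"
 have sm: "semialgebraic Bm" unfolding Bm_def
  by (intro semialgebraic_Int LB(2) semialgebraic_eval_pos[OF pdeg_uminus[OF pdeg_mult[OF Suc.prems(1) e']]])
 have sp: "semialgebraic Bp" unfolding Bp_def
  by (intro semialgebraic_Int LB(2) semialgebraic_eval_pos[OF pdeg_mult[OF Suc.prems(1) e']])
 have Bm: "(x, y) \<in> Bm \<longleftrightarrow> (x, y) \<in> B \<and> poly (e x) y * poly (pderiv (e x)) y < 0"
  and Bp: "(x, y) \<in> Bp \<longleftrightarrow> (x, y) \<in> B \<and> poly (e x) y * poly (pderiv (e x)) y > 0" for x y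
  by (auto simp: Bm_def Bp_def e'_def)
 define N where "N C x = int (card {y \<in> root_set L' x. (x, y) \<in> C})" for C x
 have N: "sa_count (N C)" if "semialgebraic C" for C
  unfolding N_def[abs_def] using sa_count_root_set[OF Suc.IH L'(1) that] .
 \<comment> \<open>The right-hand side of \<open>punctured_root_count\<close> with the ends moved to
   infinity; the last summand restores the roots of \<open>e\<close> that are themselves cutting
   points.\<close>
 define G where "G x = of_bool (x \<in> bot_nbhd Bm) + of_bool (x \<in> top_nbhd Bp) - of_bool (x \<in> bot_nbhd B)
   + N (rt_nbhd Bm) x + N (lt_nbhd Bp) x - N (rt_nbhd B) x + N (B \<inter> {(x, y). poly (e x) y = 0}) x" for x
 have G: "sa_count G"
  unfolding G_def[abs_def] using semialgebraic_bot_nbhd(1) semialgebraic_top_nbhd(1) sm sp LB(2)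
  by (intro sa_count_add sa_count_diff N sa_count_of_bool semialgebraic_rt_nbhd semialgebraic_lt_nbhd
    semialgebraic_Int semialgebraic_eval_zero[OF Suc.prems(1)]) auto
 \<comment> \<open>Where the coefficient of degree \<open>Suc d\<close> vanishes, \<open>e\<close>
   equals its truncation, which the induction hypothesis covers.\<close>
 define e0 where "e0 x = e x - monom (coeff (e x) (Suc d)) (Suc d)" for x
 have e0: "e0 \<in> pdeg d" using pdeg_truncate[OF Suc.prems(1)] by (simp add: e0_def[abs_def])
 have "root_count e A x = (if coeff (e x) (Suc d) = 0 then root_count e0 A x else G x)" for x
 proof (cases "coeff (e x) (Suc d) = 0")
  case True
  then show ?thesis by (simp add: e0_def root_count_def)
 next
  case False
  then have ne: "e x \<noteq> 0" by auto
  have "degree (e x) = Suc d"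
   using False pdeg_degree[OF Suc.prems(1), of x] le_degree[of "e x" "Suc d"] by simp
  then have ne': "pderiv (e x) \<noteq> 0" by (simp add: pderiv_eq_0_iff)
  let ?E = "root_set L' x"
  let ?B = "{y. (x, y) \<in> B}"
  have finE: "finite ?E" by (rule finite_root_set)
  have finR: "finite {y. poly (e x) y = 0}" using ne by (rule poly_roots_finite)
  have fin: "finite (?E \<union> {y. poly (e x) y = 0})" using finE finR by simp
  obtain N1 where N1: "\<And>a. a < N1 \<Longrightarrow> ev_ind (\<lambda>y. (x, y) \<in> Bm) (at_right a) = of_bool (\<forall>\<^sub>F y in at_bot. (x, y) \<in> Bm)"
   using ev_ind_right_bot[OF semialgebraic_bot_nbhd(2)[OF sm, of x]] by blast
  obtain N2 where N2: "\<And>a. a < N2 \<Longrightarrow> ev_ind (\<lambda>y. (x, y) \<in> B) (at_right a) = of_bool (\<forall>\<^sub>F y in at_bot. (x, y) \<in> B)"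
   using ev_ind_right_bot[OF semialgebraic_bot_nbhd(2)[OF LB(2), of x]] by blast
  obtain N3 where N3: "\<And>a. a > N3 \<Longrightarrow> ev_ind (\<lambda>y. (x, y) \<in> Bp) (at_left a) = of_bool (\<forall>\<^sub>F y in at_top. (x, y) \<in> Bp)"
   using ev_ind_left_top[OF semialgebraic_top_nbhd(2)[OF sp, of x]] by blast
  obtain l u where lu: "\<And>y. y \<in> ?E \<union> {y. poly (e x) y = 0} \<Longrightarrow> l < y \<and> y < u"
  proof -
   obtain M where M: "\<And>y. y \<in> ?E \<union> {y. poly (e x) y = 0} \<Longrightarrow> \<bar>y\<bar> \<le> M"
    using finite_imp_bounded[OF fin] by (auto simp: bounded_iff)
   have "- M - 1 < y \<and> y < M + 1" if "y \<in> ?E \<union> {y. poly (e x) y = 0}" for y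
    using M[OF that] by linarith
   then show thesis by (rule that)
  qed
  define a where "a = min (min N1 N2) (min l u) - 1"
  define b where "b = max N3 (max l u) + 1"
  have ab: "a < b" "a < N1" "a < N2" "b > N3" "a < l" "u < b" by (auto simp: a_def b_def)
  have inab: "a < y \<and> y < b" if "y \<in> ?E \<union> {y. poly (e x) y = 0}" for y
   using lu[OF that] ab by linarith
  have "int (card {y \<in> {a<..<b} - ?E. y \<in> ?B \<and> poly (e x) y = 0}) =
   ev_ind (\<lambda>y. y \<in> ?B \<and> poly (e x) y * poly (pderiv (e x)) y < 0) (at_right a)
   + ev_ind (\<lambda>y. y \<in> ?B \<and> poly (e x) y * poly (pderiv (e x)) y > 0) (at_left b)
   - ev_ind (\<lambda>y. y \<in> ?B) (at_right a)
   + (\<Sum>r\<in>?E. ev_ind (\<lambda>y. y \<in> ?B \<and> poly (e x) y * poly (pderiv (e x)) y < 0) (at_right r)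
     + ev_ind (\<lambda>y. y \<in> ?B \<and> poly (e x) y * poly (pderiv (e x)) y > 0) (at_left r)
     - ev_ind (\<lambda>y. y \<in> ?B) (at_right r))"
  proof (rule punctured_root_count[OF finE ab(1) _ _ ne])
   show "?E \<subseteq> {a<..<b}" using inab by auto
   show "poly (pderiv (e x)) y \<noteq> 0" if "y \<in> {a<..<b} - ?E" for y
    using that ne' by (auto simp: root_set_def L'_def e'_def)
   show "{c<..<d} \<subseteq> ?B \<or> {c<..<d} \<inter> ?B = {}" if "{c<..<d} \<inter> ?E = {}" for c d
    using determined_by_interval[OF L'(2) that] .
  qed
  also have "\<dots> = of_bool (x \<in> bot_nbhd Bm) + of_bool (x \<in> top_nbhd Bp) - of_bool (x \<in> bot_nbhd B)
   + (\<Sum>r\<in>?E. of_bool ((x, r) \<in> rt_nbhd Bm) + of_bool ((x, r) \<in> lt_nbhd Bp) - of_bool ((x, r) \<in> rt_nbhd B))"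
   using N1[OF ab(2)] N2[OF ab(3)] N3[OF ab(4)]
   by (simp add: Bm Bp bot_nbhd_def top_nbhd_def rt_nbhd_def lt_nbhd_def ev_ind_def)
  also have "(\<Sum>r\<in>?E. of_bool ((x, r) \<in> rt_nbhd Bm) + of_bool ((x, r) \<in> lt_nbhd Bp) - of_bool ((x, r) \<in> rt_nbhd B))
    = N (rt_nbhd Bm) x + N (lt_nbhd Bp) x - N (rt_nbhd B) x"
   unfolding N_def using finE
   by (simp add: sum.distrib sum_subtractf sum_of_bool_eq Collect_conj_eq)
  finally have c1: "int (card {y \<in> {a<..<b} - ?E. y \<in> ?B \<and> poly (e x) y = 0}) =
    G x - N (B \<inter> {(x, y). poly (e x) y = 0}) x"
   by (simp add: G_def)
  have "{y. poly (e x) y = 0 \<and> (x, y) \<in> A} =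
   {y \<in> {a<..<b} - ?E. y \<in> ?B \<and> poly (e x) y = 0} \<union> {y \<in> ?E. (x, y) \<in> B \<inter> {(x, y). poly (e x) y = 0}}"
   using inab LB(4) False by auto
  moreover have "card ({y \<in> {a<..<b} - ?E. y \<in> ?B \<and> poly (e x) y = 0} \<union> {y \<in> ?E. (x, y) \<in> B \<inter> {(x, y). poly (e x) y = 0}})
   = card {y \<in> {a<..<b} - ?E. y \<in> ?B \<and> poly (e x) y = 0} + card {y \<in> ?E. (x, y) \<in> B \<inter> {(x, y). poly (e x) y = 0}}"
   by (rule card_Un_disjoint) (auto intro: finite_subset[OF _ finR] finite_subset[OF _ finE])
  ultimately have "root_count e A x = G x"
   using c1 ne by (simp add: root_count_def N_def)
  then show ?thesis using False by simp
 qed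
 then have "root_count e A = (\<lambda>x. if coeff (e x) (Suc d) = 0 then root_count e0 A x else G x)" by auto
 moreover have "sa_count (\<lambda>x. if coeff (e x) (Suc d) = 0 then root_count e0 A x else G x)"
  by (intro sa_count_if semialgebraic.zero pdeg_coeff[OF Suc.prems(1)] Suc.IH e0 Suc.prems G)
 ultimately show ?case by simp
qed

section \<open>Projection along a line\<close>

lemma pdeg_list_bound:
 "set L \<subseteq> (\<Union>n. pdeg n) \<Longrightarrow> \<exists>n. set L \<subseteq> pdeg n"
proof (induction L)
 case (Cons q L)
 then obtain n m where "q \<in> pdeg n" "set L \<subseteq> pdeg m" by auto
 then have "set (q # L) \<subseteq> pdeg (max n m)" by (auto intro: pdeg_mono)
 then show ?case by blast
qed auto

theorem semialgebraic_project:
 fixes A :: "('a::euclidean_space \<times> real) set"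
 assumes A: "semialgebraic A" shows "semialgebraic {x. \<exists>y. (x, y) \<in> A}"
proof -
 obtain L where L0: "set L \<subseteq> (\<Union>n. pdeg n)" "determined_by A L"
  using semialgebraic_determined[OF A] by blast
 obtain n where L: "set L \<subseteq> pdeg n" using pdeg_list_bound[OF L0(1)] by blast
 define N where "N C x = int (card {y \<in> root_set L x. (x, y) \<in> C})" for C x
 have N: "sa_count (N C)" if "semialgebraic C" for C
  unfolding N_def[abs_def] using sa_count_root_set[OF sa_count_root_count L that] .
 have N0: "N C x \<noteq> 0 \<longleftrightarrow> (\<exists>y\<in>root_set L x. (x, y) \<in> C)" for C x
  using finite_root_set[of L x] by (auto simp: N_def)
 \<comment> \<open>A nonempty fibre contains a root from the list, or an interval that starts at
   such a root, or a half-line to the left of all of them.\<close>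
 have "(\<exists>y. (x, y) \<in> A) \<longleftrightarrow> N A x \<noteq> 0 \<or> N (rt_nbhd A) x \<noteq> 0 \<or> x \<in> bot_nbhd A" for x
 proof
  assume "\<exists>y. (x, y) \<in> A"
  then obtain y where y: "(x, y) \<in> A" by blast
  let ?E = "root_set L x"
  show "N A x \<noteq> 0 \<or> N (rt_nbhd A) x \<noteq> 0 \<or> x \<in> bot_nbhd A"
  proof (cases "y \<in> ?E")
   case True
   then show ?thesis using y N0 by blast
  next
   case yE: False
   have finE: "finite ?E" by (rule finite_root_set)
   obtain d where d: "y < d" "{y<..<d} \<inter> ?E = {}"
   proof (cases "{r\<in>?E. r > y} = {}")
    case True
    then have "{y<..<y+1} \<inter> ?E = {}" by auto
    then show thesis using that[of "y+1"] by auto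
   next
    case False
    have fin: "finite {r\<in>?E. r > y}" using finE by simp
    have "Min {r\<in>?E. r > y} \<in> {r\<in>?E. r > y}" using fin False by (rule Min_in)
    then show thesis using that[of "Min {r\<in>?E. r > y}"] Min_le[OF fin] by fastforce
   qed
   show ?thesis
   proof (cases "{r\<in>?E. r < y} = {}")
    case True
    have "(x, z) \<in> A" if "z < y" for z
    proof -
     have "{z-1<..<d} \<inter> ?E = {}"
     proof (rule equals0I)
      fix r assume r: "r \<in> {z-1<..<d} \<inter> ?E"
      show False using r True d(2) yE by (cases r y rule: linorder_cases) auto
     qed
     then show ?thesis
      using determined_by_interval_iff[OF L0(2), of "z-1" d x y z] y d(1) that by auto
    qed
    then have "\<forall>\<^sub>F z in at_bot. (x, z) \<in> A" by (auto simp: eventually_at_bot_dense)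
    then show ?thesis by (simp add: bot_nbhd_def)
   next
    case False
    have fin: "finite {r\<in>?E. r < y}" using finE by simp
    define m where "m = Max {r\<in>?E. r < y}"
    have m: "m \<in> ?E" "m < y" using Max_in[OF fin False] by (auto simp: m_def)
    have "{m<..<d} \<inter> ?E = {}"
    proof (rule equals0I)
     fix r assume r: "r \<in> {m<..<d} \<inter> ?E"
     show False using r Max_ge[OF fin, of r] d(2) yE unfolding m_def[symmetric]
      by (cases r y rule: linorder_cases) auto
    qed
    then have "{m<..<d} \<subseteq> {y. (x, y) \<in> A}"
     using determined_by_interval_iff[OF L0(2), of m d x y] y d(1) m(2) by auto
    then have "\<forall>\<^sub>F z in at_right m. (x, z) \<in> A"
     using m(2) d(1) by (auto simp: eventually_at_right_field intro!: exI[of _ d])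
    then have "(x, m) \<in> rt_nbhd A" by (simp add: rt_nbhd_def)
    then show ?thesis using m(1) N0 by blast
   qed
  qed
 next
  have r: "\<exists>y. (x, y) \<in> A" if "(x, m) \<in> rt_nbhd A" for m
  proof -
   have "\<forall>\<^sub>F y in at_right m. (x, y) \<in> A" using that by (simp add: rt_nbhd_def)
   from eventually_happens[OF this] show ?thesis by (auto simp: trivial_limit_at_right_real)
  qed
  have b: "\<exists>y. (x, y) \<in> A" if "x \<in> bot_nbhd A"
   using that eventually_happens[of "\<lambda>y. (x, y) \<in> A" at_bot] by (auto simp: bot_nbhd_def trivial_limit_at_bot_linorder)
  assume "N A x \<noteq> 0 \<or> N (rt_nbhd A) x \<noteq> 0 \<or> x \<in> bot_nbhd A"
  then show "\<exists>y. (x, y) \<in> A" using r b N0 by blast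
 qed
 then have "{x. \<exists>y. (x, y) \<in> A} = {x. N A x \<noteq> 0 \<or> N (rt_nbhd A) x \<noteq> 0 \<or> x \<in> {x. x \<in> bot_nbhd A}}"
  by auto
 also have "semialgebraic \<dots>"
  using semialgebraic_bot_nbhd(1)[OF A]
  by (intro semialgebraic_disj sa_count_nonzero N semialgebraic_rt_nbhd A) simp
 finally show ?thesis .
qed

section \<open>Definable predicates and functions\<close>

lemma semialgebraic_ex_real:
 fixes P :: "'a::euclidean_space \<Rightarrow> real \<Rightarrow> bool"
 assumes "semialgebraic {z. P (fst z) (snd z)}"
 shows "semialgebraic {x. \<exists>y. P x y}"
 using semialgebraic_project[OF assms] by simp

lemma semialgebraic_ex:
 fixes P :: "'a::euclidean_space \<Rightarrow> 'b::euclidean_space \<Rightarrow> bool"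
 assumes P: "semialgebraic {z. P (fst z) (snd z)}"
 shows "semialgebraic {x. \<exists>y. P x y}"
proof -
 \<comment> \<open>One basis vector is eliminated at a time. The coefficients are gathered in a
   function \<open>c\<close>, so that for \<open>F = Basis\<close> the quantifier ranges over all
   vectors.\<close>
 have *: "semialgebraic {z. \<exists>c. P (fst z) (snd z + (\<Sum>b\<in>F. c b *\<^sub>R b))}" if "finite F" for F
  using that
 proof (induction F rule: finite_induct)
  case empty
  then show ?case using P by simp
 next
  case (insert b F)
  let ?Q = "{z. \<exists>c. P (fst z) (snd z + (\<Sum>b\<in>F. c b *\<^sub>R b))}"
  have pm: "poly_map (\<lambda>w::('a \<times> 'b) \<times> real. (fst (fst w), snd (fst w) + snd w *\<^sub>R b))"
   using poly_map_snd[OF poly_map_id, where ?'c=real]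
   by (intro poly_map_Pair poly_map_add poly_map_scaleR poly_map_fst poly_map_snd poly_map_id poly_map_const) simp
  have "semialgebraic {w. (fst (fst w), snd (fst w) + snd w *\<^sub>R b) \<in> ?Q}"
   by (rule semialgebraic_vimage[OF insert.IH pm])
  then have "semialgebraic {w. (\<lambda>z t. (fst z, snd z + t *\<^sub>R b) \<in> ?Q) (fst w) (snd w)}" by simp
  from semialgebraic_ex_real[OF this]
  have "semialgebraic {z. \<exists>t. (fst z, snd z + t *\<^sub>R b) \<in> ?Q}" .
  moreover have "(\<exists>t. (fst z, snd z + t *\<^sub>R b) \<in> ?Q) \<longleftrightarrow>
   (\<exists>c. P (fst z) (snd z + (\<Sum>b\<in>insert b F. c b *\<^sub>R b)))" for z
  proof
   assume "\<exists>t. (fst z, snd z + t *\<^sub>R b) \<in> ?Q"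
   then obtain t c where "P (fst z) (snd z + t *\<^sub>R b + (\<Sum>b\<in>F. c b *\<^sub>R b))" by auto
   moreover have "(\<Sum>b'\<in>insert b F. (c(b := t)) b' *\<^sub>R b') = t *\<^sub>R b + (\<Sum>b\<in>F. c b *\<^sub>R b)"
    using insert.hyps by (simp add: sum.insert) (intro sum.cong; auto)
   ultimately have "P (fst z) (snd z + (\<Sum>b'\<in>insert b F. (c(b := t)) b' *\<^sub>R b'))"
    by (simp only: add.assoc)
   then show "\<exists>c. P (fst z) (snd z + (\<Sum>b\<in>insert b F. c b *\<^sub>R b))" by blast
  next
   assume "\<exists>c. P (fst z) (snd z + (\<Sum>b\<in>insert b F. c b *\<^sub>R b))"
   then obtain c where "P (fst z) (snd z + (\<Sum>b\<in>insert b F. c b *\<^sub>R b))" by blast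
   then have "P (fst z) ((snd z + c b *\<^sub>R b) + (\<Sum>b\<in>F. c b *\<^sub>R b))"
    using insert.hyps by (simp add: add.assoc)
   then show "\<exists>t. (fst z, snd z + t *\<^sub>R b) \<in> ?Q" by auto
  qed
  ultimately show ?case by simp
 qed
 have "(\<exists>c. P x (0 + (\<Sum>b\<in>Basis. c b *\<^sub>R b))) \<longleftrightarrow> (\<exists>y. P x y)" for x
 proof
  assume "\<exists>y. P x y"
  then obtain y where "P x y" by blast
  then show "\<exists>c. P x (0 + (\<Sum>b\<in>Basis. c b *\<^sub>R b))"
   by (intro exI[of _ "\<lambda>b. y \<bullet> b"]) (simp add: euclidean_representation)
 qed blast
 moreover have "semialgebraic {x. (x, 0) \<in> {z. \<exists>c. P (fst z) (snd z + (\<Sum>b\<in>Basis. c b *\<^sub>R b))}}"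
  by (rule semialgebraic_vimage[OF *]) (auto intro: poly_map_Pair poly_map_id poly_map_const)
 ultimately show ?thesis by simp
qed

lemma semialgebraic_all:
 fixes P :: "'a::euclidean_space \<Rightarrow> 'b::euclidean_space \<Rightarrow> bool"
 assumes "semialgebraic {z. P (fst z) (snd z)}"
 shows "semialgebraic {x. \<forall>y. P x y}"
 using semialgebraic_neg[OF semialgebraic_ex[OF semialgebraic_neg[OF assms]]] by simp

text \<open>Functions are total, with arbitrary values off their natural domain, so that terms can
  be composed without tracking domains.\<close>

definition sa_fun :: "('a::euclidean_space \<Rightarrow> 'b::euclidean_space) \<Rightarrow> bool" where
 "sa_fun f \<longleftrightarrow> semialgebraic {z. snd z = f (fst z)}"

lemma sa_fun_poly_map: assumes "poly_map f" shows "sa_fun f"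
proof -
 have "{z. snd z = f (fst z)} = (- (\<Union>b\<in>Basis. - {z. snd z \<bullet> b - f (fst z) \<bullet> b = 0}))"
 proof (rule set_eqI)
  fix z :: "'a \<times> 'b"
  have "snd z = f (fst z) \<longleftrightarrow> (\<forall>b\<in>Basis. snd z \<bullet> b = f (fst z) \<bullet> b)" by (rule euclidean_eq_iff)
  then show "z \<in> {z. snd z = f (fst z)} \<longleftrightarrow> z \<in> - (\<Union>b\<in>Basis. - {z. snd z \<bullet> b - f (fst z) \<bullet> b = 0})"
   by simp
 qed
 also have "semialgebraic \<dots>"
 proof (intro semialgebraic.compl semialgebraic_UN semialgebraic.zero poly_fun_diff)
  fix b :: 'b assume b: "b \<in> Basis"
  show "(\<lambda>z::'a \<times> 'b. snd z \<bullet> b) \<in> poly_fun"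
   by (rule poly_map_inner[OF poly_map_snd[OF poly_map_id]])
  have "(\<lambda>x. f x \<bullet> b) \<in> poly_fun" using assms by (rule poly_map_inner)
  from poly_fun_compose[OF this poly_map_fst[OF poly_map_id]]
  show "(\<lambda>z::'a \<times> 'b. f (fst z) \<bullet> b) \<in> poly_fun" .
 qed simp
 finally show ?thesis unfolding sa_fun_def .
qed

lemma sa_fun_id: "sa_fun (\<lambda>x. x)" by (intro sa_fun_poly_map poly_map_id)
lemma sa_fun_const: "sa_fun (\<lambda>x. c)" by (intro sa_fun_poly_map poly_map_const)
lemma sa_fun_linear: "linear f \<Longrightarrow> sa_fun f" by (intro sa_fun_poly_map poly_map_linear)

lemma semialgebraic_sa_fun:
 assumes P: "semialgebraic {y. P y}" and f: "sa_fun f" shows "semialgebraic {x. P (f x)}"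
proof -
 have "semialgebraic {z. snd z \<in> {y. P y}}"
  by (intro semialgebraic_vimage[OF P] poly_map_snd poly_map_id)
 then have "semialgebraic {z. snd z = f (fst z) \<and> P (snd z)}"
  using f by (intro semialgebraic_conj) (auto simp: sa_fun_def)
 then have "semialgebraic {x. \<exists>y. y = f x \<and> P y}"
  by (intro semialgebraic_ex) simp
 then show ?thesis by simp
qed

lemma semialgebraic_mem: "sa_fun f \<Longrightarrow> semialgebraic A \<Longrightarrow> semialgebraic {x. f x \<in> A}"
 using semialgebraic_sa_fun[of "\<lambda>y. y \<in> A" f] by simp

lemma sa_funI:
 assumes "semialgebraic {z. R (fst z) (snd z)}" "\<And>x y. R x y \<longleftrightarrow> y = f x"
 shows "sa_fun f"
 using assms by (simp add: sa_fun_def)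

lemma sa_fun_compose:
 fixes f :: "'b::euclidean_space \<Rightarrow> 'c::euclidean_space" and g :: "'a::euclidean_space \<Rightarrow> 'b"
 assumes "sa_fun f" "sa_fun g" shows "sa_fun (\<lambda>x. f (g x))"
proof (rule sa_funI[where R="\<lambda>x y. \<exists>w. w = g x \<and> y = f w"])
 have pg: "poly_map (\<lambda>v::('a \<times> 'c) \<times> 'b. (fst (fst v), snd v))"
  "poly_map (\<lambda>v::('a \<times> 'c) \<times> 'b. (snd v, snd (fst v)))"
  by (intro poly_map_Pair poly_map_fst poly_map_snd poly_map_id)+
 have "semialgebraic {v::('a \<times> 'c) \<times> 'b. (fst (fst v), snd v) \<in> {z. snd z = g (fst z)}}"
  "semialgebraic {v::('a \<times> 'c) \<times> 'b. (snd v, snd (fst v)) \<in> {z. snd z = f (fst z)}}"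
  by (rule semialgebraic_vimage[OF _ pg(1)], use assms in \<open>simp add: sa_fun_def\<close>)
   (rule semialgebraic_vimage[OF _ pg(2)], use assms in \<open>simp add: sa_fun_def\<close>)
 then show "semialgebraic {z. \<exists>w. w = g (fst z) \<and> snd z = f w}"
  by (intro semialgebraic_ex semialgebraic_conj) simp_all
qed auto

lemma sa_fun_Pair:
 fixes f :: "'a::euclidean_space \<Rightarrow> 'b::euclidean_space" and g :: "'a \<Rightarrow> 'c::euclidean_space"
 assumes "sa_fun f" "sa_fun g" shows "sa_fun (\<lambda>x. (f x, g x))"
proof (rule sa_funI[where R="\<lambda>x y. fst y = f x \<and> snd y = g x"])
 have pg: "poly_map (\<lambda>v::'a \<times> 'b \<times> 'c. (fst v, fst (snd v)))"
  "poly_map (\<lambda>v::'a \<times> 'b \<times> 'c. (fst v, snd (snd v)))"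
  by (intro poly_map_Pair poly_map_fst poly_map_snd poly_map_id)+
 have "semialgebraic {v::'a \<times> 'b \<times> 'c. (fst v, fst (snd v)) \<in> {z. snd z = f (fst z)}}"
  "semialgebraic {v::'a \<times> 'b \<times> 'c. (fst v, snd (snd v)) \<in> {z. snd z = g (fst z)}}"
  by (rule semialgebraic_vimage[OF _ pg(1)], use assms in \<open>simp add: sa_fun_def\<close>)
   (rule semialgebraic_vimage[OF _ pg(2)], use assms in \<open>simp add: sa_fun_def\<close>)
 then show "semialgebraic {z. fst (snd z) = f (fst z) \<and> snd (snd z) = g (fst z)}"
  by (intro semialgebraic_conj) simp_all
qed (auto simp: prod_eq_iff)

lemma sa_fun_fst: "sa_fun f \<Longrightarrow> sa_fun (\<lambda>x. fst (f x))"
 by (rule sa_fun_compose[of fst]) (auto intro: sa_fun_linear simp: linear_fst)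
lemma sa_fun_snd: "sa_fun f \<Longrightarrow> sa_fun (\<lambda>x. snd (f x))"
 by (rule sa_fun_compose[of snd]) (auto intro: sa_fun_linear simp: linear_snd)
lemma sa_fun_add:
 fixes f g :: "'a::euclidean_space \<Rightarrow> 'b::euclidean_space"
 assumes "sa_fun f" "sa_fun g" shows "sa_fun (\<lambda>x. f x + g x)"
 using sa_fun_compose[OF sa_fun_poly_map[OF poly_map_add[OF poly_map_fst poly_map_snd]] sa_fun_Pair[OF assms],
   OF poly_map_id poly_map_id] by simp
lemma sa_fun_scaleR:
 fixes f :: "'a::euclidean_space \<Rightarrow> real" and g :: "'a \<Rightarrow> 'b::euclidean_space"
 assumes "sa_fun f" "sa_fun g" shows "sa_fun (\<lambda>x. f x *\<^sub>R g x)"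
proof -
 have "poly_map (\<lambda>z::real \<times> 'b. fst z *\<^sub>R snd z)"
  using poly_map_fst[OF poly_map_id, where ?'b=real] by (intro poly_map_scaleR poly_map_snd poly_map_id) simp
 then show ?thesis using sa_fun_compose[OF sa_fun_poly_map sa_fun_Pair[OF assms]] by fastforce
qed
lemma sa_fun_mult:
 fixes f g :: "'a::euclidean_space \<Rightarrow> real"
 shows "sa_fun f \<Longrightarrow> sa_fun g \<Longrightarrow> sa_fun (\<lambda>x. f x * g x)"
 using sa_fun_scaleR[of f g] by simp
lemma sa_fun_uminus:
 fixes f :: "'a::euclidean_space \<Rightarrow> 'b::euclidean_space"
 shows "sa_fun f \<Longrightarrow> sa_fun (\<lambda>x. - f x)"
 using sa_fun_scaleR[OF sa_fun_const[of "-1"], of f] by simp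
lemma sa_fun_diff:
 fixes f g :: "'a::euclidean_space \<Rightarrow> 'b::euclidean_space"
 shows "sa_fun f \<Longrightarrow> sa_fun g \<Longrightarrow> sa_fun (\<lambda>x. f x - g x)"
 using sa_fun_add[OF _ sa_fun_uminus, of f g] by simp
lemma sa_fun_power: "sa_fun f \<Longrightarrow> sa_fun (\<lambda>x. (f x :: real) ^ n)"
 by (induction n) (auto intro: sa_fun_const sa_fun_mult)
lemma sa_fun_sum:
 fixes f :: "'i \<Rightarrow> 'a::euclidean_space \<Rightarrow> 'b::euclidean_space"
 shows "finite I \<Longrightarrow> (\<And>i. i \<in> I \<Longrightarrow> sa_fun (f i)) \<Longrightarrow> sa_fun (\<lambda>x. \<Sum>i\<in>I. f i x)"
 by (induction I rule: finite_induct) (auto intro: sa_fun_add sa_fun_const)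
lemma sa_fun_inner:
 fixes f g :: "'a::euclidean_space \<Rightarrow> 'b::euclidean_space"
 assumes "sa_fun f" "sa_fun g" shows "sa_fun (\<lambda>x. f x \<bullet> g x)"
proof -
 have "sa_fun (\<lambda>x. f x \<bullet> b)" if "sa_fun f" for f :: "'a \<Rightarrow> 'b" and b
  by (rule sa_fun_compose[OF sa_fun_linear that])
   (simp add: bounded_linear.linear bounded_linear_inner_left)
 then have "sa_fun (\<lambda>x. \<Sum>b\<in>Basis. (f x \<bullet> b) * (g x \<bullet> b))"
  using assms by (intro sa_fun_sum sa_fun_mult) auto
 then show ?thesis by (simp flip: euclidean_inner)
qed

lemma semialgebraic_eq:
 fixes f g :: "'a::euclidean_space \<Rightarrow> 'b::euclidean_space"
 assumes "sa_fun f" "sa_fun g" shows "semialgebraic {x. f x = g x}"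
 using semialgebraic_sa_fun[OF _ sa_fun_Pair[OF assms], of "\<lambda>z. snd z = fst z"]
  sa_fun_id[where ?'a='b] by (simp add: sa_fun_def eq_commute)

lemma semialgebraic_less:
 fixes f g :: "'a::euclidean_space \<Rightarrow> real"
 assumes "sa_fun f" "sa_fun g" shows "semialgebraic {x. f x < g x}"
proof -
 have "semialgebraic {y::real. y > 0}"
  using semialgebraic.pos[of "\<lambda>y::real. y"] poly_map_id[where ?'a=real] by simp
 from semialgebraic_sa_fun[OF this sa_fun_diff[OF assms(2,1)]] show ?thesis by simp
qed

lemma semialgebraic_le:
 fixes f g :: "'a::euclidean_space \<Rightarrow> real"
 assumes "sa_fun f" "sa_fun g" shows "semialgebraic {x. f x \<le> g x}"
 using semialgebraic_neg[OF semialgebraic_less[OF assms(2,1)]] by (simp add: not_less)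

lemma semialgebraic_iff:
 "semialgebraic {x. P x} \<Longrightarrow> semialgebraic {x. Q x} \<Longrightarrow> semialgebraic {x. P x \<longleftrightarrow> Q x}"
 unfolding iff_conv_conj_imp by (intro semialgebraic_conj semialgebraic_imp)

lemma semialgebraic_bex:
 fixes P :: "'a::euclidean_space \<Rightarrow> 'b::euclidean_space \<Rightarrow> bool"
 assumes "semialgebraic A" "semialgebraic {z. P (fst z) (snd z)}"
 shows "semialgebraic {x. \<exists>y\<in>A. P x y}"
 unfolding Bex_def
 by (intro semialgebraic_ex semialgebraic_conj semialgebraic_mem assms sa_fun_snd sa_fun_id)

lemma semialgebraic_ball:
 fixes P :: "'a::euclidean_space \<Rightarrow> 'b::euclidean_space \<Rightarrow> bool"
 assumes "semialgebraic A" "semialgebraic {z. P (fst z) (snd z)}"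
 shows "semialgebraic {x. \<forall>y\<in>A. P x y}"
 unfolding Ball_def
 by (intro semialgebraic_all semialgebraic_imp semialgebraic_mem assms sa_fun_snd sa_fun_id)

lemma sa_fun_if:
 fixes f g :: "'a::euclidean_space \<Rightarrow> 'b::euclidean_space"
 assumes "semialgebraic {x. P x}" "sa_fun f" "sa_fun g"
 shows "sa_fun (\<lambda>x. if P x then f x else g x)"
proof (rule sa_funI[where R="\<lambda>x y. (P x \<longrightarrow> y = f x) \<and> (\<not> P x \<longrightarrow> y = g x)"])
 have P: "semialgebraic {z::'a \<times> 'b. P (fst z)}"
  by (rule semialgebraic_sa_fun[OF assms(1) sa_fun_fst[OF sa_fun_id]])
 show "semialgebraic {z. (P (fst z) \<longrightarrow> snd z = f (fst z)) \<and> (\<not> P (fst z) \<longrightarrow> snd z = g (fst z))}"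
  by (intro semialgebraic_conj semialgebraic_imp semialgebraic_neg P semialgebraic_eq sa_fun_snd sa_fun_id
    sa_fun_compose[OF assms(2)] sa_fun_compose[OF assms(3)] sa_fun_fst)
qed auto

lemma sa_fun_abs: "sa_fun f \<Longrightarrow> sa_fun (\<lambda>x. \<bar>f x :: real\<bar>)"
 unfolding abs_if by (intro sa_fun_if semialgebraic_less sa_fun_const sa_fun_uminus)
lemma sa_fun_max: "sa_fun f \<Longrightarrow> sa_fun g \<Longrightarrow> sa_fun (\<lambda>x. max (f x :: real) (g x))"
 unfolding max_def by (intro sa_fun_if semialgebraic_le)
lemma sa_fun_min: "sa_fun f \<Longrightarrow> sa_fun g \<Longrightarrow> sa_fun (\<lambda>x. min (f x :: real) (g x))"
 unfolding min_def by (intro sa_fun_if semialgebraic_le)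

lemma sa_fun_inverse:
 fixes f :: "'a::euclidean_space \<Rightarrow> real"
 assumes "sa_fun f" shows "sa_fun (\<lambda>x. inverse (f x))"
proof -
 have "sa_fun (inverse :: real \<Rightarrow> real)"
  by (rule sa_funI[where R="\<lambda>x y. (x = 0 \<longrightarrow> y = 0) \<and> (x \<noteq> 0 \<longrightarrow> x * y = 1)"])
   (intro semialgebraic_conj semialgebraic_imp semialgebraic_neg semialgebraic_eq sa_fun_mult sa_fun_fst
    sa_fun_snd sa_fun_id sa_fun_const, auto simp: field_simps)
 from sa_fun_compose[OF this assms] show ?thesis .
qed

lemma sa_fun_divide:
 fixes f g :: "'a::euclidean_space \<Rightarrow> real"
 shows "sa_fun f \<Longrightarrow> sa_fun g \<Longrightarrow> sa_fun (\<lambda>x. f x / g x)"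
 unfolding divide_inverse by (intro sa_fun_mult sa_fun_inverse)

lemma sa_fun_sqrt:
 fixes f :: "'a::euclidean_space \<Rightarrow> real"
 assumes "sa_fun f" shows "sa_fun (\<lambda>x. sqrt (f x))"
proof -
 have "sa_fun sqrt"
 proof (rule sa_funI[where R="\<lambda>x y. (0 \<le> x \<longrightarrow> 0 \<le> y \<and> y * y = x) \<and> (\<not> 0 \<le> x \<longrightarrow> y \<le> 0 \<and> - (y * y) = x)"])
  show "semialgebraic {z::real \<times> real. (0 \<le> fst z \<longrightarrow> 0 \<le> snd z \<and> snd z * snd z = fst z) \<and>
    (\<not> 0 \<le> fst z \<longrightarrow> snd z \<le> 0 \<and> - (snd z * snd z) = fst z)}"
   by (intro semialgebraic_conj semialgebraic_imp semialgebraic_neg semialgebraic_eq semialgebraic_le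
     sa_fun_mult sa_fun_uminus sa_fun_fst sa_fun_snd sa_fun_id sa_fun_const)
  fix x y :: real
  have "y = sqrt x" if "0 \<le> x" "0 \<le> y" "y * y = x"
   using that real_sqrt_abs2[of y] by simp
  moreover have "y = sqrt x" if "\<not> 0 \<le> x" "y \<le> 0" "- (y * y) = x"
  proof -
   have "sqrt (- x) = - y" using that real_sqrt_abs2[of y] by auto
   then show ?thesis by (simp add: real_sqrt_minus)
  qed
  moreover have "0 \<le> x \<Longrightarrow> sqrt x * sqrt x = x" "x < 0 \<Longrightarrow> - (sqrt x * sqrt x) = x"
   using real_sqrt_mult_self[of x] by auto
  ultimately show "((0 \<le> x \<longrightarrow> 0 \<le> y \<and> y * y = x) \<and> (\<not> 0 \<le> x \<longrightarrow> y \<le> 0 \<and> - (y * y) = x)) = (y = sqrt x)"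
   by auto
 qed
 from sa_fun_compose[OF this assms] show ?thesis .
qed

lemma sa_fun_norm:
 fixes f :: "'a::euclidean_space \<Rightarrow> 'b::euclidean_space"
 shows "sa_fun f \<Longrightarrow> sa_fun (\<lambda>x. norm (f x))"
 unfolding norm_eq_sqrt_inner by (intro sa_fun_sqrt sa_fun_inner)

lemma sa_fun_dist:
 fixes f g :: "'a::euclidean_space \<Rightarrow> 'b::euclidean_space"
 shows "sa_fun f \<Longrightarrow> sa_fun g \<Longrightarrow> sa_fun (\<lambda>x. dist (f x) (g x))"
 unfolding dist_norm by (intro sa_fun_norm sa_fun_diff)

text \<open>With quantifiers among the rules, Tarski--Seidenberg becomes a matter of syntax: a
  first-order formula over semialgebraic sets and functions defines a semialgebraic set.\<close>

lemmas sa_intros = semialgebraic_conj semialgebraic_disj semialgebraic_neg semialgebraic_imp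
 semialgebraic_iff semialgebraic_ball semialgebraic_bex semialgebraic_ex semialgebraic_all
 semialgebraic_le semialgebraic_less semialgebraic_eq semialgebraic_Collect_const
 sa_fun_id sa_fun_const sa_fun_Pair sa_fun_fst sa_fun_snd sa_fun_add sa_fun_diff sa_fun_uminus
 sa_fun_scaleR sa_fun_mult sa_fun_power sa_fun_inner sa_fun_abs sa_fun_max sa_fun_min
 sa_fun_inverse sa_fun_divide sa_fun_sqrt sa_fun_norm sa_fun_dist

text \<open>Passage from partial maps to total functions: the default 0 is harmless because the
  domain, a projection of the graph, is semialgebraic.\<close>

lemma semialgebraic_map_zero_ext:
 fixes f :: "'a::euclidean_space \<Rightarrow> 'b::euclidean_space"
 assumes "semialgebraic_map S f"
 shows "semialgebraic S" "sa_fun (\<lambda>x. if x \<in> S then f x else 0)"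
proof -
 let ?G = "{(x, f x) |x. x \<in> S}"
 have G: "semialgebraic ?G" using assms by (simp add: semialgebraic_map_def)
 then have "semialgebraic {x. \<exists>y. (x, y) \<in> ?G}" by (intro semialgebraic_ex) simp
 moreover have "{x. \<exists>y. (x, y) \<in> ?G} = S" by auto
 ultimately show S: "semialgebraic S" by simp
 show "sa_fun (\<lambda>x. if x \<in> S then f x else 0)"
 proof (rule sa_funI[where R="\<lambda>x y. (x \<in> S \<longrightarrow> (x, y) \<in> ?G) \<and> (x \<notin> S \<longrightarrow> y = 0)"])
  show "semialgebraic {z. (fst z \<in> S \<longrightarrow> (fst z, snd z) \<in> ?G) \<and> (fst z \<notin> S \<longrightarrow> snd z = 0)}"
   by (intro sa_intros semialgebraic_mem S G)
 qed auto
qed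

lemma semialgebraic_map_sa_fun:
 fixes f :: "'a::euclidean_space \<Rightarrow> 'b::euclidean_space"
 assumes "semialgebraic S" "sa_fun f" shows "semialgebraic_map S f"
proof -
 have "{(x, f x) |x. x \<in> S} = {z. fst z \<in> S \<and> snd z = f (fst z)}" by auto
 also have "semialgebraic \<dots>"
  by (intro sa_intros semialgebraic_mem assms sa_fun_compose[OF assms(2)])
 finally show ?thesis by (simp add: semialgebraic_map_def)
qed

lemma semialgebraic_closure: assumes "semialgebraic S" shows "semialgebraic (closure S)"
proof -
 have "closure S = {x. \<forall>e::real. 0 < e \<longrightarrow> (\<exists>y\<in>S. dist y x < e)}"
  by (auto simp: closure_approachable)
 also have "semialgebraic \<dots>" by (intro sa_intros assms)
 finally show ?thesis .
qed

lemma semialgebraic_interior: "semialgebraic S \<Longrightarrow> semialgebraic (interior S)"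
 unfolding interior_closure by (intro semialgebraic.compl semialgebraic_closure)

lemma sa_fun_infdist:
 assumes A: "semialgebraic A" and f: "sa_fun f" shows "sa_fun (\<lambda>x. infdist (f x) A)"
proof (cases "A = {}")
 case True
 then show ?thesis by (simp add: infdist_def sa_fun_const)
next
 case False
 have "sa_fun (\<lambda>x. infdist x A)"
 proof (rule sa_funI[where R="\<lambda>x y. (\<forall>a\<in>A. y \<le> dist x a) \<and> (\<forall>t::real. y < t \<longrightarrow> (\<exists>a\<in>A. dist x a < t))"])
  show "semialgebraic {z. (\<forall>a\<in>A. snd z \<le> dist (fst z) a) \<and> (\<forall>t::real. snd z < t \<longrightarrow> (\<exists>a\<in>A. dist (fst z) a < t))}"
   by (intro sa_intros A)
  fix x :: 'a and y :: real
  have bdd: "bdd_below (dist x ` A)" by (intro bdd_belowI[of _ 0]) auto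
  have I: "infdist x A = (INF a\<in>A. dist x a)" using False by (simp add: infdist_def)
  show "((\<forall>a\<in>A. y \<le> dist x a) \<and> (\<forall>t. y < t \<longrightarrow> (\<exists>a\<in>A. dist x a < t))) \<longleftrightarrow> y = infdist x A"
  proof
   assume *: "(\<forall>a\<in>A. y \<le> dist x a) \<and> (\<forall>t. y < t \<longrightarrow> (\<exists>a\<in>A. dist x a < t))"
   have "y \<le> infdist x A" unfolding I using * False by (intro cINF_greatest) auto
   moreover have "\<not> y < infdist x A"
   proof
    assume "y < infdist x A"
    then obtain a where "a \<in> A" "dist x a < infdist x A" using * by blast
    then show False using infdist_le[of a A x] by simp
   qed
   ultimately show "y = infdist x A" by simp
  next
   assume y: "y = infdist x A"
   show "(\<forall>a\<in>A. y \<le> dist x a) \<and> (\<forall>t. y < t \<longrightarrow> (\<exists>a\<in>A. dist x a < t))"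
    using cINF_less_iff[OF False bdd] unfolding y I[symmetric]
    by (auto intro: infdist_le)
  qed
 qed
 from sa_fun_compose[OF this f] show ?thesis .
qed

section \<open>Calculus of smooth maps\<close>

notation frechet_derivative ("\<D>")

text \<open>Recursion on the order, in place of the family \<open>iter_partials\<close>, permits
  induction on \<open>n\<close>. The partial derivatives are formed at \<open>x\<close> and not
  within \<open>U\<close>, so the notion is meant for open \<open>U\<close>.\<close>

primrec Ck :: "nat \<Rightarrow> 'a::euclidean_space set \<Rightarrow> ('a \<Rightarrow> 'b::real_normed_vector) \<Rightarrow> bool" where
 "Ck 0 U f \<longleftrightarrow> continuous_on U f"
| "Ck (Suc n) U f \<longleftrightarrow> f differentiable_on U \<and> (\<forall>i\<in>Basis. Ck n U (\<lambda>x. \<D> f (at x) i))"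

lemma Ck_Suc_D: "Ck (Suc n) U f \<Longrightarrow> Ck n U f"
 by (induction n arbitrary: f) (auto intro: differentiable_imp_continuous_on)

lemma Ck_le: "Ck n U f \<Longrightarrow> m \<le> n \<Longrightarrow> Ck m U f"
 by (induction n) (use Ck_Suc_D le_Suc_eq in blast)+

lemma Ck_continuous_on: "Ck n U f \<Longrightarrow> continuous_on U f"
 using Ck_le[of n U f 0] by simp

lemma Ck_subset: "Ck n U f \<Longrightarrow> V \<subseteq> U \<Longrightarrow> Ck n V f"
 by (induction n arbitrary: f) (auto intro: continuous_on_subset differentiable_on_subset)

lemma Ck_has_derivative:
 assumes "Ck (Suc n) U f" "open U" "x \<in> U"
 shows "(f has_derivative \<D> f (at x)) (at x)"
 using assms by (metis Ck.simps(2) at_within_open differentiable_on_def frechet_derivative_works)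

lemma frechet_derivative_cong_open:
 assumes "open U" "x \<in> U" "\<And>x. x \<in> U \<Longrightarrow> f x = g x"
 shows "\<D> f (at x) = \<D> g (at x)"
proof -
 have "(f has_derivative D) (at x) \<longleftrightarrow> (g has_derivative D) (at x)" for D
  using has_derivative_transform_within_open[OF _ assms(1,2), of f D UNIV g]
   has_derivative_transform_within_open[OF _ assms(1,2), of g D UNIV f] assms(3) by auto
 then show ?thesis by (simp add: frechet_derivative_def)
qed

lemma Ck_cong:
 "Ck n U f \<Longrightarrow> open U \<Longrightarrow> (\<And>x. x \<in> U \<Longrightarrow> f x = g x) \<Longrightarrow> Ck n U g"
proof (induction n arbitrary: f g)
 case 0
 then show ?case using continuous_on_cong[of U U f g] by simp
next
 case (Suc n)
 have "g differentiable_on U"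
  unfolding differentiable_on_def
 proof
  fix x assume x: "x \<in> U"
  have "(g has_derivative \<D> f (at x)) (at x)"
   by (rule has_derivative_transform_within_open[OF Ck_has_derivative[OF Suc.prems(1,2) x] Suc.prems(2) x])
    (use Suc.prems(3) in auto)
  then have "g differentiable (at x)" unfolding differentiable_def by blast
  then show "g differentiable (at x within U)" by (rule differentiable_at_withinI)
 qed
 moreover have "Ck n U (\<lambda>x. \<D> g (at x) i)" if "i \<in> Basis" for i
 proof (rule Suc.IH[OF _ Suc.prems(2)])
  show "Ck n U (\<lambda>x. \<D> f (at x) i)" using Suc.prems(1) that by simp
  show "\<D> f (at x) i = \<D> g (at x) i" if "x \<in> U" for x
   using frechet_derivative_cong_open[OF Suc.prems(2) that Suc.prems(3)] by simp
 qed
 ultimately show ?case by simp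
qed

text \<open>The derivative may be supplied as any explicit \<open>F\<close>, which spares
  computations with \<open>frechet_derivative\<close>.\<close>

lemma Ck_SucI:
 assumes "open U" "\<And>x. x \<in> U \<Longrightarrow> (f has_derivative F x) (at x)"
  and "\<And>i. i \<in> Basis \<Longrightarrow> Ck n U (\<lambda>x. F x i)"
 shows "Ck (Suc n) U f"
proof -
 have "f differentiable_on U"
  using assms(1,2) by (meson differentiable_at_imp_differentiable_on differentiable_def)
 moreover have "Ck n U (\<lambda>x. \<D> f (at x) i)" if "i \<in> Basis" for i
  using assms(3)[OF that] assms(1)
  by (rule Ck_cong) (use frechet_derivative_at[OF assms(2)] in metis)
 ultimately show ?thesis by simp
qed

lemma Ck_local:
 assumes "\<And>x. x \<in> U \<Longrightarrow> \<exists>V. open V \<and> x \<in> V \<and> Ck n V f"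
 shows "Ck n U f"
 using assms
proof (induction n arbitrary: f)
 case 0
 have "continuous (at x within U) f" if "x \<in> U" for x
  using 0[OF that] by (auto simp: continuous_on_eq_continuous_at intro: continuous_at_imp_continuous_at_within)
 then show ?case by (simp add: continuous_on_eq_continuous_within)
next
 case (Suc n)
 have "f differentiable_on U"
  unfolding differentiable_on_def
 proof
  fix x assume "x \<in> U"
  then obtain V where "open V" "x \<in> V" "Ck (Suc n) V f" using Suc.prems by blast
  then have "f differentiable (at x)" using Ck_has_derivative differentiable_def by blast
  then show "f differentiable (at x within U)" by (rule differentiable_at_withinI)
 qed
 moreover have "Ck n U (\<lambda>x. \<D> f (at x) i)" if "i \<in> Basis" for i
  by (rule Suc.IH) (use Suc.prems that in \<open>metis Ck.simps(2)\<close>)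
 ultimately show ?case by simp
qed

lemma Ck_const: "open U \<Longrightarrow> Ck n U (\<lambda>x. c)"
proof (induction n arbitrary: c)
 case (Suc n)
 show ?case by (rule Ck_SucI[where F="\<lambda>x h. 0"]) (use Suc in auto)
qed simp

lemma Ck_add:
 assumes "open U" shows "Ck n U f \<Longrightarrow> Ck n U g \<Longrightarrow> Ck n U (\<lambda>x. f x + g x)"
proof (induction n arbitrary: f g)
 case (Suc n)
 show ?case
  by (rule Ck_SucI[OF assms has_derivative_add[OF Ck_has_derivative[OF Suc.prems(1) assms] Ck_has_derivative[OF Suc.prems(2) assms]]])
   (use Suc in auto)
qed (auto intro: continuous_on_add)

lemma Ck_linear:
 assumes "open U" "bounded_linear L" shows "Ck n U f \<Longrightarrow> Ck n U (\<lambda>x. L (f x))"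
proof (induction n arbitrary: f)
 case 0
 then show ?case
  by (auto intro: bounded_linear.continuous_on[OF assms(2)])
next
 case (Suc n)
 show ?case
  by (rule Ck_SucI[OF assms(1) bounded_linear.has_derivative[OF assms(2) Ck_has_derivative[OF Suc.prems assms(1)]]])
   (use Suc in auto)
qed

lemma Ck_bilinear:
 assumes "open U" "bounded_bilinear B"
 shows "Ck n U f \<Longrightarrow> Ck n U g \<Longrightarrow> Ck n U (\<lambda>x. B (f x) (g x))"
proof (induction n arbitrary: f g)
 case 0
 then show ?case by (auto intro: bounded_bilinear.continuous_on[OF assms(2)])
next
 case (Suc n)
 show ?case
 proof (rule Ck_SucI[OF assms(1) bounded_bilinear.FDERIV[OF assms(2)
     Ck_has_derivative[OF Suc.prems(1) assms(1)] Ck_has_derivative[OF Suc.prems(2) assms(1)]]])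
  fix i :: 'a assume "i \<in> Basis"
  then have *: "Ck n U (\<lambda>x. \<D> f (at x) i)" "Ck n U (\<lambda>x. \<D> g (at x) i)"
   using Suc.prems by simp_all
  show "Ck n U (\<lambda>x. B (f x) (\<D> g (at x) i) + B (\<D> f (at x) i) (g x))"
   by (rule Ck_add[OF assms(1) Suc.IH[OF Ck_Suc_D[OF Suc.prems(1)] *(2)] Suc.IH[OF *(1) Ck_Suc_D[OF Suc.prems(2)]]])
 qed
qed

lemma Ck_sum:
 assumes "open U" shows "finite I \<Longrightarrow> (\<And>i. i \<in> I \<Longrightarrow> Ck n U (f i)) \<Longrightarrow> Ck n U (\<lambda>x. \<Sum>i\<in>I. f i x)"
 by (induction I rule: finite_induct) (auto intro: Ck_const Ck_add assms)

lemma linear_basis_expansion: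
 fixes L :: "'a::euclidean_space \<Rightarrow> 'b::real_vector"
 assumes "linear L" shows "L v = (\<Sum>b\<in>Basis. (v \<bullet> b) *\<^sub>R L b)"
proof -
 have "L v = L (\<Sum>b\<in>Basis. (v \<bullet> b) *\<^sub>R b)" by (simp add: euclidean_representation)
 also have "\<dots> = (\<Sum>b\<in>Basis. (v \<bullet> b) *\<^sub>R L b)"
  using assms by (simp add: linear_sum linear_scale)
 finally show ?thesis .
qed

lemma Ck_ident: "open U \<Longrightarrow> Ck n U (\<lambda>x. x)"
proof (cases n)
 case (Suc m)
 assume U: "open U"
 show ?thesis unfolding Suc
  by (rule Ck_SucI[OF U, where F="\<lambda>x h. h"]) (auto intro: Ck_const[OF U])
qed auto

lemma Ck_compose:
 fixes f :: "'b::euclidean_space \<Rightarrow> 'c::real_normed_vector" and g :: "'a::euclidean_space \<Rightarrow> 'b"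
 assumes "open U" "open V"
 shows "Ck n V f \<Longrightarrow> Ck n U g \<Longrightarrow> g ` U \<subseteq> V \<Longrightarrow> Ck n U (\<lambda>x. f (g x))"
proof (induction n arbitrary: f g)
 case 0
 then show ?case using continuous_on_compose2[of V f U g] by simp
next
 case (Suc n)
 have df: "(f has_derivative \<D> f (at (g x))) (at (g x))" if "x \<in> U" for x
  using Ck_has_derivative[OF Suc.prems(1) assms(2)] Suc.prems(3) that by auto
 note dg = Ck_has_derivative[OF Suc.prems(2) assms(1)]
 show ?case
 proof (rule Ck_SucI[OF assms(1)])
  show "((\<lambda>x. f (g x)) has_derivative (\<lambda>h. \<D> f (at (g x)) (\<D> g (at x) h))) (at x)"
   if "x \<in> U" for x
   using diff_chain_at[OF dg[OF that] df[OF that]] by (simp add: o_def)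
  fix i :: 'a assume i: "i \<in> Basis"
  have "Ck n U (\<lambda>x. \<Sum>b\<in>Basis. (\<D> g (at x) i \<bullet> b) *\<^sub>R \<D> f (at (g x)) b)"
  proof (intro Ck_sum[OF assms(1)] Ck_bilinear[OF assms(1) bounded_bilinear_scaleR])
   fix b :: 'b assume "b \<in> Basis"
   show "Ck n U (\<lambda>x. \<D> g (at x) i \<bullet> b)"
    using Suc.prems(2) i by (intro Ck_linear[OF assms(1) bounded_linear_inner_left]) simp
   show "Ck n U (\<lambda>x. \<D> f (at (g x)) b)"
    using Suc.IH[of "\<lambda>y. \<D> f (at y) b" g] Suc.prems Ck_Suc_D[OF Suc.prems(2)] \<open>b \<in> Basis\<close>
    by simp
  qed simp
  then show "Ck n U (\<lambda>x. \<D> f (at (g x)) (\<D> g (at x) i))"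
  proof (rule Ck_cong[OF _ assms(1)])
   fix x assume "x \<in> U"
   show "(\<Sum>b\<in>Basis. (\<D> g (at x) i \<bullet> b) *\<^sub>R \<D> f (at (g x)) b) =
     \<D> f (at (g x)) (\<D> g (at x) i)"
    by (rule linear_basis_expansion[symmetric]) (use df[OF \<open>x \<in> U\<close>] has_derivative_linear in blast)
  qed
 qed
qed

section \<open>Linear systems whose coefficients depend on a point\<close>

lemma linear_family_lower_bound:
 fixes A :: "'a::euclidean_space \<Rightarrow> 'b::euclidean_space \<Rightarrow> 'c::euclidean_space"
 assumes "open U" "x0 \<in> U" "\<And>x. x \<in> U \<Longrightarrow> linear (A x)" "inj (A x0)"
  and cont: "\<And>b. b \<in> Basis \<Longrightarrow> continuous_on U (\<lambda>x. A x b)"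
 obtains c where "c > 0" "\<forall>\<^sub>F x in at x0. x \<in> U \<and> (\<forall>v. c * norm v \<le> norm (A x v))"
proof -
 obtain c0 where c0: "c0 > 0" "\<And>v. c0 * norm v \<le> norm (A x0 v)"
 proof -
  obtain B where "B > 0" "\<And>x. B * norm x \<le> norm (A x0 x)"
   using linear_inj_bounded_below_pos[OF assms(3)[OF assms(2)] assms(4)] by blast
  then show thesis using that by blast
 qed
 define \<eta> where "\<eta> x = (\<Sum>b\<in>Basis. norm (A x b - A x0 b))" for x
 have "(\<eta> \<longlongrightarrow> (\<Sum>b\<in>Basis. norm (A x0 b - A x0 b))) (at x0)"
  unfolding \<eta>_def
  using cont assms(1,2) by (intro tendsto_intros) (simp add: continuous_on_eq_continuous_at isCont_def)
 then have "\<forall>\<^sub>F x in at x0. \<eta> x < c0 / 2" using c0(1) by (intro order_tendstoD(2)) auto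
 moreover have "\<forall>\<^sub>F x in at x0. x \<in> U" using assms(1,2) eventually_at_topological by blast
 ultimately have "\<forall>\<^sub>F x in at x0. x \<in> U \<and> (\<forall>v. c0 / 2 * norm v \<le> norm (A x v))"
 proof eventually_elim
  case (elim x)
  have "c0 / 2 * norm v \<le> norm (A x v)" for v
  proof -
   have "A x v - A x0 v = (\<Sum>b\<in>Basis. (v \<bullet> b) *\<^sub>R (A x b - A x0 b))"
    using linear_basis_expansion[OF assms(3)[OF elim(2)], of v] linear_basis_expansion[OF assms(3)[OF assms(2)], of v]
    by (simp add: scaleR_diff_right sum_subtractf)
   also have "norm \<dots> \<le> (\<Sum>b\<in>Basis. norm v * norm (A x b - A x0 b))"
    by (rule sum_norm_le) (auto intro!: mult_right_mono Basis_le_norm)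
   also have "\<dots> = norm v * \<eta> x" by (simp add: \<eta>_def sum_distrib_left)
   also have "\<dots> \<le> norm v * (c0 / 2)" using elim(1) by (intro mult_left_mono) auto
   finally have "norm (A x v - A x0 v) \<le> c0 / 2 * norm v" by (simp add: mult.commute)
   then show ?thesis using c0(2)[of v] norm_triangle_ineq2[of "A x0 v" "A x v"]
    by (simp add: norm_minus_commute)
  qed
  then show ?case using elim by blast
 qed
 then show thesis using that[of "c0 / 2"] c0(1) by simp
qed

text \<open>\<open>A x\<close> is injective but not necessarily square, so there is no inverse to
  follow along. The lower bound \<open>c * norm v \<le> norm (A x v)\<close>, uniform near
  \<open>x0\<close>, takes its place.\<close>

lemma linear_solution_continuous:
 fixes A :: "'a::euclidean_space \<Rightarrow> 'b::euclidean_space \<Rightarrow> 'c::euclidean_space"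
 assumes "open U" "\<And>x. x \<in> U \<Longrightarrow> linear (A x)" "\<And>x. x \<in> U \<Longrightarrow> inj (A x)"
  and cont: "\<And>b. b \<in> Basis \<Longrightarrow> continuous_on U (\<lambda>x. A x b)" "continuous_on U w"
  and sol: "\<And>x. x \<in> U \<Longrightarrow> A x (u x) = w x"
 shows "continuous_on U u"
proof -
 have "isCont u x0" if x0: "x0 \<in> U" for x0
 proof -
  obtain c where c: "c > 0" "\<forall>\<^sub>F x in at x0. x \<in> U \<and> (\<forall>v. c * norm v \<le> norm (A x v))"
   using linear_family_lower_bound[OF assms(1) x0 assms(2) assms(3)[OF x0] cont(1)] by blast
  have cw: "(w \<longlongrightarrow> w x0) (at x0)" and cA: "((\<lambda>x. A x b) \<longlongrightarrow> A x0 b) (at x0)" if "b \<in> Basis" for b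
   using cont that assms(1) x0 by (simp_all add: continuous_on_eq_continuous_at isCont_def)
  have "((\<lambda>x. norm (w x - (\<Sum>b\<in>Basis. (u x0 \<bullet> b) *\<^sub>R A x b)) / c) \<longlongrightarrow>
    norm (w x0 - (\<Sum>b\<in>Basis. (u x0 \<bullet> b) *\<^sub>R A x0 b)) / c) (at x0)"
   using cont(2) assms(1) x0 c(1)
   by (intro tendsto_intros cA) (simp_all add: continuous_on_eq_continuous_at isCont_def)
  moreover have "(\<Sum>b\<in>Basis. (u x0 \<bullet> b) *\<^sub>R A x0 b) = w x0"
   using linear_basis_expansion[OF assms(2)[OF x0], of "u x0"] sol[OF x0] by simp
  ultimately have lim: "((\<lambda>x. norm (w x - (\<Sum>b\<in>Basis. (u x0 \<bullet> b) *\<^sub>R A x b)) / c) \<longlongrightarrow> 0) (at x0)" by simp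
  have "\<forall>\<^sub>F x in at x0. norm (u x - u x0) \<le> norm (w x - (\<Sum>b\<in>Basis. (u x0 \<bullet> b) *\<^sub>R A x b)) / c"
   using c(2)
  proof eventually_elim
   case (elim x)
   have "A x (u x - u x0) = w x - (\<Sum>b\<in>Basis. (u x0 \<bullet> b) *\<^sub>R A x b)"
    using elim sol linear_diff[OF assms(2)] linear_basis_expansion[OF assms(2), of x "u x0"] by simp
   then show ?case using elim c(1) by (metis mult.commute pos_le_divide_eq)
  qed
  then have "((\<lambda>x. u x - u x0) \<longlongrightarrow> 0) (at x0)" by (rule Lim_null_comparison[OF _ lim])
  then show ?thesis by (simp add: isCont_def LIM_zero_iff)
 qed
 then show ?thesis by (simp add: continuous_at_imp_continuous_on)
qed

text \<open>A left inverse \<open>B\<close> of \<open>A x0\<close> gives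
  \<open>u x - u x0 = B (r x) - q x\<close> with \<open>r\<close> differentiable and
  \<open>q\<close> negligible: \<open>u x - u x0\<close> is of the order of
  \<open>norm (x - x0)\<close> by the lower bound, and \<open>A x - A x0\<close> tends to 0.\<close>

lemma linear_solution_has_derivative:
 fixes A :: "'a::euclidean_space \<Rightarrow> 'b::euclidean_space \<Rightarrow> 'c::euclidean_space"
 assumes "open U" "\<And>x. x \<in> U \<Longrightarrow> linear (A x)" "\<And>x. x \<in> U \<Longrightarrow> inj (A x)"
  and dA: "\<And>b. b \<in> Basis \<Longrightarrow> (\<lambda>x. A x b) differentiable_on U" and dw: "w differentiable_on U"
  and sol: "\<And>x. x \<in> U \<Longrightarrow> A x (u x) = w x" and x0: "x0 \<in> U"
 shows "u differentiable (at x0)"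
proof -
 have cA: "continuous_on U (\<lambda>x. A x b)" if "b \<in> Basis" for b
  using differentiable_imp_continuous_on[OF dA[OF that]] .
 obtain c where c: "c > 0" "\<forall>\<^sub>F x in at x0. x \<in> U \<and> (\<forall>v. c * norm v \<le> norm (A x v))"
  using linear_family_lower_bound[OF assms(1) x0 assms(2) assms(3)[OF x0] cA] by blast
 \<comment> \<open>The residual of the constant candidate \<open>u x0\<close>; it is differentiable
   because \<open>A x\<close> is applied to a fixed vector.\<close>
 define r where "r x = w x - (\<Sum>b\<in>Basis. (u x0 \<bullet> b) *\<^sub>R A x b)" for x
 have Aex: "A x v = (\<Sum>b\<in>Basis. (v \<bullet> b) *\<^sub>R A x b)" if "x \<in> U" for x v
  by (rule linear_basis_expansion[OF assms(2)[OF that]])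
 have dAx: "(\<lambda>x. A x b) differentiable (at x0)" if "b \<in> Basis" for b
  using dA[OF that] x0 assms(1) by (metis at_within_open differentiable_on_def)
 have dwx: "w differentiable (at x0)"
  using dw x0 assms(1) by (metis at_within_open differentiable_on_def)
 have "r differentiable (at x0)" unfolding r_def
  by (intro differentiable_diff dwx differentiable_sum ballI differentiable_scaleR differentiable_const dAx finite_Basis)
 then obtain r' where r': "(r has_derivative r') (at x0)" by (auto simp: differentiable_def)
 have r0: "r x0 = 0" using sol[OF x0] Aex[OF x0, of "u x0"] by (simp add: r_def)
 obtain B where B: "linear B" "B \<circ> A x0 = id"
  using linear_injective_left_inverse[OF assms(2)[OF x0] assms(3)[OF x0]] by blast
 have bB: "bounded_linear B" using B(1) by (simp add: linear_conv_bounded_linear)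
 define z where "z x = u x - u x0" for x
 define q where "q x = B (A x (z x) - A x0 (z x))" for x
 have zr: "A x (z x) = r x" if "x \<in> U" for x
  using sol[OF that] linear_diff[OF assms(2)[OF that]] Aex[OF that, of "u x0"] by (simp add: z_def r_def)
 have zB: "z x = B (r x) - q x" if "x \<in> U" for x
 proof -
  have "q x = B (A x (z x)) - B (A x0 (z x))" unfolding q_def by (rule linear_diff[OF B(1)])
  moreover have "B (A x0 (z x)) = z x" using B(2) by (metis comp_apply id_apply)
  ultimately show ?thesis using zr[OF that] by simp
 qed
 obtain K where K: "K > 0" "\<And>v. norm (B v) \<le> norm v * K"
  using bounded_linear.pos_bounded[OF bB] by blast
 have rd: "((\<lambda>x. norm (r x - r' (x - x0)) / norm (x - x0)) \<longlongrightarrow> 0) (at x0)"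
  using r' r0 by (simp add: has_derivative_iff_norm)
 have bl: "bounded_linear r'" using r' by (rule has_derivative_bounded_linear)
 obtain M where M: "M > 0" "\<And>v. norm (r' v) \<le> norm v * M"
  using bounded_linear.pos_bounded[OF bl] by blast
 have "\<forall>\<^sub>F x in at x0. norm (r x - r' (x - x0)) / norm (x - x0) < 1"
  using rd by (rule order_tendstoD(2)) simp
 then have rb: "\<forall>\<^sub>F x in at x0. norm (r x) \<le> (M + 1) * norm (x - x0)"
 proof (eventually_elim)
  case (elim x)
  have "norm (r x - r' (x - x0)) \<le> norm (x - x0)"
   using elim r0 linear_0[OF bounded_linear.linear[OF bl]]
   by (cases "x = x0") (auto simp: divide_less_eq split: if_splits)
  then show ?case using M(2)[of "x - x0"] norm_triangle_sub[of "r x" "r' (x - x0)"]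
   by (simp add: algebra_simps)
 qed
 define \<eta> where "\<eta> x = (\<Sum>b\<in>Basis. norm (A x b - A x0 b))" for x
 have cAx: "((\<lambda>x. A x b) \<longlongrightarrow> A x0 b) (at x0)" if "b \<in> Basis" for b
  using cA[OF that] assms(1) x0 by (simp add: continuous_on_eq_continuous_at isCont_def)
 have "(\<eta> \<longlongrightarrow> (\<Sum>b\<in>Basis. norm (A x0 b - A x0 b))) (at x0)"
  unfolding \<eta>_def by (intro tendsto_intros cAx)
 then have \<eta>: "((\<lambda>x. \<eta> x * ((M + 1) / c) * K) \<longlongrightarrow> 0 * ((M + 1) / c) * K) (at x0)"
  by (intro tendsto_mult tendsto_const) simp
 have qb: "\<forall>\<^sub>F x in at x0. norm (norm (q x) / norm (x - x0)) \<le> \<eta> x * ((M + 1) / c) * K"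
  using rb c(2)
 proof eventually_elim
  case (elim x)
  have "c * norm (z x) \<le> norm (r x)" using elim(2) zr by metis
  then have zn: "norm (z x) \<le> (M + 1) / c * norm (x - x0)"
   using elim(1) c(1) by (simp add: field_simps)
  have "A x (z x) - A x0 (z x) = (\<Sum>b\<in>Basis. (z x \<bullet> b) *\<^sub>R (A x b - A x0 b))"
   using Aex[of x "z x"] Aex[OF x0, of "z x"] elim(2)
   by (simp add: scaleR_diff_right sum_subtractf)
  also have "norm \<dots> \<le> (\<Sum>b\<in>Basis. norm (z x) * norm (A x b - A x0 b))"
   by (rule sum_norm_le) (auto intro!: mult_right_mono Basis_le_norm)
  also have "\<dots> = norm (z x) * \<eta> x" by (simp add: \<eta>_def sum_distrib_left)
  also have "\<dots> \<le> ((M + 1) / c * norm (x - x0)) * \<eta> x"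
   by (intro mult_right_mono zn) (auto simp: \<eta>_def intro: sum_nonneg)
  finally have *: "norm (A x (z x) - A x0 (z x)) \<le> ((M + 1) / c * norm (x - x0)) * \<eta> x" .
  have "norm (q x) \<le> (((M + 1) / c * norm (x - x0)) * \<eta> x) * K"
   unfolding q_def using K(2)[of "A x (z x) - A x0 (z x)"] mult_right_mono[OF *, of K] K(1) by linarith
  moreover have "\<eta> x \<ge> 0" by (auto simp: \<eta>_def intro: sum_nonneg)
  ultimately show ?case using M(1) c(1) K(1)
   by (cases "x = x0") (auto simp: divide_le_eq mult_ac)
 qed
 have q0: "q x0 = 0" using linear_0[OF B(1)] by (simp add: q_def)
 have "(q has_derivative (\<lambda>h. 0)) (at x0)"
  unfolding has_derivative_iff_norm
  using Lim_null_comparison[OF qb] \<eta> q0 by simp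
 moreover have "((\<lambda>x. B (r x)) has_derivative (\<lambda>h. B (r' h))) (at x0)"
  by (rule bounded_linear.has_derivative[OF bB r'])
 ultimately have "((\<lambda>x. B (r x) - q x) has_derivative (\<lambda>h. B (r' h) - 0)) (at x0)"
  by (rule has_derivative_diff[rotated])
 then have "(z has_derivative (\<lambda>h. B (r' h) - 0)) (at x0)"
  by (rule has_derivative_transform_within_open[OF _ assms(1) x0]) (use zB in auto)
 then have "((\<lambda>x. z x + u x0) has_derivative (\<lambda>h. B (r' h) - 0)) (at x0)"
  by (intro has_derivative_add_const)
 then show ?thesis by (auto simp: z_def differentiable_def)
qed

text \<open>Differentiating \<open>A x (u x) = w x\<close> shows that each partial derivative of
  \<open>u\<close> solves the same system with a new right-hand side, which involves
  \<open>u\<close> but no derivative of \<open>u\<close>. Hence each order of smoothness yields the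
  next.\<close>

lemma Ck_linear_solution:
 fixes A :: "'a::euclidean_space \<Rightarrow> 'b::euclidean_space \<Rightarrow> 'c::euclidean_space"
 assumes "open U" "\<And>x. x \<in> U \<Longrightarrow> linear (A x)" "\<And>x. x \<in> U \<Longrightarrow> inj (A x)"
  and "\<And>b. b \<in> Basis \<Longrightarrow> Ck n U (\<lambda>x. A x b)" "Ck n U w"
  and "\<And>x. x \<in> U \<Longrightarrow> A x (u x) = w x"
 shows "Ck n U u"
 using assms(4-)
proof (induction n arbitrary: u w)
 case 0
 then show ?case using linear_solution_continuous[OF assms(1-3)] by simp
next
 case (Suc n)
 have u: "Ck n U u"
  by (rule Suc.IH[OF Ck_Suc_D[OF Suc.prems(1)] Ck_Suc_D[OF Suc.prems(2)] Suc.prems(3)])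
 have du: "u differentiable (at x)" if "x \<in> U" for x
  using linear_solution_has_derivative[OF assms(1-3) _ _ Suc.prems(3) that] Suc.prems(1,2) by simp
 show ?case
 proof (rule Ck_SucI[OF assms(1), where F="\<lambda>x. \<D> u (at x)"])
  show "(u has_derivative \<D> u (at x)) (at x)" if "x \<in> U" for x
   using du[OF that] by (simp add: frechet_derivative_works)
  fix i :: 'a assume i: "i \<in> Basis"
  show "Ck n U (\<lambda>x. \<D> u (at x) i)"
  proof (rule Suc.IH)
   show "Ck n U (\<lambda>x. A x b)" if "b \<in> Basis" for b using Suc.prems(1)[OF that] by (rule Ck_Suc_D)
   show "Ck n U (\<lambda>x. \<D> w (at x) i -
     (\<Sum>b\<in>Basis. (u x \<bullet> b) *\<^sub>R \<D> (\<lambda>x. A x b) (at x) i))"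
   proof -
    have "Ck n U (\<lambda>x. \<D> w (at x) i +
     (\<Sum>b\<in>Basis. (- u x \<bullet> b) *\<^sub>R \<D> (\<lambda>x. A x b) (at x) i))"
    proof (intro Ck_add[OF assms(1)] Ck_sum[OF assms(1)] Ck_bilinear[OF assms(1) bounded_bilinear_scaleR])
     show "Ck n U (\<lambda>x. \<D> w (at x) i)" using Suc.prems(2) i by simp
     show "Ck n U (\<lambda>x. - u x \<bullet> b)" for b
      using Ck_linear[OF assms(1) bounded_linear_minus[OF bounded_linear_inner_left] u] by simp
     show "Ck n U (\<lambda>x. \<D> (\<lambda>x. A x b) (at x) i)" if "b \<in> Basis" for b
      using Suc.prems(1)[OF that] i by simp
    qed simp
    then show ?thesis by (simp add: sum_negf)
   qed
   fix x assume x: "x \<in> U"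
   have dA: "((\<lambda>x. A x b) has_derivative \<D> (\<lambda>x. A x b) (at x)) (at x)" if "b \<in> Basis" for b
    by (rule Ck_has_derivative[OF Suc.prems(1)[OF that] assms(1) x])
   have dux: "(u has_derivative \<D> u (at x)) (at x)"
    using du[OF x] by (simp add: frechet_derivative_works)
   have "((\<lambda>x. \<Sum>b\<in>Basis. (u x \<bullet> b) *\<^sub>R A x b) has_derivative
    (\<lambda>h. \<Sum>b\<in>Basis. (u x \<bullet> b) *\<^sub>R \<D> (\<lambda>x. A x b) (at x) h + (\<D> u (at x) h \<bullet> b) *\<^sub>R A x b)) (at x)"
    by (intro has_derivative_sum has_derivative_scaleR has_derivative_inner_left dA dux)
   then have "(w has_derivative
    (\<lambda>h. \<Sum>b\<in>Basis. (u x \<bullet> b) *\<^sub>R \<D> (\<lambda>x. A x b) (at x) h + (\<D> u (at x) h \<bullet> b) *\<^sub>R A x b)) (at x)"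
   proof (rule has_derivative_transform_within_open[OF _ assms(1) x])
    fix y assume "y \<in> U"
    then show "(\<Sum>b\<in>Basis. (u y \<bullet> b) *\<^sub>R A y b) = w y"
     using Suc.prems(3) linear_basis_expansion[OF assms(2), of y "u y"] by simp
   qed
   then have "\<D> w (at x) = (\<lambda>h. \<Sum>b\<in>Basis. (u x \<bullet> b) *\<^sub>R \<D> (\<lambda>x. A x b) (at x) h + (\<D> u (at x) h \<bullet> b) *\<^sub>R A x b)"
    by (rule frechet_derivative_at[symmetric])
   then show "A x (\<D> u (at x) i) = \<D> w (at x) i -
     (\<Sum>b\<in>Basis. (u x \<bullet> b) *\<^sub>R \<D> (\<lambda>x. A x b) (at x) i)"
    using linear_basis_expansion[OF assms(2)[OF x], of "\<D> u (at x) i"]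
    by (simp add: sum.distrib)
  qed
 qed
qed

section \<open>Smoothness of continuous implicit functions\<close>

lemma implicit_has_derivative:
 fixes F :: "'a::euclidean_space \<times> 'b::euclidean_space \<Rightarrow> 'c::euclidean_space"
 assumes F: "(F has_derivative D) (at (x0, y x0))" and inj: "inj (\<lambda>v. D (0, v))"
  and cont: "isCont y x0" and U: "open U" "x0 \<in> U" "\<And>x. x \<in> U \<Longrightarrow> F (x, y x) = 0"
 shows "y differentiable (at x0)"
proof -
 have bD: "bounded_linear D" using F by (rule has_derivative_bounded_linear)
 have lD: "linear D" using bD by (rule bounded_linear.linear)
 have l2: "linear (\<lambda>v. D (0, v))" "linear (\<lambda>h. D (h, 0))"
  using linear_compose[of "\<lambda>v. (0, v)" D] linear_compose[of "\<lambda>h. (h, 0)" D] lD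
  by (auto simp: o_def linear_iff)
 obtain B where B: "linear B" "B \<circ> (\<lambda>v. D (0, v)) = id"
  using linear_injective_left_inverse[OF l2(1) inj] by blast
 define T where "T h = - B (D (h, 0))" for h
 have lT: "linear T" unfolding T_def
  using linear_compose_neg[OF linear_compose[OF l2(2) B(1)]] by (simp add: o_def)
 have bT: "bounded_linear T" using lT by (simp add: linear_conv_bounded_linear)
 obtain K where K: "K > 0" "\<And>v. norm (B v) \<le> norm v * K"
  using bounded_linear.pos_bounded[of B] B(1) by (auto simp: linear_conv_bounded_linear)
 obtain M where M: "M > 0" "\<And>v. norm (T v) \<le> norm v * M"
  using bounded_linear.pos_bounded[OF bT] by blast
 define \<rho> where "\<rho> x = F (x, y x) - F (x0, y x0) - D (x - x0, y x - y x0)" for x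
 have yT: "y x - y x0 = T (x - x0) - B (\<rho> x)" if "x \<in> U" for x
 proof -
  have "D (x - x0, y x - y x0) = D (x - x0, 0) + D (0, y x - y x0)"
   using linear_add[OF lD, of "(x - x0, 0)" "(0, y x - y x0)"] by simp
  then have "\<rho> x = - D (x - x0, 0) - D (0, y x - y x0)"
   using U that by (simp add: \<rho>_def)
  then have "B (\<rho> x) = T (x - x0) - B (D (0, y x - y x0))"
   using linear_diff[OF B(1)] linear_neg[OF B(1)] by (simp add: T_def)
  moreover have "B (D (0, y x - y x0)) = y x - y x0" using B(2) by (metis comp_apply id_apply)
  ultimately show ?thesis by simp
 qed
 have "(y has_derivative T) (at x0)"
  unfolding has_derivative_at_alt
 proof (intro conjI bT allI impI)
  fix e :: real assume e: "e > 0"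
  \<comment> \<open>The first bound allows half of \<open>norm (y x - y x0)\<close> to be absorbed,
    giving \<open>norm (y x - y x0) \<le> (2 * M + 1) * norm (x - x0)\<close>; the second turns the
    remaining error into \<open>e * norm (x - x0)\<close>.\<close>
  define \<epsilon> where "\<epsilon> = min (1 / (2 * K)) (e / (K * (2 * M + 2)))"
  have \<epsilon>: "\<epsilon> > 0" "K * \<epsilon> \<le> 1/2" "K * \<epsilon> * (2 * M + 2) \<le> e"
  proof -
   show "\<epsilon> > 0" using K M e by (simp add: \<epsilon>_def)
   have "K * \<epsilon> \<le> K * (1 / (2 * K))" using K(1) by (intro mult_left_mono) (auto simp: \<epsilon>_def)
   then show "K * \<epsilon> \<le> 1/2" using K(1) by simp
   have "(K * (2 * M + 2)) * \<epsilon> \<le> (K * (2 * M + 2)) * (e / (K * (2 * M + 2)))"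
    using K(1) M(1) by (intro mult_left_mono) (auto simp: \<epsilon>_def)
   also have "\<dots> = e" using K(1) M(1) by (simp add: nonzero_eq_divide_eq)
   finally show "K * \<epsilon> * (2 * M + 2) \<le> e" by (simp add: mult_ac)
  qed
  obtain d where d: "d > 0" "\<And>z. norm (z - (x0, y x0)) < d \<Longrightarrow>
    norm (F z - F (x0, y x0) - D (z - (x0, y x0))) \<le> \<epsilon> * norm (z - (x0, y x0))"
   using F \<epsilon>(1) unfolding has_derivative_at_alt by blast
  have "isCont (\<lambda>x. (x, y x)) x0" using cont by (intro continuous_intros)
  then obtain d1 where d1: "d1 > 0" "\<And>x. dist x x0 < d1 \<Longrightarrow> dist (x, y x) (x0, y x0) < d"
   using d(1) unfolding continuous_at_eps_delta by blast
  obtain d2 where d2: "d2 > 0" "ball x0 d2 \<subseteq> U" using U open_contains_ball by blast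
  have "norm (y x - y x0 - T (x - x0)) \<le> e * norm (x - x0)" if x: "norm (x - x0) < min d1 d2" for x
  proof -
   have xU: "x \<in> U" using d2 x by (auto simp: dist_norm norm_minus_commute)
   have "norm ((x, y x) - (x0, y x0)) < d" using d1(2)[of x] x by (simp add: dist_norm)
   then have "norm (\<rho> x) \<le> \<epsilon> * norm (x - x0, y x - y x0)"
    using d(2)[of "(x, y x)"] by (simp add: \<rho>_def)
   also have "\<dots> \<le> \<epsilon> * (norm (x - x0) + norm (y x - y x0))"
    using \<epsilon>(1) norm_Pair_le[of "x - x0" "y x - y x0"] by (intro mult_left_mono) auto
   finally have "K * norm (\<rho> x) \<le> K * (\<epsilon> * (norm (x - x0) + norm (y x - y x0)))"
    using K(1) by (intro mult_left_mono) auto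
   then have Br: "norm (B (\<rho> x)) \<le> K * \<epsilon> * (norm (x - x0) + norm (y x - y x0))"
    using K(2)[of "\<rho> x"] by (simp add: mult_ac)
   also have "\<dots> \<le> 1/2 * (norm (x - x0) + norm (y x - y x0))"
    using \<epsilon>(2) by (intro mult_right_mono) auto
   finally have "norm (y x - y x0) \<le> norm (x - x0) * M + 1/2 * (norm (x - x0) + norm (y x - y x0))"
    using arg_cong[OF yT[OF xU], of norm] M(2)[of "x - x0"] norm_triangle_ineq4[of "T (x - x0)" "B (\<rho> x)"] by linarith
   then have yb: "norm (y x - y x0) \<le> (2 * M + 1) * norm (x - x0)" by (simp add: algebra_simps)
   have "norm (y x - y x0 - T (x - x0)) = norm (B (\<rho> x))" using yT[OF xU] by simp
   also have "\<dots> \<le> K * \<epsilon> * (norm (x - x0) + (2 * M + 1) * norm (x - x0))"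
    using Br yb K(1) \<epsilon>(1) by (smt (verit) mult_left_mono mult_pos_pos)
   also have "\<dots> = (K * \<epsilon> * (2 * M + 2)) * norm (x - x0)" by (simp add: algebra_simps)
   also have "\<dots> \<le> e * norm (x - x0)" using \<epsilon>(3) by (intro mult_right_mono) auto
   finally show ?thesis .
  qed
  then show "\<exists>d>0. \<forall>x. norm (x - x0) < d \<longrightarrow> norm (y x - y x0 - T (x - x0)) \<le> e * norm (x - x0)"
   using d1(1) d2(1) by (intro exI[of _ "min d1 d2"]) auto
 qed
 then show ?thesis by (auto simp: differentiable_def)
qed

text \<open>Existence is not at stake, as \<open>y\<close> is given and continuous. Its derivative
  solves a linear system whose coefficients are derivatives of \<open>F\<close> along the graph of
  \<open>y\<close>, so \<open>Ck_linear_solution\<close> raises the smoothness of \<open>y\<close>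
  by one order at a time.\<close>

lemma Ck_implicit:
 fixes F :: "'a::euclidean_space \<times> 'b::euclidean_space \<Rightarrow> 'c::euclidean_space"
 assumes "open U" "open W" and F: "\<And>n. Ck n W F" and cont: "continuous_on U y"
  and W: "\<And>x. x \<in> U \<Longrightarrow> (x, y x) \<in> W" and z: "\<And>x. x \<in> U \<Longrightarrow> F (x, y x) = 0"
  and inj: "\<And>x. x \<in> U \<Longrightarrow> inj (\<lambda>v. \<D> F (at (x, y x)) (0, v))"
 shows "Ck n U y"
proof (induction n)
 case 0
 then show ?case using cont by simp
next
 case (Suc n)
 have dF: "(F has_derivative \<D> F (at (x, y x))) (at (x, y x))" if "x \<in> U" for x
  using Ck_has_derivative[OF F assms(2) W[OF that]] .
 have dy: "(y has_derivative \<D> y (at x)) (at x)" if "x \<in> U" for x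
 proof -
  have "isCont y x" using cont assms(1) that by (simp add: continuous_on_eq_continuous_at)
  from implicit_has_derivative[OF dF[OF that] inj[OF that] this assms(1) that z]
  show ?thesis by (simp add: frechet_derivative_works)
 qed
 have Cp: "Ck n U (\<lambda>x. (x, y x))"
 proof -
  have "Ck n U (\<lambda>x. (x, 0) + (0, y x))"
   by (intro Ck_add[OF assms(1)] Ck_linear[OF assms(1) _ Ck_ident[OF assms(1)]] Ck_linear[OF assms(1) _ Suc])
    (auto intro: bounded_linear_Pair bounded_linear_ident bounded_linear_zero)
  then show ?thesis by simp
 qed
 have CD: "Ck n U (\<lambda>x. \<D> F (at (x, y x)) j)" if "j \<in> Basis" for j
  using Ck_compose[OF assms(1,2) _ Cp, of "\<lambda>z. \<D> F (at z) j"] F[of "Suc n"] W that by auto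
 show ?case
 proof (rule Ck_SucI[OF assms(1) dy])
  fix i :: 'a assume i: "i \<in> Basis"
  show "Ck n U (\<lambda>x. \<D> y (at x) i)"
  proof (rule Ck_linear_solution[OF assms(1), where A="\<lambda>x v. \<D> F (at (x, y x)) (0, v)"
     and w="\<lambda>x. - \<D> F (at (x, y x)) (i, 0)"])
   fix x assume x: "x \<in> U"
   have lD: "linear (\<D> F (at (x, y x)))"
    using dF[OF x] has_derivative_linear by blast
   show "linear (\<lambda>v. \<D> F (at (x, y x)) (0, v))"
    using linear_compose[of "\<lambda>v. (0, v)", OF _ lD] by (auto simp: o_def linear_iff)
   show "inj (\<lambda>v. \<D> F (at (x, y x)) (0, v))" by (rule inj[OF x])
   have "((\<lambda>x. F (x, y x)) has_derivative (\<lambda>h. \<D> F (at (x, y x)) (h, \<D> y (at x) h))) (at x)"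
    using diff_chain_at[OF has_derivative_Pair[OF has_derivative_ident dy[OF x]] dF[OF x]] by (simp add: o_def)
   moreover have "((\<lambda>x. F (x, y x)) has_derivative (\<lambda>h. 0)) (at x)"
    by (rule has_derivative_transform_within_open[OF has_derivative_const assms(1) x]) (use z in auto)
   ultimately have "(\<lambda>h. \<D> F (at (x, y x)) (h, \<D> y (at x) h)) = (\<lambda>h. 0)"
    by (rule has_derivative_unique)
   then have "\<D> F (at (x, y x)) (i, \<D> y (at x) i) = 0" by meson
   then show "\<D> F (at (x, y x)) (0, \<D> y (at x) i) = - \<D> F (at (x, y x)) (i, 0)"
    using linear_add[OF lD, of "(i, 0)" "(0, \<D> y (at x) i)"]
    by (simp add: eq_neg_iff_add_eq_0 add.commute)
  next
   show "Ck n U (\<lambda>x. \<D> F (at (x, y x)) (0, b))" if "b \<in> Basis" for b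
    using that by (intro CD) (auto simp: Basis_prod_def)
   show "Ck n U (\<lambda>x. - \<D> F (at (x, y x)) (i, 0))"
    using i by (intro Ck_linear[OF assms(1) bounded_linear_minus[OF bounded_linear_ident]] CD) (auto simp: Basis_prod_def)
  qed
 qed
qed

lemma smooth_on_iff_Ck: "smooth_on U f \<longleftrightarrow> open U \<and> (\<forall>n. Ck n U f)"
proof safe
 assume s: "smooth_on U f"
 then show "open U" by (simp add: smooth_on_def)
 have "Ck n U g" if "g \<in> iter_partials f" for g n
  using that
 proof (induction n arbitrary: g)
  case 0
  then show ?case using s by (auto simp: smooth_on_def intro: differentiable_imp_continuous_on)
 next
  case (Suc n)
  then show ?case using s by (auto simp: smooth_on_def intro: iter_partials.step)
 qed
 then show "Ck n U f" for n using iter_partials.base by blast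
next
 assume U: "open U" and C: "\<forall>n. Ck n U f"
 have "\<forall>n. Ck n U g" if "g \<in> iter_partials f" for g
  using that
 proof induction
  case base
  then show ?case using C by simp
 next
  case (step g i)
  show ?case
  proof
   fix n
   have "Ck (Suc n) U g" using step by blast
   then show "Ck n U (\<lambda>x. \<D> g (at x) i)" using step.hyps(2) by (simp only: Ck.simps)
  qed
 qed
 then show "smooth_on U f" using U unfolding smooth_on_def by (metis Ck.simps(2))
qed

section \<open>Nash functions\<close>

text \<open>The function is total, and semialgebraic everywhere; only its smoothness is confined to \<open>U\<close>.\<close>
definition nash_on :: "'a::euclidean_space set \<Rightarrow> ('a \<Rightarrow> 'b::euclidean_space) \<Rightarrow> bool" where
 "nash_on U f \<longleftrightarrow> open U \<and> (\<forall>n. Ck n U f) \<and> sa_fun f"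

lemma nash_on_open: "nash_on U f \<Longrightarrow> open U" by (simp add: nash_on_def)
lemma nash_on_sa_fun: "nash_on U f \<Longrightarrow> sa_fun f" by (simp add: nash_on_def)
lemma nash_on_Ck: "nash_on U f \<Longrightarrow> Ck n U f" by (simp add: nash_on_def)
lemma nash_on_continuous_on: "nash_on U f \<Longrightarrow> continuous_on U f"
 using nash_on_Ck[of U f 0] by simp
lemma nash_on_subset: "nash_on U f \<Longrightarrow> V \<subseteq> U \<Longrightarrow> open V \<Longrightarrow> nash_on V f"
 unfolding nash_on_def using Ck_subset by blast

lemma nash_map_on_nash_on:
 assumes "nash_on U f" "semialgebraic U" "S \<subseteq> U" "\<And>x. x \<in> S \<Longrightarrow> f x = g x"
 shows "nash_map_on S g"
 unfolding nash_map_on_def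
proof (intro exI[of _ U] exI[of _ f] conjI)
 show "smooth_on U f" using assms(1) by (simp add: smooth_on_iff_Ck nash_on_def)
 show "semialgebraic_map U f"
  using assms(1,2) by (intro semialgebraic_map_sa_fun) (auto simp: nash_on_def)
qed (use assms in \<open>auto simp: nash_on_def\<close>)

lemma nash_on_const: "open U \<Longrightarrow> nash_on U (\<lambda>x. c)"
 by (simp add: nash_on_def Ck_const sa_fun_const)
lemma nash_on_ident: "open U \<Longrightarrow> nash_on U (\<lambda>x. x)"
 by (simp add: nash_on_def Ck_ident sa_fun_id)
lemma nash_on_add: "nash_on U f \<Longrightarrow> nash_on U g \<Longrightarrow> nash_on U (\<lambda>x. f x + g x)"
 by (simp add: nash_on_def Ck_add sa_fun_add)
lemma nash_on_linear:
 fixes L :: "'b::euclidean_space \<Rightarrow> 'c::euclidean_space"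
 assumes "linear L" "nash_on U f" shows "nash_on U (\<lambda>x. L (f x))"
 using assms(2) sa_fun_compose[OF sa_fun_linear[OF assms(1)], of f]
  Ck_linear[OF nash_on_open[OF assms(2)] assms(1)[unfolded linear_conv_bounded_linear]]
 by (simp add: nash_on_def)
lemma nash_on_minus: "nash_on U f \<Longrightarrow> nash_on U (\<lambda>x. - f x)"
 using nash_on_linear[of uminus U f] by (simp add: linear_iff)
lemma nash_on_diff: "nash_on U f \<Longrightarrow> nash_on U g \<Longrightarrow> nash_on U (\<lambda>x. f x - g x)"
 using nash_on_add[OF _ nash_on_minus, of U f g] by simp
lemma nash_on_scaleR:
 fixes f :: "'a::euclidean_space \<Rightarrow> real" and g :: "'a \<Rightarrow> 'b::euclidean_space"
 shows "nash_on U f \<Longrightarrow> nash_on U g \<Longrightarrow> nash_on U (\<lambda>x. f x *\<^sub>R g x)"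
 by (simp add: nash_on_def Ck_bilinear[OF _ bounded_bilinear_scaleR] sa_fun_scaleR)
lemma nash_on_mult:
 fixes f g :: "'a::euclidean_space \<Rightarrow> real"
 shows "nash_on U f \<Longrightarrow> nash_on U g \<Longrightarrow> nash_on U (\<lambda>x. f x * g x)"
 using nash_on_scaleR[of U f g] by simp
lemma nash_on_power:
 fixes f :: "'a::euclidean_space \<Rightarrow> real"
 shows "nash_on U f \<Longrightarrow> nash_on U (\<lambda>x. f x ^ n)"
 by (induction n) (auto intro: nash_on_const nash_on_mult nash_on_open)
lemma nash_on_sum:
 fixes f :: "'i \<Rightarrow> 'a::euclidean_space \<Rightarrow> 'b::euclidean_space"
 shows "open U \<Longrightarrow> finite I \<Longrightarrow> (\<And>i. i \<in> I \<Longrightarrow> nash_on U (f i)) \<Longrightarrow> nash_on U (\<lambda>x. \<Sum>i\<in>I. f i x)"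
 by (rotate_tac, induction I rule: finite_induct) (auto intro: nash_on_add nash_on_const)
lemma nash_on_fst:
 fixes f :: "'a::euclidean_space \<Rightarrow> 'b::euclidean_space \<times> 'c::euclidean_space"
 shows "nash_on U f \<Longrightarrow> nash_on U (\<lambda>x. fst (f x))"
 by (rule nash_on_linear[OF linear_fst])
lemma nash_on_snd:
 fixes f :: "'a::euclidean_space \<Rightarrow> 'b::euclidean_space \<times> 'c::euclidean_space"
 shows "nash_on U f \<Longrightarrow> nash_on U (\<lambda>x. snd (f x))"
 by (rule nash_on_linear[OF linear_snd])
lemma nash_on_Pair:
 fixes f :: "'a::euclidean_space \<Rightarrow> 'b::euclidean_space" and g :: "'a \<Rightarrow> 'c::euclidean_space"
 assumes "nash_on U f" "nash_on U g" shows "nash_on U (\<lambda>x. (f x, g x))"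
proof -
 have "nash_on U (\<lambda>x. (f x, 0) + (0, g x))"
  by (intro nash_on_add nash_on_linear[OF _ assms(1)] nash_on_linear[OF _ assms(2)]) (auto simp: linear_iff)
 then show ?thesis by simp
qed
lemma nash_on_inner_const: "nash_on U f \<Longrightarrow> nash_on U (\<lambda>x. f x \<bullet> b)"
 using nash_on_linear[of "\<lambda>x. x \<bullet> b"] by (simp add: bounded_linear.linear bounded_linear_inner_left)
lemma nash_on_inner:
 assumes "nash_on U f" "nash_on U g" shows "nash_on U (\<lambda>x. f x \<bullet> g x)"
proof -
 have "nash_on U (\<lambda>x. \<Sum>b\<in>Basis. (f x \<bullet> b) * (g x \<bullet> b))"
  using assms by (intro nash_on_sum nash_on_mult nash_on_inner_const) (auto intro: nash_on_open)
 then show ?thesis by (simp flip: euclidean_inner)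
qed
lemma nash_on_compose:
 fixes f :: "'b::euclidean_space \<Rightarrow> 'c::euclidean_space" and g :: "'a::euclidean_space \<Rightarrow> 'b"
 assumes "nash_on V f" "nash_on U g" "g ` U \<subseteq> V" shows "nash_on U (\<lambda>x. f (g x))"
 using assms Ck_compose[of U V _ f g] sa_fun_compose[of f g] by (simp add: nash_on_def)

lemma nash_on_poly_fun: "p \<in> poly_fun \<Longrightarrow> nash_on UNIV p"
 by (induction rule: poly_fun.induct)
  (auto intro: nash_on_const nash_on_add nash_on_mult nash_on_inner_const[OF nash_on_ident])

text \<open>A function strictly increasing in its last variable with a sign change on every fibre
 has a Nash zero; the fibres of \<open>T\<close> are intervals.\<close>
lemma nash_on_implicit:
 fixes F :: "'a::euclidean_space \<times> real \<Rightarrow> real"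
 assumes U: "open U" "semialgebraic U" and T: "open T" "semialgebraic T" and F: "nash_on T F"
  and conv: "\<And>x s t u. (x, s) \<in> T \<Longrightarrow> (x, t) \<in> T \<Longrightarrow> s \<le> u \<Longrightarrow> u \<le> t \<Longrightarrow> (x, u) \<in> T"
  and d: "\<And>x t. (x, t) \<in> T \<Longrightarrow> ((\<lambda>t. F (x, t)) has_real_derivative F' x t) (at t)"
  and pos: "\<And>x t. (x, t) \<in> T \<Longrightarrow> F' x t > 0"
  and sg: "\<And>x. x \<in> U \<Longrightarrow> \<exists>s t. (x, s) \<in> T \<and> (x, t) \<in> T \<and> F (x, s) < 0 \<and> F (x, t) > 0"
 obtains g where "nash_on U g" "\<And>x. x \<in> U \<Longrightarrow> (x, g x) \<in> T \<and> F (x, g x) = 0"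
  "\<And>x t. (x, t) \<in> T \<Longrightarrow> x \<in> U \<Longrightarrow> t < g x \<longleftrightarrow> F (x, t) < 0"
proof -
 have mono: "F (x, s) < F (x, t)" if "(x, s) \<in> T" "(x, t) \<in> T" "s < t" for x s t
  by (rule DERIV_pos_imp_increasing[OF that(3), of "\<lambda>t. F (x, t)"]) (use conv[OF that(1,2)] d pos in blast)
 have contF: "continuous_on T F" by (rule nash_on_continuous_on[OF F])
 have ivt: "\<exists>u. s < u \<and> u < t \<and> (x, u) \<in> T \<and> F (x, u) = 0"
  if st: "(x, s) \<in> T" "(x, t) \<in> T" "F (x, s) < 0" "F (x, t) > 0" for x s t
 proof -
  have "s < t" using mono[OF st(2,1)] st(3,4) by (metis less_asym less_trans linorder_cases)
  have "continuous_on {s..t} (\<lambda>u. F (x, u))"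
   by (rule continuous_on_compose2[OF contF]) (use conv[OF st(1,2)] in \<open>auto intro!: continuous_intros\<close>)
  then obtain u where "s \<le> u" "u \<le> t" "F (x, u) = 0"
   using IVT'[of "\<lambda>u. F (x, u)" s 0 t] st \<open>s < t\<close> by auto
  moreover have "u \<noteq> s" "u \<noteq> t" using st calculation by auto
  ultimately show ?thesis using conv[OF st(1,2)] by (intro exI[of _ u]) auto
 qed
 define g where "g x = (if x \<in> U then THE t. (x, t) \<in> T \<and> F (x, t) = 0 else 0)" for x
 have ex1: "\<exists>!t. (x, t) \<in> T \<and> F (x, t) = 0" if "x \<in> U" for x
 proof (rule ex_ex1I)
  show "\<exists>t. (x, t) \<in> T \<and> F (x, t) = 0" using sg[OF that] ivt by blast
  show "t = u" if "(x, t) \<in> T \<and> F (x, t) = 0" "(x, u) \<in> T \<and> F (x, u) = 0" for t u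
   using mono[of x t u] mono[of x u t] that by (metis linorder_cases less_irrefl)
 qed
 have g: "(x, g x) \<in> T \<and> F (x, g x) = 0" if "x \<in> U" for x
  unfolding g_def using theI'[OF ex1[OF that]] that by simp
 have guniq: "t = g x" if "x \<in> U" "(x, t) \<in> T" "F (x, t) = 0" for x t
  using ex1[OF that(1)] g[OF that(1)] that by blast
 have sag: "sa_fun g"
 proof (rule sa_funI[where R="\<lambda>x t. (x \<in> U \<longrightarrow> (x, t) \<in> T \<and> F (x, t) = 0) \<and> (x \<notin> U \<longrightarrow> t = 0)"])
  show "semialgebraic {z. (fst z \<in> U \<longrightarrow> (fst z, snd z) \<in> T \<and> F (fst z, snd z) = 0) \<and> (fst z \<notin> U \<longrightarrow> snd z = 0)}"
   by (intro sa_intros semialgebraic_mem U T sa_fun_compose[OF nash_on_sa_fun[OF F]])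
  show "((x \<in> U \<longrightarrow> (x, t) \<in> T \<and> F (x, t) = 0) \<and> (x \<notin> U \<longrightarrow> t = 0)) = (t = g x)" for x t
   using g guniq by (auto simp: g_def)
 qed
 have cont: "continuous_on U g"
  unfolding continuous_on_iff
 proof (intro ballI allI impI)
  fix x0 and e :: real assume x0: "x0 \<in> U" and e: "e > 0"
  have g0: "(x0, g x0) \<in> T" "F (x0, g x0) = 0" using g[OF x0] by auto
  obtain r where r: "r > 0" "ball (x0, g x0) r \<subseteq> T" using T(1) g0(1) open_contains_ball by blast
  \<comment> \<open>The sign change between \<open>g x0 - h\<close> and \<open>g x0 + h\<close>
    persists for nearby \<open>x\<close> and traps \<open>g x\<close> there.\<close>
  define h where "h = min (r/2) (e/2)"
  have h: "h > 0" "h < r" "h < e" using r e by (auto simp: h_def)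
  have hT: "(x0, g x0 - h) \<in> T" "(x0, g x0 + h) \<in> T"
   using h r(2) by (auto intro!: subsetD[OF r(2)] simp: dist_Pair_Pair dist_real_def)
  have Fs: "F (x0, g x0 - h) < 0" "F (x0, g x0 + h) > 0"
   using mono[OF hT(1) g0(1)] mono[OF g0(1) hT(2)] g0(2) h(1) by auto
  have ev1: "\<forall>\<^sub>F x in nhds x0. (x, c) \<in> T" if "(x0, c) \<in> T" for c
  proof -
   have "open {x. (x, c) \<in> T}"
    using open_vimage[OF T(1), of "\<lambda>x. (x, c)"] by (simp add: vimage_def continuous_intros)
   then show ?thesis using that eventually_nhds_in_open[of "{x. (x, c) \<in> T}" x0] by simp
  qed
  have lim: "((\<lambda>x. F (x, c)) \<longlongrightarrow> F (x0, c)) (nhds x0)" if "(x0, c) \<in> T" for c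
  proof -
   have "isCont F (x0, c)" using contF T(1) that by (simp add: continuous_on_eq_continuous_at)
   then have "isCont (\<lambda>x. F (x, c)) x0"
    by (intro isCont_o2[where g=F and f="\<lambda>x. (x, c)"] continuous_intros)
   then show ?thesis using tendsto_at_iff_tendsto_nhds[of "\<lambda>x. F (x, c)" x0] by (simp add: isCont_def)
  qed
  have "\<forall>\<^sub>F x in nhds x0. x \<in> U" using U(1) x0 eventually_nhds_in_open by blast
  then have "\<forall>\<^sub>F x in nhds x0. dist (g x) (g x0) < e"
   using ev1[OF hT(1)] ev1[OF hT(2)] order_tendstoD(2)[OF lim[OF hT(1)] Fs(1)] order_tendstoD(1)[OF lim[OF hT(2)] Fs(2)]
  proof eventually_elim
   case (elim x)
   then obtain u where "g x0 - h < u" "u < g x0 + h" "(x, u) \<in> T" "F (x, u) = 0"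
    using ivt by blast
   then have "\<bar>g x - g x0\<bar> < h" using guniq[OF elim(1)] by force
   then show ?case using h by (simp add: dist_real_def)
  qed
  then show "\<exists>d>0. \<forall>x\<in>U. dist x x0 < d \<longrightarrow> dist (g x) (g x0) < e"
   unfolding eventually_nhds_metric by blast
 qed
 have "Ck n U g" for n
 proof (rule Ck_implicit[OF U(1) T(1) nash_on_Ck[OF F] cont])
  show "(x, g x) \<in> T" "F (x, g x) = 0" if "x \<in> U" for x using g[OF that] by auto
  show "inj (\<lambda>v. \<D> F (at (x, g x)) (0, v))" if "x \<in> U" for x
  proof -
   let ?D = "\<D> F (at (x, g x))"
   have gT: "(x, g x) \<in> T" using g[OF that] by simp
   have D: "(F has_derivative ?D) (at (x, g x))"
    by (rule Ck_has_derivative[OF nash_on_Ck[OF F] T(1) gT])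
   have "((\<lambda>t. F (x, t)) has_derivative (\<lambda>v. ?D (0, v))) (at (g x))"
    using diff_chain_at[OF has_derivative_Pair[OF has_derivative_const has_derivative_ident] D] by (simp add: o_def)
   then have "(\<lambda>v. ?D (0, v)) = (\<lambda>v. F' x (g x) * v)"
    using d[OF gT] unfolding has_field_derivative_def by (rule has_derivative_unique)
   then show ?thesis using pos[OF gT] by (auto simp: inj_def)
  qed
 qed
 then have "nash_on U g" using U(1) sag by (simp add: nash_on_def)
 moreover have "t < g x \<longleftrightarrow> F (x, t) < 0" if "(x, t) \<in> T" "x \<in> U" for x t
  using mono[OF that(1), of "g x"] mono[of x "g x" t] g[OF that(2)] that(1)
  by (metis less_asym linorder_cases)
 ultimately show thesis using that g by blast
qed

lemma nash_on_real_inverse: "nash_on {x::real. x \<noteq> 0} inverse"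
proof -
 have op: "open {x::real. x \<noteq> 0}" by (simp add: open_Collect_neq)
 \<comment> \<open>The inverse solves the linear equation \<open>x * u = 1\<close>.\<close>
 have "Ck n {x::real. x \<noteq> 0} inverse" for n
 proof (rule Ck_linear_solution[OF op, where A="\<lambda>x v. x * v" and w="\<lambda>x. 1"])
  show "Ck n {x::real. x \<noteq> 0} (\<lambda>x. x * b)" for b
   using Ck_linear[OF op bounded_linear_mult_left Ck_ident[OF op]] .
 qed (auto simp: linear_iff inj_def algebra_simps intro: Ck_const[OF op])
 then show ?thesis using op sa_fun_inverse[OF sa_fun_id] by (simp add: nash_on_def)
qed

lemma nash_on_inverse:
 fixes f :: "'a::euclidean_space \<Rightarrow> real"
 shows "nash_on U f \<Longrightarrow> (\<And>x. x \<in> U \<Longrightarrow> f x \<noteq> 0) \<Longrightarrow> nash_on U (\<lambda>x. inverse (f x))"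
 by (rule nash_on_compose[OF nash_on_real_inverse]) auto

lemma nash_on_divide:
 fixes f g :: "'a::euclidean_space \<Rightarrow> real"
 shows "nash_on U f \<Longrightarrow> nash_on U g \<Longrightarrow> (\<And>x. x \<in> U \<Longrightarrow> g x \<noteq> 0) \<Longrightarrow> nash_on U (\<lambda>x. f x / g x)"
 unfolding divide_inverse by (intro nash_on_mult nash_on_inverse)

lemma nash_on_real_sqrt: "nash_on {0<..} sqrt"
proof -
 have op: "open {0::real<..}" by simp
 \<comment> \<open>The square root is a continuous solution of \<open>y * y = x\<close>, whose
   derivative in \<open>y\<close> is nonzero for positive \<open>x\<close>.\<close>
 define F where "F z = snd z * snd z - fst z" for z :: "real \<times> real"
 have F: "nash_on UNIV F" unfolding F_def[abs_def]
  by (intro nash_on_diff nash_on_mult nash_on_fst nash_on_snd nash_on_ident open_UNIV)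
 have dF: "\<D> F (at (x, y)) (0, v) = 2 * y * v" for x y v
 proof -
  have "(F has_derivative (\<lambda>h. snd (x, y) * snd h + snd h * snd (x, y) - fst h)) (at (x, y))"
   unfolding F_def[abs_def] by (intro derivative_intros)
  from frechet_derivative_at[OF this, symmetric] show ?thesis by simp
 qed
 have "Ck n {0::real<..} sqrt" for n
  by (rule Ck_implicit[OF op open_UNIV nash_on_Ck[OF F]])
   (auto simp: F_def dF inj_def intro: continuous_intros)
 then show ?thesis using op sa_fun_sqrt[OF sa_fun_id] by (simp add: nash_on_def)
qed

lemma nash_on_sqrt:
 "nash_on U f \<Longrightarrow> (\<And>x. x \<in> U \<Longrightarrow> f x > 0) \<Longrightarrow> nash_on U (\<lambda>x. sqrt (f x))"
 by (rule nash_on_compose[OF nash_on_real_sqrt]) auto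

lemmas nash_intros = nash_on_const nash_on_ident nash_on_add nash_on_diff nash_on_minus nash_on_mult nash_on_scaleR
 nash_on_power nash_on_fst nash_on_snd nash_on_Pair nash_on_inner nash_on_divide nash_on_sqrt

section \<open>Polynomial growth and the Lojasiewicz inequality\<close>

text \<open>The exponent makes the weights decay at infinity faster than any given power, the factor
  \<open>k\<close> makes them small on bounded sets. Up to a change of index they are closed under
  products and division by constants, so they can stand in for arbitrary tolerances.\<close>

definition wt :: "nat \<Rightarrow> 'a::euclidean_space \<Rightarrow> real" where
 "wt k x = 1 / (real k * (1 + x \<bullet> x) ^ k)"

lemma wt_pos: "k \<ge> 1 \<Longrightarrow> wt k x > 0"
 by (simp add: wt_def zero_less_mult_iff add_pos_nonneg)

lemma one_le_1_inner: "1 \<le> 1 + x \<bullet> (x::'a::euclidean_space)" by simp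

lemma nash_on_wt: assumes "k \<ge> 1" shows "nash_on UNIV (wt k)"
proof -
 have "real k * (1 + x \<bullet> x) ^ k \<noteq> 0" for x :: 'a
  using assms one_le_1_inner[of x] by (metis mult_eq_0_iff not_one_le_zero of_nat_eq_0_iff power_eq_0_iff)
 then show ?thesis unfolding wt_def[abs_def]
  by (intro nash_intros open_UNIV) auto
qed

lemma wt_le1: assumes "k \<ge> 1" shows "wt k x \<le> 1"
proof -
 have "1 * 1 \<le> real k * (1 + x \<bullet> x) ^ k"
  using assms one_le_1_inner[of x] by (intro mult_mono one_le_power) auto
 then show ?thesis by (simp add: wt_def)
qed

lemma wt_mono: assumes "1 \<le> k" "k \<le> j" shows "wt j x \<le> wt k x"
proof -
 have "real k * (1 + x \<bullet> x) ^ k \<le> real j * (1 + x \<bullet> x) ^ j"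
  using assms one_le_1_inner[of x] by (intro mult_mono power_increasing) auto
 moreover have "real k * (1 + x \<bullet> x) ^ k > 0" using assms by (simp add: add_pos_nonneg)
 ultimately show ?thesis by (simp add: wt_def frac_le)
qed

text \<open>The index is at least \<open>i * k\<close>, the product of the constant factors, and at
  least \<open>i + k\<close>, the exponent of the product.\<close>

lemma wt_mult: assumes "1 \<le> i" "1 \<le> k" shows "wt (i * k + i + k) x \<le> wt i x * wt k x"
proof -
 have "real i * (1 + x \<bullet> x) ^ i * (real k * (1 + x \<bullet> x) ^ k) = real (i * k) * (1 + x \<bullet> x) ^ (i + k)"
  by (simp add: power_add mult_ac)
 also have "\<dots> \<le> real (i * k + i + k) * (1 + x \<bullet> x) ^ (i * k + i + k)"
  using one_le_1_inner[of x] by (intro mult_mono power_increasing) auto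
 finally have "real i * (1 + x \<bullet> x) ^ i * (real k * (1 + x \<bullet> x) ^ k) \<le> \<dots>" .
 moreover have "real i * (1 + x \<bullet> x) ^ i * (real k * (1 + x \<bullet> x) ^ k) > 0"
  using assms by (simp add: add_pos_nonneg)
 ultimately show ?thesis by (simp add: wt_def frac_le)
qed

lemma wt_scale: assumes "1 \<le> n" "1 \<le> k" shows "wt (n * k) x \<le> wt k x / n"
proof -
 have "real n * (real k * (1 + x \<bullet> x) ^ k) \<le> real (n * k) * (1 + x \<bullet> x) ^ (n * k)"
  using assms one_le_1_inner[of x] by (simp add: mult.assoc mult_left_mono power_increasing)
 moreover have "real n * (real k * (1 + x \<bullet> x) ^ k) > 0" using assms by (simp add: add_pos_nonneg)
 ultimately have "wt (n * k) x \<le> 1 / (real n * (real k * (1 + x \<bullet> x) ^ k))"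
  unfolding wt_def by (intro frac_le) auto
 then show ?thesis by (simp add: wt_def mult.commute)
qed

text \<open>Off the roots a whole interval around \<open>y\<close> would belong to the fibre,
  against uniqueness. Hence the value of a semialgebraic function is at each point a root of one of
  finitely many polynomials.\<close>

lemma graph_root:
 assumes L: "determined_by A L" and y: "(x, y) \<in> A" "\<And>t. (x, t) \<in> A \<Longrightarrow> t = y"
 shows "y \<in> root_set L x"
proof (rule ccontr)
 assume "y \<notin> root_set L x"
 then obtain d where d: "d > 0" "\<And>z. z \<in> root_set L x \<Longrightarrow> d \<le> dist z y"
  using finite_set_avoid[OF finite_root_set, of L x y] by (metis dist_commute)
 have "{y - d<..<y + d} \<inter> root_set L x = {}"
  using d(2) by (force simp: dist_real_def)
 then have "(x, y + d/2) \<in> A"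
  using determined_by_interval_iff[OF L, of "y - d" "y + d" x y "y + d/2"] y(1) d(1) by auto
 then show False using y(2) d(1) by force
qed

section \<open>Growth of polynomials, roots and functions of one variable\<close>

lemma poly_fun_real: "p \<in> (poly_fun :: (real \<Rightarrow> real) set) \<Longrightarrow> \<exists>P. p = poly P"
proof (induction rule: poly_fun.induct)
 case (const c)
 show ?case by (intro exI[of _ "[:c:]"]) auto
next
 case (coord b)
 then show ?case by (intro exI[of _ "[:0, 1:]"]) auto
next
 case (add p q)
 then obtain P Q where "p = poly P" "q = poly Q" by blast
 then show ?case by (intro exI[of _ "P + Q"]) auto
next
 case (mult p q)
 then obtain P Q where "p = poly P" "q = poly Q" by blast
 then show ?case by (intro exI[of _ "P * Q"]) auto
qed

lemma poly_upper_growth: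
 fixes P :: "real poly"
 shows "\<exists>k. \<forall>\<^sub>F r in at_top. \<bar>poly P r\<bar> \<le> r ^ k"
proof (induction P)
 case 0
 show ?case by (intro exI[of _ 0]) auto
next
 case (pCons a P)
 then obtain k where k: "\<forall>\<^sub>F r in at_top. \<bar>poly P r\<bar> \<le> r ^ k" by blast
 have "\<forall>\<^sub>F r in at_top. \<bar>poly (pCons a P) r\<bar> \<le> r ^ (k + 2)"
  using k eventually_ge_at_top[of "max 2 \<bar>a\<bar>"]
 proof eventually_elim
  case (elim r)
  have "r \<ge> 2" "r \<ge> \<bar>a\<bar>" using elim by auto
  have "r ^ 1 \<le> r ^ (k + 1)" using \<open>r \<ge> 2\<close> by (intro power_increasing) auto
  then have "\<bar>a\<bar> \<le> r ^ (k + 1)" using \<open>r \<ge> \<bar>a\<bar>\<close> by simp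
  have "\<bar>poly (pCons a P) r\<bar> \<le> \<bar>a\<bar> + r * \<bar>poly P r\<bar>"
   using \<open>r \<ge> 2\<close> abs_triangle_ineq[of a "r * poly P r"] by (simp add: abs_mult)
  also have "\<dots> \<le> r ^ (k + 1) + r * r ^ k"
   using \<open>\<bar>a\<bar> \<le> r ^ (k + 1)\<close> elim(1) \<open>r \<ge> 2\<close> by (intro add_mono mult_left_mono) auto
  also have "\<dots> = 2 * r ^ (k + 1)" by simp
  also have "\<dots> \<le> r * r ^ (k + 1)" using \<open>r \<ge> 2\<close> by (intro mult_right_mono) auto
  finally show ?case by simp
 qed
 then show ?case by blast
qed

lemma poly_lower_growth:
 fixes P :: "real poly"
 assumes "P \<noteq> 0" shows "\<exists>c>0. \<forall>\<^sub>F r in at_top. c \<le> \<bar>poly P r\<bar>"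
proof (cases "degree P = 0")
 case True
 then obtain a where "P = [:a:]" by (auto elim: degree_eq_zeroE)
 then show ?thesis using assms by (intro exI[of _ "\<bar>a\<bar>"]) auto
next
 case False
 then have "filterlim (poly P) at_infinity at_infinity" by (intro filterlim_poly_at_infinity) auto
 then have "filterlim (poly P) at_infinity at_top"
  by (rule filterlim_mono) (auto simp: at_top_le_at_infinity)
 then have "\<forall>\<^sub>F r in at_top. 1 \<le> norm (poly P r)"
  by (auto simp: filterlim_at_infinity[of 0, OF order_refl])
 then show ?thesis by (intro exI[of _ 1]) auto
qed

text \<open>Cauchy's bound: for \<open>\<bar>y\<bar> > 1\<close> and degree \<open>m\<close> the
  lower terms sum to at most \<open>m * M * \<bar>y\<bar> ^ (m - 1)\<close> and have to balance the
  leading one.\<close>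

lemma poly_root_bound:
 fixes P :: "real poly"
 assumes "P \<noteq> 0" "poly P y = 0" "degree P \<le> n" "c > 0" "c \<le> \<bar>lead_coeff P\<bar>"
  and M: "\<And>i. i \<le> n \<Longrightarrow> \<bar>coeff P i\<bar> \<le> M"
 shows "\<bar>y\<bar> \<le> 1 + real n * M / c"
proof (cases "\<bar>y\<bar> \<le> 1")
 case True
 have "M \<ge> 0" using M[of 0] by simp
 then show ?thesis using True assms(4) by (smt (verit) divide_nonneg_pos mult_nonneg_nonneg of_nat_0_le_iff)
next
 case False
 define m where "m = degree P"
 have "m \<noteq> 0"
 proof
  assume "m = 0"
  then obtain a where "P = [:a:]" unfolding m_def by (auto elim: degree_eq_zeroE)
  then show False using assms(1,2) by auto
 qed
 then obtain l where l: "m = Suc l" by (cases m) auto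
 have "0 = (\<Sum>i\<le>m. coeff P i * y ^ i)" using assms(2) by (simp add: poly_altdef m_def)
 also have "\<dots> = (\<Sum>i\<le>l. coeff P i * y ^ i) + coeff P m * y ^ m" by (simp add: l)
 finally have "\<bar>coeff P m * y ^ m\<bar> = \<bar>\<Sum>i\<le>l. coeff P i * y ^ i\<bar>" by linarith
 also have "\<dots> \<le> (\<Sum>i\<le>l. \<bar>coeff P i * y ^ i\<bar>)" by (rule sum_abs)
 also have "\<dots> \<le> (\<Sum>i\<le>l. M * \<bar>y\<bar> ^ l)"
 proof (rule sum_mono)
  fix i assume "i \<in> {..l}"
  then have "\<bar>y\<bar> ^ i \<le> \<bar>y\<bar> ^ l" using False by (intro power_increasing) auto
  moreover have "\<bar>coeff P i\<bar> \<le> M" using M[of i] \<open>i \<in> {..l}\<close> l assms(3) by (simp add: m_def)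
  ultimately show "\<bar>coeff P i * y ^ i\<bar> \<le> M * \<bar>y\<bar> ^ l"
   unfolding abs_mult power_abs by (intro mult_mono) auto
 qed
 also have "\<dots> = real m * M * \<bar>y\<bar> ^ l" by (simp add: l algebra_simps)
 finally have "\<bar>coeff P m\<bar> * \<bar>y\<bar> * \<bar>y\<bar> ^ l \<le> real m * M * \<bar>y\<bar> ^ l"
  by (simp add: l abs_mult power_abs mult_ac)
 then have "\<bar>coeff P m\<bar> * \<bar>y\<bar> \<le> real m * M" using False by (simp add: mult_le_cancel_right)
 moreover have "c * \<bar>y\<bar> \<le> \<bar>coeff P m\<bar> * \<bar>y\<bar>" using assms(5) by (simp add: m_def mult_right_mono)
 moreover have "real m * M \<le> real n * M"
  using assms(3) M[of 0] by (intro mult_right_mono) (auto simp: m_def)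
 ultimately have "\<bar>y\<bar> \<le> real n * M / c" using assms(4) by (simp add: field_simps)
 then show ?thesis by simp
qed

text \<open>Each coefficient is a polynomial in \<open>r\<close>, hence identically zero or
  eventually bounded away from 0, and it grows at most like a power. Cauchy's bound applies with
  whichever coefficient leads at \<open>r\<close>.\<close>

lemma pdeg_root_growth:
 assumes q: "q \<in> (pdeg n :: (real \<Rightarrow> real poly) set)"
 shows "\<exists>k. \<forall>\<^sub>F r in at_top. \<forall>y. q r \<noteq> 0 \<longrightarrow> poly (q r) y = 0 \<longrightarrow> \<bar>y\<bar> \<le> r ^ k"
proof -
 have "\<forall>i. \<exists>P. (\<lambda>x. coeff (q x) i) = poly P" using poly_fun_real[OF pdeg_coeff[OF q]] by blast
 then obtain P where P: "\<And>i x. coeff (q x) i = poly (P i) x" by metis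
 have "\<exists>k. \<forall>\<^sub>F r in at_top. \<forall>i\<le>m. \<bar>poly (P i) r\<bar> \<le> r ^ k" for m
 proof (induction m)
  case 0
  show ?case using poly_upper_growth[of "P 0"] by simp
 next
  case (Suc m)
  then obtain k where k: "\<forall>\<^sub>F r in at_top. \<forall>i\<le>m. \<bar>poly (P i) r\<bar> \<le> r ^ k" by blast
  obtain l where l: "\<forall>\<^sub>F r in at_top. \<bar>poly (P (Suc m)) r\<bar> \<le> r ^ l" using poly_upper_growth by blast
  have "\<forall>\<^sub>F r in at_top. \<forall>i\<le>Suc m. \<bar>poly (P i) r\<bar> \<le> r ^ (k + l)"
   using k l eventually_ge_at_top[of 1]
  proof eventually_elim
   case (elim r)
   have "r ^ k \<le> r ^ (k + l)" "r ^ l \<le> r ^ (k + l)" using elim(3) by (auto intro: power_increasing)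
   then show ?case using elim by (auto simp: le_Suc_eq intro: order_trans)
  qed
  then show ?case by blast
 qed
 then obtain k where k: "\<forall>\<^sub>F r in at_top. \<forall>i\<le>n. \<bar>poly (P i) r\<bar> \<le> r ^ k" by blast
 have "\<exists>c>0. \<forall>\<^sub>F r in at_top. \<forall>i\<le>m. poly (P i) r = 0 \<or> c \<le> \<bar>poly (P i) r\<bar>" for m
 proof (induction m)
  case 0
  show ?case using poly_lower_growth[of "P 0"] by (cases "P 0 = 0") (auto intro: exI[of _ 1] elim: eventually_mono)
 next
  case (Suc m)
  then obtain c where c: "c > 0" "\<forall>\<^sub>F r in at_top. \<forall>i\<le>m. poly (P i) r = 0 \<or> c \<le> \<bar>poly (P i) r\<bar>" by blast
  obtain d where d: "d > 0" "\<forall>\<^sub>F r in at_top. poly (P (Suc m)) r = 0 \<or> d \<le> \<bar>poly (P (Suc m)) r\<bar>"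
  proof (cases "P (Suc m) = 0")
   case True
   then show thesis using that[of 1] by simp
  next
   case False
   then obtain d where "d > 0" "\<forall>\<^sub>F r in at_top. d \<le> \<bar>poly (P (Suc m)) r\<bar>"
    using poly_lower_growth by blast
   then show thesis using that[of d] eventually_mono[of "\<lambda>r. d \<le> \<bar>poly (P (Suc m)) r\<bar>" at_top "\<lambda>r. poly (P (Suc m)) r = 0 \<or> d \<le> \<bar>poly (P (Suc m)) r\<bar>"] by blast
  qed
  have "\<forall>\<^sub>F r in at_top. \<forall>i\<le>Suc m. poly (P i) r = 0 \<or> min c d \<le> \<bar>poly (P i) r\<bar>"
   using c(2) d(2) by eventually_elim (auto simp: le_Suc_eq min_le_iff_disj)
  then show ?case using c(1) d(1) by (intro exI[of _ "min c d"]) auto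
 qed
 then obtain c where c: "c > 0" "\<forall>\<^sub>F r in at_top. \<forall>i\<le>n. poly (P i) r = 0 \<or> c \<le> \<bar>poly (P i) r\<bar>" by blast
 have "\<forall>\<^sub>F r in at_top. \<forall>y. q r \<noteq> 0 \<longrightarrow> poly (q r) y = 0 \<longrightarrow> \<bar>y\<bar> \<le> r ^ (k + 2)"
  using k c(2) eventually_ge_at_top[of "max 2 (1 + real n / c)"]
 proof eventually_elim
  case (elim r)
  have r: "r \<ge> 2" "r \<ge> 1 + real n / c" using elim(3) by auto
  show ?case
  proof (intro allI impI)
   fix y assume y: "q r \<noteq> 0" "poly (q r) y = 0"
   have "\<bar>y\<bar> \<le> 1 + real n * r ^ k / c"
   proof (rule poly_root_bound[OF y pdeg_degree[OF q] c(1)])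
    have "lead_coeff (q r) \<noteq> 0" using y(1) by simp
    then show "c \<le> \<bar>lead_coeff (q r)\<bar>" using elim(2) pdeg_degree[OF q, of r] P by metis
    show "\<bar>coeff (q r) i\<bar> \<le> r ^ k" if "i \<le> n" for i using elim(1) P that by simp
   qed
   also have "\<dots> \<le> r ^ k + (real n / c) * r ^ k" using r(1) by (auto intro: one_le_power)
   also have "\<dots> = (1 + real n / c) * r ^ k" by (simp add: algebra_simps)
   also have "\<dots> \<le> r * r ^ k" using r by (intro mult_right_mono) auto
   also have "\<dots> \<le> r ^ (k + 2)" using r power_increasing[of "k + 1" "k + 2" r] by simp
   finally show "\<bar>y\<bar> \<le> r ^ (k + 2)" .
  qed
 qed
 then show ?thesis by blast
qed

lemma sa_fun_real_growth:
 assumes "sa_fun (\<phi> :: real \<Rightarrow> real)"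
 obtains k where "\<forall>\<^sub>F r in at_top. \<bar>\<phi> r\<bar> \<le> r ^ k"
proof -
 obtain L where L: "set L \<subseteq> (\<Union>n. pdeg n)" "determined_by {z. snd z = \<phi> (fst z)} L"
  using semialgebraic_determined[OF assms[unfolded sa_fun_def]] by blast
 have "\<exists>k. \<forall>\<^sub>F r in at_top. \<forall>y\<in>root_set L r. \<bar>y\<bar> \<le> r ^ k" using L(1)
 proof (induction L)
  case Nil
  show ?case by (simp add: root_set_def)
 next
  case (Cons q L)
  then obtain k where k: "\<forall>\<^sub>F r in at_top. \<forall>y\<in>root_set L r. \<bar>y\<bar> \<le> r ^ k" by auto
  obtain n where "q \<in> pdeg n" using Cons.prems by auto
  then obtain l where l: "\<forall>\<^sub>F r in at_top. \<forall>y. q r \<noteq> 0 \<longrightarrow> poly (q r) y = 0 \<longrightarrow> \<bar>y\<bar> \<le> r ^ l"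
   using pdeg_root_growth by blast
  have "\<forall>\<^sub>F r in at_top. \<forall>y\<in>root_set (q # L) r. \<bar>y\<bar> \<le> r ^ (k + l)"
   using k l eventually_ge_at_top[of 1]
  proof eventually_elim
   case (elim r)
   have "r ^ k \<le> r ^ (k + l)" "r ^ l \<le> r ^ (k + l)" using elim(3) by (auto intro: power_increasing)
   moreover have "root_set (q # L) r = {y. q r \<noteq> 0 \<and> poly (q r) y = 0} \<union> root_set L r"
    by (auto simp: root_set_def)
   ultimately show ?case using elim(1,2) by (auto intro: order_trans)
  qed
  then show ?case by blast
 qed
 then obtain k where k: "\<forall>\<^sub>F r in at_top. \<forall>y\<in>root_set L r. \<bar>y\<bar> \<le> r ^ k" by blast
 have root: "\<phi> r \<in> root_set L r" for r by (rule graph_root[OF L(2)]) auto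
 from k have "\<forall>\<^sub>F r in at_top. \<bar>\<phi> r\<bar> \<le> r ^ k" by eventually_elim (use root in blast)
 then show thesis using that by blast
qed

theorem lojasiewicz:
 fixes S :: "'a::euclidean_space set" and \<epsilon> :: "'a \<Rightarrow> real"
 assumes S: "closed S" "semialgebraic S" and \<epsilon>: "sa_fun \<epsilon>"
  and loc: "\<And>x. x \<in> S \<Longrightarrow> \<exists>\<delta>>0. \<exists>c>0. \<forall>y\<in>S. dist y x < \<delta> \<longrightarrow> c \<le> \<epsilon> y"
 obtains k where "k \<ge> 1" "\<And>x. x \<in> S \<Longrightarrow> wt k x \<le> \<epsilon> x"
proof -
 have bnd: "\<exists>c>0. \<forall>x\<in>S. norm x \<le> r \<longrightarrow> c \<le> \<epsilon> x" for r
 proof -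
  let ?K = "S \<inter> cball 0 r"
  have "compact ?K" using S(1) by (simp add: closed_Int_compact)
  obtain \<delta> c where dc: "\<And>x. x \<in> S \<Longrightarrow> \<delta> x > 0 \<and> c x > 0 \<and> (\<forall>y\<in>S. dist y x < \<delta> x \<longrightarrow> c x \<le> \<epsilon> y)"
   using loc by metis
  have "?K \<subseteq> (\<Union>x\<in>?K. ball x (\<delta> x))" using dc by force
  then obtain F where F: "F \<subseteq> ?K" "finite F" "?K \<subseteq> (\<Union>x\<in>F. ball x (\<delta> x))"
   using compactE_image[OF \<open>compact ?K\<close>, of ?K "\<lambda>x. ball x (\<delta> x)"] by blast
  define c0 where "c0 = Min (insert 1 (c ` F))"
  have "c0 > 0" using F dc by (subst c0_def, subst Min_gr_iff) auto
  moreover have "c0 \<le> \<epsilon> y" if "y \<in> S" "norm y \<le> r" for y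
  proof -
   have "y \<in> ?K" using that by simp
   then obtain x where x: "x \<in> F" "dist y x < \<delta> x" using F(3) by (auto simp: dist_commute)
   then have "c x \<le> \<epsilon> y" using dc F(1) that by blast
   moreover have "c0 \<le> c x" unfolding c0_def using F(2) x(1) by (intro Min_le) auto
   ultimately show ?thesis by simp
  qed
  ultimately show ?thesis by blast
 qed
 \<comment> \<open>The element 1 keeps \<open>V r\<close> nonempty when no point of \<open>S\<close>
   has norm at most \<open>r\<close>.\<close>
 define V where "V r = insert 1 {inverse (\<epsilon> x) |x. x \<in> S \<and> norm x \<le> r}" for r :: real
 have bdd: "bdd_above (V r)" for r
 proof -
  obtain c where c: "c > 0" "\<forall>x\<in>S. norm x \<le> r \<longrightarrow> c \<le> \<epsilon> x" using bnd by blast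
  have "v \<le> max 1 (inverse c)" if "v \<in> V r" for v
   using that c by (auto simp: V_def le_max_iff_disj intro!: le_imp_inverse_le)
  then show ?thesis by (rule bdd_aboveI)
 qed
 define \<phi> where "\<phi> r = Sup (V r)" for r
 have "sa_fun \<phi>"
 proof (rule sa_funI[where R="\<lambda>r y. 1 \<le> y \<and> (\<forall>x\<in>S. norm x \<le> r \<longrightarrow> inverse (\<epsilon> x) \<le> y) \<and>
   (\<forall>t::real. t < y \<longrightarrow> t < 1 \<or> (\<exists>x\<in>S. norm x \<le> r \<and> t < inverse (\<epsilon> x)))"])
  show "semialgebraic {z. 1 \<le> snd z \<and> (\<forall>x\<in>S. norm x \<le> fst z \<longrightarrow> inverse (\<epsilon> x) \<le> snd z) \<and>
   (\<forall>t::real. t < snd z \<longrightarrow> t < 1 \<or> (\<exists>x\<in>S. norm x \<le> fst z \<and> t < inverse (\<epsilon> x)))}"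
   by (intro sa_intros S sa_fun_compose[OF \<epsilon>])
  fix r y :: real
  have "(1 \<le> y \<and> (\<forall>x\<in>S. norm x \<le> r \<longrightarrow> inverse (\<epsilon> x) \<le> y) \<and>
   (\<forall>t::real. t < y \<longrightarrow> t < 1 \<or> (\<exists>x\<in>S. norm x \<le> r \<and> t < inverse (\<epsilon> x))))
   \<longleftrightarrow> (\<forall>v\<in>V r. v \<le> y) \<and> (\<forall>t<y. \<exists>v\<in>V r. t < v)"
   by (auto simp: V_def)
  also have "\<dots> \<longleftrightarrow> y = \<phi> r"
  proof
   assume *: "(\<forall>v\<in>V r. v \<le> y) \<and> (\<forall>t<y. \<exists>v\<in>V r. t < v)"
   have ne: "V r \<noteq> {}" by (auto simp: V_def)
   have "\<phi> r \<le> y" unfolding \<phi>_def using * ne by (intro cSup_least) auto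
   moreover have "\<not> \<phi> r < y"
    using * less_cSup_iff[OF ne bdd] unfolding \<phi>_def by blast
   ultimately show "y = \<phi> r" by simp
  next
   assume "y = \<phi> r"
   moreover have "V r \<noteq> {}" by (auto simp: V_def)
   ultimately show "(\<forall>v\<in>V r. v \<le> y) \<and> (\<forall>t<y. \<exists>v\<in>V r. t < v)"
    using cSup_upper[OF _ bdd] less_cSup_iff[OF _ bdd] by (auto simp: \<phi>_def)
  qed
  finally show "(1 \<le> y \<and> (\<forall>x\<in>S. norm x \<le> r \<longrightarrow> inverse (\<epsilon> x) \<le> y) \<and>
   (\<forall>t::real. t < y \<longrightarrow> t < 1 \<or> (\<exists>x\<in>S. norm x \<le> r \<and> t < inverse (\<epsilon> x)))) = (y = \<phi> r)" .
 qed
 then obtain k where "\<forall>\<^sub>F r in at_top. \<bar>\<phi> r\<bar> \<le> r ^ k" using sa_fun_real_growth by blast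
 then obtain r0 where r0: "r0 \<ge> 1" "\<And>r. r \<ge> r0 \<Longrightarrow> \<phi> r \<le> r ^ k"
 proof -
  assume "\<forall>\<^sub>F r in at_top. \<bar>\<phi> r\<bar> \<le> r ^ k"
  then obtain N where "\<And>r. r \<ge> N \<Longrightarrow> \<bar>\<phi> r\<bar> \<le> r ^ k" by (auto simp: eventually_at_top_linorder)
  then show thesis using that[of "max 1 N"] by (auto simp: abs_le_iff)
 qed
 define K where "K = k + nat \<lceil>r0 ^ k\<rceil> + 1"
 have "wt K x \<le> \<epsilon> x" if x: "x \<in> S" for x
 proof -
  let ?n = "1 + x \<bullet> x"
  \<comment> \<open>At least \<open>norm x\<close> and at least \<open>r0\<close>, yet polynomial in
    \<open>x\<close>.\<close>
  define r where "r = r0 * ?n"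
  have n1: "1 \<le> ?n" by simp
  have "0 \<le> (norm x - 1)\<^sup>2" by simp
  then have "2 * norm x \<le> 1 + (norm x)\<^sup>2" by (simp add: power2_diff)
  then have "norm x \<le> ?n" using norm_ge_zero[of x] unfolding power2_norm_eq_inner by linarith
  then have r: "norm x \<le> r" "r0 \<le> r"
   using r0(1) n1 mult_mono[of 1 r0 "norm x" ?n] mult_left_mono[of 1 ?n r0] by (auto simp: r_def)
  have "inverse (\<epsilon> x) \<le> \<phi> r" unfolding \<phi>_def
   by (rule cSup_upper[OF _ bdd]) (use x r in \<open>auto simp: V_def\<close>)
  also have "\<dots> \<le> r ^ k" using r0(2) r(2) by simp
  also have "\<dots> = r0 ^ k * ?n ^ k" by (simp add: r_def power_mult_distrib)
  also have "\<dots> \<le> real K * ?n ^ K"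
  proof (intro mult_mono power_increasing)
   show "r0 ^ k \<le> real K" unfolding K_def using real_nat_ceiling_ge[of "r0 ^ k"] by simp
  qed (use n1 in \<open>auto simp: K_def\<close>)
  finally have *: "inverse (\<epsilon> x) \<le> real K * ?n ^ K" .
  obtain c where "c > 0" "c \<le> \<epsilon> x" using bnd[of "norm x"] x by blast
  then have "\<epsilon> x > 0" by simp
  have "wt K x = inverse (real K * ?n ^ K)" by (simp add: wt_def inverse_eq_divide)
  also have "\<dots> \<le> inverse (inverse (\<epsilon> x))" using * \<open>\<epsilon> x > 0\<close> by (intro le_imp_inverse_le) auto
  finally show ?thesis by simp
 qed
 then show thesis using that[of K] by (simp add: K_def)
qed

lemma lojasiewicz_continuous:
 fixes S :: "'a::euclidean_space set" and \<epsilon> :: "'a \<Rightarrow> real"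
 assumes S: "closed S" "semialgebraic S" and \<epsilon>: "sa_fun \<epsilon>" "continuous_on S \<epsilon>"
  and pos: "\<And>x. x \<in> S \<Longrightarrow> \<epsilon> x > 0"
 obtains k where "k \<ge> 1" "\<And>x. x \<in> S \<Longrightarrow> wt k x \<le> \<epsilon> x"
proof (rule lojasiewicz[OF S \<epsilon>(1)])
 fix x assume x: "x \<in> S"
 then have "\<epsilon> x / 2 > 0" using pos by simp
 then obtain d where d: "d > 0" "\<And>y. y \<in> S \<Longrightarrow> dist y x < d \<Longrightarrow> dist (\<epsilon> y) (\<epsilon> x) < \<epsilon> x / 2"
  using \<epsilon>(2) x unfolding continuous_on_iff by meson
 have "\<epsilon> x / 2 \<le> \<epsilon> y" if "y \<in> S" "dist y x < d" for y
  using d(2)[OF that] by (simp add: dist_real_def abs_if split: if_splits)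
 then show "\<exists>\<delta>>0. \<exists>c>0. \<forall>y\<in>S. dist y x < \<delta> \<longrightarrow> c \<le> \<epsilon> y"
  using d(1) \<open>\<epsilon> x / 2 > 0\<close> by blast
qed (use that in blast)

text \<open>The Lojasiewicz inequality is applied to \<open>1 / (1 + \<bar>f x\<bar>)\<close>, which
  is positive also where \<open>f\<close> vanishes.\<close>

lemma sa_fun_polynomial_bound:
 fixes S :: "'a::euclidean_space set" and f :: "'a \<Rightarrow> real"
 assumes S: "closed S" "semialgebraic S" and f: "sa_fun f" "continuous_on S f"
 obtains k where "k \<ge> 1" "\<And>x. x \<in> S \<Longrightarrow> \<bar>f x\<bar> * wt k x \<le> 1"
proof -
 have c: "continuous_on S (\<lambda>x. 1 / (1 + \<bar>f x\<bar>))"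
  using f(2) by (intro continuous_intros) (auto simp: add_nonneg_eq_0_iff)
 have s: "sa_fun (\<lambda>x. 1 / (1 + \<bar>f x\<bar>))" by (intro sa_intros f(1))
 obtain k where k: "k \<ge> 1" "\<And>x. x \<in> S \<Longrightarrow> wt k x \<le> 1 / (1 + \<bar>f x\<bar>)"
  by (rule lojasiewicz_continuous[OF S s c]) (auto simp: add_pos_nonneg)
 have "\<bar>f x\<bar> * wt k x \<le> 1" if "x \<in> S" for x
 proof -
  have "\<bar>f x\<bar> * wt k x \<le> \<bar>f x\<bar> * (1 / (1 + \<bar>f x\<bar>))" using k(2)[OF that] by (intro mult_left_mono) auto
  also have "\<dots> \<le> 1" by (simp add: divide_simps add_pos_nonneg)
  finally show ?thesis .
 qed
 then show thesis using that k(1) by blast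
qed

section \<open>Separation of semialgebraic sets\<close>

text \<open>A single polynomial does not in general separate semialgebraic sets; maxima and minima
  of polynomials do, and they can be smoothed explicitly.\<close>

inductive_set lat_poly :: "('a::euclidean_space \<Rightarrow> real) set" where
 poly: "p \<in> poly_fun \<Longrightarrow> p \<in> lat_poly"
| max: "p \<in> lat_poly \<Longrightarrow> q \<in> lat_poly \<Longrightarrow> (\<lambda>x. max (p x) (q x)) \<in> lat_poly"
| min: "p \<in> lat_poly \<Longrightarrow> q \<in> lat_poly \<Longrightarrow> (\<lambda>x. min (p x) (q x)) \<in> lat_poly"

lemma lat_poly_sa_fun: "p \<in> lat_poly \<Longrightarrow> sa_fun p"
 by (induction rule: lat_poly.induct) (auto intro: sa_fun_max sa_fun_min nash_on_sa_fun[OF nash_on_poly_fun])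

lemma lat_poly_continuous: "p \<in> lat_poly \<Longrightarrow> continuous_on UNIV p"
 by (induction rule: lat_poly.induct) (auto intro: continuous_on_max continuous_on_min nash_on_continuous_on[OF nash_on_poly_fun])

text \<open>\<open>E (x, \<eta>)\<close> is a smoothing of \<open>u\<close> at scale \<open>\<eta>\<close>. The Lipschitz bound in \<open>\<eta>\<close> allows the scale
 to be chosen as the solution of a fixed point equation.\<close>
definition smoothing :: "('a::euclidean_space \<Rightarrow> real) \<Rightarrow> ('a \<times> real \<Rightarrow> real) \<Rightarrow> real \<Rightarrow> bool" where
 "smoothing u E L \<longleftrightarrow> nash_on (UNIV \<times> {0<..}) E \<and> 0 \<le> L \<and>
  (\<forall>x \<eta>. \<eta> > 0 \<longrightarrow> \<bar>E (x, \<eta>) - u x\<bar> \<le> L * \<eta> \<and>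
    (\<exists>D. ((\<lambda>\<eta>. E (x, \<eta>)) has_real_derivative D) (at \<eta>) \<and> \<bar>D\<bar> \<le> L))"

lemma sqrt_smoothing_bound:
 fixes d \<eta> :: real assumes "\<eta> > 0"
 shows "\<bar>sqrt (d\<^sup>2 + \<eta>\<^sup>2) - \<bar>d\<bar>\<bar> \<le> \<eta>"
proof -
 have "sqrt (d\<^sup>2 + \<eta>\<^sup>2) \<le> \<bar>d\<bar> + \<eta>"
  using sqrt_add_le_add_sqrt[of "d\<^sup>2" "\<eta>\<^sup>2"] assms by simp
 moreover have "\<bar>d\<bar> \<le> sqrt (d\<^sup>2 + \<eta>\<^sup>2)" by (rule real_le_rsqrt) simp
 ultimately show ?thesis by simp
qed

lemma smoothing_combine_bound:
 fixes s e g u v a b \<eta> :: real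
 assumes "\<bar>s - \<bar>e - g\<bar>\<bar> \<le> \<eta>" "\<bar>e - u\<bar> \<le> a" "\<bar>g - v\<bar> \<le> b" "\<sigma> = 1 \<or> \<sigma> = -1"
 shows "\<bar>(e + g + \<sigma> * s) / 2 - (u + v + \<sigma> * \<bar>u - v\<bar>) / 2\<bar> \<le> a + b + \<eta>"
proof -
 define w where "w = \<bar>u - v\<bar>"
 have "\<bar>s - w\<bar> \<le> \<eta> + a + b" unfolding w_def using assms(1-3) by linarith
 then have sw: "s - w \<le> \<eta> + a + b" "w - s \<le> \<eta> + a + b" by auto
 have "0 \<le> \<eta>" using assms(1) by linarith
 have eg: "e - u \<le> a" "u - e \<le> a" "g - v \<le> b" "v - g \<le> b" using assms(2,3) by auto
 have up: "(a + b + (\<eta> + a + b)) / 2 \<le> a + b + \<eta>" using \<open>0 \<le> \<eta>\<close> by (simp add: field_simps)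
 have bd: "\<bar>(p + q + r) / 2\<bar> \<le> a + b + \<eta>"
  if "p \<le> a" "-p \<le> a" "q \<le> b" "-q \<le> b" "r \<le> \<eta> + a + b" "-r \<le> \<eta> + a + b" for p q r
 proof -
  have "p + q + r \<le> a + b + (\<eta> + a + b)" "-p + -q + -r \<le> a + b + (\<eta> + a + b)"
   by (intro add_mono that)+
  then have "\<bar>(p + q + r) / 2\<bar> \<le> (a + b + (\<eta> + a + b)) / 2" by (simp add: abs_le_iff)
  then show ?thesis using up by (rule order_trans)
 qed
 have eq: "(e + g + s) / 2 - (u + v + w) / 2 = ((e - u) + (g - v) + (s - w)) / 2"
  "(e + g - s) / 2 - (u + v - w) / 2 = ((e - u) + (g - v) + (w - s)) / 2"
  by (simp_all add: field_simps)
 have "\<bar>(e + g + s) / 2 - (u + v + w) / 2\<bar> \<le> a + b + \<eta>"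
  unfolding eq by (rule bd) (use sw eg in auto)
 moreover have "\<bar>(e + g - s) / 2 - (u + v - w) / 2\<bar> \<le> a + b + \<eta>"
  unfolding eq by (rule bd) (use sw eg in auto)
 ultimately show ?thesis unfolding w_def[symmetric] using assms(4) by auto
qed

text \<open>\<open>\<sigma> = 1\<close> gives the maximum and \<open>\<sigma> = -1\<close> the
  minimum, as \<open>(u + v \<plusminus> \<bar>u - v\<bar>) / 2\<close>. The absolute value of
  \<open>d\<close> becomes \<open>sqrt (d^2 + \<eta>^2)\<close>, which is off by at most \<eta> and
  has partial derivatives bounded by 1 in both arguments.\<close>

lemma smoothing_combine:
 fixes u v :: "'a::euclidean_space \<Rightarrow> real"
 assumes u: "smoothing u E L" and v: "smoothing v G M" and \<sigma>: "\<sigma> = 1 \<or> \<sigma> = -1"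
 shows "smoothing (\<lambda>x. (u x + v x + \<sigma> * \<bar>u x - v x\<bar>) / 2)
  (\<lambda>z. (E z + G z + \<sigma> * sqrt ((E z - G z)\<^sup>2 + (snd z)\<^sup>2)) / 2) (L + M + 1)"
 unfolding smoothing_def
proof (intro conjI allI impI)
 have nE: "nash_on (UNIV \<times> {0<..}) E" and nG: "nash_on (UNIV \<times> {0<..}) G" and L: "0 \<le> L" "0 \<le> M"
  using u v by (auto simp: smoothing_def)
 have op: "open (UNIV \<times> {0::real<..} :: ('a \<times> real) set)" by (intro open_Times) auto
 have "(E z - G z)\<^sup>2 + (snd z)\<^sup>2 > 0" if "z \<in> UNIV \<times> {0<..}" for z :: "'a \<times> real"
  using that by (auto intro: add_nonneg_pos)
 then show "nash_on (UNIV \<times> {0<..}) (\<lambda>z. (E z + G z + \<sigma> * sqrt ((E z - G z)\<^sup>2 + (snd z)\<^sup>2)) / 2)"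
  by (intro nash_intros nE nG op) auto
 show "0 \<le> L + M + 1" using L by simp
 fix x and \<eta> :: real assume \<eta>: "\<eta> > 0"
 have bE: "\<bar>E (x, \<eta>) - u x\<bar> \<le> L * \<eta>" and bG: "\<bar>G (x, \<eta>) - v x\<bar> \<le> M * \<eta>"
  using u v \<eta> by (auto simp: smoothing_def)
 have "\<bar>sqrt ((E (x, \<eta>) - G (x, \<eta>))\<^sup>2 + \<eta>\<^sup>2) - \<bar>E (x, \<eta>) - G (x, \<eta>)\<bar>\<bar> \<le> \<eta>"
  by (rule sqrt_smoothing_bound[OF \<eta>])
 then have "\<bar>(E (x, \<eta>) + G (x, \<eta>) + \<sigma> * sqrt ((E (x, \<eta>) - G (x, \<eta>))\<^sup>2 + \<eta>\<^sup>2)) / 2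
   - (u x + v x + \<sigma> * \<bar>u x - v x\<bar>) / 2\<bar> \<le> L * \<eta> + M * \<eta> + \<eta>"
  using bE bG \<sigma> by (intro smoothing_combine_bound)
 then show "\<bar>(E (x, \<eta>) + G (x, \<eta>) + \<sigma> * sqrt ((E (x, \<eta>) - G (x, \<eta>))\<^sup>2 + (snd (x, \<eta>))\<^sup>2)) / 2
   - (u x + v x + \<sigma> * \<bar>u x - v x\<bar>) / 2\<bar> \<le> (L + M + 1) * \<eta>"
  by (simp add: algebra_simps)
 obtain D D' where D: "((\<lambda>\<eta>. E (x, \<eta>)) has_real_derivative D) (at \<eta>)" "\<bar>D\<bar> \<le> L"
  "((\<lambda>\<eta>. G (x, \<eta>)) has_real_derivative D') (at \<eta>)" "\<bar>D'\<bar> \<le> M"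
  using u v \<eta> unfolding smoothing_def by metis
 define s where "s = sqrt ((E (x, \<eta>) - G (x, \<eta>))\<^sup>2 + \<eta>\<^sup>2)"
 have spos: "(E (x, \<eta>) - G (x, \<eta>))\<^sup>2 + \<eta>\<^sup>2 > 0" using \<eta> by (auto intro: add_nonneg_pos)
 then have s: "s > 0" "\<bar>E (x, \<eta>) - G (x, \<eta>)\<bar> \<le> s" "\<eta> \<le> s"
  using \<eta> by (auto simp: s_def intro: real_le_rsqrt)
 define Q where "Q = (D + D' + \<sigma> * (((E (x, \<eta>) - G (x, \<eta>)) * (D - D') + \<eta>) / s)) / 2"
 have "((\<lambda>\<eta>. (E (x, \<eta>) + G (x, \<eta>) + \<sigma> * sqrt ((E (x, \<eta>) - G (x, \<eta>))\<^sup>2 + (snd (x, \<eta>))\<^sup>2)) / 2)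
   has_real_derivative Q) (at \<eta>)"
 proof -
  have "((\<lambda>\<eta>. (E (x, \<eta>) - G (x, \<eta>))\<^sup>2 + \<eta>\<^sup>2) has_real_derivative
   2 * (E (x, \<eta>) - G (x, \<eta>)) * (D - D') + 2 * \<eta>) (at \<eta>)"
   by (rule derivative_eq_intros D(1) D(3) refl)+ simp
  from DERIV_chain2[OF DERIV_real_sqrt[OF spos] this]
  have "((\<lambda>\<eta>. sqrt ((E (x, \<eta>) - G (x, \<eta>))\<^sup>2 + \<eta>\<^sup>2)) has_real_derivative
   ((E (x, \<eta>) - G (x, \<eta>)) * (D - D') + \<eta>) / s) (at \<eta>)"
   by (rule DERIV_cong) (use s(1) in \<open>simp only: s_def[symmetric], simp add: field_simps\<close>)
  from DERIV_cmult[OF this, of \<sigma>]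
  have "((\<lambda>\<eta>. (E (x, \<eta>) + G (x, \<eta>) + \<sigma> * sqrt ((E (x, \<eta>) - G (x, \<eta>))\<^sup>2 + \<eta>\<^sup>2)) / 2)
   has_real_derivative Q) (at \<eta>)"
   unfolding Q_def by (intro DERIV_cdivide DERIV_add D(1) D(3))
  then show ?thesis by simp
 qed
 moreover have "\<bar>Q\<bar> \<le> L + M + 1"
 proof -
  have "\<bar>(E (x, \<eta>) - G (x, \<eta>)) * (D - D')\<bar> \<le> s * (L + M)"
   unfolding abs_mult using s D by (intro mult_mono) auto
  then have "\<bar>(E (x, \<eta>) - G (x, \<eta>)) * (D - D') + \<eta>\<bar> \<le> (L + M + 1) * s"
   using s \<eta> by (simp add: algebra_simps)
  then have "\<bar>((E (x, \<eta>) - G (x, \<eta>)) * (D - D') + \<eta>) / s\<bar> \<le> L + M + 1"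
   using s(1) by (simp add: abs_divide divide_le_eq)
  then have q: "\<bar>\<sigma> * (((E (x, \<eta>) - G (x, \<eta>)) * (D - D') + \<eta>) / s)\<bar> \<le> L + M + 1"
   using \<sigma> by (auto simp: abs_mult)
  have "\<bar>D + D' + \<sigma> * (((E (x, \<eta>) - G (x, \<eta>)) * (D - D') + \<eta>) / s)\<bar> \<le> (L + M) + (L + M + 1)"
   using D(2,4) by (intro order_trans[OF abs_triangle_ineq] add_mono q) auto
  then show ?thesis unfolding Q_def using L by simp
 qed
 ultimately show "\<exists>D. ((\<lambda>\<eta>. (E (x, \<eta>) + G (x, \<eta>) + \<sigma> * sqrt ((E (x, \<eta>) - G (x, \<eta>))\<^sup>2 + (snd (x, \<eta>))\<^sup>2)) / 2)
   has_real_derivative D) (at \<eta>) \<and> \<bar>D\<bar> \<le> L + M + 1" by blast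
qed

lemma lat_poly_smoothing: "u \<in> lat_poly \<Longrightarrow> \<exists>E L. smoothing u E L"
proof (induction rule: lat_poly.induct)
 case (poly p)
 have "smoothing p (\<lambda>z. p (fst z)) 0"
  unfolding smoothing_def
 proof (intro conjI allI impI)
  show "nash_on (UNIV \<times> {0::real<..}) (\<lambda>z. p (fst z))"
   by (rule nash_on_compose[OF nash_on_poly_fun[OF poly]]) (auto intro!: nash_on_fst nash_on_ident open_Times open_greaterThan)
 qed (auto intro!: exI[of _ 0])
 then show ?case by blast
next
 case (max p q)
 then obtain E L G M where "smoothing p E L" "smoothing q G M" by blast
 from smoothing_combine[OF this, of 1]
 have "smoothing (\<lambda>x. (p x + q x + \<bar>p x - q x\<bar>) / 2) (\<lambda>z. (E z + G z + sqrt ((E z - G z)\<^sup>2 + (snd z)\<^sup>2)) / 2) (L + M + 1)" by simp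
 moreover have "(\<lambda>x. (p x + q x + \<bar>p x - q x\<bar>) / 2) = (\<lambda>x. max (p x) (q x))" by (auto simp: max_def abs_if)
 ultimately show ?case by auto
next
 case (min p q)
 then obtain E L G M where "smoothing p E L" "smoothing q G M" by blast
 from smoothing_combine[OF this, of "-1"]
 have "smoothing (\<lambda>x. (p x + q x - \<bar>p x - q x\<bar>) / 2) (\<lambda>z. (E z + G z - sqrt ((E z - G z)\<^sup>2 + (snd z)\<^sup>2)) / 2) (L + M + 1)" by simp
 moreover have "(\<lambda>x. (p x + q x - \<bar>p x - q x\<bar>) / 2) = (\<lambda>x. min (p x) (q x))" by (auto simp: min_def abs_if)
 ultimately show ?case by auto
qed

section \<open>Separation by lattice polynomials\<close>

inductive dnf :: "'a::euclidean_space set \<Rightarrow> bool" where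
 basic: "g \<in> poly_fun \<Longrightarrow> finite F \<Longrightarrow> F \<subseteq> poly_fun \<Longrightarrow> dnf {x. g x = 0 \<and> (\<forall>f\<in>F. f x > 0)}"
| un: "dnf A \<Longrightarrow> dnf B \<Longrightarrow> dnf (A \<union> B)"

text \<open>Two equations merge into one as a sum of squares; this is why a basic set carries a
  single equation.\<close>

lemma dnf_Int: assumes "dnf A" "dnf B" shows "dnf (A \<inter> B)"
proof -
 have *: "dnf ({x. g x = 0 \<and> (\<forall>f\<in>F. f x > 0)} \<inter> B)"
  if g: "g \<in> poly_fun" "finite F" "F \<subseteq> poly_fun" and B: "dnf B" for g F B
  using B
 proof induction
  case (basic h G)
  have "{x. g x = 0 \<and> (\<forall>f\<in>F. f x > 0)} \<inter> {x. h x = 0 \<and> (\<forall>f\<in>G. f x > 0)} =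
   {x. g x * g x + h x * h x = 0 \<and> (\<forall>f\<in>F \<union> G. f x > 0)}"
   by (auto simp: sum_squares_eq_zero_iff)
  also have "dnf \<dots>" using g basic by (intro dnf.basic poly_fun.add poly_fun.mult) auto
  finally show ?case .
 next
  case (un A B)
  then show ?case by (simp add: Int_Un_distrib dnf.un)
 qed
 show ?thesis using assms(1)
 proof induction
  case (basic g F)
  then show ?case using * assms(2) by blast
 next
  case (un A A')
  then show ?case by (simp add: Int_Un_distrib2 dnf.un)
 qed
qed

lemma dnf_pos: "p \<in> poly_fun \<Longrightarrow> dnf {x. p x > 0}"
 using dnf.basic[OF poly_fun.const[of 0], of "{p}"] by simp

lemma dnf_zero: "p \<in> poly_fun \<Longrightarrow> dnf {x. p x = 0}"
 using dnf.basic[of p "{}"] by simp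

lemma semialgebraic_dnf: "semialgebraic A \<Longrightarrow> dnf A \<and> dnf (- A)"
proof (induction rule: semialgebraic.induct)
 case (pos p)
 have "- {x. p x > 0} = {x. p x = 0} \<union> {x. - p x > 0}" by auto
 then show ?case using pos dnf_pos[OF poly_fun_uminus[OF pos]]
  by (simp only:) (intro conjI dnf_pos dnf.un dnf_zero poly_fun_uminus)
next
 case (zero p)
 have "- {x. p x = 0} = {x. p x > 0} \<union> {x. - p x > 0}" by auto
 then show ?case using zero dnf_pos[OF poly_fun_uminus[OF zero]]
  by (simp only:) (intro conjI dnf_pos dnf.un dnf_zero poly_fun_uminus)
next
 case (union A B)
 then show ?case by (simp add: dnf.un dnf_Int)
qed auto

lemma lat_poly_finite_min:
 assumes "w \<in> lat_poly"
 shows "finite F \<Longrightarrow> F \<subseteq> poly_fun \<Longrightarrow> \<exists>m\<in>lat_poly. \<forall>x. m x > 0 \<longleftrightarrow> w x > 0 \<and> (\<forall>h\<in>F. h x > 0)"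
proof (induction F rule: finite_induct)
 case empty
 then show ?case using assms by auto
next
 case (insert h F)
 then obtain m where m: "m \<in> lat_poly" "\<forall>x. m x > 0 \<longleftrightarrow> w x > 0 \<and> (\<forall>h\<in>F. h x > 0)" by auto
 have "h \<in> lat_poly" using insert.prems by (auto intro: lat_poly.poly)
 then show ?case using m by (intro bexI[OF _ lat_poly.min[of h m]]) auto
qed

lemma poly_fun_prod:
 "finite F \<Longrightarrow> F \<subseteq> poly_fun \<Longrightarrow> (\<lambda>x. \<Prod>h\<in>F. h x) \<in> poly_fun"
 by (induction F rule: finite_induct) (auto intro: poly_fun.const poly_fun.mult)

lemma semialgebraic_finite_ball:
 assumes "finite F" "\<And>h. h \<in> F \<Longrightarrow> semialgebraic {x. P h x}"
 shows "semialgebraic {x. \<forall>h\<in>F. P h x}"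
proof -
 have "{x. \<forall>h\<in>F. P h x} = - (\<Union>h\<in>F. - {x. P h x})" by auto
 then show ?thesis using assms by (simp only:) (intro semialgebraic.compl semialgebraic_UN)
qed

lemma poly_fun_continuous: "p \<in> poly_fun \<Longrightarrow> continuous_on S p"
 using nash_on_continuous_on[OF nash_on_poly_fun] continuous_on_subset by blast

lemma poly_fun_sa_fun: "p \<in> poly_fun \<Longrightarrow> sa_fun p"
 by (rule nash_on_sa_fun[OF nash_on_poly_fun])

text \<open>Where all \<open>f \<in> F\<close> are positive on \<open>B\<close>, the function \<open>g\<close> has no zero, and the Lojasiewicz inequality on
 the closed set \<open>{(x, t). t * (\<Prod>f\<in>F. f x) = 1}\<close> bounds it below by a power of the product.\<close>
lemma separate_basic:
 fixes B :: "'a::euclidean_space set"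
 assumes g: "g \<in> poly_fun" "finite F" "F \<subseteq> poly_fun" and B: "closed B" "semialgebraic B"
  and disj: "{x. g x = 0 \<and> (\<forall>f\<in>F. f x > 0)} \<inter> B = {}"
 obtains u where "u \<in> lat_poly" "\<And>x. g x = 0 \<Longrightarrow> (\<forall>f\<in>F. f x > 0) \<Longrightarrow> u x > 0" "\<And>x. x \<in> B \<Longrightarrow> u x \<le> 0"
proof -
 define f where "f x = (\<Prod>h\<in>F. h x)" for x
 have f: "f \<in> poly_fun" unfolding f_def[abs_def] using poly_fun_prod g by blast
 define K where "K = {z :: 'a \<times> real. fst z \<in> B \<and> (\<forall>h\<in>F. 0 \<le> h (fst z)) \<and> snd z * f (fst z) = 1}"
 have cont: "continuous_on UNIV (\<lambda>z::'a \<times> real. p (fst z))" if "p \<in> poly_fun" for p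
  by (rule continuous_on_compose2[OF poly_fun_continuous[OF that]]) (auto intro: continuous_intros)
 have "closed K"
 proof -
  have "closed {z :: 'a \<times> real. fst z \<in> B}"
   using closed_vimage[OF B(1), of "fst :: 'a \<times> real \<Rightarrow> 'a"] by (simp add: vimage_def continuous_on_fst)
  moreover have "closed {z :: 'a \<times> real. \<forall>h\<in>F. 0 \<le> h (fst z)}"
  proof -
   have "{z :: 'a \<times> real. \<forall>h\<in>F. 0 \<le> h (fst z)} = (\<Inter>h\<in>F. {z. 0 \<le> h (fst z)})" by auto
   then show ?thesis using g(3)
    by (simp only:) (intro closed_INT ballI closed_Collect_le cont continuous_on_const, auto)
  qed
  moreover have "closed {z :: 'a \<times> real. snd z * f (fst z) = 1}"
   by (intro closed_Collect_eq continuous_on_mult cont[OF f] continuous_on_snd continuous_on_id continuous_on_const)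
  ultimately show ?thesis unfolding K_def by (intro closed_Collect_conj)
 qed
 moreover have "semialgebraic K" unfolding K_def
 proof (intro semialgebraic_conj semialgebraic_finite_ball[OF g(2)] semialgebraic_mem[OF _ B(2)])
  show "semialgebraic {z::'a \<times> real. 0 \<le> h (fst z)}" if "h \<in> F" for h
   by (rule semialgebraic_le[OF sa_fun_const sa_fun_compose[OF poly_fun_sa_fun[OF subsetD[OF g(3) that]] sa_fun_fst[OF sa_fun_id]]])
  show "semialgebraic {z::'a \<times> real. snd z * f (fst z) = 1}"
   by (intro semialgebraic_eq sa_intros sa_fun_compose[OF poly_fun_sa_fun[OF f]])
 qed (intro sa_intros)
 moreover have "sa_fun (\<lambda>z::'a \<times> real. g (fst z) * g (fst z))"
  by (intro sa_intros sa_fun_compose[OF poly_fun_sa_fun[OF g(1)]])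
 moreover have "continuous_on K (\<lambda>z. g (fst z) * g (fst z))"
  by (intro continuous_on_mult continuous_on_subset[OF cont[OF g(1)]]) auto
 moreover have "g (fst z) * g (fst z) > 0" if "z \<in> K" for z
 proof -
  have "f (fst z) \<noteq> 0" using that by (auto simp: K_def)
  then have "h (fst z) \<noteq> 0" if "h \<in> F" for h using g(2) that by (auto simp: f_def)
  then have "\<forall>h\<in>F. h (fst z) > 0" using \<open>z \<in> K\<close> by (fastforce simp: K_def)
  then have "g (fst z) \<noteq> 0" using disj \<open>z \<in> K\<close> by (auto simp: K_def)
  then show ?thesis using zero_less_power2[of "g (fst z)"] by (simp add: power2_eq_square)
 qed
 ultimately have "\<exists>k\<ge>1. \<forall>z\<in>K. wt k z \<le> g (fst z) * g (fst z)"
  by (rule lojasiewicz_continuous) auto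
 then obtain k where k: "k \<ge> 1" "\<And>z. z \<in> K \<Longrightarrow> wt k z \<le> g (fst z) * g (fst z)" by blast
 \<comment> \<open>The Lojasiewicz bound at \<open>t = 1 / f x\<close>, multiplied by
   \<open>f x ^ (2 * k)\<close>, becomes a polynomial inequality. At the points of \<open>B\<close>
   where all of \<open>F\<close> is positive it says \<open>w x \<le> 0\<close>, while at the zeros
   of \<open>g\<close> only the term \<open>f x ^ (2 * k)\<close> remains.\<close>
 define w where "w x = f x ^ (2 * k) - g x * g x * (real k * (f x ^ 2 * (1 + x \<bullet> x) + 1) ^ k)" for x
 have ii: "(\<lambda>x::'a. x \<bullet> x) \<in> poly_fun"
 proof -
  have "(\<lambda>x::'a. \<Sum>b\<in>Basis. (x \<bullet> b) * (x \<bullet> b)) \<in> poly_fun"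
   by (intro poly_fun_sum poly_fun.intros) auto
  then show ?thesis by (simp flip: euclidean_inner)
 qed
 have w: "w \<in> poly_fun" unfolding w_def[abs_def]
  by (intro poly_fun_diff poly_fun.add poly_fun.mult poly_fun_power poly_fun.const f g(1) ii)
 obtain u where u: "u \<in> lat_poly" "\<And>x. u x > 0 \<longleftrightarrow> w x > 0 \<and> (\<forall>h\<in>F. h x > 0)"
  using lat_poly_finite_min[OF lat_poly.poly[OF w] g(2,3)] by blast
 have "u x > 0" if "g x = 0" "\<forall>h\<in>F. h x > 0" for x
 proof -
  have "f x > 0" unfolding f_def using that(2) by (simp add: prod_pos)
  then show ?thesis using u(2) that by (simp add: w_def)
 qed
 moreover have "u x \<le> 0" if xB: "x \<in> B" for x
 proof (rule ccontr)
  assume "\<not> u x \<le> 0"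
  then have wx: "w x > 0" and hx: "\<forall>h\<in>F. h x > 0" using u(2)[of x] by auto
  have fx: "f x > 0" unfolding f_def using hx by (simp add: prod_pos)
  define t where "t = inverse (f x)"
  have "(x, t) \<in> K" using xB hx fx by (auto simp: K_def t_def less_imp_le)
  then have "wt k (x, t) \<le> g x * g x" using k(2) by fastforce
  moreover have "wt k (x, t) = 1 / (real k * (1 + x \<bullet> x + t * t) ^ k)"
   by (simp add: wt_def inner_prod_def add.assoc)
  moreover have "real k * (1 + x \<bullet> x + t * t) ^ k > 0"
   using k(1) by (simp add: add_pos_nonneg)
  ultimately have "1 \<le> g x * g x * (real k * (1 + x \<bullet> x + t * t) ^ k)"
   by (simp add: divide_le_eq)
  then have "f x ^ (2 * k) * 1 \<le> f x ^ (2 * k) * (g x * g x * (real k * (1 + x \<bullet> x + t * t) ^ k))"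
   using fx by (intro mult_left_mono) auto
  also have "\<dots> = g x * g x * (real k * (f x ^ 2 * (1 + x \<bullet> x + t * t)) ^ k)"
   unfolding power_mult by (simp only: power_mult_distrib mult_ac)
  also have "f x ^ 2 * (1 + x \<bullet> x + t * t) = f x ^ 2 * (1 + x \<bullet> x) + 1"
   using fx by (simp add: t_def power2_eq_square field_simps)
  finally show False using wx by (simp add: w_def)
 qed
 ultimately show thesis using that u(1) by blast
qed

text \<open>Basic pieces of \<open>A\<close> are separated one by one, and the maximum handles their
  union. As \<open>A\<close> is any semialgebraic set, a closed set can be separated from its own
  complement, as \<open>nash_minorant\<close> requires.\<close>

theorem separate_lat_poly:
 fixes A B :: "'a::euclidean_space set"
 assumes "semialgebraic A" and B: "closed B" "semialgebraic B" and disj: "A \<inter> B = {}"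
 obtains u where "u \<in> lat_poly" "\<And>x. x \<in> A \<Longrightarrow> u x > 0" "\<And>x. x \<in> B \<Longrightarrow> u x \<le> 0"
proof -
 have "dnf A" using semialgebraic_dnf[OF assms(1)] by blast
 then have "\<exists>u\<in>lat_poly. (\<forall>x\<in>A. u x > 0) \<and> (\<forall>x\<in>B. u x \<le> 0)" using disj
 proof induction
  case (basic g F)
  show ?case
   by (rule separate_basic[OF basic(1-3) B basic.prems]) blast
 next
  case (un A A')
  then obtain u u' where u: "u \<in> lat_poly" "\<forall>x\<in>A. u x > 0" "\<forall>x\<in>B. u x \<le> 0"
   "u' \<in> lat_poly" "\<forall>x\<in>A'. u' x > 0" "\<forall>x\<in>B. u' x \<le> 0" by blast
  have "(\<forall>x\<in>A \<union> A'. max (u x) (u' x) > 0) \<and> (\<forall>x\<in>B. max (u x) (u' x) \<le> 0)"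
   using u by (auto simp: less_max_iff_disj)
  then show ?case by (rule bexI[OF _ lat_poly.max[OF u(1,4)]])
 qed
 then show thesis using that by blast
qed

text \<open>For \<open>v\<close> at least \<open>wt j / 4\<close> on \<open>A\<close> and at most
  \<open>- wt j / 4\<close> on \<open>B\<close>, the function
  \<open>(1 + v / sqrt (v^2 + wt l)) / 2\<close> is close to 1 on \<open>A\<close> and to 0 on
  \<open>B\<close> once \<open>wt l\<close> is small against \<open>v^2\<close>.\<close>

theorem nash_step:
 fixes A B :: "'a::euclidean_space set"
 assumes A: "closed A" "semialgebraic A" and B: "closed B" "semialgebraic B" and disj: "A \<inter> B = {}"
  and k: "k \<ge> 1"
 obtains \<psi> where "nash_on UNIV \<psi>" "\<And>x. 0 \<le> \<psi> x" "\<And>x. \<psi> x \<le> 1"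
  "\<And>x. x \<in> A \<Longrightarrow> 1 - \<psi> x \<le> wt k x" "\<And>x. x \<in> B \<Longrightarrow> \<psi> x \<le> wt k x"
proof -
 obtain u where u: "u \<in> lat_poly" "\<And>x. x \<in> A \<Longrightarrow> u x > 0" "\<And>x. x \<in> B \<Longrightarrow> u x \<le> 0"
  using separate_lat_poly[OF A(2) B disj] by blast
 obtain E L where E: "smoothing u E L" using lat_poly_smoothing[OF u(1)] by blast
 then have L: "L \<ge> 0" by (simp add: smoothing_def)
 obtain j where j: "j \<ge> 1" "\<And>x. x \<in> A \<Longrightarrow> wt j x \<le> u x"
  by (rule lojasiewicz_continuous[OF A lat_poly_sa_fun[OF u(1)] continuous_on_subset[OF lat_poly_continuous[OF u(1)]]])
   (use u(2) in auto)
 \<comment> \<open>Smoothing at scale \<open>wt (n * j)\<close> then costs at most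
   \<open>L * wt j / n\<close>, which is below \<open>wt j / 4\<close>.\<close>
 define n where "n = nat \<lceil>4 * L\<rceil> + 1"
 define i where "i = n * j"
 have i: "i \<ge> 1" using j(1) by (simp add: i_def n_def)
 have Li: "L * wt i x \<le> wt j x / 4" for x :: 'a
 proof -
  have "4 * L \<le> real n" unfolding n_def using real_nat_ceiling_ge[of "4 * L"] by simp
  have "L * wt i x \<le> L * (wt j x / n)"
   unfolding i_def using wt_scale[of n j x] L j(1) by (intro mult_left_mono) (auto simp: n_def)
  also have "\<dots> = (L / n) * wt j x" by simp
  also have "\<dots> \<le> (1/4) * wt j x"
   using \<open>4 * L \<le> real n\<close> wt_pos[OF j(1), of x] by (intro mult_right_mono) (auto simp: divide_le_eq n_def)
  finally show ?thesis by simp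
 qed
 \<comment> \<open>\<open>u\<close> is at least \<open>wt j\<close> on \<open>A\<close> and at most
   0 on \<open>B\<close>; subtracting \<open>wt j / 2\<close> makes the two cases symmetric and
   leaves room for the smoothing error.\<close>
 define v where "v x = E (x, wt i x) - wt j x / 2" for x
 have nE: "nash_on (UNIV \<times> {0<..}) E" using E by (simp add: smoothing_def)
 have v: "nash_on UNIV v"
  unfolding v_def[abs_def]
  by (intro nash_intros nash_on_compose[OF nE] nash_on_wt i j(1) open_UNIV) (use wt_pos[OF i] in auto)
 have Eu: "\<bar>E (x, wt i x) - u x\<bar> \<le> wt j x / 4" for x
  using E wt_pos[OF i, of x] Li[of x] unfolding smoothing_def by (meson order_trans)
 have vA: "v x \<ge> wt j x / 4" if "x \<in> A" for x
  using Eu[of x] j(2)[OF that] unfolding v_def by linarith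
 have vB: "v x \<le> - wt j x / 4" if "x \<in> B" for x
  using Eu[of x] u(3)[OF that] unfolding v_def by linarith
 \<comment> \<open>The indices lead to \<open>wt l \<le> wt j * wt j * wt k / 4\<close>: small
   against the square of \<open>v\<close>, with the factor \<open>wt k\<close> to spare.\<close>
 define m1 where "m1 = j * j + j + j"
 define m2 where "m2 = m1 * k + m1 + k"
 define l where "l = 4 * m2"
 have m: "m1 \<ge> 1" "m2 \<ge> 1" "l \<ge> 1" using j(1) k by (auto simp: m1_def m2_def l_def)
 have wl: "wt l x \<le> wt j x * wt j x * wt k x / 4" for x :: 'a
 proof -
  have "wt l x \<le> wt m2 x / 4" using wt_scale[of 4 m2 x] m by (simp add: l_def)
  moreover have "wt m2 x \<le> wt m1 x * wt k x" unfolding m2_def by (rule wt_mult[OF m(1) k])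
  moreover have "wt m1 x * wt k x \<le> (wt j x * wt j x) * wt k x"
   unfolding m1_def using wt_mult[OF j(1) j(1), of x] wt_pos[OF k, of x] by (intro mult_right_mono) auto
  ultimately show ?thesis by simp
 qed
 define s where "s x = sqrt (v x ^ 2 + wt l x)" for x
 have sp: "v x ^ 2 + wt l x > 0" for x using wt_pos[OF m(3), of x] by (intro add_nonneg_pos) auto
 then have s: "s x > 0" "s x ^ 2 = v x ^ 2 + wt l x" "\<bar>v x\<bar> \<le> s x" for x
  using wt_pos[OF m(3), of x] by (auto simp: s_def less_imp_le intro: real_le_rsqrt)
 define \<psi> where "\<psi> x = (1 + v x / s x) / 2" for x
 \<comment> \<open>Here \<open>w\<close> stands for \<open>\<bar>v x\<bar>\<close>, so that
   \<open>(s x - w) * (s x + w) = wt l x\<close>.\<close>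
 have bound: "1 - w / s x \<le> 2 * wt k x" if "w \<ge> wt j x / 4" "w ^ 2 = v x ^ 2" for w x
 proof -
  have wp: "w > 0" using that(1) wt_pos[OF j(1), of x] by linarith
  have "\<bar>v x\<bar> = w" using that(2) wp by (metis abs_of_pos power2_eq_iff_nonneg abs_ge_zero less_imp_le power2_abs)
  then have ws: "w \<le> s x" using s(3)[of x] by simp
  have "(wt j x / 4) * (wt j x / 4) \<le> w * w"
   using that(1) wt_pos[OF j(1), of x] by (intro mult_mono) auto
  also have "w * w \<le> w * s x" using ws wp by (intro mult_left_mono) auto
  finally have q: "wt j x * wt j x / 16 \<le> w * s x" by simp
  have "(s x - w) * (s x + w) = wt l x"
   using s(2)[of x] that(2) by (simp add: power2_eq_square algebra_simps)
  moreover have "(s x - w) * (2 * w) \<le> (s x - w) * (s x + w)"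
   using ws by (intro mult_left_mono) auto
  ultimately have "(s x - w) * (2 * w) \<le> wt j x * wt j x * wt k x / 4" using wl[of x] by linarith
  also have "\<dots> \<le> 4 * wt k x * (w * s x)"
   using mult_left_mono[OF q, of "4 * wt k x"] wt_pos[OF k, of x] by (simp add: mult_ac)
  finally have "(s x - w) * (2 * w) \<le> (2 * wt k x * s x) * (2 * w)" by (simp add: mult_ac)
  then have "s x - w \<le> 2 * wt k x * s x" using wp by (metis mult_le_cancel_right_pos mult_pos_pos zero_less_numeral)
  then show ?thesis using s(1)[of x] by (simp add: field_simps)
 qed
 have "nash_on UNIV \<psi>"
  unfolding \<psi>_def[abs_def] s_def[abs_def]
  by (intro nash_intros v nash_on_wt m(3) open_UNIV) (use sp in \<open>auto simp: less_imp_neq[symmetric]\<close>)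
 moreover have "0 \<le> \<psi> x" "\<psi> x \<le> 1" for x
  using s(1,3)[of x] by (auto simp: \<psi>_def field_simps abs_le_iff)
 moreover have "1 - \<psi> x \<le> wt k x" if "x \<in> A" for x
  using bound[OF vA[OF that]] by (simp add: \<psi>_def field_simps)
 moreover have "\<psi> x \<le> wt k x" if "x \<in> B" for x
  using bound[of x "- v x"] vB[OF that] by (simp add: \<psi>_def field_simps)
 ultimately show thesis using that by blast
qed

text \<open>No weight minorizes \<open>u\<close> off \<open>K\<close> in general, since
  \<open>u\<close> decays towards \<open>K\<close>; the smoothing scale must itself be of the size
  of \<open>u\<close>. It is found as the fixed point
  \<open>\<nu> x = \<kappa> * E (x, \<nu> x)\<close>, and that scale already is the desired
  minorant.\<close>

theorem nash_minorant:
 fixes K :: "'a::euclidean_space set"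
 assumes K: "closed K" "semialgebraic K"
 obtains \<nu> w where "nash_on (- K) \<nu>" "\<And>x. x \<notin> K \<Longrightarrow> \<nu> x > 0"
  "continuous_on UNIV w" "\<And>x. x \<in> K \<Longrightarrow> w x \<le> (0::real)" "\<And>x. x \<notin> K \<Longrightarrow> \<nu> x \<le> w x"
proof -
 have sK: "semialgebraic (- K)" and oK: "open (- K)" using K semialgebraic.compl by auto
 obtain u where u: "u \<in> lat_poly" "\<And>x. x \<in> - K \<Longrightarrow> u x > 0" "\<And>x. x \<in> K \<Longrightarrow> u x \<le> 0"
  using separate_lat_poly[OF sK K] by auto
 obtain E L where E: "smoothing u E L" using lat_poly_smoothing[OF u(1)] by blast
 then have L: "L \<ge> 0" and nE: "nash_on (UNIV \<times> {0<..}) E" by (auto simp: smoothing_def)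
 \<comment> \<open>\<open>\<kappa> * E\<close> becomes a contraction in the scale, with constant at
   most 1/2. So \<open>F\<close> increases in the scale, and its zero is comparable to
   \<open>\<kappa> * u x\<close>.\<close>
 define \<kappa> where "\<kappa> = 1 / (2 * (L + 1))"
 have \<kappa>: "\<kappa> > 0" "\<kappa> * L \<le> 1/2" using L by (auto simp: \<kappa>_def field_simps)
 obtain D where D: "\<And>x \<eta>. \<eta> > 0 \<Longrightarrow> ((\<lambda>\<eta>. E (x, \<eta>)) has_real_derivative D x \<eta>) (at \<eta>) \<and> \<bar>D x \<eta>\<bar> \<le> L"
  using E unfolding smoothing_def by metis
 define F where "F z = snd z - \<kappa> * E z" for z
 define T where "T = (- K) \<times> {0::real<..}"
 have T: "open T" "semialgebraic T"
 proof -
  show "open T" unfolding T_def using oK by (intro open_Times) auto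
  have "T = {z. fst z \<in> - K \<and> 0 < snd z}" by (auto simp: T_def)
  then show "semialgebraic T"
   by (simp only:) (intro semialgebraic_conj semialgebraic_less semialgebraic_mem sa_intros sK)
 qed
 have F: "nash_on T F" unfolding F_def[abs_def]
  by (intro nash_intros T nash_on_subset[OF nE]) (auto simp: T_def T[unfolded T_def])
 have dF: "((\<lambda>t. F (x, t)) has_real_derivative 1 - \<kappa> * D x t) (at t)" if "(x, t) \<in> T" for x t
  unfolding F_def using D[of t x] that by (auto intro!: derivative_eq_intros simp: T_def)
 have pF: "1 - \<kappa> * D x t > 0" if "(x, t) \<in> T" for x t
 proof -
  have "\<kappa> * D x t \<le> \<kappa> * L" using D[of t x] that \<kappa>(1) by (intro mult_left_mono) (auto simp: T_def)
  then show ?thesis using \<kappa>(2) by linarith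
 qed
 have EL: "\<bar>\<kappa> * E (x, t) - \<kappa> * u x\<bar> \<le> t / 2" if "t > 0" for x t
 proof -
  have "\<bar>\<kappa> * E (x, t) - \<kappa> * u x\<bar> = \<kappa> * \<bar>E (x, t) - u x\<bar>"
   using \<kappa>(1) by (simp add: abs_mult flip: right_diff_distrib)
  also have "\<dots> \<le> \<kappa> * (L * t)" using E that \<kappa>(1) by (intro mult_left_mono) (auto simp: smoothing_def)
  also have "\<dots> \<le> 1/2 * t" using mult_right_mono[OF \<kappa>(2), of t] that by (simp add: mult.assoc)
  finally show ?thesis by simp
 qed
 have sg: "\<exists>s t. (x, s) \<in> T \<and> (x, t) \<in> T \<and> F (x, s) < 0 \<and> F (x, t) > 0" if "x \<in> - K" for x
 proof (intro exI conjI)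
  have p: "\<kappa> * u x > 0" using u(2)[OF that] \<kappa>(1) by simp
  then show "(x, \<kappa> * u x / 2) \<in> T" "(x, 4 * (\<kappa> * u x)) \<in> T" using that by (auto simp: T_def)
  show "F (x, \<kappa> * u x / 2) < 0" using EL[of "\<kappa> * u x / 2" x] p unfolding F_def snd_conv by linarith
  show "F (x, 4 * (\<kappa> * u x)) > 0" using EL[of "4 * (\<kappa> * u x)" x] p unfolding F_def snd_conv by linarith
 qed
 obtain \<nu> where \<nu>: "nash_on (- K) \<nu>" "\<And>x. x \<in> - K \<Longrightarrow> (x, \<nu> x) \<in> T \<and> F (x, \<nu> x) = 0"
 proof (rule nash_on_implicit[OF oK sK T F _ dF pF sg])
  show "(x, u) \<in> T" if "(x, s) \<in> T" "(x, t) \<in> T" "s \<le> u" "u \<le> t" for x s t u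
   using that by (auto simp: T_def)
 qed blast+
 have "\<nu> x \<le> 2 * \<kappa> * u x" if "x \<notin> K" for x
 proof -
  have "\<nu> x > 0" "\<nu> x = \<kappa> * E (x, \<nu> x)" using \<nu>(2)[of x] that by (auto simp: F_def T_def)
  then show ?thesis using EL[of "\<nu> x" x] by linarith
 qed
 moreover have "continuous_on UNIV (\<lambda>x. 2 * \<kappa> * u x)"
  by (intro continuous_on_mult continuous_on_const lat_poly_continuous u(1))
 moreover have "2 * \<kappa> * u x \<le> 0" if "x \<in> K" for x
  using u(3)[OF that] \<kappa>(1) by (simp add: mult_nonneg_nonpos)
 moreover have "\<nu> x > 0" if "x \<notin> K" for x using \<nu>(2)[of x] that by (auto simp: T_def)
 ultimately show thesis using that[OF \<nu>(1)] by blast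
qed

section \<open>Approximation of semialgebraic functions on closed sets\<close>

text \<open>The approximants live on the whole space, as gluing needs. On a closed semialgebraic set
  the weights account for every positive continuous semialgebraic tolerance.\<close>

definition approximable :: "'a::euclidean_space set \<Rightarrow> ('a \<Rightarrow> real) \<Rightarrow> bool" where
 "approximable S f \<longleftrightarrow> (\<forall>k\<ge>1. \<exists>h. nash_on UNIV h \<and> (\<forall>x\<in>S. \<bar>h x - f x\<bar> \<le> wt k x))"

lemma approximable_empty: "approximable {} f"
 by (auto simp: approximable_def intro!: exI[of _ "\<lambda>x. 0"] nash_on_const)

lemma nash_on_UNIV_continuous_on: "nash_on UNIV h \<Longrightarrow> continuous_on S h"
 using nash_on_continuous_on continuous_on_subset by blast

lemma closed_abs_ge_wt:
 fixes S :: "'a::euclidean_space set"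
 assumes S: "closed S" "semialgebraic S" and f: "sa_fun f" "continuous_on S f" and h: "nash_on UNIV h" and k: "k \<ge> 1"
 shows "closed {x\<in>S. wt k x / 2 \<le> \<bar>h x - f x\<bar>}" "semialgebraic {x\<in>S. wt k x / 2 \<le> \<bar>h x - f x\<bar>}"
proof -
 have "continuous_on S (\<lambda>x. \<bar>h x - f x\<bar> - wt k x / 2)"
  using f(2) nash_on_UNIV_continuous_on[OF h] nash_on_UNIV_continuous_on[OF nash_on_wt[OF k]]
  by (intro continuous_intros) auto
 from continuous_closed_preimage[OF this S(1), of "{0..}"]
 show "closed {x\<in>S. wt k x / 2 \<le> \<bar>h x - f x\<bar>}" by (simp add: vimage_def Int_def)
 show "semialgebraic {x\<in>S. wt k x / 2 \<le> \<bar>h x - f x\<bar>}"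
  by (intro sa_intros semialgebraic_mem S f(1) nash_on_sa_fun[OF h] nash_on_sa_fun[OF nash_on_wt[OF k]])
qed

text \<open>\<open>W\<close>, good on \<open>A\<close>, is bad only on a closed set \<open>X\<close>
  away from \<open>A\<close>; \<open>Z\<close>, good on \<open>X\<close>, is bad only on a closed
  set \<open>Y\<close> away from \<open>X\<close>. A step function that is nearly 1 on
  \<open>X\<close> and nearly 0 on \<open>Y\<close> blends them, suppressing each where it is bad.
  Thus \<open>S - A\<close> is met only through its closed subsets.\<close>

lemma approximable_glue:
 fixes S :: "'a::euclidean_space set"
 assumes S: "closed S" "semialgebraic S" and f: "sa_fun f" "continuous_on S f"
  and A: "A \<subseteq> S" "approximable A f"
  and C: "\<And>C. closed C \<Longrightarrow> semialgebraic C \<Longrightarrow> C \<subseteq> S - A \<Longrightarrow> approximable C f"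
 shows "approximable S f"
 unfolding approximable_def
proof (intro allI impI)
 fix k :: nat assume k: "k \<ge> 1"
 have k4: "4 * k \<ge> 1" using k by simp
 have wk: "wt k x > 0" "wt (4 * k) x \<le> wt k x / 4" for x :: 'a
  using wt_pos[OF k] wt_scale[of 4 k x] k by auto
 obtain W where W: "nash_on UNIV W" "\<And>x. x \<in> A \<Longrightarrow> \<bar>W x - f x\<bar> \<le> wt (4 * k) x"
  using A(2) k4 unfolding approximable_def by blast
 define X where "X = {x\<in>S. wt k x / 2 \<le> \<bar>W x - f x\<bar>}"
 have X: "closed X" "semialgebraic X" unfolding X_def by (intro closed_abs_ge_wt S f W(1) k)+
 have "X \<inter> A = {}"
 proof (rule equals0I)
  fix x assume "x \<in> X \<inter> A"
  then show False using W(2)[of x] wk[of x] by (simp add: X_def)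
 qed
 then have "X \<subseteq> S - A" by (auto simp: X_def)
 then obtain Z where Z: "nash_on UNIV Z" "\<And>x. x \<in> X \<Longrightarrow> \<bar>Z x - f x\<bar> \<le> wt (4 * k) x"
  using C[OF X] k4 unfolding approximable_def by blast
 define Y where "Y = {x\<in>S. wt k x / 2 \<le> \<bar>Z x - f x\<bar>}"
 have Y: "closed Y" "semialgebraic Y" unfolding Y_def by (intro closed_abs_ge_wt S f Z(1) k)+
 have disj: "X \<inter> Y = {}"
 proof (rule equals0I)
  fix x assume "x \<in> X \<inter> Y"
  then show False using Z(2)[of x] wk[of x] by (simp add: Y_def)
 qed
 have cont: "continuous_on S (\<lambda>x. \<bar>W x - f x\<bar> + \<bar>Z x - f x\<bar>)"
  using f(2) nash_on_UNIV_continuous_on[OF W(1)] nash_on_UNIV_continuous_on[OF Z(1)]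
  by (intro continuous_intros)
 have saf: "sa_fun (\<lambda>x. \<bar>W x - f x\<bar> + \<bar>Z x - f x\<bar>)"
  by (intro sa_intros f(1) nash_on_sa_fun[OF W(1)] nash_on_sa_fun[OF Z(1)])
 obtain j where j: "j \<ge> 1" "\<And>x. x \<in> S \<Longrightarrow> \<bar>\<bar>W x - f x\<bar> + \<bar>Z x - f x\<bar>\<bar> * wt j x \<le> 1"
  using sa_fun_polynomial_bound[OF S saf cont] by blast
 \<comment> \<open>The error of the step function has to beat
   \<open>\<bar>W x - f x\<bar> + \<bar>Z x - f x\<bar>\<close>, which is at most
   \<open>1 / wt j x\<close>, and still leave \<open>wt (4 * k)\<close>.\<close>
 define l where "l = j * (4 * k) + j + 4 * k"
 have l: "l \<ge> 1" using k by (simp add: l_def)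
 have wl: "wt l x \<le> wt j x * wt (4 * k) x" for x :: 'a unfolding l_def by (rule wt_mult[OF j(1) k4])
 have small: "c * p \<le> wt k x / 4" if "x \<in> S" "0 \<le> c" "c \<le> wt l x" "0 \<le> p" "p \<le> \<bar>W x - f x\<bar> + \<bar>Z x - f x\<bar>" for x c p
 proof -
  have "c * p \<le> (wt j x * wt (4 * k) x) * (\<bar>W x - f x\<bar> + \<bar>Z x - f x\<bar>)"
   using that wl[of x] by (intro mult_mono) auto
  also have "\<dots> = wt (4 * k) x * ((\<bar>W x - f x\<bar> + \<bar>Z x - f x\<bar>) * wt j x)" by (simp add: mult_ac)
  also have "\<dots> \<le> wt (4 * k) x * 1" using j(2)[OF that(1)] wt_pos[OF k4, of x] by (intro mult_left_mono) auto
  finally show ?thesis using wk(2)[of x] by simp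
 qed
 obtain \<psi> where \<psi>: "nash_on UNIV \<psi>" "\<And>x. 0 \<le> \<psi> x" "\<And>x. \<psi> x \<le> 1"
  "\<And>x. x \<in> X \<Longrightarrow> 1 - \<psi> x \<le> wt l x" "\<And>x. x \<in> Y \<Longrightarrow> \<psi> x \<le> wt l x"
  using nash_step[OF X Y disj l] by blast
 have "\<bar>W x + \<psi> x * (Z x - W x) - f x\<bar> \<le> wt k x" if x: "x \<in> S" for x
 proof -
  have "W x + \<psi> x * (Z x - W x) - f x = (1 - \<psi> x) * (W x - f x) + \<psi> x * (Z x - f x)"
   by (simp add: algebra_simps)
  also have "\<bar>\<dots>\<bar> \<le> (1 - \<psi> x) * \<bar>W x - f x\<bar> + \<psi> x * \<bar>Z x - f x\<bar>"
   using \<psi>(2,3)[of x] abs_triangle_ineq[of "(1 - \<psi> x) * (W x - f x)" "\<psi> x * (Z x - f x)"]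
   by (simp add: abs_mult)
  finally have le: "\<bar>W x + \<psi> x * (Z x - W x) - f x\<bar> \<le> (1 - \<psi> x) * \<bar>W x - f x\<bar> + \<psi> x * \<bar>Z x - f x\<bar>" .
  have conv: "c * p \<le> wt k x / 2" if "0 \<le> c" "c \<le> 1" "0 \<le> p" "p \<le> wt k x / 2" for c p
   using mult_mono[OF that(2) that(4)] that by simp
  have "(1 - \<psi> x) * \<bar>W x - f x\<bar> \<le> wt k x / 2"
  proof (cases "x \<in> X")
   case True
   then show ?thesis using small[OF x, of "1 - \<psi> x" "\<bar>W x - f x\<bar>"] \<psi>(3)[of x] \<psi>(4) wk(1)[of x] by simp
  next
   case False
   then show ?thesis using x \<psi>(2,3)[of x] by (intro conv) (auto simp: X_def)
  qed
  moreover have "\<psi> x * \<bar>Z x - f x\<bar> \<le> wt k x / 2"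
  proof (cases "x \<in> Y")
   case True
   then show ?thesis using small[OF x, of "\<psi> x" "\<bar>Z x - f x\<bar>"] \<psi>(2)[of x] \<psi>(5) wk(1)[of x] by simp
  next
   case False
   then show ?thesis using x \<psi>(2,3)[of x] by (intro conv) (auto simp: Y_def)
  qed
  ultimately show ?thesis using le by linarith
 qed
 moreover have "nash_on UNIV (\<lambda>x. W x + \<psi> x * (Z x - W x))"
  by (intro nash_intros W Z \<psi>)
 ultimately show "\<exists>h. nash_on UNIV h \<and> (\<forall>x\<in>S. \<bar>h x - f x\<bar> \<le> wt k x)" by blast
qed

text \<open>A property that can be glued along closed subsets may be checked on closed sets
 contained in, or disjoint from, a given semialgebraic set.\<close>
lemma stratify:
 fixes Prp :: "'a::euclidean_space set \<Rightarrow> bool"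
 assumes glue: "\<And>S A. closed S \<Longrightarrow> semialgebraic S \<Longrightarrow> S \<subseteq> S0 \<Longrightarrow> closed A \<Longrightarrow> semialgebraic A \<Longrightarrow> A \<subseteq> S \<Longrightarrow> Prp A \<Longrightarrow>
   (\<And>C. closed C \<Longrightarrow> semialgebraic C \<Longrightarrow> C \<subseteq> S - A \<Longrightarrow> Prp C) \<Longrightarrow> Prp S"
  and "semialgebraic X"
 shows "closed S \<Longrightarrow> semialgebraic S \<Longrightarrow> S \<subseteq> S0 \<Longrightarrow>
  (\<And>C. closed C \<Longrightarrow> semialgebraic C \<Longrightarrow> C \<subseteq> S \<Longrightarrow> C \<subseteq> X \<or> C \<inter> X = {} \<Longrightarrow> Prp C) \<Longrightarrow> Prp S"
 using assms(2)
proof (induction arbitrary: S)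
 case (pos p)
 let ?A = "{x\<in>S. p x \<le> 0}"
 have "closed ?A"
  using continuous_closed_preimage[OF poly_fun_continuous[OF pos(1)] pos(2), of "{..0}"]
  by (simp add: vimage_def Int_def)
 moreover have "semialgebraic ?A"
  by (intro sa_intros semialgebraic_mem pos poly_fun_sa_fun)
 ultimately show ?case using pos(2-4) by (intro glue[of S ?A] pos(5)) auto
next
 case (zero p)
 let ?A = "{x\<in>S. p x = 0}"
 have "closed ?A"
  using continuous_closed_preimage[OF poly_fun_continuous[OF zero(1)] zero(2), of "{0}"]
  by (simp add: vimage_def Int_def)
 moreover have "semialgebraic ?A"
  by (intro sa_intros semialgebraic_mem zero poly_fun_sa_fun)
 ultimately show ?case using zero(2-4) by (intro glue[of S ?A] zero(5)) auto
next
 case (union A B)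
 show ?case
 proof (rule union.IH(1)[OF union.prems(1-3)])
  fix C assume C: "closed C" "semialgebraic C" "C \<subseteq> S" "C \<subseteq> A \<or> C \<inter> A = {}"
  show "Prp C"
  proof (rule union.IH(2)[OF C(1,2)])
   show "C \<subseteq> S0" using C union.prems by blast
   fix C' assume C': "closed C'" "semialgebraic C'" "C' \<subseteq> C" "C' \<subseteq> B \<or> C' \<inter> B = {}"
   show "Prp C'"
    by (rule union.prems(4)[OF C'(1,2)]) (use C C' in blast)+
  qed
 qed
next
 case (compl A)
 show ?case by (rule compl.IH[OF compl.prems(1-3)], rule compl.prems(4)) auto
qed

lemma stratify_list:
 fixes Prp :: "'a::euclidean_space set \<Rightarrow> bool"
 assumes glue: "\<And>S A. closed S \<Longrightarrow> semialgebraic S \<Longrightarrow> S \<subseteq> S0 \<Longrightarrow> closed A \<Longrightarrow> semialgebraic A \<Longrightarrow> A \<subseteq> S \<Longrightarrow> Prp A \<Longrightarrow>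
   (\<And>C. closed C \<Longrightarrow> semialgebraic C \<Longrightarrow> C \<subseteq> S - A \<Longrightarrow> Prp C) \<Longrightarrow> Prp S"
 shows "(\<And>X. X \<in> set Xs \<Longrightarrow> semialgebraic X) \<Longrightarrow> closed S \<Longrightarrow> semialgebraic S \<Longrightarrow> S \<subseteq> S0 \<Longrightarrow>
  (\<And>C. closed C \<Longrightarrow> semialgebraic C \<Longrightarrow> C \<subseteq> S \<Longrightarrow> (\<And>X. X \<in> set Xs \<Longrightarrow> C \<subseteq> X \<or> C \<inter> X = {}) \<Longrightarrow> Prp C) \<Longrightarrow> Prp S"
proof (induction Xs arbitrary: S)
 case Nil
 then show ?case by simp
next
 case (Cons X Xs)
 have X: "semialgebraic X" using Cons.prems(1) by simp
 show ?case
 proof (rule stratify[OF glue X Cons.prems(2-4)])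
  fix C assume C: "closed C" "semialgebraic C" "C \<subseteq> S" "C \<subseteq> X \<or> C \<inter> X = {}"
  show "Prp C"
  proof (rule Cons.IH[OF _ C(1,2)])
   show "C \<subseteq> S0" using C Cons.prems by blast
   fix C' assume C': "closed C'" "semialgebraic C'" "C' \<subseteq> C" "\<And>X. X \<in> set Xs \<Longrightarrow> C' \<subseteq> X \<or> C' \<inter> X = {}"
   show "Prp C'"
   proof (rule Cons.prems(5)[OF C'(1,2)])
    show "C' \<subseteq> S" using C C' by blast
    show "C' \<subseteq> Y \<or> C' \<inter> Y = {}" if "Y \<in> set (X # Xs)" for Y
     using that C(4) C'(3,4) by auto
   qed
  qed (use Cons.prems(1) in simp)
 qed blast
qed

lemma approximable_stratify:
 fixes S :: "'a::euclidean_space set"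
 assumes S: "closed S" "semialgebraic S" and f: "sa_fun f" "continuous_on S f"
  and Xs: "\<And>X. X \<in> set Xs \<Longrightarrow> semialgebraic X"
  and C: "\<And>C. closed C \<Longrightarrow> semialgebraic C \<Longrightarrow> C \<subseteq> S \<Longrightarrow> C \<noteq> {} \<Longrightarrow>
   (\<And>X. X \<in> set Xs \<Longrightarrow> C \<subseteq> X \<or> C \<inter> X = {}) \<Longrightarrow> approximable C f"
 shows "approximable S f"
proof (rule stratify_list[where Prp="\<lambda>C. approximable C f" and S0=S and Xs=Xs, OF _ Xs S order_refl])
 show "approximable S' f"
  if "closed S'" "semialgebraic S'" "S' \<subseteq> S" "closed A" "semialgebraic A" "A \<subseteq> S'" "approximable A f"
   "\<And>C. closed C \<Longrightarrow> semialgebraic C \<Longrightarrow> C \<subseteq> S' - A \<Longrightarrow> approximable C f" for S' A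
  by (rule approximable_glue[OF that(1,2) f(1) continuous_on_subset[OF f(2) that(3)] that(6,7,8)])
 show "approximable C' f" if "closed C'" "semialgebraic C'" "C' \<subseteq> S" "\<And>X. X \<in> set Xs \<Longrightarrow> C' \<subseteq> X \<or> C' \<inter> X = {}" for C'
  using C[OF that(1-3) _ that(4)] approximable_empty by (cases "C' = {}") auto
qed

section \<open>Continuity of roots along constant sign conditions\<close>

lemma poly_mono_interval:
 fixes p :: "real poly"
 assumes "\<And>z. a \<le> z \<Longrightarrow> z \<le> b \<Longrightarrow> 0 \<le> \<sigma> * poly (pderiv p) z" "a \<le> u" "u \<le> v" "v \<le> b"
 shows "\<sigma> * poly p u \<le> \<sigma> * poly p v"
proof (cases "u = v")
 case False
 then have "u < v" using assms by simp
 then obtain z where z: "u < z" "z < v" "poly p v - poly p u = (v - u) * poly (pderiv p) z"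
  using poly_MVT[of u v p] by blast
 have "\<sigma> * (poly p v - poly p u) = (v - u) * (\<sigma> * poly (pderiv p) z)" using z(3) by simp
 also have "\<dots> \<ge> 0" using z assms(2-) \<open>u < v\<close> assms(1)[of z] by simp
 finally show ?thesis by (simp add: algebra_simps)
qed simp

lemma pderiv_funpow_eq_0: "degree (p :: real poly) < k \<Longrightarrow> (pderiv ^^ k) p = 0"
proof (induction k arbitrary: p)
 case (Suc k)
 show ?case
 proof (cases "degree p = 0")
  case True
  then have "pderiv p = 0" by (simp add: pderiv_eq_0_iff)
  moreover have "(pderiv ^^ k) 0 = (0 :: real poly)" by (induction k) auto
  ultimately show ?thesis by (simp add: funpow_Suc_right del: funpow.simps)
 next
  case False
  then have "degree (pderiv p) < k" using Suc.prems by (simp add: degree_pderiv)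
  from Suc.IH[OF this] show ?thesis by (simp add: funpow_Suc_right del: funpow.simps)
 qed
qed simp

text \<open>Thom's lemma\<close>
lemma thom_unique:
 fixes p :: "real poly"
 assumes "p \<noteq> 0" "poly p a = 0" "poly p b = 0"
  and sg: "\<And>k. k \<ge> 1 \<Longrightarrow> \<exists>\<sigma>\<in>{1, -1}. 0 \<le> \<sigma> * poly ((pderiv ^^ k) p) a \<and> 0 \<le> \<sigma> * poly ((pderiv ^^ k) p) b"
 shows "a = b"
proof -
 have main: False if ab: "a < b" and z: "poly p a = 0" "poly p b = 0"
  and sg: "\<And>k. k \<ge> 1 \<Longrightarrow> \<exists>\<sigma>\<in>{1, -1}. 0 \<le> \<sigma> * poly ((pderiv ^^ k) p) a \<and> 0 \<le> \<sigma> * poly ((pderiv ^^ k) p) b" for a b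
 proof -
  \<comment> \<open>Descending induction, starting from a derivative that vanishes identically: if
    the next derivative has a weakly constant sign on \<open>[a, b]\<close>, this one is monotone,
    and a weak sign common to both ends extends to the interval.\<close>
  have "\<exists>\<sigma>\<in>{1, -1::real}. \<forall>z. a \<le> z \<longrightarrow> z \<le> b \<longrightarrow> 0 \<le> \<sigma> * poly ((pderiv ^^ k) p) z"
   if "k \<ge> 1" "k \<le> degree p + 1" for k
   using that(2,1)
  proof (induction k rule: inc_induct)
   case base
   have "(pderiv ^^ (degree p + 1)) p = 0" by (rule pderiv_funpow_eq_0) simp
   then show ?case by auto
  next
   case (step k)
   have "\<exists>\<tau>\<in>{1, -1::real}. \<forall>z. a \<le> z \<longrightarrow> z \<le> b \<longrightarrow> 0 \<le> \<tau> * poly (pderiv ((pderiv ^^ k) p)) z"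
    using step.IH by simp
   then obtain \<tau> where \<tau>: "\<tau> \<in> {1, -1::real}" "\<And>z. a \<le> z \<Longrightarrow> z \<le> b \<Longrightarrow> 0 \<le> \<tau> * poly (pderiv ((pderiv ^^ k) p)) z"
    by blast
   obtain \<sigma> where \<sigma>: "\<sigma> \<in> {1, -1}" "0 \<le> \<sigma> * poly ((pderiv ^^ k) p) a" "0 \<le> \<sigma> * poly ((pderiv ^^ k) p) b"
    using sg[OF step.prems] by blast
   have mo: "\<tau> * poly ((pderiv ^^ k) p) u \<le> \<tau> * poly ((pderiv ^^ k) p) v" if "a \<le> u" "u \<le> v" "v \<le> b" for u v
    by (rule poly_mono_interval[of a b]) (use \<tau>(2) that in auto)
   have "0 \<le> \<sigma> * poly ((pderiv ^^ k) p) z" if "a \<le> z" "z \<le> b" for z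
    using mo[of a z] mo[of z b] that \<tau>(1) \<sigma> by auto
   then show ?case using \<sigma>(1) by blast
  qed
  from this[of 1] have "\<exists>\<tau>\<in>{1, -1::real}. \<forall>z. a \<le> z \<longrightarrow> z \<le> b \<longrightarrow> 0 \<le> \<tau> * poly (pderiv p) z" by simp
  then obtain \<tau> where \<tau>: "\<tau> \<in> {1, -1::real}" "\<And>z. a \<le> z \<Longrightarrow> z \<le> b \<Longrightarrow> 0 \<le> \<tau> * poly (pderiv p) z"
   by blast
  have mo: "\<tau> * poly p u \<le> \<tau> * poly p v" if "a \<le> u" "u \<le> v" "v \<le> b" for u v
   by (rule poly_mono_interval[of a b]) (use \<tau>(2) that in auto)
  have "poly p y = 0" if "a \<le> y" "y \<le> b" for y
   using mo[of a y] mo[of y b] that \<tau>(1) z by auto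
  then have "{a..b} \<subseteq> {y. poly p y = 0}" by auto
  then show False using poly_roots_finite[OF assms(1)] infinite_Icc[OF ab] finite_subset by blast
 qed
 show ?thesis
 proof (rule ccontr)
  assume "a \<noteq> b"
  then consider "a < b" | "b < a" by linarith
  then show False
  proof cases
   case 1
   then show False using main[of a b] assms by blast
  next
   case 2
   then show False using main[of b a] assms(2,3) sg by blast
  qed
 qed
qed

lemma pdeg_pderiv_funpow: "P \<in> pdeg n \<Longrightarrow> (\<lambda>x. (pderiv ^^ k) (P x)) \<in> pdeg n"
proof (induction k)
 case (Suc k)
 then show ?case using pdeg_mono[OF pdeg_pderiv[OF Suc.IH]] by simp
qed simp

lemma pdeg_eval_continuous: "P \<in> pdeg n \<Longrightarrow> continuous_on S (\<lambda>z. poly (P (fst z)) (snd z))"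
 by (rule poly_fun_continuous[OF pdeg_eval])

lemma pdeg_eval_sa_fun:
 "P \<in> pdeg n \<Longrightarrow> sa_fun f \<Longrightarrow> sa_fun g \<Longrightarrow> sa_fun (\<lambda>x. poly (P (f x)) (g x))"
 using sa_fun_compose[OF poly_fun_sa_fun[OF pdeg_eval] sa_fun_Pair] by fastforce

lemma pdeg_eval_continuous_on:
 "P \<in> pdeg n \<Longrightarrow> continuous_on S f \<Longrightarrow> continuous_on S g \<Longrightarrow> continuous_on S (\<lambda>x. poly (P (f x)) (g x))"
 using continuous_on_compose2[OF pdeg_eval_continuous[of P n UNIV] continuous_on_Pair[of S f g]] by simp

text \<open>A nonvanishing leading coefficient keeps the roots bounded, so a discontinuity would
  produce a limit root of \<open>R x0\<close> other than \<open>r x0\<close>. Strict signs of the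
  derivatives become weak in the limit, which is why Thom's lemma is stated with weak signs.\<close>

lemma thom_root_continuous:
 fixes C :: "'a::euclidean_space set"
 assumes R: "R \<in> pdeg n" and lead: "\<And>x. x \<in> C \<Longrightarrow> coeff (R x) n \<noteq> 0"
  and root: "\<And>x. x \<in> C \<Longrightarrow> poly (R x) (r x) = 0"
  and sg: "\<And>k x x'. x \<in> C \<Longrightarrow> x' \<in> C \<Longrightarrow> sgn (poly ((pderiv ^^ k) (R x)) (r x)) = sgn (poly ((pderiv ^^ k) (R x')) (r x'))"
 shows "continuous_on C r"
proof (rule ccontr)
 assume "\<not> continuous_on C r"
 then obtain x0 e where x0: "x0 \<in> C" and e: "e > 0" "\<And>d. d > 0 \<Longrightarrow> \<exists>x\<in>C. dist x x0 < d \<and> \<not> dist (r x) (r x0) < e"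
  unfolding continuous_on_iff by blast
 have "\<forall>m::nat. \<exists>x\<in>C. dist x x0 < inverse (real (Suc m)) \<and> \<not> dist (r x) (r x0) < e"
  using e(2) by simp
 then obtain X where X: "\<And>m. X m \<in> C" "\<And>m. dist (X m) x0 < inverse (real (Suc m))" "\<And>m. \<not> dist (r (X m)) (r x0) < e"
  by metis
 have Xlim: "X \<longlonglongrightarrow> x0"
 proof (rule metric_tendsto_imp_tendsto[OF LIMSEQ_inverse_real_of_nat])
  show "\<forall>\<^sub>F m in sequentially. dist (X m) x0 \<le> dist (inverse (real (Suc m))) 0"
   using X(2) by (intro always_eventually allI) (simp add: less_imp_le)
 qed
 have clim: "(\<lambda>m. coeff (R (X m)) i) \<longlonglongrightarrow> coeff (R x0) i" for i
 proof -
  have "isCont (\<lambda>x. coeff (R x) i) x0"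
   using poly_fun_continuous[OF pdeg_coeff[OF R], of UNIV] by (simp add: continuous_on_eq_continuous_at)
  then show ?thesis using Xlim by (rule isCont_tendsto_compose)
 qed
 define c where "c = \<bar>coeff (R x0) n\<bar> / 2"
 have c: "c > 0" using lead[OF x0] by (simp add: c_def)
 have "(\<lambda>m. \<bar>coeff (R (X m)) n\<bar>) \<longlonglongrightarrow> \<bar>coeff (R x0) n\<bar>" by (intro tendsto_rabs clim)
 then have ev1: "\<forall>\<^sub>F m in sequentially. c < \<bar>coeff (R (X m)) n\<bar>"
  by (rule order_tendstoD) (use c in \<open>simp add: c_def\<close>)
 define M where "M = (\<Sum>i\<le>n. \<bar>coeff (R x0) i\<bar>) + 1"
 have "(\<lambda>m. \<Sum>i\<le>n. \<bar>coeff (R (X m)) i\<bar>) \<longlonglongrightarrow> (\<Sum>i\<le>n. \<bar>coeff (R x0) i\<bar>)"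
  by (intro tendsto_sum tendsto_rabs clim)
 then have ev2: "\<forall>\<^sub>F m in sequentially. (\<Sum>i\<le>n. \<bar>coeff (R (X m)) i\<bar>) < M"
  by (rule order_tendstoD) (simp add: M_def)
 from ev1 ev2 have "\<forall>\<^sub>F m in sequentially. \<bar>r (X m)\<bar> \<le> 1 + real n * M / c"
 proof eventually_elim
  case (elim m)
  have nz: "coeff (R (X m)) n \<noteq> 0" using lead X(1) by blast
  then have "degree (R (X m)) = n" using pdeg_degree[OF R, of "X m"] le_degree by fastforce
  show ?case
  proof (rule poly_root_bound[of "R (X m)"])
   show "R (X m) \<noteq> 0" using nz by auto
   show "poly (R (X m)) (r (X m)) = 0" using root X(1) by blast
   show "\<bar>coeff (R (X m)) i\<bar> \<le> M" if "i \<le> n" for i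
    using member_le_sum[of i "{..n}" "\<lambda>i. \<bar>coeff (R (X m)) i\<bar>"] that elim(2) by simp
  qed (use elim(1) c \<open>degree (R (X m)) = n\<close> in auto)
 qed
 then obtain N where N: "\<And>m. m \<ge> N \<Longrightarrow> \<bar>r (X m)\<bar> \<le> 1 + real n * M / c"
  by (auto simp: eventually_sequentially)
 let ?K = "{-(1 + real n * M / c)..1 + real n * M / c}"
 have "\<forall>m. r (X (m + N)) \<in> ?K"
 proof
  fix m
  show "r (X (m + N)) \<in> ?K" using N[of "m + N"] by (simp add: abs_le_iff)
 qed
 then obtain y \<phi> where \<phi>: "strict_mono (\<phi> :: nat \<Rightarrow> nat)" "((\<lambda>m. r (X (m + N))) \<circ> \<phi>) \<longlonglongrightarrow> y"
  using compact_Icc[of "-(1 + real n * M / c)" "1 + real n * M / c"] unfolding compact_eq_seq_compact_metric seq_compact_def by metis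
 define Y where "Y m = X (\<phi> m + N)" for m
 have Y: "\<And>m. Y m \<in> C" "Y \<longlonglongrightarrow> x0" "(\<lambda>m. r (Y m)) \<longlonglongrightarrow> y"
 proof -
  have sm: "strict_mono (\<lambda>m. \<phi> m + N)" using \<phi>(1) by (simp add: strict_mono_def)
  show "Y \<longlonglongrightarrow> x0" using LIMSEQ_subseq_LIMSEQ[OF Xlim sm] by (simp add: Y_def[abs_def] o_def)
  show "(\<lambda>m. r (Y m)) \<longlonglongrightarrow> y" using \<phi>(2) by (simp add: Y_def[abs_def] o_def)
 qed (simp add: Y_def X)
 have plim: "(\<lambda>m. poly ((pderiv ^^ k) (R (Y m))) (r (Y m))) \<longlonglongrightarrow> poly ((pderiv ^^ k) (R x0)) y" for k
 proof -
  have "isCont (\<lambda>z. poly ((pderiv ^^ k) (R (fst z))) (snd z)) (x0, y)"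
   using pdeg_eval_continuous[OF pdeg_pderiv_funpow[OF R], of UNIV k] by (simp add: continuous_on_eq_continuous_at)
  from isCont_tendsto_compose[OF this tendsto_Pair[OF Y(2,3)]] show ?thesis by simp
 qed
 have "r x0 = y"
 proof (rule thom_unique[of "R x0"])
  show "R x0 \<noteq> 0" using lead[OF x0] by auto
  show "poly (R x0) (r x0) = 0" by (rule root[OF x0])
  have "(\<lambda>m. 0) \<longlonglongrightarrow> poly (R x0) y" using plim[of 0] root[OF Y(1)] by simp
  then show "poly (R x0) y = 0" using LIMSEQ_unique tendsto_const by blast
  fix k :: nat
  let ?p = "\<lambda>x. poly ((pderiv ^^ k) (R x)) (r x)"
  have s: "sgn (?p (Y m)) = sgn (?p x0)" for m by (rule sg[OF Y(1) x0])
  show "\<exists>\<sigma>\<in>{1, -1}. 0 \<le> \<sigma> * ?p x0 \<and> 0 \<le> \<sigma> * poly ((pderiv ^^ k) (R x0)) y"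
  proof (cases "?p x0 \<ge> 0")
   case True
   then have "0 \<le> ?p (Y m)" for m using s[of m] by (metis sgn_1_pos sgn_0_0 less_eq_real_def sgn_zero)
   then have "0 \<le> poly ((pderiv ^^ k) (R x0)) y" by (intro LIMSEQ_le_const[OF plim]) auto
   then show ?thesis using True by (intro bexI[of _ 1]) auto
  next
   case False
   then have "?p (Y m) \<le> 0" for m using s[of m] by (metis sgn_1_neg less_eq_real_def linorder_not_le)
   then have "poly ((pderiv ^^ k) (R x0)) y \<le> 0" by (intro LIMSEQ_le_const2[OF plim]) auto
   then show ?thesis using False by (intro bexI[of _ "-1"]) auto
  qed
 qed
 moreover have "e \<le> dist y (r x0)"
  by (rule LIMSEQ_le_const[OF tendsto_dist[OF Y(3) tendsto_const]]) (use X(3) in \<open>auto simp: Y_def not_less\<close>)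
 ultimately show False using e(1) by simp
qed

section \<open>Nash approximation of continuous semialgebraic functions\<close>

text \<open>Compactness of the parameter interval, through the tube lemma.\<close>

lemma open_tube:
 assumes "open (W :: ('a::euclidean_space \<times> real) set)"
 shows "open {x. \<forall>s\<in>{0..1}. (x, s) \<in> W}"
proof (rule openI)
 fix x assume "x \<in> {x. \<forall>s\<in>{0..1}. (x, s) \<in> W}"
 then have "{x} \<times> {0..1} \<subseteq> W" by auto
 then obtain X0 where "x \<in> X0" "open X0" "X0 \<times> {0..1} \<subseteq> W"
  using Elementary_Topology.tube_lemma[of "{0..1::real}" W x] assms compact_Icc by blast
 then obtain e where "e > 0" "ball x e \<subseteq> X0" using open_contains_ball by blast
 then show "\<exists>e>0. ball x e \<subseteq> {x. \<forall>s\<in>{0..1}. (x, s) \<in> W}"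
  using \<open>X0 \<times> {0..1} \<subseteq> W\<close> by blast
qed

lemma poly_abs_bound:
 fixes p :: "real poly"
 assumes "degree p \<le> d" "\<bar>t\<bar> \<le> T"
 shows "\<bar>poly p t\<bar> \<le> (\<Sum>i\<le>d. \<bar>coeff p i\<bar> * T ^ i)"
proof -
 have "\<bar>poly p t\<bar> \<le> (\<Sum>i\<le>d. \<bar>coeff p i * t ^ i\<bar>)"
  unfolding poly_altdef_bound[OF assms(1)] by (rule sum_abs)
 also have "\<dots> \<le> (\<Sum>i\<le>d. \<bar>coeff p i\<bar> * T ^ i)"
  unfolding abs_mult power_abs using assms(2) by (intro sum_mono mult_left_mono power_mono) auto
 finally show ?thesis .
qed

lemma poly_strict_mono:
 fixes p :: "real poly"
 assumes "\<And>z. u \<le> z \<Longrightarrow> z \<le> v \<Longrightarrow> poly (pderiv p) z > 0" "u < v"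
 shows "poly p u < poly p v"
 using poly_MVT[OF assms(2), of p] assms by (metis diff_gt_0_iff_gt less_imp_le mult_pos_pos)

text \<open>In the box over \<open>C\<close> the graph of \<open>f\<close> is the only zero of the
  increasing \<open>P x\<close>, but off \<open>C\<close> nothing is known. There \<open>P\<close>
  is faded out in favour of \<open>t - \<mu> x\<close>, which is increasing and vanishes in the
  middle of the box. The blend has a zero over every point of the space, and this zero is
  Nash.\<close>

lemma approximable_box:
 fixes C :: "'a::euclidean_space set"
 assumes C: "closed C" "semialgebraic C" and P: "P \<in> pdeg d" and f: "sa_fun f" "continuous_on C f"
  and root: "\<And>x. x \<in> C \<Longrightarrow> poly (P x) (f x) = 0"
  and \<alpha>: "nash_on UNIV \<alpha>" and \<beta>: "nash_on UNIV \<beta>" and box: "\<And>x. x \<in> C \<Longrightarrow> \<alpha> x < f x \<and> f x < \<beta> x"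
  and mono: "\<And>x t. x \<in> C \<Longrightarrow> \<alpha> x \<le> t \<Longrightarrow> t \<le> \<beta> x \<Longrightarrow> poly (pderiv (P x)) t > 0"
 shows "approximable C f"
 unfolding approximable_def
proof (intro allI impI)
 fix k :: nat assume k: "k \<ge> 1"
 have bx: "\<alpha> x < f x" "f x < \<beta> x" if "x \<in> C" for x using box[OF that] by auto
 note cu = nash_on_UNIV_continuous_on
 have P': "(\<lambda>x. pderiv (P x)) \<in> pdeg d" using pdeg_mono[OF pdeg_pderiv[OF P]] by simp
 have "continuous_on C (\<lambda>x. (\<beta> x - f x) / 2)" using f(2) cu[OF \<beta>] by (intro continuous_intros) auto
 moreover have "sa_fun (\<lambda>x. (\<beta> x - f x) / 2)" by (intro sa_intros f nash_on_sa_fun[OF \<beta>])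
 ultimately obtain i where i: "i \<ge> 1" "\<And>x. x \<in> C \<Longrightarrow> wt i x \<le> (\<beta> x - f x) / 2"
  using lojasiewicz_continuous[OF C, of "\<lambda>x. (\<beta> x - f x) / 2"] box by (metis diff_gt_0_iff_gt half_gt_zero)
 \<comment> \<open>Off \<open>C\<close> the box may be empty. \<gamma> is a positive Nash substitute
   for its height, obtained by smoothing the positive part of \<open>m\<close>; the margin
   \<open>wt i\<close> ensures \<open>f < \<beta>1 \<le> \<beta>\<close> on
   \<open>C\<close>.\<close>
 define m where "m x = \<beta> x - \<alpha> x - wt i x" for x
 define \<gamma> where "\<gamma> x = (m x + sqrt ((m x)\<^sup>2 + (wt i x)\<^sup>2)) / 2" for x
 have mp: "(m x)\<^sup>2 + (wt i x)\<^sup>2 > 0" for x using wt_pos[OF i(1), of x] by (auto intro: add_nonneg_pos)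
 have n\<gamma>: "nash_on UNIV \<gamma>" unfolding \<gamma>_def[abs_def] m_def[abs_def]
  by (intro nash_intros \<alpha> \<beta> nash_on_wt i(1) open_UNIV) (use mp in \<open>auto simp: m_def\<close>)
 have \<gamma>pos: "\<gamma> x > 0" for x
 proof -
  have "sqrt ((m x)\<^sup>2) < sqrt ((m x)\<^sup>2 + (wt i x)\<^sup>2)" using wt_pos[OF i(1), of x] by (intro real_sqrt_less_mono) simp
  then have "\<bar>m x\<bar> < sqrt ((m x)\<^sup>2 + (wt i x)\<^sup>2)" by simp
  then show ?thesis by (simp add: \<gamma>_def abs_less_iff)
 qed
 define \<beta>1 where "\<beta>1 x = \<alpha> x + \<gamma> x" for x
 have n\<beta>1: "nash_on UNIV \<beta>1" unfolding \<beta>1_def[abs_def] by (intro nash_intros \<alpha> n\<gamma>)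
 have \<beta>1: "f x < \<beta>1 x" "\<beta>1 x \<le> \<beta> x" if "x \<in> C" for x
 proof -
  have wi: "wt i x > 0" "wt i x \<le> (\<beta> x - f x) / 2" using wt_pos[OF i(1)] i(2)[OF that] by auto
  then have m0: "m x > 0" using bx[OF that] unfolding m_def by (linarith | argo)
  have "m x \<le> sqrt ((m x)\<^sup>2 + (wt i x)\<^sup>2)" by (rule real_le_rsqrt) simp
  then have "m x \<le> \<gamma> x" by (simp add: \<gamma>_def)
  then show "f x < \<beta>1 x" using wi bx[OF that] unfolding \<beta>1_def m_def by (linarith | argo)
  have "sqrt ((m x)\<^sup>2 + (wt i x)\<^sup>2) \<le> m x + wt i x"
   using sqrt_add_le_add_sqrt[of "(m x)\<^sup>2" "(wt i x)\<^sup>2"] m0 wi by simp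
  then show "\<beta>1 x \<le> \<beta> x" using wi unfolding \<beta>1_def \<gamma>_def m_def by (linarith | argo)
 qed
 have mono1: "poly (pderiv (P x)) t > 0" if "x \<in> C" "\<alpha> x \<le> t" "t \<le> \<beta>1 x" for x t
  using mono[OF that(1,2)] \<beta>1(2)[OF that(1)] that(3) by simp
 define T where "T x = \<bar>\<alpha> x\<bar> + \<bar>\<beta>1 x\<bar>" for x
 \<comment> \<open>A bound on the box for both \<open>P\<close> and its derivative; being continuous
   and semialgebraic, it can be beaten by weights.\<close>
 define B where "B x = (\<Sum>i\<le>d. \<bar>coeff (P x) i\<bar> * T x ^ i) + (\<Sum>i\<le>d. \<bar>coeff (pderiv (P x)) i\<bar> * T x ^ i)" for x
 have Bn: "(\<Sum>i\<le>d. \<bar>coeff p i\<bar> * T x ^ i) \<ge> 0" for p :: "real poly" and x by (intro sum_nonneg) (auto simp: T_def)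
 have B0: "B x \<ge> 0" for x using Bn unfolding B_def by (simp add: add_nonneg_nonneg)
 have Bb: "\<bar>poly (P x) t\<bar> \<le> B x" "\<bar>poly (pderiv (P x)) t\<bar> \<le> B x" if "\<alpha> x \<le> t" "t \<le> \<beta>1 x" for x t
 proof -
  have t: "\<bar>t\<bar> \<le> T x" using that unfolding T_def by (linarith | argo)
  show "\<bar>poly (P x) t\<bar> \<le> B x" using poly_abs_bound[OF pdeg_degree[OF P, of x] t] Bn[of "pderiv (P x)" x] unfolding B_def by linarith
  show "\<bar>poly (pderiv (P x)) t\<bar> \<le> B x" using poly_abs_bound[OF pdeg_degree[OF P', of x] t] Bn[of "P x" x] unfolding B_def by linarith
 qed
 have cB: "continuous_on S B" for S unfolding B_def[abs_def] T_def[abs_def]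
  by (intro continuous_intros cu[OF \<alpha>] cu[OF n\<beta>1] poly_fun_continuous[OF pdeg_coeff[OF P]] poly_fun_continuous[OF pdeg_coeff[OF P']])
 have sB: "sa_fun B" unfolding B_def[abs_def] T_def[abs_def]
  by (intro sa_intros sa_fun_sum finite_atMost nash_on_sa_fun[OF \<alpha>] nash_on_sa_fun[OF n\<beta>1]
    poly_fun_sa_fun[OF pdeg_coeff[OF P]] poly_fun_sa_fun[OF pdeg_coeff[OF P']])
 note s\<alpha> = nash_on_sa_fun[OF \<alpha>] and s\<gamma> = nash_on_sa_fun[OF n\<gamma>] and s\<beta>1 = nash_on_sa_fun[OF n\<beta>1]
 \<comment> \<open>Here \<open>P\<close> alone increases across the box and changes sign. The height
   is normalized to \<open>{0..1}\<close> so that \<open>open_tube\<close> gives openness.\<close>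
 define G where "G = {x. (\<forall>s\<in>{0..1}. 0 < poly (pderiv (P x)) (\<alpha> x + s * \<gamma> x)) \<and> poly (P x) (\<alpha> x) < 0 \<and> 0 < poly (P x) (\<beta>1 x)}"
 have "open G"
 proof -
  have "continuous_on UNIV (\<lambda>z::'a \<times> real. poly (pderiv (P (fst z))) (\<alpha> (fst z) + snd z * \<gamma> (fst z)))"
   by (intro pdeg_eval_continuous_on[OF P'] continuous_intros continuous_on_compose2[OF cu[OF \<alpha>, of UNIV]]
     continuous_on_compose2[OF cu[OF n\<gamma>, of UNIV]]) auto
  then have "open {z::'a \<times> real. 0 < poly (pderiv (P (fst z))) (\<alpha> (fst z) + snd z * \<gamma> (fst z))}"
   by (intro open_Collect_less continuous_on_const)
  from open_tube[OF this] have "open {x. \<forall>s\<in>{0..1}. 0 < poly (pderiv (P x)) (\<alpha> x + s * \<gamma> x)}" by simp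
  moreover have "open {x. poly (P x) (\<alpha> x) < 0}" "open {x. 0 < poly (P x) (\<beta>1 x)}"
   by (intro open_Collect_less continuous_on_const pdeg_eval_continuous_on[OF P] continuous_on_id cu[OF \<alpha>] cu[OF n\<beta>1])+
  ultimately show ?thesis unfolding G_def by (intro open_Collect_conj)
 qed
 have "semialgebraic G"
 proof -
  have "semialgebraic {s::real. 0 \<le> s \<and> s \<le> 1}" by (intro sa_intros)
  then have I: "semialgebraic {0..1::real}" by (simp add: atLeastAtMost_def atLeast_def atMost_def Collect_conj_eq)
  show ?thesis unfolding G_def
   by (intro sa_intros I pdeg_eval_sa_fun[OF P'] pdeg_eval_sa_fun[OF P] s\<alpha> s\<beta>1 sa_fun_compose[OF s\<alpha>] sa_fun_compose[OF s\<gamma>])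
 qed
 define D where "D = - G"
 have D: "closed D" "semialgebraic D"
  unfolding D_def using \<open>open G\<close> \<open>semialgebraic G\<close> by (auto intro: semialgebraic.compl)
 have "C \<subseteq> G"
 proof
  fix x assume x: "x \<in> C"
  have ab: "\<alpha> x < f x" "f x < \<beta>1 x" using bx[OF x] \<beta>1(1)[OF x] by auto
  have "0 < poly (pderiv (P x)) (\<alpha> x + s * \<gamma> x)" if "s \<in> {0..1}" for s
   using that \<gamma>pos[of x] mult_right_mono[of s 1 "\<gamma> x"] by (intro mono1[OF x]) (auto simp: \<beta>1_def)
  moreover have "poly (P x) (\<alpha> x) < 0"
   using poly_strict_mono[of "\<alpha> x" "f x" "P x"] mono1[OF x] ab root[OF x] by simp
  moreover have "0 < poly (P x) (\<beta>1 x)"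
   using poly_strict_mono[of "f x" "\<beta>1 x" "P x"] mono1[OF x] ab root[OF x] by simp
  ultimately show "x \<in> G" by (simp add: G_def)
 qed
 then have disj: "C \<inter> D = {}" by (auto simp: D_def)
 \<comment> \<open>If \<open>\<psi> \<le> \<epsilon>D\<close> on \<open>D\<close>, neither the
   values nor the slope of \<open>\<psi> * P\<close> can spoil the sign change and the slope of
   \<open>(1 - \<psi>) * (t - \<mu>)\<close>.\<close>
 define \<epsilon>D where "\<epsilon>D x = min 1 (\<gamma> x) / (8 * (B x + 1))" for x
 have B1: "B x + 1 > 0" "8 * (B x + 1) \<noteq> 0" for x using B0[of x] by auto
 have \<epsilon>Dpos: "\<epsilon>D x > 0" for x using \<gamma>pos[of x] B1[of x] by (simp add: \<epsilon>D_def)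
 have "continuous_on UNIV \<epsilon>D" unfolding \<epsilon>D_def[abs_def]
  using B1(2) by (intro continuous_intros cu[OF n\<gamma>] cB) auto
 moreover have "sa_fun \<epsilon>D" unfolding \<epsilon>D_def[abs_def] by (intro sa_intros s\<gamma> sB)
 ultimately obtain l1 where l1: "l1 \<ge> 1" "\<And>x. wt l1 x \<le> \<epsilon>D x"
  using lojasiewicz_continuous[OF closed_UNIV semialgebraic_UNIV, of \<epsilon>D] \<epsilon>Dpos by (metis UNIV_I)
 \<comment> \<open>The factor 1/2 keeps \<open>f - e\<close> and \<open>f + e\<close> strictly
   inside the box.\<close>
 define e where "e x = min (wt k x) (min (f x - \<alpha> x) (\<beta>1 x - f x)) / 2" for x
 have e: "e x > 0" "e x < wt k x" "\<alpha> x < f x - e x" "f x + e x < \<beta>1 x" if "x \<in> C" for x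
 proof -
  define M where "M = min (wt k x) (min (f x - \<alpha> x) (\<beta>1 x - f x))"
  have M: "M > 0" "M \<le> wt k x" "M \<le> f x - \<alpha> x" "M \<le> \<beta>1 x - f x"
   using bx[OF that] \<beta>1(1)[OF that] wt_pos[OF k, of x] by (auto simp: M_def)
  have "e x + e x = M" by (simp add: e_def M_def)
  then show "e x > 0" "e x < wt k x" "\<alpha> x < f x - e x" "f x + e x < \<beta>1 x" using M by linarith+
 qed
 have ce: "continuous_on C e" unfolding e_def[abs_def]
  using f(2) by (intro continuous_intros cu[OF nash_on_wt[OF k]] cu[OF \<alpha>] cu[OF n\<beta>1]) auto
 have se: "sa_fun e" unfolding e_def[abs_def]
  by (intro sa_intros f(1) s\<alpha> s\<beta>1 nash_on_sa_fun[OF nash_on_wt[OF k]])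
 \<comment> \<open>The smaller of the heights of \<open>P\<close> at the two test points: if
   \<open>F\<close> differs from \<open>P\<close> by less than this, its zero lies between
   them.\<close>
 define \<theta> where "\<theta> x = min (- poly (P x) (f x - e x)) (poly (P x) (f x + e x))" for x
 have \<theta>: "\<theta> x > 0" if "x \<in> C" for x
 proof -
  have "poly (P x) (f x - e x) < poly (P x) (f x)"
   by (rule poly_strict_mono) (use e[OF that] bx[OF that] mono1[OF that] in auto)
  moreover have "poly (P x) (f x) < poly (P x) (f x + e x)"
   by (rule poly_strict_mono) (use e[OF that] bx[OF that] mono1[OF that] in auto)
  ultimately show ?thesis using root[OF that] by (simp add: \<theta>_def)
 qed
 \<comment> \<open>On the box \<open>\<bar>F - P\<bar>\<close> is at most
   \<open>(1 - \<psi>) * (\<gamma> + B)\<close>, so this choice brings it down to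
   \<open>\<theta> / 2\<close>.\<close>
 define \<epsilon>C where "\<epsilon>C x = \<theta> x / (2 * (\<gamma> x + B x + 1))" for x
 have gB: "\<gamma> x + B x + 1 > 0" for x using \<gamma>pos[of x] B0[of x] by (linarith | argo)
 have gB2: "2 * (\<gamma> x + B x + 1) \<noteq> 0" for x using gB[of x] by simp
 have "continuous_on C \<epsilon>C" unfolding \<epsilon>C_def[abs_def] \<theta>_def[abs_def]
  using f(2) ce by (intro continuous_intros cu[OF n\<gamma>] cB pdeg_eval_continuous_on[OF P]) (use gB2 in blast)+
 moreover have "sa_fun \<epsilon>C" unfolding \<epsilon>C_def[abs_def] \<theta>_def[abs_def]
  by (intro sa_intros s\<gamma> sB pdeg_eval_sa_fun[OF P] f(1) se)
 moreover have "\<epsilon>C x > 0" if "x \<in> C" for x using \<theta>[OF that] gB[of x] by (simp add: \<epsilon>C_def)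
 ultimately obtain l2 where l2: "l2 \<ge> 1" "\<And>x. x \<in> C \<Longrightarrow> wt l2 x \<le> \<epsilon>C x"
  using lojasiewicz_continuous[OF C, of \<epsilon>C] by metis
 define l where "l = l1 + l2"
 have l: "l \<ge> 1" "wt l x \<le> wt l1 x" "wt l x \<le> wt l2 x" for x :: 'a
  using l1(1) l2(1) wt_mono[of l1 l x] wt_mono[of l2 l x] by (auto simp: l_def)
 obtain \<psi> where \<psi>: "nash_on UNIV \<psi>" "\<And>x. 0 \<le> \<psi> x" "\<And>x. \<psi> x \<le> 1"
  "\<And>x. x \<in> C \<Longrightarrow> 1 - \<psi> x \<le> wt l x" "\<And>x. x \<in> D \<Longrightarrow> \<psi> x \<le> wt l x"
  using nash_step[OF C D disj l(1)] by blast
 have \<psi>D: "\<psi> x * B x \<le> 1/8" "\<psi> x * B x \<le> \<gamma> x / 8" "\<psi> x \<le> 1/8" if "x \<in> D" for x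
 proof -
  have c: "\<psi> x \<le> \<epsilon>D x" using \<psi>(5)[OF that] l(2)[of x] l1(2)[of x] by (linarith | argo)
  then have "\<psi> x * (B x + 1) \<le> \<epsilon>D x * (B x + 1)" using B1(1)[of x] by (intro mult_right_mono) auto
  also have "\<dots> = min 1 (\<gamma> x) / 8" using B1(1)[of x] by (simp add: \<epsilon>D_def field_simps)
  finally have "\<psi> x * B x + \<psi> x \<le> min 1 (\<gamma> x) / 8" by (simp add: algebra_simps)
  moreover have "0 \<le> \<psi> x" "0 \<le> \<psi> x * B x" using \<psi>(2) B0 by auto
  moreover have "min 1 (\<gamma> x) \<le> 1" "min 1 (\<gamma> x) \<le> \<gamma> x" by auto
  ultimately show "\<psi> x * B x \<le> 1/8" "\<psi> x * B x \<le> \<gamma> x / 8" "\<psi> x \<le> 1/8" by (linarith | argo)+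
 qed
 define \<mu> where "\<mu> x = \<alpha> x + \<gamma> x / 2" for x
 define F where "F z = (1 - \<psi> (fst z)) * (snd z - \<mu> (fst z)) + \<psi> (fst z) * poly (P (fst z)) (snd z)" for z
 define F' where "F' x t = (1 - \<psi> x) + \<psi> x * poly (pderiv (P x)) t" for x t
 define U where "U = {z. \<alpha> (fst z) < snd z \<and> snd z < \<beta>1 (fst z)}"
 have nf: "nash_on UNIV (\<lambda>z::'a \<times> real. h (fst z))" if "nash_on UNIV h" for h :: "'a \<Rightarrow> real"
  by (rule nash_on_compose[OF that]) (auto intro!: nash_on_fst nash_on_ident)
 have n\<mu>: "nash_on UNIV \<mu>" unfolding \<mu>_def[abs_def] by (intro nash_intros \<alpha> n\<gamma>) auto
 have oU: "open U" unfolding U_def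
  by (intro open_Collect_conj open_Collect_less cu[OF nf[OF \<alpha>]] cu[OF nf[OF n\<beta>1]] continuous_on_snd continuous_on_id)
 have sU: "semialgebraic U" unfolding U_def
  by (intro sa_intros sa_fun_compose[OF s\<alpha>] sa_fun_compose[OF s\<beta>1])
 have nFU: "nash_on UNIV F" unfolding F_def[abs_def]
  by (intro nash_intros nf[OF \<psi>(1)] nf[OF n\<mu>] nash_on_poly_fun[OF pdeg_eval[OF P]] open_UNIV)
 have nF: "nash_on U F" by (rule nash_on_subset[OF nFU subset_UNIV oU])
 have dF: "((\<lambda>t. F (x, t)) has_real_derivative F' x t) (at t)" for x t
  unfolding F_def F'_def fst_conv snd_conv
  by (rule derivative_eq_intros poly_DERIV refl)+ simp
 have conv: "c * a + (1 - c) * b > 0" if "0 \<le> c" "c \<le> 1" "a > 0" "b > 0" for a b c :: real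
  using that by (cases "c = 0") (auto intro: add_pos_nonneg)
 have F'pos: "F' x t > 0" if "(x, t) \<in> U" for x t
 proof (cases "x \<in> G")
  case True
  define s where "s = (t - \<alpha> x) / \<gamma> x"
  have s: "s \<in> {0..1}" "\<alpha> x + s * \<gamma> x = t"
   using that \<gamma>pos[of x] by (auto simp: s_def U_def \<beta>1_def field_simps)
  have "poly (pderiv (P x)) t > 0" using True s by (auto simp: G_def)
  then show ?thesis using conv[of "\<psi> x" "poly (pderiv (P x)) t" 1] \<psi>(2,3)[of x] by (simp add: F'_def add.commute)
 next
  case False
  then have x: "x \<in> D" by (simp add: D_def)
  have "\<bar>\<psi> x * poly (pderiv (P x)) t\<bar> \<le> \<psi> x * B x"
   unfolding abs_mult using \<psi>(2)[of x] Bb(2)[of x t] that by (auto simp: U_def intro!: mult_left_mono)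
  then show ?thesis using \<psi>D[OF x] unfolding F'_def by (linarith | argo)
 qed
 have Fends: "F (x, \<alpha> x) < 0" "F (x, \<beta>1 x) > 0" for x
 proof -
  have eq: "F (x, \<alpha> x) = - ((1 - \<psi> x) * (\<gamma> x / 2)) + \<psi> x * poly (P x) (\<alpha> x)"
   "F (x, \<beta>1 x) = (1 - \<psi> x) * (\<gamma> x / 2) + \<psi> x * poly (P x) (\<beta>1 x)"
   by (simp_all add: F_def \<mu>_def \<beta>1_def algebra_simps)
  have "F (x, \<alpha> x) < 0 \<and> F (x, \<beta>1 x) > 0"
  proof (cases "x \<in> G")
   case True
   then have g: "- poly (P x) (\<alpha> x) > 0" "poly (P x) (\<beta>1 x) > 0" by (auto simp: G_def)
   have "\<gamma> x / 2 > 0" using \<gamma>pos[of x] by simp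
   from conv[OF \<psi>(2,3) g(1) this, of x] conv[OF \<psi>(2,3) g(2) this, of x]
   show ?thesis unfolding eq by (simp add: algebra_simps)
  next
   case False
   then have x: "x \<in> D" by (simp add: D_def)
   have b: "\<bar>\<psi> x * poly (P x) t\<bar> \<le> \<gamma> x / 8" if "\<alpha> x \<le> t" "t \<le> \<beta>1 x" for t
   proof -
    have "\<bar>\<psi> x * poly (P x) t\<bar> \<le> \<psi> x * B x"
     unfolding abs_mult using \<psi>(2)[of x] Bb(1)[OF that] by (auto intro!: mult_left_mono)
    then show ?thesis using \<psi>D(2)[OF x] by (linarith | argo)
   qed
   have ab: "\<alpha> x \<le> \<beta>1 x" using \<gamma>pos[of x] by (simp add: \<beta>1_def)
   have "7/8 * (\<gamma> x / 2) \<le> (1 - \<psi> x) * (\<gamma> x / 2)"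
    using \<psi>D(3)[OF x] \<gamma>pos[of x] by (intro mult_right_mono) auto
   moreover have "\<gamma> x / 8 < 7/8 * (\<gamma> x / 2)" using \<gamma>pos[of x] by simp
   ultimately have Q: "\<gamma> x / 8 < (1 - \<psi> x) * (\<gamma> x / 2)" by (rule less_le_trans[rotated])
   have "\<bar>\<psi> x * poly (P x) (\<alpha> x)\<bar> < (1 - \<psi> x) * (\<gamma> x / 2)" "\<bar>\<psi> x * poly (P x) (\<beta>1 x)\<bar> < (1 - \<psi> x) * (\<gamma> x / 2)"
    using le_less_trans[OF b Q] ab by auto
   then show ?thesis unfolding eq abs_less_iff by (intro conjI) linarith+
  qed
  then show "F (x, \<alpha> x) < 0" "F (x, \<beta>1 x) > 0" by auto
 qed
 have sg: "\<exists>s t. (x, s) \<in> U \<and> (x, t) \<in> U \<and> F (x, s) < 0 \<and> F (x, t) > 0" for x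
 proof -
  have ab: "\<alpha> x < \<beta>1 x" using \<gamma>pos[of x] by (simp add: \<beta>1_def)
  have c: "isCont (\<lambda>t. F (x, t)) t" for t using dF DERIV_isCont by blast
  have "((\<lambda>t. F (x, t)) \<longlongrightarrow> F (x, \<alpha> x)) (at_right (\<alpha> x))"
   using c[of "\<alpha> x"] unfolding isCont_def by (rule tendsto_within_subset) simp
  from order_tendstoD(2)[OF this Fends(1)] eventually_at_right_real[OF ab]
  have "\<forall>\<^sub>F s in at_right (\<alpha> x). (x, s) \<in> U \<and> F (x, s) < 0"
   by eventually_elim (auto simp: U_def)
  from eventually_happens[OF this] obtain s where s: "(x, s) \<in> U" "F (x, s) < 0"
   by (auto simp: trivial_limit_at_right_real)
  have "((\<lambda>t. F (x, t)) \<longlongrightarrow> F (x, \<beta>1 x)) (at_left (\<beta>1 x))"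
   using c[of "\<beta>1 x"] unfolding isCont_def by (rule tendsto_within_subset) simp
  from order_tendstoD(1)[OF this Fends(2)] eventually_at_left_real[OF ab]
  have "\<forall>\<^sub>F s in at_left (\<beta>1 x). (x, s) \<in> U \<and> F (x, s) > 0"
   by eventually_elim (auto simp: U_def)
  from eventually_happens[OF this] obtain t where t: "(x, t) \<in> U" "F (x, t) > 0"
   by (auto simp: trivial_limit_at_left_real)
  show ?thesis using s t by blast
 qed
 have cvU: "(x, u) \<in> U" if "(x, s) \<in> U" "(x, t) \<in> U" "s \<le> u" "u \<le> t" for x s t u
  using that by (auto simp: U_def)
 obtain g where g: "nash_on UNIV g" "\<And>x. (x, g x) \<in> U \<and> F (x, g x) = 0"
  "\<And>x t. (x, t) \<in> U \<Longrightarrow> t < g x \<longleftrightarrow> F (x, t) < 0"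
  by (rule nash_on_implicit[OF open_UNIV semialgebraic_UNIV oU sU nF cvU dF F'pos sg]) auto
 have "\<bar>g x - f x\<bar> \<le> wt k x" if x: "x \<in> C" for x
 proof -
  have est: "\<bar>F (x, t) - poly (P x) t\<bar> < \<theta> x" if t: "\<alpha> x \<le> t" "t \<le> \<beta>1 x" for t
  proof -
   have "F (x, t) - poly (P x) t = (1 - \<psi> x) * (t - \<mu> x - poly (P x) t)" by (simp add: F_def algebra_simps)
   moreover have "\<bar>t - \<mu> x - poly (P x) t\<bar> \<le> \<gamma> x + B x"
    using Bb(1)[OF t] t \<gamma>pos[of x] unfolding \<mu>_def \<beta>1_def by (linarith | argo)
   ultimately have "\<bar>F (x, t) - poly (P x) t\<bar> \<le> (1 - \<psi> x) * (\<gamma> x + B x)"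
    unfolding abs_mult using \<psi>(3)[of x] by (simp add: abs_mult mult_left_mono)
   also have "\<dots> \<le> \<epsilon>C x * (\<gamma> x + B x)"
    using \<psi>(4)[OF x] l(3)[of x] l2(2)[OF x] \<gamma>pos[of x] B0[of x] by (intro mult_right_mono) auto
   also have "\<dots> \<le> \<epsilon>C x * (\<gamma> x + B x + 1)"
    using \<theta>[OF x] gB[of x] by (intro mult_left_mono) (auto simp: \<epsilon>C_def)
   also have "\<dots> = \<theta> x / 2" using gB[of x] by (simp add: \<epsilon>C_def field_simps)
   finally show ?thesis using \<theta>[OF x] by simp
  qed
  have in1: "(x, f x - e x) \<in> U" "(x, f x + e x) \<in> U" using e[OF x] bx[OF x] \<beta>1(1)[OF x] by (auto simp: U_def)
  have "F (x, f x - e x) < 0"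
  proof -
   have "\<theta> x \<le> - poly (P x) (f x - e x)" by (simp add: \<theta>_def)
   moreover have "\<bar>F (x, f x - e x) - poly (P x) (f x - e x)\<bar> < \<theta> x"
    using in1(1) by (intro est) (auto simp: U_def)
   ultimately show ?thesis by linarith
  qed
  then have "f x - e x < g x" using g(3)[OF in1(1)] by simp
  moreover have "F (x, f x + e x) > 0"
  proof -
   have "\<theta> x \<le> poly (P x) (f x + e x)" by (simp add: \<theta>_def)
   moreover have "\<bar>F (x, f x + e x) - poly (P x) (f x + e x)\<bar> < \<theta> x"
    using in1(2) by (intro est) (auto simp: U_def)
   ultimately show ?thesis by linarith
  qed
  then have "\<not> f x + e x < g x" using g(3)[OF in1(2)] by simp
  ultimately show ?thesis using e[OF x] unfolding abs_le_iff by linarith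
 qed
 then show "\<exists>h. nash_on UNIV h \<and> (\<forall>x\<in>C. \<bar>h x - f x\<bar> \<le> wt k x)" using g(1) by blast
qed

section \<open>Adjacent roots and Nash barriers\<close>

lemma poly_nonroot_sign:
 fixes p :: "real poly"
 assumes "\<And>z. min u v \<le> z \<Longrightarrow> z \<le> max u v \<Longrightarrow> poly p z \<noteq> 0"
 shows "sgn (poly p u) = sgn (poly p v)"
proof -
 have main: "sgn (poly p s) = sgn (poly p t)" if "s < t" "\<And>z. s \<le> z \<Longrightarrow> z \<le> t \<Longrightarrow> poly p z \<noteq> 0" for s t
 proof (rule ccontr)
  assume ne: "sgn (poly p s) \<noteq> sgn (poly p t)"
  have "poly p s \<noteq> 0" "poly p t \<noteq> 0" using that by auto
  then have "poly p s * poly p t < 0"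
   using ne by (auto simp: sgn_if mult_less_0_iff split: if_splits)
  then show False using poly_IVT[OF that(1), of p] that(2) by (meson less_imp_le)
 qed
 consider "u < v" | "u = v" | "v < u" by linarith
 then show ?thesis
 proof cases
  case 1
  then show ?thesis by (intro main assms) auto
 next
  case 3
  then show ?thesis by (intro main[symmetric] assms) auto
 qed simp
qed

text \<open>For \<open>\<sigma> = 1\<close> this is the nearest root strictly above the graph of
  \<open>f\<close>, for \<open>\<sigma> = -1\<close> the nearest one strictly below.\<close>

definition next_root :: "('a \<Rightarrow> real poly) \<Rightarrow> ('a \<Rightarrow> real) \<Rightarrow> real \<Rightarrow> 'a \<Rightarrow> real \<Rightarrow> bool" where
 "next_root R f \<sigma> x y \<longleftrightarrow> poly (R x) y = 0 \<and> 0 < \<sigma> * (y - f x) \<and>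
   (\<forall>t. poly (R x) t = 0 \<longrightarrow> 0 < \<sigma> * (t - f x) \<longrightarrow> \<sigma> * (y - f x) \<le> \<sigma> * (t - f x))"

lemma next_root_unique:
 "\<sigma> \<noteq> 0 \<Longrightarrow> next_root R f \<sigma> x y \<Longrightarrow> next_root R f \<sigma> x z \<Longrightarrow> y = z"
proof -
 assume "\<sigma> \<noteq> 0" and n: "next_root R f \<sigma> x y" "next_root R f \<sigma> x z"
 then have "\<sigma> * (y - f x) = \<sigma> * (z - f x)" unfolding next_root_def by (meson antisym)
 then show "y = z" using \<open>\<sigma> \<noteq> 0\<close> by simp
qed

lemma next_root_exists:
 assumes "R x \<noteq> 0" "poly (R x) t = 0" "0 < \<sigma> * (t - f x)"
 shows "\<exists>y. next_root R f \<sigma> x y"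
proof -
 let ?Z = "{t. poly (R x) t = 0 \<and> 0 < \<sigma> * (t - f x)}"
 have fin: "finite ?Z" using poly_roots_finite[OF assms(1)] by (rule rev_finite_subset) auto
 have "t \<in> ?Z" using assms by simp
 then obtain y where "y \<in> ?Z" "\<forall>z\<in>?Z. \<sigma> * (y - f x) \<le> \<sigma> * (z - f x)"
  using ex_is_arg_min_if_finite[OF fin, of "\<lambda>t. \<sigma> * (t - f x)"] unfolding is_arg_min_linorder by blast
 then show ?thesis unfolding next_root_def by blast
qed

definition next_root_fun :: "('a \<Rightarrow> real poly) \<Rightarrow> ('a \<Rightarrow> real) \<Rightarrow> real \<Rightarrow> 'a \<Rightarrow> real" where
 "next_root_fun R f \<sigma> x = (if \<exists>y. next_root R f \<sigma> x y then THE y. next_root R f \<sigma> x y else 0)"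

lemma next_root_fun:
 assumes "\<sigma> \<noteq> 0" "\<exists>y. next_root R f \<sigma> x y" shows "next_root R f \<sigma> x (next_root_fun R f \<sigma> x)"
proof -
 obtain y where y: "next_root R f \<sigma> x y" using assms(2) by blast
 then have "(THE y. next_root R f \<sigma> x y) = y"
  by (rule the_equality) (rule next_root_unique[OF assms(1) _ y])
 then show ?thesis using y by (auto simp: next_root_fun_def)
qed

lemma semialgebraic_next_root:
 fixes R :: "'a::euclidean_space \<Rightarrow> real poly"
 assumes R: "R \<in> pdeg n" and f: "sa_fun f"
 shows "semialgebraic {z. next_root R f \<sigma> (fst z) (snd z)}" "semialgebraic {x. \<exists>y. next_root R f \<sigma> x y}"
proof -
 show *: "semialgebraic {z. next_root R f \<sigma> (fst z) (snd z)}"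
  unfolding next_root_def
  by (intro sa_intros pdeg_eval_sa_fun[OF R] sa_fun_compose[OF f])
 show "semialgebraic {x. \<exists>y. next_root R f \<sigma> x y}"
  by (rule semialgebraic_ex[OF *])
qed

lemma sa_fun_next_root:
 fixes R :: "'a::euclidean_space \<Rightarrow> real poly"
 assumes R: "R \<in> pdeg n" and f: "sa_fun f" and \<sigma>: "\<sigma> \<noteq> 0"
 shows "sa_fun (next_root_fun R f \<sigma>)"
proof (rule sa_funI[where R="\<lambda>x y. next_root R f \<sigma> x y \<or> (\<not> (\<exists>y. next_root R f \<sigma> x y) \<and> y = 0)"])
 have "semialgebraic {z::'a \<times> real. \<exists>y. next_root R f \<sigma> (fst z) y}"
  by (rule semialgebraic_sa_fun[OF semialgebraic_next_root(2)[OF R f] sa_fun_fst[OF sa_fun_id]])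
 then show "semialgebraic {z. next_root R f \<sigma> (fst z) (snd z) \<or> (\<not> (\<exists>y. next_root R f \<sigma> (fst z) y) \<and> snd z = 0)}"
  by (intro semialgebraic_disj semialgebraic_conj[OF semialgebraic_neg] semialgebraic_next_root(1)[OF R f]
    semialgebraic_eq sa_fun_snd sa_fun_id sa_fun_const)
 show "(next_root R f \<sigma> x y \<or> (\<not> (\<exists>y. next_root R f \<sigma> x y) \<and> y = 0)) = (y = next_root_fun R f \<sigma> x)" for x y
  using next_root_fun[OF \<sigma>, of R f x] next_root_unique[OF \<sigma>, of R f x y] by (auto simp: next_root_fun_def)
qed

text \<open>Between the graph of \<open>f\<close> and the graph of \<open>\<alpha>\<close> there is no root of \<open>R\<close>; \<open>\<sigma> = \<plusminus>1\<close> is the side.\<close>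
lemma nash_barrier:
 fixes C :: "'a::euclidean_space set"
 assumes C: "closed C" "semialgebraic C" and R: "R \<in> pdeg n" and f: "sa_fun f" "continuous_on C f" and \<sigma>: "\<sigma> \<in> {1, -1}"
  and nz: "\<And>x. x \<in> C \<Longrightarrow> R x \<noteq> 0 \<and> poly (R x) (f x) \<noteq> 0"
  and alt: "(\<forall>x\<in>C. \<exists>y. next_root R f \<sigma> x y) \<and> continuous_on C (next_root_fun R f \<sigma>) \<and> approximable C (next_root_fun R f \<sigma>)
   \<or> (\<forall>x\<in>C. \<not> (\<exists>y. next_root R f \<sigma> x y))"
 obtains \<alpha> where "nash_on UNIV \<alpha>" "\<And>x. x \<in> C \<Longrightarrow> 0 < \<sigma> * (\<alpha> x - f x)"
  "\<And>x t. x \<in> C \<Longrightarrow> 0 \<le> \<sigma> * (t - f x) \<Longrightarrow> \<sigma> * (t - f x) \<le> \<sigma> * (\<alpha> x - f x) \<Longrightarrow> poly (R x) t \<noteq> 0"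
proof -
 have \<sigma>0: "\<sigma> \<noteq> 0" "\<sigma> * \<sigma> = 1" using \<sigma> by auto
 have f0: "poly (R x) t \<noteq> 0" if "x \<in> C" "\<sigma> * (t - f x) = 0" for x t
  using nz[OF that(1)] that(2) \<sigma>0 by simp
 define a where "a = next_root_fun R f \<sigma>"
 from alt show thesis
 proof (elim disjE conjE)
  assume ex: "\<forall>x\<in>C. \<exists>y. next_root R f \<sigma> x y" and ca: "continuous_on C (next_root_fun R f \<sigma>)"
   and ap: "approximable C (next_root_fun R f \<sigma>)"
  have a: "next_root R f \<sigma> x (a x)" if "x \<in> C" for x
   unfolding a_def by (rule next_root_fun[OF \<sigma>0(1)]) (use ex that in blast)
  have "continuous_on C (\<lambda>x. \<sigma> * (a x - f x))" using ca f(2) unfolding a_def by (intro continuous_intros)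
  moreover have "sa_fun (\<lambda>x. \<sigma> * (a x - f x))"
   unfolding a_def by (intro sa_intros f(1) sa_fun_next_root[OF R f(1) \<sigma>0(1)])
  moreover have "0 < \<sigma> * (a x - f x)" if "x \<in> C" for x using a[OF that] by (simp add: next_root_def)
  ultimately obtain j where j: "j \<ge> 1" "\<And>x. x \<in> C \<Longrightarrow> wt j x \<le> \<sigma> * (a x - f x)"
   using lojasiewicz_continuous[OF C, of "\<lambda>x. \<sigma> * (a x - f x)"] by metis
  \<comment> \<open>The distance from \<open>f\<close> to the next root is then at least
    \<open>4 * wt i\<close>. Shifting an approximation \<open>h\<close> of that root by
    \<open>2 * wt i\<close> towards \<open>f\<close> puts it strictly in between, whatever the sign
    of its error.\<close>
  define i where "i = 4 * j"
  have i: "i \<ge> 1" "4 * wt i x \<le> wt j x" "wt i x > 0" for x :: 'a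
   using j(1) wt_scale[of 4 j x] wt_pos[of i x] by (auto simp: i_def)
  obtain h where h: "nash_on UNIV h" "\<And>x. x \<in> C \<Longrightarrow> \<bar>h x - a x\<bar> \<le> wt i x"
   using ap i(1) unfolding approximable_def a_def by blast
  define \<alpha> where "\<alpha> x = h x - 2 * \<sigma> * wt i x" for x
  have eq: "\<sigma> * (\<alpha> x - f x) = \<sigma> * (a x - f x) + \<sigma> * (h x - a x) - 2 * wt i x" for x
  proof -
   have "\<sigma> * (\<alpha> x - f x) = \<sigma> * (a x - f x) + \<sigma> * (h x - a x) - 2 * (\<sigma> * \<sigma>) * wt i x"
    by (simp add: \<alpha>_def algebra_simps)
   then show ?thesis using \<sigma>0(2) by simp
  qed
  have hb: "\<sigma> * (h x - a x) \<le> wt i x" "- (\<sigma> * (h x - a x)) \<le> wt i x" if "x \<in> C" for x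
   using h(2)[OF that] \<sigma> by (auto simp: abs_le_iff)
  have pos: "0 < \<sigma> * (\<alpha> x - f x)" and less: "\<sigma> * (\<alpha> x - f x) < \<sigma> * (a x - f x)" if "x \<in> C" for x
   using hb[OF that] i(2,3)[of x] j(2)[OF that] unfolding eq by (linarith | argo)+
  show thesis
  proof (rule that[of \<alpha>])
   show "nash_on UNIV \<alpha>" unfolding \<alpha>_def[abs_def] by (intro nash_intros h(1) nash_on_wt i(1) open_UNIV)
   show "poly (R x) t \<noteq> 0" if "x \<in> C" "0 \<le> \<sigma> * (t - f x)" "\<sigma> * (t - f x) \<le> \<sigma> * (\<alpha> x - f x)" for x t
   proof
    assume z: "poly (R x) t = 0"
    then have "\<sigma> * (t - f x) \<noteq> 0" using f0[OF that(1), of t] by blast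
    then have "0 < \<sigma> * (t - f x)" using that(2) by linarith
    then have "\<sigma> * (a x - f x) \<le> \<sigma> * (t - f x)" using a[OF that(1)] z unfolding next_root_def by blast
    then show False using less[OF that(1)] that(3) by linarith
   qed
  qed (rule pos)
 next
  assume no: "\<forall>x\<in>C. \<not> (\<exists>y. next_root R f \<sigma> x y)"
  obtain j where j: "j \<ge> 1" "\<And>x. x \<in> C \<Longrightarrow> \<bar>f x\<bar> * wt j x \<le> 1"
   using sa_fun_polynomial_bound[OF C f] by blast
  \<comment> \<open>With no root on this side, any Nash function beyond \<open>f\<close> will do,
    and \<open>1 / wt j\<close> dominates \<open>\<bar>f\<bar>\<close>.\<close>
  define \<alpha> where "\<alpha> x = \<sigma> * (1 / wt j x + 1)" for x :: 'a
  have wj: "wt j x > 0" for x :: 'a by (rule wt_pos[OF j(1)])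
  show thesis
  proof (rule that[of \<alpha>])
   show "nash_on UNIV \<alpha>" unfolding \<alpha>_def[abs_def]
    by (intro nash_intros nash_on_wt j(1) open_UNIV) (use wj less_imp_neq in metis)
   fix x assume x: "x \<in> C"
   have "\<bar>f x\<bar> \<le> 1 / wt j x" using j(2)[OF x] wj[of x] by (simp add: field_simps)
   moreover have "\<sigma> * (\<alpha> x - f x) = (\<sigma> * \<sigma>) * (1 / wt j x + 1) - \<sigma> * f x" by (simp add: \<alpha>_def algebra_simps)
   moreover have "\<sigma> * f x \<le> \<bar>f x\<bar>" using \<sigma> by auto
   ultimately show "0 < \<sigma> * (\<alpha> x - f x)" using \<sigma>0(2) by simp
   show "poly (R x) t \<noteq> 0" if "0 \<le> \<sigma> * (t - f x)" for t
   proof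
    assume z: "poly (R x) t = 0"
    then have "\<sigma> * (t - f x) \<noteq> 0" using f0[OF x, of t] by blast
    then have "0 < \<sigma> * (t - f x)" using that by linarith
    then show False using next_root_exists[of R x t \<sigma> f] z nz[OF x] no x by blast
   qed
  qed
 qed
qed

text \<open>Induction on the degree bound, on pieces where the relevant signs are constant. If the
  leading coefficient vanishes, or if \<open>f\<close> is also a root of the derivative, the degree
  drops. Otherwise the roots of the derivative next to \<open>f\<close> are continuous by Thom's
  lemma and approximable by induction. They give barriers between which \<open>P\<close> is strictly
  monotone, and \<open>approximable_box\<close> applies.\<close>

lemma approximable_root:
 fixes S :: "'a::euclidean_space set"
 shows "P \<in> pdeg d \<Longrightarrow> closed S \<Longrightarrow> semialgebraic S \<Longrightarrow> sa_fun f \<Longrightarrow> continuous_on S f \<Longrightarrow>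
  (\<And>x. x \<in> S \<Longrightarrow> P x \<noteq> 0 \<and> poly (P x) (f x) = 0) \<Longrightarrow> approximable S f"
proof (induction d arbitrary: P S f)
 case 0
 have "S = {}"
 proof (rule equals0I)
  fix x assume x: "x \<in> S"
  obtain c where "P x = [:c:]" using pdeg_degree[OF 0(1), of x] by (auto elim: degree_eq_zeroE)
  then show False using 0(6)[OF x] by auto
 qed
 then show ?case by (simp add: approximable_empty)
next
 case (Suc d)
 note P = Suc.prems(1) and S = Suc.prems(2,3) and f = Suc.prems(4,5)
 define R where "R x = pderiv (P x)" for x
 have R: "R \<in> pdeg d" using pdeg_pderiv[OF P] by (simp add: R_def[abs_def])
 let ?a = "\<lambda>\<sigma>. next_root_fun R f \<sigma>"
 let ?D = "\<lambda>k \<sigma> x. poly ((pderiv ^^ k) (R x)) (?a \<sigma> x)"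
 \<comment> \<open>The conditions to be made constant: vanishing of the leading coefficient, sign of
   the derivative \<open>R\<close> at \<open>f\<close>, existence of the adjacent roots of
   \<open>R\<close>, and the signs of all derivatives of \<open>R\<close> there. A negative sign is
   what remains when the value is neither positive nor zero.\<close>
 define \<X> where "\<X> = {{x. coeff (P x) (Suc d) = 0}, {x. poly (R x) (f x) = 0}, {x. 0 < poly (R x) (f x)}}
   \<union> (\<lambda>\<sigma>. {x. \<exists>y. next_root R f \<sigma> x y}) ` {1, -1}
   \<union> (\<lambda>(\<sigma>, k). {x. 0 < ?D k \<sigma> x}) ` ({1, -1} \<times> {..d}) \<union> (\<lambda>(\<sigma>, k). {x. ?D k \<sigma> x = 0}) ` ({1, -1} \<times> {..d})"
 have "finite \<X>" unfolding \<X>_def by (intro finite_UnI finite_imageI finite_cartesian_product) auto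
 then obtain Xs where Xs: "set Xs = \<X>" using finite_list by blast
 have Xs_sa: "semialgebraic X" if "X \<in> set Xs" for X
 proof -
  have sD: "sa_fun (\<lambda>x. ?D k \<sigma> x)" if "\<sigma> \<noteq> 0" for k \<sigma>
   by (rule pdeg_eval_sa_fun[OF pdeg_pderiv_funpow[OF R] sa_fun_id sa_fun_next_root[OF R f(1) that]])
  have "semialgebraic {x. coeff (P x) (Suc d) = 0}" by (rule semialgebraic.zero[OF pdeg_coeff[OF P]])
  moreover have sR: "sa_fun (\<lambda>x. poly (R x) (f x))" by (rule pdeg_eval_sa_fun[OF R sa_fun_id f(1)])
  moreover have "semialgebraic {x. poly (R x) (f x) = 0}" "semialgebraic {x. 0 < poly (R x) (f x)}"
   by (intro semialgebraic_eq semialgebraic_less sa_fun_const sR)+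
  moreover have "semialgebraic {x. \<exists>y. next_root R f \<sigma> x y}" for \<sigma>
   by (rule semialgebraic_next_root(2)[OF R f(1)])
  moreover have "semialgebraic {x. 0 < ?D k \<sigma> x}" "semialgebraic {x. ?D k \<sigma> x = 0}" if "\<sigma> \<noteq> 0" for k \<sigma>
   by (intro semialgebraic_eq semialgebraic_less sa_fun_const sD[OF that])+
  ultimately show ?thesis using that unfolding Xs \<X>_def by fastforce
 qed
 show ?case
 proof (rule approximable_stratify[OF S f Xs_sa])
  fix C assume C: "closed C" "semialgebraic C" and CS: "C \<subseteq> S" and ne: "C \<noteq> {}"
   and hom: "\<And>X. X \<in> set Xs \<Longrightarrow> C \<subseteq> X \<or> C \<inter> X = {}"
  have fC: "continuous_on C f" using continuous_on_subset[OF f(2) CS] .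
  have PC: "P x \<noteq> 0" "poly (P x) (f x) = 0" if "x \<in> C" for x using Suc.prems(6) that CS by blast+
  have hom1: "C \<subseteq> {x. coeff (P x) (Suc d) = 0} \<or> C \<inter> {x. coeff (P x) (Suc d) = 0} = {}"
   "C \<subseteq> {x. poly (R x) (f x) = 0} \<or> C \<inter> {x. poly (R x) (f x) = 0} = {}"
   "C \<subseteq> {x. 0 < poly (R x) (f x)} \<or> C \<inter> {x. 0 < poly (R x) (f x)} = {}"
   by (rule hom, unfold Xs \<X>_def, blast)+
  have homE: "C \<subseteq> {x. \<exists>y. next_root R f \<sigma> x y} \<or> C \<inter> {x. \<exists>y. next_root R f \<sigma> x y} = {}" if "\<sigma> \<in> {1, -1}" for \<sigma>
   by (rule hom) (unfold Xs \<X>_def, use that in blast)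
  have mem: "{x. 0 < ?D k \<sigma> x} \<in> \<X>" "{x. ?D k \<sigma> x = 0} \<in> \<X>" if "\<sigma> \<in> {1, -1}" "k \<le> d" for \<sigma> k
  proof -
   have "(\<sigma>, k) \<in> {1, -1} \<times> {..d}" using that by blast
   from imageI[OF this, of "\<lambda>(\<sigma>, k). {x. 0 < ?D k \<sigma> x}"] imageI[OF this, of "\<lambda>(\<sigma>, k). {x. ?D k \<sigma> x = 0}"]
   show "{x. 0 < ?D k \<sigma> x} \<in> \<X>" "{x. ?D k \<sigma> x = 0} \<in> \<X>" unfolding \<X>_def by (simp_all only: case_prod_conv, blast+)
  qed
  have homD: "C \<subseteq> {x. 0 < ?D k \<sigma> x} \<or> C \<inter> {x. 0 < ?D k \<sigma> x} = {}"
   "C \<subseteq> {x. ?D k \<sigma> x = 0} \<or> C \<inter> {x. ?D k \<sigma> x = 0} = {}" if "\<sigma> \<in> {1, -1}" "k \<le> d" for \<sigma> k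
   using hom[unfolded Xs] mem[OF that] by blast+
  show "approximable C f"
  proof (cases "C \<subseteq> {x. coeff (P x) (Suc d) = 0}")
   case True
   then have "P x - monom (coeff (P x) (Suc d)) (Suc d) = P x" if "x \<in> C" for x using that by auto
   then show ?thesis
    using Suc.IH[OF pdeg_truncate[OF P] C f(1) fC] PC by auto
  next
   case False
   then have lead: "coeff (P x) (Suc d) \<noteq> 0" if "x \<in> C" for x using hom1(1) that by blast
   then have leadR: "coeff (R x) d \<noteq> 0" if "x \<in> C" for x using that by (simp add: R_def coeff_pderiv)
   then have R0: "R x \<noteq> 0" if "x \<in> C" for x using that by fastforce
   show ?thesis
   proof (cases "C \<subseteq> {x. poly (R x) (f x) = 0}")
    case True
    then show ?thesis using Suc.IH[OF R C f(1) fC] R0 by blast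
   next
    case False
    then have nz: "poly (R x) (f x) \<noteq> 0" if "x \<in> C" for x using hom1(2) that by blast
    have barrier: "\<exists>\<alpha>. nash_on UNIV \<alpha> \<and> (\<forall>x\<in>C. 0 < \<sigma> * (\<alpha> x - f x)) \<and>
      (\<forall>x\<in>C. \<forall>t. 0 \<le> \<sigma> * (t - f x) \<longrightarrow> \<sigma> * (t - f x) \<le> \<sigma> * (\<alpha> x - f x) \<longrightarrow> poly (R x) t \<noteq> 0)"
     if \<sigma>: "\<sigma> \<in> {1, -1}" for \<sigma>
    proof -
     have \<sigma>0: "\<sigma> \<noteq> 0" using \<sigma> by auto
     have alt: "(\<forall>x\<in>C. \<exists>y. next_root R f \<sigma> x y) \<and> continuous_on C (?a \<sigma>) \<and> approximable C (?a \<sigma>)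
       \<or> (\<forall>x\<in>C. \<not> (\<exists>y. next_root R f \<sigma> x y))"
     proof (cases "C \<subseteq> {x. \<exists>y. next_root R f \<sigma> x y}")
      case True
      have a: "next_root R f \<sigma> x (?a \<sigma> x)" if "x \<in> C" for x
       by (rule next_root_fun[OF \<sigma>0]) (use True that in blast)
      have root: "poly (R x) (?a \<sigma> x) = 0" if "x \<in> C" for x using a[OF that] by (simp add: next_root_def)
      have "sgn (?D k \<sigma> x) = sgn (?D k \<sigma> x')" if "x \<in> C" "x' \<in> C" for k x x'
      proof (cases "k \<le> d")
       case kd: True
       consider "C \<subseteq> {x. 0 < ?D k \<sigma> x}" | "C \<subseteq> {x. ?D k \<sigma> x = 0}"
        | "C \<inter> {x. 0 < ?D k \<sigma> x} = {}" "C \<inter> {x. ?D k \<sigma> x = 0} = {}"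
        using homD[OF \<sigma> kd] by blast
       then show ?thesis
       proof cases
        case 1
        then have "0 < ?D k \<sigma> x" "0 < ?D k \<sigma> x'" using that by blast+
        then show ?thesis by simp
       next
        case 2
        then have "?D k \<sigma> x = 0" "?D k \<sigma> x' = 0" using that by blast+
        then show ?thesis by simp
       next
        case 3
        have "?D k \<sigma> y < 0" if "y \<in> C" for y
        proof -
         have "\<not> 0 < ?D k \<sigma> y" "?D k \<sigma> y \<noteq> 0" using 3 that by blast+
         then show ?thesis by linarith
        qed
        then have "?D k \<sigma> x < 0" "?D k \<sigma> x' < 0" using that by blast+
        then show ?thesis by simp
       qed
      next
       case False
       then have "(pderiv ^^ k) (R y) = 0" for y using pdeg_degree[OF R, of y] by (intro pderiv_funpow_eq_0) simp
       then show ?thesis by simp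
      qed
      then have "continuous_on C (?a \<sigma>)"
       by (intro thom_root_continuous[OF R leadR root])
      moreover from this have "approximable C (?a \<sigma>)"
       using Suc.IH[OF R C sa_fun_next_root[OF R f(1) \<sigma>0]] R0 root by blast
      ultimately show ?thesis using True by blast
     next
      case False
      then show ?thesis using homE[OF \<sigma>] by blast
     qed
     have nz': "R x \<noteq> 0 \<and> poly (R x) (f x) \<noteq> 0" if "x \<in> C" for x using R0[OF that] nz[OF that] ..
     show ?thesis
     proof (rule nash_barrier[OF C R f(1) fC \<sigma> _ alt])
      fix \<alpha> assume "nash_on UNIV \<alpha>" "\<And>x. x \<in> C \<Longrightarrow> 0 < \<sigma> * (\<alpha> x - f x)"
       "\<And>x t. x \<in> C \<Longrightarrow> 0 \<le> \<sigma> * (t - f x) \<Longrightarrow> \<sigma> * (t - f x) \<le> \<sigma> * (\<alpha> x - f x) \<Longrightarrow> poly (R x) t \<noteq> 0"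
      then show ?thesis by (intro exI[of _ \<alpha>] conjI ballI allI impI)
     qed (rule nz')
    qed
    obtain \<alpha> where \<alpha>: "nash_on UNIV \<alpha>" "\<And>x. x \<in> C \<Longrightarrow> \<alpha> x < f x"
     "\<And>x t. x \<in> C \<Longrightarrow> \<alpha> x \<le> t \<Longrightarrow> t \<le> f x \<Longrightarrow> poly (R x) t \<noteq> 0"
    proof -
     obtain \<alpha> where \<alpha>: "nash_on UNIV \<alpha>" "\<forall>x\<in>C. 0 < - 1 * (\<alpha> x - f x)"
      "\<forall>x\<in>C. \<forall>t. 0 \<le> - 1 * (t - f x) \<longrightarrow> - 1 * (t - f x) \<le> - 1 * (\<alpha> x - f x) \<longrightarrow> poly (R x) t \<noteq> 0"
      using barrier[of "-1"] by blast
     show thesis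
     proof (rule that[OF \<alpha>(1)])
      show "\<alpha> x < f x" if "x \<in> C" for x using \<alpha>(2)[rule_format, OF that] by simp
      show "poly (R x) t \<noteq> 0" if "x \<in> C" "\<alpha> x \<le> t" "t \<le> f x" for x t
       using \<alpha>(3)[rule_format, OF that(1), of t] that(2,3) by simp
     qed
    qed
    obtain \<beta> where \<beta>: "nash_on UNIV \<beta>" "\<And>x. x \<in> C \<Longrightarrow> f x < \<beta> x"
     "\<And>x t. x \<in> C \<Longrightarrow> f x \<le> t \<Longrightarrow> t \<le> \<beta> x \<Longrightarrow> poly (R x) t \<noteq> 0"
    proof -
     obtain \<beta> where \<beta>: "nash_on UNIV \<beta>" "\<forall>x\<in>C. 0 < 1 * (\<beta> x - f x)"
      "\<forall>x\<in>C. \<forall>t. 0 \<le> 1 * (t - f x) \<longrightarrow> 1 * (t - f x) \<le> 1 * (\<beta> x - f x) \<longrightarrow> poly (R x) t \<noteq> 0"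
      using barrier[of 1] by blast
     show thesis
     proof (rule that[OF \<beta>(1)])
      show "f x < \<beta> x" if "x \<in> C" for x using \<beta>(2)[rule_format, OF that] by simp
      show "poly (R x) t \<noteq> 0" if "x \<in> C" "f x \<le> t" "t \<le> \<beta> x" for x t
       using \<beta>(3)[rule_format, OF that(1), of t] that(2,3) by simp
     qed
    qed
    have sgR: "sgn (poly (R x) t) = sgn (poly (R x) (f x))" if "x \<in> C" "\<alpha> x \<le> t" "t \<le> \<beta> x" for x t
    proof (rule poly_nonroot_sign)
     fix z assume "min t (f x) \<le> z" "z \<le> max t (f x)"
     then show "poly (R x) z \<noteq> 0"
      using \<alpha>(2,3)[OF that(1)] \<beta>(2,3)[OF that(1)] that(2,3) by (cases "z \<le> f x") auto
    qed
    show ?thesis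
    proof (cases "C \<subseteq> {x. 0 < poly (R x) (f x)}")
     case True
     show ?thesis
     proof (rule approximable_box[OF C P f(1) fC PC(2) \<alpha>(1) \<beta>(1)])
      show "0 < poly (pderiv (P x)) t" if "x \<in> C" "\<alpha> x \<le> t" "t \<le> \<beta> x" for x t
      proof -
       have "0 < poly (R x) (f x)" using True that(1) by blast
       then have "sgn (poly (R x) t) = 1" using sgR[OF that] by simp
       then show ?thesis by (simp add: R_def sgn_1_pos)
      qed
     qed (use \<alpha>(2) \<beta>(2) in auto)
    next
     case False
     then have neg: "poly (R x) (f x) < 0" if "x \<in> C" for x
     proof -
      have "\<not> 0 < poly (R x) (f x)" using False hom1(3) that by blast
      then show ?thesis using nz[OF that] by linarith
     qed
     show ?thesis
     \<comment> \<open>A decreasing \<open>P\<close> is replaced by \<open>- P\<close>, which has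
       the same roots.\<close>
     proof (rule approximable_box[OF C pdeg_uminus[OF P] f(1) fC _ \<alpha>(1) \<beta>(1)])
      show "0 < poly (pderiv (- P x)) t" if "x \<in> C" "\<alpha> x \<le> t" "t \<le> \<beta> x" for x t
      proof -
       have "sgn (poly (R x) t) = -1" using sgR[OF that] neg[OF that(1)] by simp
       then show ?thesis by (simp add: R_def pderiv_minus sgn_1_neg)
      qed
     qed (use \<alpha>(2) \<beta>(2) PC(2) in auto)
    qed
   qed
  qed
 qed
qed

text \<open>At each \<open>x\<close> the value \<open>f x\<close> is a root of some polynomial from
  a finite list, but of which one may depend on \<open>x\<close>. On a piece that is homogeneous for
  the sets where a given polynomial serves, one choice is valid throughout.\<close>

theorem approximable_sa_fun:
 fixes S :: "'a::euclidean_space set"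
 assumes S: "closed S" "semialgebraic S" and f: "sa_fun f" "continuous_on S f"
 shows "approximable S f"
proof -
 obtain L where L0: "set L \<subseteq> (\<Union>n. pdeg n)" "determined_by {z. snd z = f (fst z)} L"
  using semialgebraic_determined[OF f(1)[unfolded sa_fun_def]] by blast
 obtain n where L: "set L \<subseteq> pdeg n" using pdeg_list_bound[OF L0(1)] by blast
 let ?X = "\<lambda>q. {x. q x \<noteq> 0 \<and> poly (q x) (f x) = 0}"
 show ?thesis
 proof (rule approximable_stratify[OF S f, where Xs="map ?X L"])
  fix X assume "X \<in> set (map ?X L)"
  then obtain q where q: "q \<in> pdeg n" "X = ?X q" using L by auto
  show "semialgebraic X" unfolding q(2)
   by (intro semialgebraic_conj semialgebraic_pdeg_nonzero[OF q(1)] semialgebraic_eq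
     pdeg_eval_sa_fun[OF q(1) sa_fun_id f(1)] sa_fun_const)
 next
  fix C assume C: "closed C" "semialgebraic C" "C \<subseteq> S" "C \<noteq> {}"
   and hom: "\<And>X. X \<in> set (map ?X L) \<Longrightarrow> C \<subseteq> X \<or> C \<inter> X = {}"
  obtain x where x: "x \<in> C" using C(4) by blast
  have "f x \<in> root_set L x" by (rule graph_root[OF L0(2)]) auto
  then obtain q where q: "q \<in> set L" "q x \<noteq> 0" "poly (q x) (f x) = 0" by (auto simp: root_set_def)
  then have "x \<in> C \<inter> ?X q" using x by simp
  then have sub: "C \<subseteq> ?X q" using hom[of "?X q"] q(1) by auto
  show "approximable C f"
   by (rule approximable_root[OF _ C(1,2) f(1) continuous_on_subset[OF f(2) C(3)], of q n]) (use q(1) L sub in auto)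
 qed
qed

section \<open>The nearest point retraction\<close>

text \<open>Equivalently, \<open>|y - q|\<^sup>2 \<ge> |y - p|\<^sup>2 + |q - p|\<^sup>2 / 2\<close> for all \<open>q\<close> in \<open>M\<close>: this makes nearest points unique
 and Lipschitz in \<open>y\<close>, and second derivatives along \<open>M\<close> definite.\<close>
definition near_pt :: "'a::euclidean_space set \<Rightarrow> 'a \<Rightarrow> 'a \<Rightarrow> bool" where
 "near_pt M y p \<longleftrightarrow> p \<in> M \<and> (\<forall>q\<in>M. (y - p) \<bullet> (q - p) \<le> (q - p) \<bullet> (q - p) / 4)"

lemma near_pt_self: "p \<in> M \<Longrightarrow> near_pt M p p"
 by (simp add: near_pt_def)

text \<open>Adding the two defining inequalities gives
  \<open>d \<bullet> d \<le> 2 * ((y' - y) \<bullet> d)\<close> for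
  \<open>d = p' - p\<close>.\<close>

lemma near_pt_lipschitz:
 assumes "near_pt M y p" "near_pt M y' p'" shows "dist p p' \<le> 2 * dist y y'"
proof -
 define d where "d = p' - p"
 have "(y - p) \<bullet> d \<le> d \<bullet> d / 4" using assms by (auto simp: near_pt_def d_def)
 moreover have "(y' - p') \<bullet> (p - p') \<le> (p - p') \<bullet> (p - p') / 4" using assms by (auto simp: near_pt_def)
 then have "- ((y' - p') \<bullet> d) \<le> d \<bullet> d / 4"
  by (simp add: d_def inner_diff_left inner_diff_right inner_commute algebra_simps)
 ultimately have "(y - p) \<bullet> d - (y' - p') \<bullet> d \<le> d \<bullet> d / 2" by argo
 moreover have "(y - p) \<bullet> d - (y' - p') \<bullet> d = d \<bullet> d - (y' - y) \<bullet> d"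
  by (simp add: d_def inner_diff_left inner_diff_right algebra_simps)
 ultimately have "d \<bullet> d \<le> 2 * ((y' - y) \<bullet> d)" by argo
 also have "\<dots> \<le> 2 * (norm (y' - y) * norm d)" using norm_cauchy_schwarz[of "y' - y" d] by simp
 finally have "norm d * norm d \<le> (2 * norm (y' - y)) * norm d"
  by (simp add: power2_norm_eq_inner[symmetric] power2_eq_square mult_ac)
 then have "norm d \<le> 2 * norm (y' - y)"
  by (cases "norm d = 0") (auto simp: mult_le_cancel_right)
 then show ?thesis by (simp add: d_def dist_norm norm_minus_commute)
qed

text \<open>The interior is taken to have an open domain of smoothness; for a submanifold it still
  contains \<open>M\<close>.\<close>

definition retract_dom :: "'a::euclidean_space set \<Rightarrow> 'a set" where
 "retract_dom M = interior {y. \<exists>p. near_pt M y p}"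

definition retract_map :: "'a::euclidean_space set \<Rightarrow> 'a \<Rightarrow> 'a" where
 "retract_map M y = (if \<exists>p. near_pt M y p then THE p. near_pt M y p else 0)"

lemma near_pt_unique: "near_pt M y p \<Longrightarrow> near_pt M y p' \<Longrightarrow> p = p'"
 using near_pt_lipschitz[of M y p y p'] by simp

lemma retract_map_eq: assumes "near_pt M y p" shows "retract_map M y = p"
proof -
 have "(THE p. near_pt M y p) = p"
  using assms by (rule the_equality) (rule near_pt_unique[OF _ assms])
 then show ?thesis using assms by (auto simp: retract_map_def)
qed

lemma retract_map: "y \<in> retract_dom M \<Longrightarrow> near_pt M y (retract_map M y)"
proof -
 assume "y \<in> retract_dom M"
 then obtain p where "near_pt M y p" unfolding retract_dom_def using interior_subset by blast
 then show ?thesis using retract_map_eq by metis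
qed

lemma semialgebraic_near_pt: "semialgebraic M \<Longrightarrow> semialgebraic {z. near_pt M (fst z) (snd z)}"
 unfolding near_pt_def by (intro sa_intros semialgebraic_mem)

lemma semialgebraic_retract_dom: "semialgebraic M \<Longrightarrow> semialgebraic (retract_dom M)"
 unfolding retract_dom_def by (intro semialgebraic_interior semialgebraic_ex semialgebraic_near_pt)

lemma sa_fun_retract_map:
 fixes M :: "'a::euclidean_space set"
 assumes "semialgebraic M" shows "sa_fun (retract_map M)"
proof (rule sa_funI[where R="\<lambda>y p. near_pt M y p \<or> (\<not> (\<exists>p. near_pt M y p) \<and> p = 0)"])
 note s = semialgebraic_near_pt[OF assms]
 have "semialgebraic {z::'a \<times> 'a. \<exists>p. near_pt M (fst z) p}"
  by (rule semialgebraic_sa_fun[OF semialgebraic_ex[OF s] sa_fun_fst[OF sa_fun_id]])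
 then show "semialgebraic {z. near_pt M (fst z) (snd z) \<or> (\<not> (\<exists>p. near_pt M (fst z) p) \<and> snd z = 0)}"
  by (intro semialgebraic_disj semialgebraic_conj[OF semialgebraic_neg] s
    semialgebraic_eq sa_fun_snd sa_fun_id sa_fun_const)
 show "(near_pt M y p \<or> (\<not> (\<exists>p. near_pt M y p) \<and> p = 0)) = (p = retract_map M y)" for y p
 proof (cases "\<exists>p. near_pt M y p")
  case True
  then obtain p' where p': "near_pt M y p'" by blast
  show ?thesis unfolding retract_map_eq[OF p'] using near_pt_unique p' by blast
 qed (simp add: retract_map_def)
qed

subsection \<open>Charts\<close>

lemma Ck_local_lipschitz:
 fixes f :: "'a::euclidean_space \<Rightarrow> 'b::euclidean_space"
 assumes "Ck (Suc 0) U f" "open U" "x0 \<in> U"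
 obtains r L where "r > 0" "L \<ge> 0" "cball x0 r \<subseteq> U" "\<And>x y. x \<in> cball x0 r \<Longrightarrow> y \<in> cball x0 r \<Longrightarrow> norm (f x - f y) \<le> L * norm (x - y)"
proof -
 obtain r where r: "r > 0" "cball x0 r \<subseteq> U" using assms(2,3) open_contains_cball by blast
 let ?g = "\<lambda>x. \<Sum>b\<in>Basis. norm (\<D> f (at x) b)"
 have "continuous_on (cball x0 r) ?g"
  using assms(1) r(2) by (intro continuous_intros) (auto intro: continuous_on_subset)
 then obtain L where L: "\<And>x. x \<in> cball x0 r \<Longrightarrow> ?g x \<le> L"
  using compact_cball continuous_attains_sup[of "cball x0 r" ?g] r(1) by (metis cball_eq_empty less_le_not_le)
 have "norm (f x - f y) \<le> max L 0 * norm (x - y)" if xy: "x \<in> cball x0 r" "y \<in> cball x0 r" for x y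
 proof (rule differentiable_bound[OF convex_cball _ _ xy])
  fix z assume z: "z \<in> cball x0 r"
  have d: "(f has_derivative \<D> f (at z)) (at z)"
   using Ck_has_derivative[OF assms(1,2)] z r(2) by blast
  then show "(f has_derivative \<D> f (at z)) (at z within cball x0 r)"
   by (rule has_derivative_at_withinI)
  show "onorm (\<D> f (at z)) \<le> max L 0"
  proof (rule onorm_le)
   fix h
   have "norm (\<D> f (at z) h) = norm (\<Sum>b\<in>Basis. (h \<bullet> b) *\<^sub>R \<D> f (at z) b)"
    using linear_basis_expansion[OF has_derivative_linear[OF d], of h] by simp
   also have "\<dots> \<le> (\<Sum>b\<in>Basis. norm h * norm (\<D> f (at z) b))"
    by (rule sum_norm_le) (auto intro!: mult_right_mono Basis_le_norm)
   also have "\<dots> = ?g z * norm h" by (simp add: sum_distrib_left mult.commute)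
   also have "\<dots> \<le> max L 0 * norm h" using L[OF z] by (intro mult_right_mono) auto
   finally show "norm (\<D> f (at z) h) \<le> max L 0 * norm h" .
  qed
 qed
 then show thesis using that[of r "max L 0"] r by simp
qed

text \<open>The derivative is Lipschitz near \<open>x0\<close>, and the mean value inequality on a
  segment turns this into a quadratic remainder, uniform in the base point \<open>x\<close>.\<close>

lemma Ck_quadratic:
 fixes f :: "'a::euclidean_space \<Rightarrow> 'b::euclidean_space"
 assumes "Ck (Suc (Suc 0)) U f" "open U" "x0 \<in> U"
 obtains r K where "r > 0" "K \<ge> 0" "cball x0 r \<subseteq> U"
  "\<And>x y. x \<in> cball x0 r \<Longrightarrow> y \<in> cball x0 r \<Longrightarrow>
    norm (f y - f x - \<D> f (at x) (y - x)) \<le> K * (norm (y - x))\<^sup>2"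
proof -
 have "\<exists>r L. r > 0 \<and> L \<ge> 0 \<and> cball x0 r \<subseteq> U \<and> (\<forall>x\<in>cball x0 r. \<forall>y\<in>cball x0 r.
   norm (\<D> f (at x) b - \<D> f (at y) b) \<le> L * norm (x - y))" if "b \<in> Basis" for b
 proof -
  have "Ck (Suc 0) U (\<lambda>x. \<D> f (at x) b)" using assms(1) that by simp
  from Ck_local_lipschitz[OF this assms(2,3)] show ?thesis by metis
 qed
 then obtain r L where rL: "\<And>b. b \<in> Basis \<Longrightarrow> r b > 0 \<and> L b \<ge> 0 \<and> cball x0 (r b) \<subseteq> U \<and> (\<forall>x\<in>cball x0 (r b). \<forall>y\<in>cball x0 (r b).
   norm (\<D> f (at x) b - \<D> f (at y) b) \<le> L b * norm (x - y))" by metis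
 define s where "s = Min (r ` Basis)"
 have s: "s > 0" "s \<le> r b" if "b \<in> Basis" for b
  using rL that by (auto simp: s_def)
 obtain b0 :: 'a where b0: "b0 \<in> Basis" using nonempty_Basis by blast
 have s0: "s > 0" using s(1)[OF b0] .
 have sU: "cball x0 s \<subseteq> U" using rL[OF b0] s(2)[OF b0] by (meson order_trans subset_cball)
 define K where "K = (\<Sum>b\<in>Basis. L b)"
 have K0: "K \<ge> 0" unfolding K_def using rL by (intro sum_nonneg) auto
 have lip: "norm (\<D> f (at w) h - \<D> f (at z) h) \<le> K * norm (w - z) * norm h"
  if "w \<in> cball x0 s" "z \<in> cball x0 s" for w z h
 proof -
  have lin: "linear (\<D> f (at v))" if "v \<in> cball x0 s" for v
   using has_derivative_linear[OF Ck_has_derivative[OF assms(1,2)]] that sU by blast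
  have "\<D> f (at w) h - \<D> f (at z) h =
   (\<Sum>b\<in>Basis. (h \<bullet> b) *\<^sub>R (\<D> f (at w) b - \<D> f (at z) b))"
   using linear_basis_expansion[OF lin[OF that(1)], of h] linear_basis_expansion[OF lin[OF that(2)], of h]
   by (simp add: scaleR_diff_right sum_subtractf)
  also have "norm \<dots> \<le> (\<Sum>b\<in>Basis. norm h * (L b * norm (w - z)))"
  proof (rule sum_norm_le)
   fix b :: 'a assume b: "b \<in> Basis"
   have "w \<in> cball x0 (r b)" "z \<in> cball x0 (r b)" using that s(2)[OF b] by auto
   then show "norm ((h \<bullet> b) *\<^sub>R (\<D> f (at w) b - \<D> f (at z) b)) \<le> norm h * (L b * norm (w - z))"
    using rL[OF b] Basis_le_norm[OF b, of h] by (auto intro!: mult_mono)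
  qed
  also have "\<dots> = K * norm (w - z) * norm h" by (simp add: K_def sum_distrib_left sum_distrib_right mult_ac)
  finally show ?thesis .
 qed
 have "norm (f y - f x - \<D> f (at x) (y - x)) \<le> K * (norm (y - x))\<^sup>2"
  if xy: "x \<in> cball x0 s" "y \<in> cball x0 s" for x y
 proof -
  let ?g = "\<lambda>w. f w - \<D> f (at x) w"
  have seg: "closed_segment x y \<subseteq> cball x0 s" using xy by (simp add: closed_segment_subset)
  have linx: "bounded_linear (\<D> f (at x))"
   using has_derivative_bounded_linear[OF Ck_has_derivative[OF assms(1,2)]] xy(1) sU by blast
  have "norm (?g y - ?g x) \<le> (K * norm (y - x)) * norm (y - x)"
  proof (rule differentiable_bound[OF convex_closed_segment])
   fix w assume w: "w \<in> closed_segment x y"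
   then have wb: "w \<in> cball x0 s" using seg by blast
   have d: "(f has_derivative \<D> f (at w)) (at w)"
    using Ck_has_derivative[OF assms(1,2)] wb sU by blast
   then show "(?g has_derivative (\<lambda>h. \<D> f (at w) h - \<D> f (at x) h)) (at w within closed_segment x y)"
    by (intro has_derivative_diff has_derivative_at_withinI[OF d] bounded_linear.has_derivative[OF linx has_derivative_ident])
   have nw: "norm (w - x) \<le> norm (y - x)"
    using w segment_bound(1)[of w x y] by (simp add: norm_minus_commute)
   show "onorm (\<lambda>h. \<D> f (at w) h - \<D> f (at x) h) \<le> K * norm (y - x)"
   proof (rule onorm_le)
    fix h
    have "norm (\<D> f (at w) h - \<D> f (at x) h) \<le> K * norm (w - x) * norm h"
     by (rule lip[OF wb xy(1)])
    also have "\<dots> \<le> K * norm (y - x) * norm h"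
     using nw K0 by (intro mult_right_mono mult_left_mono) auto
    finally show "norm (\<D> f (at w) h - \<D> f (at x) h) \<le> K * norm (y - x) * norm h" .
   qed
  qed auto
  moreover have "?g y - ?g x = f y - f x - \<D> f (at x) (y - x)"
   using linear_diff[OF bounded_linear.linear[OF linx], of y x] by (simp add: algebra_simps)
  ultimately show ?thesis by (simp add: power2_eq_square mult_ac)
 qed
 then show thesis using that[OF s0 K0 sU] by blast
qed

definition chart :: "'a::euclidean_space set \<Rightarrow> 'a set \<Rightarrow> 'a set \<Rightarrow> ('a \<Rightarrow> 'a) \<Rightarrow> ('a \<Rightarrow> 'a) \<Rightarrow> 'a set \<Rightarrow> bool" where
 "chart M U V \<phi> \<psi> B \<longleftrightarrow> open U \<and> open V \<and> (\<forall>n. Ck n U \<phi>) \<and> (\<forall>n. Ck n V \<psi>) \<and> \<phi> ` U \<subseteq> V \<and> \<psi> ` V \<subseteq> U \<and>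
   (\<forall>x\<in>U. \<psi> (\<phi> x) = x) \<and> (\<forall>z\<in>V. \<phi> (\<psi> z) = z) \<and> B \<subseteq> Basis \<and> (\<forall>x\<in>U. x \<in> M \<longleftrightarrow> \<phi> x \<in> span B)"

lemma smooth_diffeo_inverse:
 assumes "smooth_diffeo U V \<phi>"
 obtains \<psi> where "open U" "open V" "\<And>n. Ck n U \<phi>" "\<And>n. Ck n V \<psi>" "\<phi> ` U \<subseteq> V" "\<psi> ` V \<subseteq> U"
  "\<And>x. x \<in> U \<Longrightarrow> \<psi> (\<phi> x) = x" "\<And>z. z \<in> V \<Longrightarrow> \<phi> (\<psi> z) = z"
proof -
 obtain \<psi> where \<psi>: "smooth_on V \<psi>" "\<forall>x\<in>U. \<psi> (\<phi> x) = x" "\<forall>y\<in>V. \<phi> (\<psi> y) = y"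
  using assms by (auto simp: smooth_diffeo_def)
 have "\<psi> ` V \<subseteq> U" using \<psi>(2) assms by (auto simp: smooth_diffeo_def)
 then show thesis using that[of \<psi>] \<psi> assms by (auto simp: smooth_diffeo_def smooth_on_iff_Ck)
qed

lemma submanifold_chart:
 assumes "submanifold d M" "p \<in> M"
 obtains U V \<phi> \<psi> B where "chart M U V \<phi> \<psi> B" "p \<in> U" "card B = d"
proof -
 obtain U V \<phi> B where c: "open U" "p \<in> U" "smooth_diffeo U V \<phi>" "B \<subseteq> Basis" "card B = d" "\<phi> ` (M \<inter> U) = V \<inter> span B"
  using assms unfolding submanifold_def by blast
 obtain \<psi> where \<psi>: "open V" "\<And>n. Ck n U \<phi>" "\<And>n. Ck n V \<psi>" "\<phi> ` U \<subseteq> V" "\<psi> ` V \<subseteq> U"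
  "\<And>x. x \<in> U \<Longrightarrow> \<psi> (\<phi> x) = x" "\<And>z. z \<in> V \<Longrightarrow> \<phi> (\<psi> z) = z"
  using smooth_diffeo_inverse[OF c(3)] by metis
 have "x \<in> M \<longleftrightarrow> \<phi> x \<in> span B" if x: "x \<in> U" for x
 proof
  assume "x \<in> M"
  then show "\<phi> x \<in> span B" using c(6) x by blast
 next
  assume "\<phi> x \<in> span B"
  then have "\<phi> x \<in> \<phi> ` (M \<inter> U)" using c(6) \<psi>(4) x by blast
  then obtain x' where "x' \<in> M" "x' \<in> U" "\<phi> x' = \<phi> x" by auto
  then show "x \<in> M" using \<psi>(6) x by metis
 qed
 then have "chart M U V \<phi> \<psi> B" using c(1,4) \<psi> by (auto simp: chart_def)
 then show thesis using that c by blast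
qed

lemma chart_deriv:
 assumes "chart M U V \<phi> \<psi> B" "z \<in> V"
 shows "(\<psi> has_derivative \<D> \<psi> (at z)) (at z)"
 using assms Ck_has_derivative[of 0 V \<psi> z] by (auto simp: chart_def simp del: Ck.simps)

lemma chart_deriv_inj:
 assumes c: "chart M U V \<phi> \<psi> B" "z \<in> V" and z: "\<D> \<psi> (at z) \<zeta> = 0"
 shows "\<zeta> = 0"
proof -
 have V: "open V" and pz: "\<psi> z \<in> U" using c by (auto simp: chart_def)
 have d\<phi>: "(\<phi> has_derivative \<D> \<phi> (at (\<psi> z))) (at (\<psi> z))"
  using c pz Ck_has_derivative[of 0 U \<phi> "\<psi> z"] by (auto simp: chart_def simp del: Ck.simps)
 from diff_chain_at[OF chart_deriv[OF c] d\<phi>]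
 have "((\<lambda>z. \<phi> (\<psi> z)) has_derivative (\<lambda>h. \<D> \<phi> (at (\<psi> z)) (\<D> \<psi> (at z) h))) (at z)"
  by (simp add: o_def)
 moreover have "((\<lambda>z. \<phi> (\<psi> z)) has_derivative (\<lambda>h. h)) (at z)"
  by (rule has_derivative_transform_within_open[OF has_derivative_ident V c(2)]) (use c in \<open>auto simp: chart_def\<close>)
 ultimately have "(\<lambda>h. \<D> \<phi> (at (\<psi> z)) (\<D> \<psi> (at z) h)) = (\<lambda>h. h)"
  by (rule has_derivative_unique)
 then have "\<D> \<phi> (at (\<psi> z)) 0 = \<zeta>" using z by metis
 then show ?thesis using linear_0[OF has_derivative_linear[OF d\<phi>]] by simp
qed

lemma chart_line:
 assumes c: "chart M U V \<phi> \<psi> B" and z: "z \<in> V" "z \<in> span B" "\<zeta> \<in> span B"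
 obtains e where "e > 0" "\<And>t. \<bar>t\<bar> < e \<Longrightarrow> z + t *\<^sub>R \<zeta> \<in> V \<and> \<psi> (z + t *\<^sub>R \<zeta>) \<in> M"
  "\<And>t. \<bar>t\<bar> < e \<Longrightarrow> ((\<lambda>t. \<psi> (z + t *\<^sub>R \<zeta>)) has_vector_derivative \<D> \<psi> (at (z + t *\<^sub>R \<zeta>)) \<zeta>) (at t)"
proof -
 have V: "open V" using c by (simp add: chart_def)
 then obtain r where r: "r > 0" "ball z r \<subseteq> V" using z(1) open_contains_ball by blast
 define e where "e = r / (norm \<zeta> + 1)"
 have e: "e > 0" using r(1) by (simp add: e_def add_nonneg_pos)
 have inV: "z + t *\<^sub>R \<zeta> \<in> V" if "\<bar>t\<bar> < e" for t
 proof -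
  have "\<bar>t\<bar> * (norm \<zeta> + 1) < r" using that by (simp add: e_def pos_less_divide_eq add_nonneg_pos)
  then have "norm (t *\<^sub>R \<zeta>) < r" using abs_ge_zero[of t] by (simp add: algebra_simps)
  then show ?thesis using r(2) by (auto simp: dist_norm)
 qed
 moreover have "\<psi> (z + t *\<^sub>R \<zeta>) \<in> M" if "\<bar>t\<bar> < e" for t
 proof -
  have "z + t *\<^sub>R \<zeta> \<in> span B" using z by (intro span_add span_scale)
  then show ?thesis using c inV[OF that] by (auto simp: chart_def)
 qed
 moreover have "((\<lambda>t. \<psi> (z + t *\<^sub>R \<zeta>)) has_vector_derivative \<D> \<psi> (at (z + t *\<^sub>R \<zeta>)) \<zeta>) (at t)" if "\<bar>t\<bar> < e" for t
 proof -
  have d: "((\<lambda>t. z + t *\<^sub>R \<zeta>) has_derivative (\<lambda>s. s *\<^sub>R \<zeta>)) (at t)"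
   by (auto intro!: derivative_eq_intros)
  note D = chart_deriv[OF c inV[OF that]]
  from diff_chain_at[OF d D] have "((\<lambda>t. \<psi> (z + t *\<^sub>R \<zeta>)) has_derivative (\<lambda>s. \<D> \<psi> (at (z + t *\<^sub>R \<zeta>)) (s *\<^sub>R \<zeta>))) (at t)"
   by (simp add: o_def)
  then show ?thesis using linear_scale[OF has_derivative_linear[OF D]]
   by (simp add: has_vector_derivative_def)
 qed
 ultimately show thesis using that[OF e] by blast
qed

text \<open>The squared distance has a local minimum at 0 along the curve
  \<open>t \<mapsto> \<psi> (z + t *\<^sub>R \<zeta>)\<close> in \<open>M\<close>. Minimality is
  asked only within \<open>N\<close>, since while the retraction is being constructed it is known
  only near the base point.\<close>

lemma distance_minimum_first_order:
 assumes c: "chart M U V \<phi> \<psi> B" and z: "z \<in> V" "z \<in> span B" "\<zeta> \<in> span B" and N: "open N" "\<psi> z \<in> N"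
  and min: "\<And>q. q \<in> M \<Longrightarrow> q \<in> N \<Longrightarrow> dist y (\<psi> z) \<le> dist y q"
 shows "(y - \<psi> z) \<bullet> \<D> \<psi> (at z) \<zeta> = 0"
proof -
 obtain e where e: "e > 0" "\<And>t. \<bar>t\<bar> < e \<Longrightarrow> z + t *\<^sub>R \<zeta> \<in> V \<and> \<psi> (z + t *\<^sub>R \<zeta>) \<in> M"
  "\<And>t. \<bar>t\<bar> < e \<Longrightarrow> ((\<lambda>t. \<psi> (z + t *\<^sub>R \<zeta>)) has_vector_derivative \<D> \<psi> (at (z + t *\<^sub>R \<zeta>)) \<zeta>) (at t)"
  using chart_line[OF c z] by blast
 define \<gamma> where "\<gamma> t = \<psi> (z + t *\<^sub>R \<zeta>)" for t
 define v where "v = \<D> \<psi> (at z) \<zeta>"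
 have \<gamma>0: "\<gamma> 0 = \<psi> z" by (simp add: \<gamma>_def)
 have d\<gamma>: "(\<gamma> has_derivative (\<lambda>s. s *\<^sub>R v)) (at 0)"
  using e(3)[of 0] e(1) by (simp add: \<gamma>_def[abs_def] v_def has_vector_derivative_def)
 have "isCont \<gamma> 0" using d\<gamma> has_derivative_continuous by blast
 then have "\<forall>\<^sub>F t in nhds 0. \<gamma> t \<in> N"
  using N \<gamma>0 by (metis continuous_within isCont_def tendsto_at_iff_tendsto_nhds topological_tendstoD)
 then obtain d where d: "d > 0" "\<And>t. \<bar>t\<bar> < d \<Longrightarrow> \<gamma> t \<in> N"
  unfolding eventually_nhds_metric by (auto simp: dist_real_def)
 define g where "g t = (y - \<gamma> t) \<bullet> (y - \<gamma> t)" for t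
 have "(g has_derivative (\<lambda>s. (y - \<gamma> 0) \<bullet> (- (s *\<^sub>R v)) + (- (s *\<^sub>R v)) \<bullet> (y - \<gamma> 0))) (at 0)"
  unfolding g_def by (auto intro!: derivative_eq_intros d\<gamma>)
 then have "(g has_real_derivative - 2 * ((y - \<psi> z) \<bullet> v)) (at 0)"
  unfolding has_field_derivative_def
  by (rule has_derivative_eq_rhs) (auto simp: fun_eq_iff \<gamma>0 inner_commute algebra_simps)
 moreover have "g 0 \<le> g t" if "\<bar>0 - t\<bar> < min d e" for t
 proof -
  have "dist y (\<psi> z) \<le> dist y (\<gamma> t)" using min[of "\<gamma> t"] e(2)[of t] d(2)[of t] that by (simp add: \<gamma>_def)
  then have "(norm (y - \<gamma> 0))\<^sup>2 \<le> (norm (y - \<gamma> t))\<^sup>2" by (intro power_mono) (auto simp: dist_norm \<gamma>0)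
  then show ?thesis by (simp add: g_def power2_norm_eq_inner)
 qed
 ultimately have "- 2 * ((y - \<psi> z) \<bullet> v) = 0"
  using e(1) d(1) DERIV_local_min[of g _ 0 "min d e"] by (metis min_less_iff_conj)
 then show ?thesis by (simp add: v_def)
qed

lemma near_pt_first_order:
 assumes c: "chart M U V \<phi> \<psi> B" and z: "z \<in> V" "z \<in> span B" "\<zeta> \<in> span B" and np: "near_pt M y (\<psi> z)"
 shows "(y - \<psi> z) \<bullet> \<D> \<psi> (at z) \<zeta> = 0"
proof (rule distance_minimum_first_order[OF c z open_UNIV UNIV_I])
 fix q assume "q \<in> M"
 then have "(y - \<psi> z) \<bullet> (q - \<psi> z) \<le> (q - \<psi> z) \<bullet> (q - \<psi> z) / 4" using np by (auto simp: near_pt_def)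
 moreover have "(y - q) \<bullet> (y - q) = (y - \<psi> z) \<bullet> (y - \<psi> z) - 2 * ((y - \<psi> z) \<bullet> (q - \<psi> z)) + (q - \<psi> z) \<bullet> (q - \<psi> z)"
  by (simp add: inner_diff_left inner_diff_right inner_commute algebra_simps)
 moreover have "0 \<le> (q - \<psi> z) \<bullet> (q - \<psi> z)" by (rule inner_ge_zero)
 ultimately have "(y - \<psi> z) \<bullet> (y - \<psi> z) \<le> (y - q) \<bullet> (y - q)" by argo
 then show "dist y (\<psi> z) \<le> dist y q" by (simp add: dist_norm norm_le)
qed

text \<open>Up to a factor the hypothesis says that the second derivative of the squared distance
  along the curve vanishes. The strengthened inequality in \<open>near_pt\<close> forces that
  distance to grow quadratically, which leaves only \<open>\<zeta> = 0\<close>. This is the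
  nondegeneracy behind the smoothness of the retraction.\<close>

lemma near_pt_second_order:
 assumes c: "chart M U V \<phi> \<psi> B" and z: "z \<in> V" "z \<in> span B" "\<zeta> \<in> span B" and np: "near_pt M y (\<psi> z)"
  and d: "((\<lambda>t. (y - \<psi> (z + t *\<^sub>R \<zeta>)) \<bullet> \<D> \<psi> (at (z + t *\<^sub>R \<zeta>)) \<zeta>) has_real_derivative 0) (at 0)"
 shows "\<zeta> = 0"
proof (rule ccontr)
 assume "\<zeta> \<noteq> 0"
 obtain e where e: "e > 0" "\<And>t. \<bar>t\<bar> < e \<Longrightarrow> z + t *\<^sub>R \<zeta> \<in> V \<and> \<psi> (z + t *\<^sub>R \<zeta>) \<in> M"
  "\<And>t. \<bar>t\<bar> < e \<Longrightarrow> ((\<lambda>t. \<psi> (z + t *\<^sub>R \<zeta>)) has_vector_derivative \<D> \<psi> (at (z + t *\<^sub>R \<zeta>)) \<zeta>) (at t)"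
  using chart_line[OF c z] by blast
 define \<gamma> where "\<gamma> t = \<psi> (z + t *\<^sub>R \<zeta>)" for t
 define \<omega> where "\<omega> t = (y - \<gamma> t) \<bullet> \<D> \<psi> (at (z + t *\<^sub>R \<zeta>)) \<zeta>" for t
 define v where "v = \<D> \<psi> (at z) \<zeta>"
 have v0: "v \<noteq> 0" using chart_deriv_inj[OF c z(1)] \<open>\<zeta> \<noteq> 0\<close> by (auto simp: v_def)
 have \<gamma>0: "\<gamma> 0 = \<psi> z" by (simp add: \<gamma>_def)
 define E where "E t = (y - \<gamma> t) \<bullet> (y - \<gamma> t)" for t
 have dE: "(E has_real_derivative - 2 * \<omega> t) (at t)" if "\<bar>t\<bar> < e" for t
 proof -
  have "(\<gamma> has_derivative (\<lambda>s. s *\<^sub>R \<D> \<psi> (at (z + t *\<^sub>R \<zeta>)) \<zeta>)) (at t)"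
   using e(3)[OF that] by (simp add: \<gamma>_def[abs_def] has_vector_derivative_def)
  then have "(E has_derivative (\<lambda>s. (y - \<gamma> t) \<bullet> (- (s *\<^sub>R \<D> \<psi> (at (z + t *\<^sub>R \<zeta>)) \<zeta>))
    + (- (s *\<^sub>R \<D> \<psi> (at (z + t *\<^sub>R \<zeta>)) \<zeta>)) \<bullet> (y - \<gamma> t))) (at t)"
   unfolding E_def by (auto intro!: derivative_eq_intros)
  then show ?thesis unfolding has_field_derivative_def
   by (rule has_derivative_eq_rhs) (auto simp: fun_eq_iff \<omega>_def inner_commute algebra_simps)
 qed
 have \<omega>0: "\<omega> 0 = 0" using near_pt_first_order[OF c z np] by (simp add: \<omega>_def \<gamma>0)
 have lower: "E 0 + (\<gamma> t - \<psi> z) \<bullet> (\<gamma> t - \<psi> z) / 2 \<le> E t" if "\<bar>t\<bar> < e" for t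
 proof -
  have "(y - \<psi> z) \<bullet> (\<gamma> t - \<psi> z) \<le> (\<gamma> t - \<psi> z) \<bullet> (\<gamma> t - \<psi> z) / 4"
   using np e(2)[OF that] by (auto simp: near_pt_def \<gamma>_def)
  moreover have "E t = E 0 - 2 * ((y - \<psi> z) \<bullet> (\<gamma> t - \<psi> z)) + (\<gamma> t - \<psi> z) \<bullet> (\<gamma> t - \<psi> z)"
   by (simp add: E_def \<gamma>0 inner_diff_left inner_diff_right inner_commute algebra_simps)
  ultimately show ?thesis by argo
 qed
 \<comment> \<open>At time \<open>t\<close> the growth is at least
   \<open>t * t * (v \<bullet> v) / 8\<close>; with this \<epsilon> the upper bound is half of
   that.\<close>
 define \<epsilon> where "\<epsilon> = v \<bullet> v / 32"
 have \<epsilon>: "\<epsilon> > 0" using v0 by (simp add: \<epsilon>_def)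
 have "(\<omega> has_derivative (\<lambda>s. 0)) (at 0)"
  using d unfolding has_field_derivative_def \<omega>_def \<gamma>_def by (rule has_derivative_eq_rhs) auto
 then have "\<exists>d1>0. \<forall>t. norm (t - 0) < d1 \<longrightarrow> norm (\<omega> t - \<omega> 0 - 0) \<le> \<epsilon> * norm (t - 0)"
  using \<epsilon> unfolding has_derivative_at_alt by blast
 then obtain d1 where d1: "d1 > 0" "\<And>t. \<bar>t\<bar> < d1 \<Longrightarrow> \<bar>\<omega> t\<bar> \<le> \<epsilon> * \<bar>t\<bar>"
  by (auto simp: \<omega>0)
 have d\<gamma>: "(\<gamma> has_derivative (\<lambda>s. s *\<^sub>R v)) (at 0)"
  using e(3)[of 0] e(1) by (simp add: \<gamma>_def[abs_def] v_def has_vector_derivative_def)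
 have "norm v / 2 > 0" using v0 by simp
 with d\<gamma> have "\<exists>d2>0. \<forall>t. norm (t - 0) < d2 \<longrightarrow> norm (\<gamma> t - \<gamma> 0 - (t - 0) *\<^sub>R v) \<le> norm v / 2 * norm (t - 0)"
  unfolding has_derivative_at_alt by blast
 then obtain d2 where d2: "d2 > 0" "\<And>t. \<bar>t\<bar> < d2 \<Longrightarrow> norm (\<gamma> t - \<psi> z - t *\<^sub>R v) \<le> norm v / 2 * \<bar>t\<bar>"
  by (auto simp: \<gamma>0)
 define t where "t = min e (min d1 d2) / 2"
 have t: "t > 0" "t < e" "t < d1" "t < d2" using e(1) d1(1) d2(1) by (auto simp: t_def)
 obtain s where s: "0 < s" "s < t" "E t - E 0 = (t - 0) * (- 2 * \<omega> s)"
 proof -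
  have "(E has_real_derivative - 2 * \<omega> s) (at s)" if "0 \<le> s" "s \<le> t" for s using dE[of s] that t by simp
  from MVT2[OF t(1) this] show thesis using that by blast
 qed
 have "\<bar>\<omega> s\<bar> \<le> \<epsilon> * s" using d1(2)[of s] s t by simp
 also have "\<dots> \<le> \<epsilon> * t" using s \<epsilon> by simp
 finally have le: "- 2 * \<omega> s \<le> 2 * (\<epsilon> * t)" by linarith
 have up: "E t - E 0 \<le> t * (2 * (\<epsilon> * t))" unfolding s(3) using t(1) mult_left_mono[OF le, of t] by simp
 have "t * norm v \<le> norm (\<gamma> t - \<psi> z) + norm v / 2 * t"
  using d2(2)[of t] t norm_triangle_sub[of "t *\<^sub>R v" "\<gamma> t - \<psi> z"] by (simp add: norm_minus_commute)
 then have "t * norm v / 2 \<le> norm (\<gamma> t - \<psi> z)" by (simp add: field_simps)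
 then have "(t * norm v / 2)\<^sup>2 \<le> (norm (\<gamma> t - \<psi> z))\<^sup>2" using t(1) by (intro power_mono) auto
 then have "t * t * (v \<bullet> v) / 4 \<le> (\<gamma> t - \<psi> z) \<bullet> (\<gamma> t - \<psi> z)"
  by (simp add: power_divide power_mult_distrib power2_norm_eq_inner) (simp add: power2_eq_square)
 then have "t * t * (v \<bullet> v) / 8 \<le> t * (2 * (\<epsilon> * t))" using lower[of t] t up by argo
 then have "t * t * (v \<bullet> v) \<le> t * t * (v \<bullet> v) / 2" by (simp add: \<epsilon>_def field_simps)
 then show False using t(1) v0 by simp
qed

text \<open>\<open>M\<close> may fail to be closed, but in a chart it is the preimage of a subspace;
  hence nearest points exist locally.\<close>

lemma chart_compact_ball:
 assumes c: "chart M U V \<phi> \<psi> B" and "p \<in> U"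
 obtains r where "r > 0" "cball p r \<subseteq> U" "compact (M \<inter> cball p r)"
proof -
 obtain r where r: "r > 0" "cball p r \<subseteq> U" using c assms(2) open_contains_cball unfolding chart_def by metis
 have cont: "continuous_on (cball p r) \<phi>"
  using c r(2) Ck_continuous_on continuous_on_subset unfolding chart_def by metis
 have "closed (span B)" by (rule closed_span)
 from continuous_closed_preimage[OF cont closed_cball this]
 have "closed (cball p r \<inter> \<phi> -` span B)" .
 moreover have "cball p r \<inter> \<phi> -` span B = M \<inter> cball p r"
  using c r(2) by (auto simp: chart_def)
 ultimately have "closed (M \<inter> cball p r)" by simp
 moreover have "bounded (M \<inter> cball p r)" using bounded_cball bounded_Int by blast
 ultimately show thesis using that[OF r] by (simp add: compact_eq_bounded_closed)
qed

text \<open>The candidate is a nearest point \<open>p\<close> in a compact piece of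
  \<open>M\<close>. For \<open>q\<close> close by, the first-order term vanishes and the
  second-order one is at most \<open>\<tau> * K * L^2\<close> times the squared distance; for
  \<open>q\<close> far away the smallness of \<open>norm (y - p)\<close> suffices.\<close>

lemma submanifold_subset_retract_dom:
 fixes M :: "'a::euclidean_space set"
 assumes "submanifold d M" shows "M \<subseteq> retract_dom M"
proof
 fix p0 assume p0: "p0 \<in> M"
 obtain U V \<phi> \<psi> B where c: "chart M U V \<phi> \<psi> B" "p0 \<in> U"
  using submanifold_chart[OF assms p0] by metis
 note cd = c(1)[unfolded chart_def]
 have U: "open U" and V: "open V" using cd by auto
 have z0: "\<phi> p0 \<in> V" "\<phi> p0 \<in> span B" using cd c(2) p0 by auto
 obtain r0 where r0: "r0 > 0" "cball p0 r0 \<subseteq> U" "compact (M \<inter> cball p0 r0)"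
  using chart_compact_ball[OF c] by blast
 obtain r1 L where r1: "r1 > 0" "L \<ge> 0" "cball p0 r1 \<subseteq> U"
  "\<And>x y. x \<in> cball p0 r1 \<Longrightarrow> y \<in> cball p0 r1 \<Longrightarrow> norm (\<phi> x - \<phi> y) \<le> L * norm (x - y)"
  using Ck_local_lipschitz[of U \<phi> p0] cd c(2) by metis
 have "Ck (Suc (Suc 0)) V \<psi>" using cd by blast
 then obtain r2 K where r2: "r2 > 0" "K \<ge> 0" "cball (\<phi> p0) r2 \<subseteq> V"
  "\<And>x y. x \<in> cball (\<phi> p0) r2 \<Longrightarrow> y \<in> cball (\<phi> p0) r2 \<Longrightarrow>
    norm (\<psi> y - \<psi> x - \<D> \<psi> (at x) (y - x)) \<le> K * (norm (y - x))\<^sup>2"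
  using Ck_quadratic[OF _ V z0(1)] by metis
 define r where "r = min (min r0 r1) (r2 / (L + 1))"
 have r: "r > 0" "r \<le> r0" "r \<le> r1" "L * r \<le> r2"
 proof -
  show "r > 0" "r \<le> r0" "r \<le> r1" using r0(1) r1(1,2) r2(1) by (auto simp: r_def)
  have "r \<le> r2 / (L + 1)" by (simp add: r_def)
  then have "r * (L + 1) \<le> r2" using r1(2) by (simp add: pos_le_divide_eq)
  then show "L * r \<le> r2" using \<open>r > 0\<close> by (simp add: algebra_simps)
 qed
 have est: "\<exists>z. z \<in> V \<and> z \<in> span B \<and> q = \<psi> z \<and> z = \<phi> q \<and> z \<in> cball (\<phi> p0) r2" if "q \<in> M" "q \<in> cball p0 r" for q
 proof -
  have qU: "q \<in> U" using that r r0(2) by force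
  have "norm (\<phi> q - \<phi> p0) \<le> L * norm (q - p0)"
   using that r r1(1) by (intro r1(4)) auto
  also have "\<dots> \<le> L * r" using that r1(2) by (intro mult_left_mono) (auto simp: dist_norm norm_minus_commute)
  finally have "\<phi> q \<in> cball (\<phi> p0) r2" using r(4) by (simp add: dist_norm norm_minus_commute)
  then show ?thesis using qU that(1) cd by (intro exI[of _ "\<phi> q"]) auto
 qed
 \<comment> \<open>The second bound brings the curvature term below the factor 1/4 of
   \<open>near_pt\<close>; the first serves the points outside \<open>cball p0 r\<close>, where
   \<open>norm (q - p) > r / 2\<close>.\<close>
 define \<tau> where "\<tau> = min (r / 8) (1 / (4 * (K * L\<^sup>2 + 1)))"
 have KL: "K * L\<^sup>2 + 1 > 0" using r2(2) by (simp add: add_nonneg_pos)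
 have \<tau>: "\<tau> > 0" "\<tau> \<le> r / 8" "\<tau> * (K * L\<^sup>2) \<le> 1/4"
 proof -
  show "\<tau> > 0" "\<tau> \<le> r / 8" using r(1) KL by (auto simp: \<tau>_def)
  have "\<tau> * (K * L\<^sup>2 + 1) \<le> (1 / (4 * (K * L\<^sup>2 + 1))) * (K * L\<^sup>2 + 1)"
   using KL by (intro mult_right_mono) (auto simp: \<tau>_def)
  also have "\<dots> = 1/4" using KL by (simp add: field_simps)
  finally show "\<tau> * (K * L\<^sup>2) \<le> 1/4" using \<open>\<tau> > 0\<close> by (simp add: algebra_simps)
 qed
 have "ball p0 \<tau> \<subseteq> {y. \<exists>p. near_pt M y p}"
 proof
  fix y assume "y \<in> ball p0 \<tau>"
  then have y: "dist y p0 < \<tau>" by (simp add: dist_commute)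
  have ne: "M \<inter> cball p0 r0 \<noteq> {}" using p0 r0(1) by auto
  obtain p where p: "p \<in> M \<inter> cball p0 r0" "\<And>q. q \<in> M \<inter> cball p0 r0 \<Longrightarrow> dist y p \<le> dist y q"
   using distance_attains_inf[OF compact_imp_closed[OF r0(3)] ne] by metis
  have yp: "dist y p < \<tau>" using p(2)[of p0] p0 r0(1) y by simp
  have pp0: "dist p p0 < r / 4" using yp y \<tau>(2) dist_triangle2[of p p0 y] by (simp add: dist_commute)
  have "p \<in> cball p0 r" using pp0 r(1) by (simp add: dist_commute)
  then obtain z where z: "z \<in> V" "z \<in> span B" "p = \<psi> z" "z = \<phi> p" "z \<in> cball (\<phi> p0) r2"
   using est[of p] p(1) by blast
  have first: "(y - p) \<bullet> \<D> \<psi> (at z) \<zeta> = 0" if "\<zeta> \<in> span B" for \<zeta>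
   unfolding z(3)
  proof (rule distance_minimum_first_order[OF c(1) z(1,2) that, where N="ball p0 r0"])
   show "\<psi> z \<in> ball p0 r0" using pp0 r(1,2) z(3) by (simp add: dist_commute)
   show "dist y (\<psi> z) \<le> dist y q" if "q \<in> M" "q \<in> ball p0 r0" for q
    using p(2)[of q] that z(3) by auto
  qed simp
  have "(y - p) \<bullet> (q - p) \<le> (q - p) \<bullet> (q - p) / 4" if q: "q \<in> M" for q
  proof (cases "q \<in> cball p0 r")
   case True
   then obtain z' where z': "z' \<in> V" "z' \<in> span B" "q = \<psi> z'" "z' = \<phi> q" "z' \<in> cball (\<phi> p0) r2"
    using est[OF q] by blast
   have "z' - z \<in> span B" using z'(2) z(2) by (rule span_diff)
   then have "(y - p) \<bullet> (q - p) = (y - p) \<bullet> (q - p - \<D> \<psi> (at z) (z' - z))"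
    using first by (simp add: inner_diff_right)
   also have "\<dots> \<le> norm (y - p) * norm (q - p - \<D> \<psi> (at z) (z' - z))"
    by (rule norm_cauchy_schwarz)
   also have "\<dots> \<le> \<tau> * (K * (norm (z' - z))\<^sup>2)"
    using yp r2(4)[OF z(5) z'(5)] z(3) z'(3) \<tau>(1) by (intro mult_mono) (auto simp: dist_norm)
   also have "\<dots> \<le> \<tau> * (K * (L * norm (q - p))\<^sup>2)"
   proof -
    have "norm (z' - z) \<le> L * norm (q - p)"
     unfolding z'(4) z(4) using True pp0 r by (intro r1(4)) (auto simp: dist_commute)
    then show ?thesis using \<tau>(1) r2(2) by (intro mult_left_mono power_mono) auto
   qed
   also have "\<dots> = (\<tau> * (K * L\<^sup>2)) * (norm (q - p))\<^sup>2" by (simp add: power_mult_distrib mult_ac)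
   also have "\<dots> \<le> 1/4 * (norm (q - p))\<^sup>2" using \<tau>(3) by (intro mult_right_mono) auto
   finally show ?thesis by (simp add: power2_norm_eq_inner)
  next
   case False
   then have "r < dist p0 q" by simp
   then have far: "r / 2 < norm (q - p)"
    using pp0 r(1) dist_triangle[of p0 q p] by (simp add: dist_norm norm_minus_commute)
   have "(y - p) \<bullet> (q - p) \<le> norm (y - p) * norm (q - p)" by (rule norm_cauchy_schwarz)
   also have "\<dots> \<le> (norm (q - p) / 4) * norm (q - p)"
    using yp \<tau>(2) far by (intro mult_right_mono) (auto simp: dist_norm)
   finally show ?thesis by (simp add: power2_norm_eq_inner[symmetric] power2_eq_square)
  qed
  then have "near_pt M y p" using p(1) by (simp add: near_pt_def)
  then show "y \<in> {y. \<exists>p. near_pt M y p}" by blast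
 qed
 then show "p0 \<in> retract_dom M"
  unfolding retract_dom_def using \<tau>(1) by (meson centre_in_ball interiorI open_ball)
qed

lemma Ck_mono_dom: "(\<And>n. Ck n V f) \<Longrightarrow> open V \<Longrightarrow> b \<in> Basis \<Longrightarrow> Ck n V (\<lambda>x. \<D> f (at x) b)"
proof -
 assume f: "\<And>n. Ck n V f" and b: "b \<in> Basis"
 have "Ck (Suc n) V f" by (rule f)
 then show ?thesis using b by simp
qed

text \<open>In a chart the coordinate \<open>u\<close> of the nearest point solves the normal
  equations: \<open>y - \<psi> u\<close> is orthogonal to the tangent directions. The Lipschitz
  bound provides the continuity that \<open>Ck_implicit\<close> starts from, and
  \<open>near_pt_second_order\<close> its injectivity condition.\<close>

lemma nash_on_retract_map:
 fixes M :: "'a::euclidean_space set"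
 assumes M: "submanifold d M" "semialgebraic M"
 shows "nash_on (retract_dom M) (retract_map M)"
proof -
 let ?W = "retract_dom M" and ?\<pi> = "retract_map M"
 have W: "open ?W" by (simp add: retract_dom_def)
 have lip: "dist (?\<pi> y) (?\<pi> y') \<le> 2 * dist y y'" if "y \<in> ?W" "y' \<in> ?W" for y y'
  using near_pt_lipschitz[OF retract_map[OF that(1)] retract_map[OF that(2)]] .
 have cont: "continuous_on ?W ?\<pi>"
  by (rule lipschitz_on_continuous_on[OF lipschitz_onI]) (use lip in auto)
 have "Ck n ?W ?\<pi>" for n
 proof (rule Ck_local)
  fix y0 assume y0: "y0 \<in> ?W"
  have p0: "?\<pi> y0 \<in> M" using retract_map[OF y0] by (simp add: near_pt_def)
  obtain U V \<phi> \<psi> B where c: "chart M U V \<phi> \<psi> B" "?\<pi> y0 \<in> U"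
   using submanifold_chart[OF M(1) p0] by metis
  note cd = c(1)[unfolded chart_def]
  have U: "open U" and V: "open V" and B: "B \<subseteq> Basis" and C\<phi>: "\<And>n. Ck n U \<phi>" and C\<psi>: "\<And>n. Ck n V \<psi>" using cd by auto
  define N where "N = ?W \<inter> ?\<pi> -` U"
  have N: "open N" unfolding N_def using continuous_open_preimage[OF cont W U] .
  have yN: "y0 \<in> N" using y0 c(2) by (simp add: N_def)
  define z where "z y = \<phi> (?\<pi> y)" for y
  have zN: "z y \<in> V" "z y \<in> span B" "?\<pi> y = \<psi> (z y)" "near_pt M y (\<psi> (z y))" if "y \<in> N" for y
  proof -
   have "y \<in> ?W" "?\<pi> y \<in> U" using that by (auto simp: N_def)
   then have np: "near_pt M y (?\<pi> y)" and pU: "?\<pi> y \<in> U" using retract_map by auto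
   then have "?\<pi> y \<in> M" by (simp add: near_pt_def)
   then show "z y \<in> V" "z y \<in> span B" and *: "?\<pi> y = \<psi> (z y)" using cd pU by (auto simp: z_def)
   show "near_pt M y (\<psi> (z y))" using np * by simp
  qed
  have contz: "continuous_on N z"
   unfolding z_def using continuous_on_compose2[OF Ck_continuous_on[OF C\<phi>] continuous_on_subset[OF cont]]
   by (auto simp: N_def)
  \<comment> \<open>One vector collects all equations: the normal equations in the coordinates of
    \<open>B\<close>, and the vanishing of the coordinate itself in the others.\<close>
  define F where "F w = (\<Sum>b\<in>Basis. (if b \<in> B then (fst w - \<psi> (snd w)) \<bullet> \<D> \<psi> (at (snd w)) b else snd w \<bullet> b) *\<^sub>R b)"
   for w :: "'a \<times> 'a"
  let ?D = "UNIV \<times> V :: ('a \<times> 'a) set"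
  have oD: "open ?D" using V by (intro open_Times) auto
  have CF: "Ck k ?D F" for k
  proof -
   have s: "Ck k ?D (\<lambda>w. snd w)" by (rule Ck_linear[OF oD bounded_linear_snd Ck_ident[OF oD]])
   have f: "Ck k ?D (\<lambda>w. fst w)" by (rule Ck_linear[OF oD bounded_linear_fst Ck_ident[OF oD]])
   have c1: "Ck k ?D (\<lambda>w. h (snd w))" if "Ck k V h" for h :: "'a \<Rightarrow> 'a"
    by (rule Ck_compose[OF oD V that s]) auto
   have "Ck k ?D (\<lambda>w. fst w + - \<psi> (snd w))"
    by (intro Ck_add[OF oD] f Ck_linear[OF oD bounded_linear_minus[OF bounded_linear_ident]] c1 C\<psi>)
   then have d: "Ck k ?D (\<lambda>w. fst w - \<psi> (snd w))" by simp
   have i1: "Ck k ?D (\<lambda>w. (fst w - \<psi> (snd w)) \<bullet> \<D> \<psi> (at (snd w)) b)" if "b \<in> Basis" for b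
    by (rule Ck_bilinear[OF oD bounded_bilinear_inner d c1[OF Ck_mono_dom[OF C\<psi> V that]]])
   have i2: "Ck k ?D (\<lambda>w. snd w \<bullet> b)" for b
    by (rule Ck_linear[OF oD bounded_linear_inner_left s])
   show ?thesis unfolding F_def
   proof (intro Ck_sum[OF oD] Ck_bilinear[OF oD bounded_bilinear_scaleR] Ck_const[OF oD] finite_Basis)
    fix b :: 'a assume "b \<in> Basis"
    then show "Ck k ?D (\<lambda>w. if b \<in> B then (fst w - \<psi> (snd w)) \<bullet> \<D> \<psi> (at (snd w)) b else snd w \<bullet> b)"
     using i1[of b] i2[of b] by (cases "b \<in> B") simp_all
   qed
  qed
  have spanB: "x \<in> span B \<longleftrightarrow> (\<forall>b\<in>Basis. b \<notin> B \<longrightarrow> x \<bullet> b = 0)" for x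
   using span_substd_basis[OF B] by blast
  have Fb: "F w \<bullet> b = (if b \<in> B then (fst w - \<psi> (snd w)) \<bullet> \<D> \<psi> (at (snd w)) b else snd w \<bullet> b)" if "b \<in> Basis" for w b
   unfolding F_def by (rule inner_sum_left_Basis[OF that])
  have Fspan: "F (y, u) \<bullet> \<zeta> = (y - \<psi> u) \<bullet> \<D> \<psi> (at u) \<zeta>" if "u \<in> V" "\<zeta> \<in> span B" for y u \<zeta>
  proof -
   have "F (y, u) \<bullet> \<zeta> = (\<Sum>b\<in>Basis. (F (y, u) \<bullet> b) * (\<zeta> \<bullet> b))" by (rule euclidean_inner)
   also have "\<dots> = (\<Sum>b\<in>Basis. ((y - \<psi> u) \<bullet> \<D> \<psi> (at u) b) * (\<zeta> \<bullet> b))"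
    using that(2) spanB by (intro sum.cong) (auto simp: Fb)
   also have "\<dots> = (y - \<psi> u) \<bullet> (\<Sum>b\<in>Basis. (\<zeta> \<bullet> b) *\<^sub>R \<D> \<psi> (at u) b)"
    by (simp add: inner_sum_right mult.commute)
   also have "\<dots> = (y - \<psi> u) \<bullet> \<D> \<psi> (at u) \<zeta>"
    using linear_basis_expansion[OF has_derivative_linear[OF chart_deriv[OF c(1) that(1)]], of \<zeta>] by simp
   finally show ?thesis .
  qed
  have "Ck n N z"
  proof (rule Ck_implicit[OF N oD CF contz])
   fix y assume y: "y \<in> N"
   show "(y, z y) \<in> ?D" using zN(1)[OF y] by simp
   show "F (y, z y) = 0"
   proof (rule euclidean_eqI)
    fix b :: 'a assume b: "b \<in> Basis"
    show "F (y, z y) \<bullet> b = 0 \<bullet> b"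
    proof (cases "b \<in> B")
     case True
     then have "b \<in> span B" by (rule span_base)
     then show ?thesis using near_pt_first_order[OF c(1) zN(1,2)[OF y] _ zN(4)[OF y]] True by (simp add: Fb[OF b])
    next
     case False
     then show ?thesis using zN(2)[OF y] spanB b by (simp add: Fb[OF b])
    qed
   qed
   let ?DF = "\<D> F (at (y, z y))"
   have DF: "(F has_derivative ?DF) (at (y, z y))"
    using Ck_has_derivative[OF CF oD] zN(1)[OF y] by blast
   have lin: "linear (\<lambda>v. ?DF (0, v))"
    using linear_compose[of "\<lambda>v. (0, v)" ?DF] has_derivative_linear[OF DF] by (auto simp: o_def linear_iff)
   show "inj (\<lambda>v. ?DF (0, v))"
   proof (rule linear_injective_0[OF lin, THEN iffD2], intro allI impI)
    fix \<zeta> assume z0: "?DF (0, \<zeta>) = 0"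
    have line: "((\<lambda>t. F (y, z y + t *\<^sub>R \<zeta>)) has_derivative (\<lambda>s. s *\<^sub>R ?DF (0, \<zeta>))) (at 0)"
    proof -
     have "((\<lambda>t. (y, z y + t *\<^sub>R \<zeta>)) has_derivative (\<lambda>s. (0, s *\<^sub>R \<zeta>))) (at 0)"
      by (auto intro!: derivative_eq_intros)
     from diff_chain_at[OF this, of F ?DF] DF
     have "((\<lambda>t. F (y, z y + t *\<^sub>R \<zeta>)) has_derivative (\<lambda>s. ?DF (0, s *\<^sub>R \<zeta>))) (at 0)" by (simp add: o_def)
     then show ?thesis using linear_scale[OF lin] by simp
    qed
    have "\<zeta> \<in> span B"
     unfolding spanB
    proof (intro ballI impI)
     fix b :: 'a assume b: "b \<in> Basis" "b \<notin> B"
     have "((\<lambda>t. F (y, z y + t *\<^sub>R \<zeta>) \<bullet> b) has_derivative (\<lambda>s. (s *\<^sub>R ?DF (0, \<zeta>)) \<bullet> b)) (at 0)"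
      by (rule has_derivative_inner_left[OF line])
     then have "((\<lambda>t. z y \<bullet> b + t * (\<zeta> \<bullet> b)) has_derivative (\<lambda>s. 0)) (at 0)"
      using b by (simp add: Fb[OF b(1)] z0 inner_add_left)
     moreover have "((\<lambda>t. z y \<bullet> b + t * (\<zeta> \<bullet> b)) has_derivative (\<lambda>s. s * (\<zeta> \<bullet> b))) (at 0)"
      by (auto intro!: derivative_eq_intros)
     ultimately have "(\<lambda>s. 0) = (\<lambda>s. s * (\<zeta> \<bullet> b))" by (rule has_derivative_unique)
     then show "\<zeta> \<bullet> b = 0" by (metis mult_1)
    qed
    moreover have "((\<lambda>t. (y - \<psi> (z y + t *\<^sub>R \<zeta>)) \<bullet> \<D> \<psi> (at (z y + t *\<^sub>R \<zeta>)) \<zeta>) has_real_derivative 0) (at 0)"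
    proof -
     have "((\<lambda>t. F (y, z y + t *\<^sub>R \<zeta>) \<bullet> \<zeta>) has_derivative (\<lambda>s. (s *\<^sub>R ?DF (0, \<zeta>)) \<bullet> \<zeta>)) (at 0)"
      by (rule has_derivative_inner_left[OF line])
     then have D0: "((\<lambda>t. F (y, z y + t *\<^sub>R \<zeta>) \<bullet> \<zeta>) has_derivative (\<lambda>s. 0)) (at 0)" by (simp add: z0)
     obtain e where e: "e > 0" "\<And>t. \<bar>t\<bar> < e \<Longrightarrow> z y + t *\<^sub>R \<zeta> \<in> V"
      using chart_line[OF c(1) zN(1,2)[OF y] \<open>\<zeta> \<in> span B\<close>] by metis
     have "((\<lambda>t. (y - \<psi> (z y + t *\<^sub>R \<zeta>)) \<bullet> \<D> \<psi> (at (z y + t *\<^sub>R \<zeta>)) \<zeta>) has_derivative (\<lambda>s. 0)) (at 0)"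
      by (rule has_derivative_transform_within_open[OF D0, of "{-e<..<e}"])
       (use e Fspan[OF _ \<open>\<zeta> \<in> span B\<close>] in auto)
     then show ?thesis unfolding has_field_derivative_def by (rule has_derivative_eq_rhs) auto
    qed
    ultimately show "\<zeta> = 0" using near_pt_second_order[OF c(1) zN(1,2)[OF y] _ zN(4)[OF y]] by blast
   qed
  qed
  then have "Ck n N (\<lambda>y. \<psi> (z y))" by (rule Ck_compose[OF N V C\<psi>]) (use zN(1) in auto)
  then have "Ck n N ?\<pi>" by (rule Ck_cong[OF _ N]) (use zN(3) in auto)
  then show "\<exists>N. open N \<and> y0 \<in> N \<and> Ck n N ?\<pi>" using N yN by blast
 qed
 then show ?thesis using W sa_fun_retract_map[OF M(2)] by (simp add: nash_on_def)
qed

section \<open>Vector-valued approximation, thresholds and continuity strata\<close>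

text \<open>Coordinate by coordinate; multiplying the index by the dimension makes the coordinate
  errors add up to at most \<open>wt k\<close>.\<close>

lemma nash_approximation:
 fixes g :: "'a::euclidean_space \<Rightarrow> 'b::euclidean_space"
 assumes S: "closed S" "semialgebraic S" and g: "sa_fun g" "continuous_on S g" and k: "k \<ge> 1"
 obtains h where "nash_on UNIV h" "\<And>x. x \<in> S \<Longrightarrow> norm (h x - g x) \<le> wt k x"
proof -
 have D: "DIM('b) \<ge> 1" using DIM_positive[where 'a='b] by linarith
 have "\<exists>h. nash_on UNIV h \<and> (\<forall>x\<in>S. \<bar>h x - g x \<bullet> b\<bar> \<le> wt (DIM('b) * k) x)" for b
 proof -
  have "approximable S (\<lambda>x. g x \<bullet> b)"
   by (intro approximable_sa_fun S sa_fun_inner g sa_fun_const continuous_intros)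
  moreover have "DIM('b) * k \<ge> 1" using D k by (simp add: Suc_le_eq)
  ultimately show ?thesis unfolding approximable_def by blast
 qed
 then obtain h where h: "\<And>b. nash_on UNIV (h b)" "\<And>b x. x \<in> S \<Longrightarrow> \<bar>h b x - g x \<bullet> b\<bar> \<le> wt (DIM('b) * k) x"
  by metis
 let ?H = "\<lambda>x. \<Sum>b\<in>Basis. h b x *\<^sub>R b"
 show thesis
 proof
  show "nash_on UNIV ?H" by (intro nash_on_sum nash_on_scaleR nash_on_const h finite_Basis open_UNIV)
  fix x assume x: "x \<in> S"
  have "norm (?H x - g x) \<le> (\<Sum>b\<in>Basis. \<bar>(?H x - g x) \<bullet> b\<bar>)" by (rule norm_le_l1)
  also have "\<dots> \<le> (\<Sum>b\<in>(Basis :: 'b set). wt k x / real DIM('b))"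
  proof (rule sum_mono)
   fix b :: 'b assume b: "b \<in> Basis"
   have "\<bar>(?H x - g x) \<bullet> b\<bar> = \<bar>h b x - g x \<bullet> b\<bar>" by (simp add: inner_diff_left inner_sum_left_Basis[OF b])
   also have "\<dots> \<le> wt (DIM('b) * k) x" by (rule h(2)[OF x])
   also have "\<dots> \<le> wt k x / real DIM('b)" by (rule wt_scale[OF D k])
   finally show "\<bar>(?H x - g x) \<bullet> b\<bar> \<le> wt k x / real DIM('b)" .
  qed
  also have "\<dots> = wt k x" using D by simp
  finally show "norm (?H x - g x) \<le> wt k x" .
 qed
qed

text \<open>The infimum of the bad radii is semialgebraic in \<open>x\<close> and locally bounded
  below, but perhaps discontinuous; the local form of the Lojasiewicz inequality is made for this
  case.\<close>

lemma threshold_wt: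
 fixes S :: "'a::euclidean_space set" and P :: "'a \<Rightarrow> real \<Rightarrow> bool"
 assumes S: "closed S" "semialgebraic S" and P: "semialgebraic {z. P (fst z) (snd z)}"
  and mono: "\<And>x r r'. P x r \<Longrightarrow> 0 < r' \<Longrightarrow> r' \<le> r \<Longrightarrow> P x r'"
  and loc: "\<And>x. x \<in> S \<Longrightarrow> \<exists>\<delta>>0. \<exists>c>0. \<forall>y\<in>S. dist y x < \<delta> \<longrightarrow> P y c"
 obtains k where "k \<ge> 1" "\<And>x. x \<in> S \<Longrightarrow> P x (wt k x)"
proof -
 \<comment> \<open>Counting all radii from 1 on as bad keeps the set nonempty. Halving its infimum
   below puts the weight strictly under it, hence among the good radii.\<close>
 define T where "T y = {r. 1 \<le> r \<or> (0 < r \<and> \<not> P y r)}" for y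
 have T: "T y \<noteq> {}" "bdd_below (T y)" "1 \<in> T y" for y
 proof -
  show "1 \<in> T y" by (simp add: T_def)
  then show "T y \<noteq> {}" by blast
  show "bdd_below (T y)" by (intro bdd_belowI[of _ 0]) (auto simp: T_def)
 qed
 have Tsa: "semialgebraic {z. v z \<in> T (u z)}" if "sa_fun u" "sa_fun v" for u v :: "'c::euclidean_space \<Rightarrow> _"
 proof -
  have "semialgebraic {z. P (u z) (v z)}"
   using semialgebraic_mem[OF sa_fun_Pair[OF that] P] by simp
  then show ?thesis unfolding T_def mem_Collect_eq by (intro sa_intros that)
 qed
 have I: "sa_fun (\<lambda>y. Inf (T y))"
 proof (rule sa_funI[where R="\<lambda>y t. (\<forall>r. r \<in> T y \<longrightarrow> t \<le> r) \<and> (\<forall>u. t < u \<longrightarrow> (\<exists>r. r \<in> T y \<and> r < u))"])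
  show "semialgebraic {z. (\<forall>r. r \<in> T (fst z) \<longrightarrow> snd z \<le> r) \<and> (\<forall>u. snd z < u \<longrightarrow> (\<exists>r. r \<in> T (fst z) \<and> r < u))}"
   by (intro sa_intros Tsa)
  fix y t
  show "((\<forall>r. r \<in> T y \<longrightarrow> t \<le> r) \<and> (\<forall>u. t < u \<longrightarrow> (\<exists>r. r \<in> T y \<and> r < u))) = (t = Inf (T y))"
  proof
   assume *: "(\<forall>r. r \<in> T y \<longrightarrow> t \<le> r) \<and> (\<forall>u. t < u \<longrightarrow> (\<exists>r. r \<in> T y \<and> r < u))"
   have "t \<le> Inf (T y)" using * by (intro cInf_greatest T) auto
   moreover have "\<not> t < Inf (T y)" using * cInf_lower[OF _ T(2)] by (meson not_less)
   ultimately show "t = Inf (T y)" by simp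
  next
   assume "t = Inf (T y)"
   then show "(\<forall>r. r \<in> T y \<longrightarrow> t \<le> r) \<and> (\<forall>u. t < u \<longrightarrow> (\<exists>r. r \<in> T y \<and> r < u))"
    using cInf_lower[OF _ T(2)] cInf_lessD[OF T(1)] by blast
  qed
 qed
 have "sa_fun (\<lambda>y. Inf (T y) / 2)" by (intro sa_intros I)
 then show thesis
 proof (rule lojasiewicz[OF S])
  fix x assume "x \<in> S"
  then obtain \<delta> c where c: "\<delta> > 0" "c > 0" "\<forall>y\<in>S. dist y x < \<delta> \<longrightarrow> P y c" using loc by blast
  have "min c 1 / 2 \<le> Inf (T y) / 2" if "y \<in> S" "dist y x < \<delta>" for y
  proof -
   have "min c 1 \<le> Inf (T y)"
   proof (rule cInf_greatest[OF T(1)])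
    fix r assume r: "r \<in> T y"
    have "P y c" using c(3) that by blast
    show "min c 1 \<le> r"
    proof (rule ccontr)
     assume "\<not> min c 1 \<le> r"
     then have "0 < r" "\<not> P y r" "r \<le> c" using r by (auto simp: T_def)
     then show False using mono[OF \<open>P y c\<close>] by blast
    qed
   qed
   then show ?thesis by simp
  qed
  moreover have "min c 1 / 2 > 0" using c(2) by simp
  ultimately show "\<exists>\<delta>>0. \<exists>c>0. \<forall>y\<in>S. dist y x < \<delta> \<longrightarrow> c \<le> Inf (T y) / 2" using c(1) by blast
 next
  fix k assume k: "k \<ge> 1" and le: "\<And>x. x \<in> S \<Longrightarrow> wt k x \<le> Inf (T x) / 2"
  show thesis
  proof (rule that[OF k])
   fix x assume x: "x \<in> S"
   have "wt k x \<notin> T x" using cInf_lower[OF _ T(2), of "wt k x" x] le[OF x] wt_pos[OF k, of x] by fastforce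
   then show "P x (wt k x)" using wt_pos[OF k, of x] by (simp add: T_def)
  qed
 qed
qed

section \<open>Pieces on which a semialgebraic function is continuous\<close>

lemma pdeg_restrict:
 assumes "q \<in> pdeg n" "m \<le> n"
 shows "\<exists>R\<in>pdeg m. \<forall>x. degree (q x) \<le> m \<longrightarrow> R x = q x"
 using assms(2,1)
proof (induction arbitrary: q rule: inc_induct)
 case base
 then show ?case by blast
next
 case (step n')
 obtain R where R: "R \<in> pdeg (Suc n')" "\<forall>x. degree (q x) \<le> Suc n' \<longrightarrow> R x = q x"
  using step.IH step.prems by blast
 let ?R = "\<lambda>x. R x - monom (coeff (R x) (Suc n')) (Suc n')"
 have "?R x = q x" if "degree (q x) \<le> n'" for x
 proof -
  have "R x = q x" using R(2) that by simp
  moreover have "coeff (q x) (Suc n') = 0" using that by (intro coeff_eq_0) simp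
  ultimately show ?thesis by simp
 qed
 then show ?case by (intro bexI[of _ ?R] pdeg_truncate[OF R(1)]) simp
qed

definition homogeneous :: "'a set list \<Rightarrow> 'a set \<Rightarrow> bool" where
 "homogeneous Xs C \<longleftrightarrow> (\<forall>X\<in>set Xs. C \<subseteq> X \<or> C \<inter> X = {})"

lemma homogeneousD: "homogeneous Xs C \<Longrightarrow> {x. Q x} \<in> set Xs \<Longrightarrow> x \<in> C \<Longrightarrow> y \<in> C \<Longrightarrow> Q x \<longleftrightarrow> Q y"
 unfolding homogeneous_def by (drule (1) bspec) auto

text \<open>On a homogeneous piece \<open>f\<close> is a root of one polynomial of constant degree,
  with constant signs of all derivatives, so Thom's lemma applies.\<close>

lemma continuity_strata_real:
 fixes f :: "'a::euclidean_space \<Rightarrow> real"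
 assumes f: "sa_fun f"
 obtains Xs where "\<And>X. X \<in> set Xs \<Longrightarrow> semialgebraic X" "\<And>C. homogeneous Xs C \<Longrightarrow> continuous_on C f"
proof -
 obtain L where L0: "set L \<subseteq> (\<Union>n. pdeg n)" "determined_by {z. snd z = f (fst z)} L"
  using semialgebraic_determined[OF f[unfolded sa_fun_def]] by blast
 obtain n where L: "set L \<subseteq> pdeg n" using pdeg_list_bound[OF L0(1)] by blast
 define X0 where "X0 q = {x. q x \<noteq> 0 \<and> poly (q x) (f x) = 0}" for q
 \<comment> \<open>Vanishing of the coefficients fixes the degree; the signs of the derivatives at
   \<open>f\<close> single out the root.\<close>
 define X1 where "X1 q i = {x. coeff (q x) i = 0}" for q :: "'a \<Rightarrow> real poly" and i
 define X2 where "X2 q k = {x. 0 < poly ((pderiv ^^ k) (q x)) (f x)}" for q k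
 define X3 where "X3 q k = {x. poly ((pderiv ^^ k) (q x)) (f x) < 0}" for q k
 define Xq where "Xq q = X0 q # map (X1 q) [0..<Suc n] @ map (X2 q) [0..<Suc n] @ map (X3 q) [0..<Suc n]" for q
 have Xq: "X0 q \<in> set (Xq q)" "i \<le> n \<Longrightarrow> X1 q i \<in> set (Xq q)" "i \<le> n \<Longrightarrow> X2 q i \<in> set (Xq q)"
  "i \<le> n \<Longrightarrow> X3 q i \<in> set (Xq q)" for q i
  unfolding Xq_def by (simp_all del: upt_Suc)
 show thesis
 proof
  show "semialgebraic X" if "X \<in> set (concat (map Xq L))" for X
  proof -
   obtain q where q: "q \<in> pdeg n" "X \<in> set (Xq q)" using \<open>X \<in> _\<close> L by auto
   note d = pdeg_eval_sa_fun[OF pdeg_pderiv_funpow[OF q(1)] sa_fun_id f]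
   have "semialgebraic (X0 q)" unfolding X0_def
    by (intro semialgebraic_conj semialgebraic_pdeg_nonzero[OF q(1)] semialgebraic_eq
      pdeg_eval_sa_fun[OF q(1) sa_fun_id f] sa_fun_const)
   moreover have "semialgebraic (X1 q i)" for i unfolding X1_def by (rule semialgebraic.zero[OF pdeg_coeff[OF q(1)]])
   moreover have "semialgebraic (X2 q k)" "semialgebraic (X3 q k)" for k
    unfolding X2_def X3_def by (intro semialgebraic_less d sa_fun_const)+
   ultimately have "\<forall>X\<in>set (Xq q). semialgebraic X" unfolding Xq_def by (simp add: ball_Un del: upt_Suc)
   then show ?thesis using q(2) by blast
  qed
  fix C assume hom: "homogeneous (concat (map Xq L)) C"
  show "continuous_on C f"
  proof (cases "C = {}")
   case False
   then obtain x where x: "x \<in> C" by blast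
   have "f x \<in> root_set L x" by (rule graph_root[OF L0(2)]) auto
   then obtain q where q: "q \<in> set L" "q x \<noteq> 0" "poly (q x) (f x) = 0" by (auto simp: root_set_def)
   have qn: "q \<in> pdeg n" using q(1) L by blast
   have hq: "homogeneous (Xq q) C" using hom q(1) by (auto simp: homogeneous_def)
   have h0: "q y \<noteq> 0 \<and> poly (q y) (f y) = 0" if "y \<in> C" for y
    using homogeneousD[OF hq Xq(1)[of q, unfolded X0_def] x that] q by simp
   have h1: "coeff (q x) i = 0 \<longleftrightarrow> coeff (q y) i = 0" if "y \<in> C" for y i
   proof (cases "i \<le> n")
    case True
    from homogeneousD[OF hq Xq(2)[OF this, of q, unfolded X1_def] x that] show ?thesis .
   next
    case False
    then show ?thesis using pdeg_degree[OF qn, of x] pdeg_degree[OF qn, of y] by (simp add: coeff_eq_0)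
   qed
   have h2: "sgn (poly ((pderiv ^^ k) (q y)) (f y)) = sgn (poly ((pderiv ^^ k) (q y')) (f y'))"
    if "y \<in> C" "y' \<in> C" for k y y'
   proof (cases "k \<le> n")
    case True
    have "0 < poly ((pderiv ^^ k) (q y)) (f y) \<longleftrightarrow> 0 < poly ((pderiv ^^ k) (q y')) (f y')"
     by (rule homogeneousD[OF hq Xq(3)[OF True, of q, unfolded X2_def] that])
    moreover have "poly ((pderiv ^^ k) (q y)) (f y) < 0 \<longleftrightarrow> poly ((pderiv ^^ k) (q y')) (f y') < 0"
     by (rule homogeneousD[OF hq Xq(4)[OF True, of q, unfolded X3_def] that])
    ultimately show ?thesis by (auto simp: sgn_if)
   next
    case False
    then show ?thesis
     using pderiv_funpow_eq_0[of "q y" k] pderiv_funpow_eq_0[of "q y'" k] pdeg_degree[OF qn, of y] pdeg_degree[OF qn, of y']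
     by simp
   qed
   define m where "m = degree (q x)"
   have deg: "degree (q y) = m" if "y \<in> C" for y
   proof (rule order_antisym)
    show "degree (q y) \<le> m"
     using h1[OF that, of "degree (q y)"] h0[OF that] le_degree[of "q x" "degree (q y)"] by (auto simp: m_def)
    show "m \<le> degree (q y)"
     using h1[OF that, of m] q(2) le_degree[of "q y" m] by (auto simp: m_def)
   qed
   have "m \<le> n" using pdeg_degree[OF qn] by (simp add: m_def)
   \<comment> \<open>\<open>thom_root_continuous\<close> wants the degree bound to be attained:
     \<open>R\<close> agrees with \<open>q\<close> on \<open>C\<close> and has the bound
     \<open>m\<close>.\<close>
   from pdeg_restrict[OF qn this] obtain R where R: "R \<in> pdeg m" "\<forall>x. degree (q x) \<le> m \<longrightarrow> R x = q x" by blast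
   have Rq: "R y = q y" if "y \<in> C" for y using R(2) deg[OF that] by simp
   show ?thesis
   proof (rule thom_root_continuous[OF R(1)])
    show "coeff (R y) m \<noteq> 0" "poly (R y) (f y) = 0" if "y \<in> C" for y
     using h0[OF that] deg[OF that] Rq[OF that] by (metis leading_coeff_0_iff) (simp add: h0[OF that] Rq[OF that])
    show "sgn (poly ((pderiv ^^ k) (R y)) (f y)) = sgn (poly ((pderiv ^^ k) (R y')) (f y'))"
     if "y \<in> C" "y' \<in> C" for k y y'
     using h2[OF that] by (simp add: Rq that)
   qed
  qed simp
 qed
qed

lemma continuity_strata:
 fixes f :: "'a::euclidean_space \<Rightarrow> 'b::euclidean_space"
 assumes f: "sa_fun f"
 obtains Xs where "\<And>X. X \<in> set Xs \<Longrightarrow> semialgebraic X" "\<And>C. homogeneous Xs C \<Longrightarrow> continuous_on C f"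
proof -
 have "\<exists>Xs. (\<forall>X\<in>set Xs. semialgebraic X) \<and> (\<forall>C. homogeneous Xs C \<longrightarrow> continuous_on C (\<lambda>x. f x \<bullet> b))" for b
 proof -
  have "sa_fun (\<lambda>x. f x \<bullet> b)" by (intro sa_intros f)
  then show ?thesis by (rule continuity_strata_real) blast
 qed
 then obtain F where F: "\<And>b X. X \<in> set (F b) \<Longrightarrow> semialgebraic X"
  "\<And>b C. homogeneous (F b) C \<Longrightarrow> continuous_on C (\<lambda>x. f x \<bullet> b)" by metis
 obtain bs where bs: "set bs = (Basis :: 'b set)" using finite_list[OF finite_Basis] by blast
 show thesis
 proof
  show "semialgebraic X" if "X \<in> set (concat (map F bs))" for X using that F(1) by auto
  fix C assume hom: "homogeneous (concat (map F bs)) C"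
  have "homogeneous (F b) C" if "b \<in> Basis" for b using hom that bs by (auto simp: homogeneous_def)
  then show "continuous_on C f" using F(2) continuous_on_componentwise by blast
 qed
qed

section \<open>Corners\<close>

text \<open>Strict differentiability: both points vary. It yields local injectivity, and directions
  that remain inward for all nearby base points.\<close>

lemma Ck_strict_derivative:
 fixes f :: "'a::euclidean_space \<Rightarrow> 'b::euclidean_space"
 assumes f: "Ck (Suc 0) U f" and U: "open U" "a \<in> U" and e: "e > 0"
 obtains r where "r > 0" "ball a r \<subseteq> U"
  "\<And>x y. x \<in> ball a r \<Longrightarrow> y \<in> ball a r \<Longrightarrow> norm (f y - f x - \<D> f (at a) (y - x)) \<le> e * norm (y - x)"
proof -
 let ?D = "\<lambda>x. \<D> f (at x)"
 have d: "(f has_derivative ?D x) (at x)" if "x \<in> U" for x using Ck_has_derivative[OF f U(1) that] .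
 let ?S = "\<lambda>x. \<Sum>b\<in>Basis. norm (?D x b - ?D a b)"
 have "continuous_on U ?S" using f by (intro continuous_intros) auto
 then have "open (U \<inter> ?S -` {..<e})" using U(1) by (intro continuous_open_preimage) auto
 moreover have "a \<in> U \<inter> ?S -` {..<e}" using U(2) e by simp
 ultimately obtain r where r: "r > 0" "ball a r \<subseteq> U \<inter> ?S -` {..<e}" using open_contains_ball by blast
 have "norm (f y - f x - ?D a (y - x)) \<le> e * norm (y - x)" if xy: "x \<in> ball a r" "y \<in> ball a r" for x y
 proof -
  have lina: "bounded_linear (?D a)" using has_derivative_bounded_linear[OF d[OF U(2)]] .
  let ?g = "\<lambda>x. f x - ?D a x"
  have "norm (?g y - ?g x) \<le> e * norm (y - x)"
  proof (rule differentiable_bound[OF convex_ball _ _ xy(2,1)])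
   fix w assume w: "w \<in> ball a r"
   then have wU: "w \<in> U" "?S w < e" using r(2) by auto
   show "(?g has_derivative (\<lambda>h. ?D w h - ?D a h)) (at w within ball a r)"
    by (intro has_derivative_diff has_derivative_at_withinI[OF d[OF wU(1)]]
      bounded_linear.has_derivative[OF lina has_derivative_ident])
   show "onorm (\<lambda>h. ?D w h - ?D a h) \<le> e"
   proof (rule onorm_le)
    fix h
    have "?D w h - ?D a h = (\<Sum>b\<in>Basis. (h \<bullet> b) *\<^sub>R (?D w b - ?D a b))"
     using linear_basis_expansion[OF has_derivative_linear[OF d[OF wU(1)]], of h]
      linear_basis_expansion[OF has_derivative_linear[OF d[OF U(2)]], of h]
     by (simp add: scaleR_diff_right sum_subtractf)
    also have "norm \<dots> \<le> (\<Sum>b\<in>Basis. norm h * norm (?D w b - ?D a b))"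
     by (rule sum_norm_le) (auto intro!: mult_right_mono Basis_le_norm)
    also have "\<dots> = ?S w * norm h" by (simp add: sum_distrib_left mult.commute)
    also have "\<dots> \<le> e * norm h" using wU(2) by (intro mult_right_mono) auto
    finally show "norm (?D w h - ?D a h) \<le> e * norm h" .
   qed
  qed
  moreover have "?g y - ?g x = f y - f x - ?D a (y - x)"
   using linear_diff[OF bounded_linear.linear[OF lina], of y x] by (simp add: algebra_simps)
  ultimately show ?thesis by simp
 qed
 moreover have "ball a r \<subseteq> U" using r(2) by blast
 ultimately show thesis using that[OF r(1)] by blast
qed

text \<open>The derivative stretches lengths by at least some \<open>c > 0\<close>; a linearization
  error of \<open>c / 2\<close> cannot make two distinct values agree.\<close>

lemma Ck_locally_injective:
 fixes f :: "'a::euclidean_space \<Rightarrow> 'b::euclidean_space"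
 assumes f: "Ck (Suc 0) U f" and U: "open U" "a \<in> U" and inj: "inj (\<D> f (at a))"
 obtains r where "r > 0" "ball a r \<subseteq> U" "inj_on f (ball a r)"
proof -
 let ?D = "\<D> f (at a)"
 have lin: "linear ?D" using has_derivative_linear[OF Ck_has_derivative[OF f U]] .
 obtain c where c: "c > 0" "\<And>v. c * norm v \<le> norm (?D v)"
  using linear_inj_bounded_below_pos[OF lin inj] by metis
 have "c / 2 > 0" using c(1) by simp
 from Ck_strict_derivative[OF f U this] obtain r where r: "r > 0" "ball a r \<subseteq> U"
  "\<And>x y. x \<in> ball a r \<Longrightarrow> y \<in> ball a r \<Longrightarrow> norm (f y - f x - ?D (y - x)) \<le> c / 2 * norm (y - x)"
  by metis
 have "inj_on f (ball a r)"
 proof (rule inj_onI)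
  fix x y assume xy: "x \<in> ball a r" "y \<in> ball a r" "f x = f y"
  have "norm (?D (y - x)) \<le> c / 2 * norm (y - x)" using r(3)[OF xy(1,2)] xy(3) by simp
  then have "c * norm (y - x) \<le> c / 2 * norm (y - x)" using c(2)[of "y - x"] by linarith
  then show "x = y" using c(1) by (auto simp: mult_le_cancel_right)
 qed
 then show thesis using that r by blast
qed

text \<open>Paths in \<open>Q\<close> that start at a corner exist only for
  \<open>s \<ge> 0\<close>, so a two-sided derivative has to be read off from one side.\<close>

lemma right_affine_derivative:
 fixes g :: "real \<Rightarrow> real"
 assumes g: "(g has_real_derivative D) (at 0)" and e: "e > 0" "\<And>s. 0 \<le> s \<Longrightarrow> s < e \<Longrightarrow> g s = \<alpha> + \<beta> * s"
 shows "D = \<beta>"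
proof -
 have "((\<lambda>y. (g y - g 0) / (y - 0)) \<longlongrightarrow> D) (at 0)" using g by (simp only: has_field_derivative_iff)
 then have "((\<lambda>y. (g y - g 0) / (y - 0)) \<longlongrightarrow> D) (at_right 0)" by (rule tendsto_within_subset) simp
 moreover have "((\<lambda>y. (g y - g 0) / (y - 0)) \<longlongrightarrow> \<beta>) (at_right 0)"
 proof (rule tendsto_eventually)
  show "\<forall>\<^sub>F y in at_right 0. (g y - g 0) / (y - 0) = \<beta>"
   unfolding eventually_at_right_field using e by (intro exI[of _ e]) auto
 qed
 ultimately show ?thesis using tendsto_unique trivial_limit_at_right_real by blast
qed

lemma Basis_projection:
 fixes B :: "'a::euclidean_space set"
 assumes B: "B \<subseteq> Basis"
 defines "P \<equiv> (\<lambda>x. \<Sum>b\<in>B. (x \<bullet> b) *\<^sub>R b)"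
 shows "P x \<in> span B" "x \<in> span B \<Longrightarrow> P x = x" "b \<in> B \<Longrightarrow> P x \<bullet> b = x \<bullet> b" "bounded_linear P"
proof -
 have fin: "finite B" using B finite_subset finite_Basis by blast
 show "P x \<in> span B" unfolding P_def by (intro span_sum span_scale span_base)
 show *: "P x \<bullet> b = x \<bullet> b" if "b \<in> B" for x b
 proof -
  have "P x \<bullet> b = (\<Sum>i\<in>B. if i = b then x \<bullet> b else 0)"
   unfolding P_def inner_sum_left by (rule sum.cong) (use B that in \<open>auto simp: inner_not_same_Basis subset_eq\<close>)
  then show ?thesis using that fin by simp
 qed
 show "bounded_linear P" unfolding P_def
  by (intro bounded_linear_sum bounded_linear_compose[OF bounded_linear_scaleR_left] bounded_linear_inner_left)
 show "P x = x" if "x \<in> span B"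
 proof (rule euclidean_eqI)
  fix i :: 'a assume i: "i \<in> Basis"
  show "P x \<bullet> i = x \<bullet> i"
  proof (cases "i \<in> B")
   case False
   have "x \<bullet> i = 0" "P x \<bullet> i = 0"
    using span_substd_basis[OF B] \<open>P x \<in> span B\<close> that i False by auto
   then show ?thesis by simp
  qed (rule *)
 qed
qed

lemma has_vector_derivative_chain:
 assumes "(g has_vector_derivative w) (at s)" "(f has_derivative D) (at (g s))"
 shows "((\<lambda>s. f (g s)) has_vector_derivative D w) (at s)"
proof -
 have "((\<lambda>s. f (g s)) has_derivative (\<lambda>h. D (h *\<^sub>R w))) (at s)"
  using diff_chain_at[of g "\<lambda>h. h *\<^sub>R w" s f D] assms by (simp add: o_def has_vector_derivative_def)
 then show ?thesis
  using linear_scale[OF has_derivative_linear[OF assms(2)]] by (simp add: has_vector_derivative_def)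
qed

text \<open>The ambient manifold need not be flat in a corner chart of \<open>Q\<close>, but the projection of the
 chart to the model space is injective on \<open>M\<close> near the corner.\<close>
lemma corner_coordinates:
 fixes M Q :: "'a::euclidean_space set"
 assumes M: "submanifold d M" and Q: "submanifold_with_corners d Q" "Q \<subseteq> M" and q: "q \<in> Q"
 obtains U \<phi> C \<gamma> w e where "open U" "q \<in> U" "\<And>n. Ck n U (\<phi> :: 'a \<Rightarrow> 'a)" "C \<subseteq> Basis"
  "\<And>y. y \<in> M \<Longrightarrow> y \<in> U \<Longrightarrow> y \<in> Q \<longleftrightarrow> (\<forall>b\<in>C. 0 \<le> \<phi> y \<bullet> b)"
  "(\<gamma> has_vector_derivative w) (at 0)" "\<gamma> 0 = q" "e > 0"
  "\<And>s. 0 \<le> s \<Longrightarrow> s < e \<Longrightarrow> \<gamma> s \<in> Q"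
  "\<And>s b. 0 \<le> s \<Longrightarrow> s < e \<Longrightarrow> b \<in> C \<Longrightarrow> \<phi> (\<gamma> s) \<bullet> b = \<phi> q \<bullet> b + 1 * s"
proof -
 obtain U V \<phi> B C where c: "open U" "q \<in> U" "smooth_diffeo U V \<phi>" "B \<subseteq> Basis" "card B = d" "C \<subseteq> B"
  "\<phi> ` (Q \<inter> U) = V \<inter> corner_model B C"
  using bspec[OF Q(1)[unfolded submanifold_with_corners_def] q] by (elim exE conjE) (rule that)
 obtain \<psi> where \<psi>: "open V" "\<And>n. Ck n U \<phi>" "\<And>n. Ck n V \<psi>" "\<phi> ` U \<subseteq> V" "\<psi> ` V \<subseteq> U"
  "\<And>x. x \<in> U \<Longrightarrow> \<psi> (\<phi> x) = x" "\<And>z. z \<in> V \<Longrightarrow> \<phi> (\<psi> z) = z"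
  using smooth_diffeo_inverse[OF c(3)] by metis
 have qM: "q \<in> M" using q Q(2) by blast
 obtain U' V' \<phi>' \<psi>' B' where c': "chart M U' V' \<phi>' \<psi>' B'" "q \<in> U'" "card B' = d"
  using submanifold_chart[OF M qM] by metis
 note cd = c'(1)[unfolded chart_def]
 have \<phi>': "open U'" "open V'" "\<And>n. Ck n U' \<phi>'" "\<And>n. Ck n V' \<psi>'" "\<phi>' ` U' \<subseteq> V'" "\<psi>' ` V' \<subseteq> U'"
  "\<And>x. x \<in> U' \<Longrightarrow> \<psi>' (\<phi>' x) = x" "\<And>z. z \<in> V' \<Longrightarrow> \<phi>' (\<psi>' z) = z" "B' \<subseteq> Basis"
  "\<And>x. x \<in> U' \<Longrightarrow> x \<in> M \<longleftrightarrow> \<phi>' x \<in> span B'"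
  using cd by simp_all
 define x0 where "x0 = \<phi> q"
 define z0 where "z0 = \<phi>' q"
 have x0: "x0 \<in> V" "x0 \<in> corner_model B C" "\<psi> x0 = q" using c(2,7) q \<psi> by (auto simp: x0_def)
 have z0: "z0 \<in> V'" "\<psi>' z0 = q" using c'(2) \<phi>' by (auto simp: z0_def)
 have QV: "\<psi> z \<in> Q" if "z \<in> V" "z \<in> corner_model B C" for z
 proof -
  have "z \<in> \<phi> ` (Q \<inter> U)" using that c(7) by blast
  then show ?thesis using \<psi>(6) by auto
 qed
 have path: "\<exists>e>0. \<forall>s. 0 \<le> s \<and> s < e \<longrightarrow> x0 + s *\<^sub>R u \<in> V \<and> x0 + s *\<^sub>R u \<in> corner_model B C"
  if u: "u \<in> span B" "\<And>b. b \<in> C \<Longrightarrow> 0 \<le> u \<bullet> b" for u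
 proof -
  obtain r where r: "r > 0" "ball x0 r \<subseteq> V" using \<psi>(1) x0(1) open_contains_ball by blast
  have "x0 + s *\<^sub>R u \<in> V \<and> x0 + s *\<^sub>R u \<in> corner_model B C" if s: "0 \<le> s" "s < r / (norm u + 1)" for s
  proof
   have "s * (norm u + 1) < r" using s(2) by (simp add: pos_less_divide_eq add_nonneg_pos)
   then have "norm (s *\<^sub>R u) < r" using s(1) by (simp add: algebra_simps)
   then have "x0 + s *\<^sub>R u \<in> ball x0 r" by (simp add: dist_norm)
   then show "x0 + s *\<^sub>R u \<in> V" using r(2) by blast
   show "x0 + s *\<^sub>R u \<in> corner_model B C"
    using x0(2) u s(1) unfolding corner_model_def
    by (auto intro!: span_add span_scale simp: inner_add_left)
  qed
  moreover have "r / (norm u + 1) > 0" using r(1) by (simp add: add_nonneg_pos)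
  ultimately show ?thesis by blast
 qed
 have d\<psi>: "(\<psi> has_derivative \<D> \<psi> (at x0)) (at x0)"
  by (rule Ck_has_derivative[OF \<psi>(3) \<psi>(1) x0(1)])
 have d\<phi>: "(\<phi> has_derivative \<D> \<phi> (at q)) (at q)"
  by (rule Ck_has_derivative[OF \<psi>(2) c(1,2)])
 have d\<phi>': "(\<phi>' has_derivative \<D> \<phi>' (at q)) (at q)"
  by (rule Ck_has_derivative[OF \<phi>'(3) \<phi>'(1) c'(2)])
 have d\<psi>': "(\<psi>' has_derivative \<D> \<psi>' (at z0)) (at z0)"
  by (rule Ck_has_derivative[OF \<phi>'(4) \<phi>'(2) z0(1)])
 \<comment> \<open>\<open>N\<close> and \<open>L\<close> are the derivatives of the change between
   the corner chart of \<open>Q\<close> and the chart of \<open>M\<close>, in the two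
   directions.\<close>
 define N where "N h = \<D> \<phi>' (at q) (\<D> \<psi> (at x0) h)" for h
 define L where "L h = \<D> \<phi> (at q) (\<D> \<psi>' (at z0) h)" for h
 have dN: "((\<lambda>x. \<phi>' (\<psi> x)) has_derivative N) (at x0)"
  using diff_chain_at[OF d\<psi>, of \<phi>' "\<D> \<phi>' (at q)"] d\<phi>' by (simp add: x0(3) o_def N_def[abs_def])
 have dL: "((\<lambda>z. \<phi> (\<psi>' z)) has_derivative L) (at z0)"
  using diff_chain_at[OF d\<psi>', of \<phi> "\<D> \<phi> (at q)"] d\<phi> by (simp add: z0(2) o_def L_def[abs_def])
 have LN: "L (N h) = h" for h
 proof -
  have "((\<lambda>x. \<phi> (\<psi>' (\<phi>' (\<psi> x)))) has_derivative (\<lambda>h. L (N h))) (at x0)"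
   using diff_chain_at[OF dN, of "\<lambda>z. \<phi> (\<psi>' z)" L] dL by (simp add: o_def x0(3) z0_def)
  moreover have "((\<lambda>x. \<phi> (\<psi>' (\<phi>' (\<psi> x)))) has_derivative (\<lambda>h. h)) (at x0)"
  proof (rule has_derivative_transform_within_open[OF has_derivative_ident])
   show "open (V \<inter> \<psi> -` U')" by (rule continuous_open_preimage[OF Ck_continuous_on[OF \<psi>(3)] \<psi>(1) \<phi>'(1)])
   show "x0 \<in> V \<inter> \<psi> -` U'" using x0 c'(2) by simp
   show "x = \<phi> (\<psi>' (\<phi>' (\<psi> x)))" if "x \<in> V \<inter> \<psi> -` U'" for x using that \<phi>'(7) \<psi>(7) by simp
  qed
  ultimately have "(\<lambda>h. L (N h)) = (\<lambda>h. h)" by (rule has_derivative_unique)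
  then show ?thesis by metis
 qed
 have linN: "linear N" using has_derivative_linear[OF dN] .
 \<comment> \<open>The path from the corner along \<open>b\<close> stays in \<open>Q\<close>, hence
   in \<open>M\<close>, for small \<open>s \<ge> 0\<close>. Its coordinates under
   \<open>\<phi>'\<close> outside \<open>B'\<close> vanish there, so its velocity lies in
   \<open>span B'\<close>.\<close>
 have Nb: "N b \<in> span B'" if b: "b \<in> B" for b
 proof -
  have "0 \<le> b \<bullet> b'" if "b' \<in> C" for b'
  proof -
   have "b \<in> Basis" "b' \<in> Basis" using c(4,6) b that by blast+
   then show ?thesis using inner_Basis[of b b'] by simp
  qed
  from path[OF span_base[OF b] this] obtain e where e: "e > 0"
   "\<And>s. 0 \<le> s \<Longrightarrow> s < e \<Longrightarrow> x0 + s *\<^sub>R b \<in> V \<and> x0 + s *\<^sub>R b \<in> corner_model B C" by blast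
  have dl: "((\<lambda>s. x0 + s *\<^sub>R b) has_vector_derivative b) (at 0)"
   unfolding has_vector_derivative_def by (auto intro!: derivative_eq_intros)
  have dn: "((\<lambda>s. \<phi>' (\<psi> (x0 + s *\<^sub>R b))) has_vector_derivative N b) (at 0)"
   using has_vector_derivative_chain[OF dl, of "\<lambda>x. \<phi>' (\<psi> x)" N] dN by simp
  have "isCont (\<lambda>s. \<psi> (x0 + s *\<^sub>R b)) 0"
   using has_vector_derivative_continuous[OF has_vector_derivative_chain[OF dl, of \<psi>]] d\<psi> by simp
  then have "((\<lambda>s. \<psi> (x0 + s *\<^sub>R b)) \<longlongrightarrow> q) (at 0)" by (simp add: isCont_def x0(3))
  from topological_tendstoD[OF this \<phi>'(1) c'(2)]
  obtain e' where e': "e' > 0" "\<And>s. s \<noteq> 0 \<Longrightarrow> \<bar>s\<bar> < e' \<Longrightarrow> \<psi> (x0 + s *\<^sub>R b) \<in> U'"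
   unfolding eventually_at by (auto simp: dist_real_def)
  have inB: "\<phi>' (\<psi> (x0 + s *\<^sub>R b)) \<in> span B'" if "0 \<le> s" "s < min e e'" for s
  proof -
   have "\<psi> (x0 + s *\<^sub>R b) \<in> M" using QV e(2)[of s] that Q(2) by auto
   moreover have "\<psi> (x0 + s *\<^sub>R b) \<in> U'" using e'(2)[of s] that c'(2) x0(3) by (cases "s = 0") auto
   ultimately show ?thesis using \<phi>'(10) by blast
  qed
  have "N b \<bullet> i = 0" if i: "i \<in> Basis" "i \<notin> B'" for i
  proof (rule right_affine_derivative)
   show "((\<lambda>s. \<phi>' (\<psi> (x0 + s *\<^sub>R b)) \<bullet> i) has_real_derivative N b \<bullet> i) (at 0)"
    using has_derivative_inner_left[OF dn[unfolded has_vector_derivative_def], of i]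
    by (simp add: has_field_derivative_def mult_commute_abs)
   show "min e e' > 0" using e(1) e'(1) by simp
   show "\<phi>' (\<psi> (x0 + s *\<^sub>R b)) \<bullet> i = 0 + 0 * s" if "0 \<le> s" "s < min e e'" for s
    using inB[OF that] span_substd_basis[OF \<phi>'(9)] i by auto
  qed
  then show ?thesis using span_substd_basis[OF \<phi>'(9)] by auto
 qed
 \<comment> \<open>Here the equal dimensions of \<open>Q\<close> and \<open>M\<close> enter:
   \<open>N\<close> is injective and both spans have dimension \<open>d\<close>.\<close>
 have Nspan: "N ` span B = span B'"
 proof (rule subspace_dim_equal)
  show "subspace (N ` span B)" using linear_subspace_image[OF linN subspace_span] .
  have "N ` span B = span (N ` B)" using linear_span_image[OF linN] by simp
  then show "N ` span B \<subseteq> span B'" using Nb by (simp add: span_minimal subspace_span image_subset_iff)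
  have "inj N" by (metis LN injI)
  then have "dim (N ` span B) = dim (span B)" using dim_image_eq[OF linN] by (simp add: inj_on_subset)
  then show "dim (span B') \<le> dim (N ` span B)"
   using c(4,5) c'(3) \<phi>'(9) by (simp add: dim_eq_card_independent independent_mono[OF independent_Basis])
 qed simp
 define P where "P x = (\<Sum>b\<in>B. (x \<bullet> b) *\<^sub>R b)" for x :: 'a
 note P = Basis_projection[OF c(4), folded P_def]
 define P' where "P' x = (\<Sum>b\<in>Basis - B'. (x \<bullet> b) *\<^sub>R b)" for x :: 'a
 have PB: "Basis - B' \<subseteq> (Basis :: 'a set)" by blast
 note P' = Basis_projection[OF PB, folded P'_def]
 have P'0: "P' x = 0 \<longleftrightarrow> x \<in> span B'" for x
 proof
  assume "P' x = 0"
  then have "x \<bullet> i = 0" if "i \<in> Basis" "i \<notin> B'" for i using P'(3)[of i x] that by simp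
  then show "x \<in> span B'" using span_substd_basis[OF \<phi>'(9)] by auto
 next
  assume "x \<in> span B'"
  then have "x \<bullet> i = 0" if "i \<in> Basis - B'" for i using span_substd_basis[OF \<phi>'(9)] that by auto
  then show "P' x = 0" by (simp add: P'_def)
 qed
 \<comment> \<open>Points of \<open>M\<close> have second component 0; the first one then has to
   determine them. The target is larger than the source, so injectivity of the derivative is the
   right condition.\<close>
 define F where "F z = (P (\<phi> (\<psi>' z)), P' z)" for z
 define V2 where "V2 = V' \<inter> \<psi>' -` U"
 have V2: "open V2" unfolding V2_def
  by (rule continuous_open_preimage[OF Ck_continuous_on[OF \<phi>'(4)] \<phi>'(2) c(1)])
 have z0V2: "z0 \<in> V2" using z0 c(2) by (simp add: V2_def)
 have CF: "Ck (Suc 0) V2 F"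
 proof -
  have "Ck (Suc 0) V2 (\<lambda>z. \<phi> (\<psi>' z))"
  proof (rule Ck_compose[OF V2 c(1) \<psi>(2)])
   show "Ck (Suc 0) V2 \<psi>'" using \<phi>'(4) by (rule Ck_subset) (simp add: V2_def)
  qed (auto simp: V2_def)
  then have "Ck (Suc 0) V2 (\<lambda>z. (P (\<phi> (\<psi>' z)), 0) + (0, P' z))"
   by (intro Ck_add[OF V2] Ck_linear[OF V2, of "\<lambda>y. (P y, 0)"] Ck_linear[OF V2, of "\<lambda>y. (0, P' y)"]
     bounded_linear_Pair P(4) P'(4) bounded_linear_zero Ck_ident[OF V2])
  then show ?thesis by (simp add: F_def[abs_def])
 qed
 have dF: "(F has_derivative (\<lambda>h. (P (L h), P' h))) (at z0)"
  unfolding F_def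
  by (intro has_derivative_Pair bounded_linear.has_derivative[OF P(4) dL]
    bounded_linear.has_derivative[OF P'(4) has_derivative_ident])
 have "inj (\<D> F (at z0))"
  unfolding frechet_derivative_at[OF dF, symmetric]
 proof (rule linear_injective_0[OF has_derivative_linear[OF dF], THEN iffD2], intro allI impI)
  fix h assume "(P (L h), P' h) = 0"
  then have h: "P (L h) = 0" "h \<in> span B'" using P'0 by (auto simp: zero_prod_def)
  then obtain k where k: "k \<in> span B" "h = N k" using Nspan by blast
  then have "k = 0" using h(1) LN P(2) by simp
  then show "h = 0" using k(2) linear_0[OF linN] by simp
 qed
 from Ck_locally_injective[OF CF V2 z0V2 this]
 obtain r where r: "r > 0" "ball z0 r \<subseteq> V2" "inj_on F (ball z0 r)" by blast
 \<comment> \<open>Neighbourhoods so small that both \<open>y\<close> and its projection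
   \<open>\<psi> (P (\<phi> y))\<close> are taken by \<open>\<phi>'\<close> to where
   \<open>F\<close> is injective.\<close>
 define O1 where "O1 = U \<inter> (U' \<inter> \<phi>' -` ball z0 r)"
 define O2 where "O2 = V \<inter> \<psi> -` O1"
 define U0 where "U0 = O1 \<inter> (U \<inter> (\<lambda>y. P (\<phi> y)) -` O2)"
 have O1: "open O1" unfolding O1_def
  by (intro open_Int c(1) continuous_open_preimage[OF Ck_continuous_on[OF \<phi>'(3)] \<phi>'(1)] open_ball)
 have O2: "open O2" unfolding O2_def
  by (rule continuous_open_preimage[OF Ck_continuous_on[OF \<psi>(3)] \<psi>(1) O1])
 have "continuous_on U (\<lambda>y. P (\<phi> y))"
  by (rule bounded_linear.continuous_on[OF P(4) Ck_continuous_on[OF \<psi>(2)]])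
 then have U0: "open U0" unfolding U0_def by (intro open_Int O1 continuous_open_preimage c(1) O2)
 have Px0: "P x0 = x0" using x0(2) P(2) by (simp add: corner_model_def)
 have "q \<in> O1" using c(2) c'(2) r(1) by (simp add: O1_def z0_def)
 then have qU0: "q \<in> U0" using x0 c(2) Px0 by (simp add: U0_def O2_def x0_def)
 have mem: "y \<in> Q \<longleftrightarrow> (\<forall>b\<in>C. 0 \<le> \<phi> y \<bullet> b)" if y: "y \<in> M" "y \<in> U0" for y
 proof
  have yU: "y \<in> U" "y \<in> U'" "\<phi>' y \<in> ball z0 r" "P (\<phi> y) \<in> O2" using y(2) by (auto simp: U0_def O1_def)
  show "\<forall>b\<in>C. 0 \<le> \<phi> y \<bullet> b" if "y \<in> Q"
   using that yU(1) c(7) by (auto simp: corner_model_def)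
  assume b: "\<forall>b\<in>C. 0 \<le> \<phi> y \<bullet> b"
  have "P (\<phi> y) \<in> corner_model B C" using P(1,3) b c(6) by (auto simp: corner_model_def)
  then have y1: "\<psi> (P (\<phi> y)) \<in> Q" using QV yU(4) by (simp add: O2_def)
  let ?y1 = "\<psi> (P (\<phi> y))"
  have y1O: "?y1 \<in> U" "?y1 \<in> U'" "\<phi>' ?y1 \<in> ball z0 r" "\<phi> ?y1 = P (\<phi> y)"
   using yU(4) \<psi>(7) by (auto simp: O2_def O1_def)
  have "P' (\<phi>' ?y1) = 0" "P' (\<phi>' y) = 0" using P'0 \<phi>'(10) y1 Q(2) y1O y(1) yU by auto
  then have "F (\<phi>' ?y1) = F (\<phi>' y)"
   using \<phi>'(7) y1O yU P(1,2) by (simp add: F_def)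
  then have "\<phi>' ?y1 = \<phi>' y" using r(3) y1O(3) yU(3) by (auto dest: inj_onD)
  then have "?y1 = y" using \<phi>'(7) y1O(2) yU(2) by metis
  then show "y \<in> Q" using y1 by simp
 qed
 \<comment> \<open>The diagonal direction of the corner, along which every constraint increases at
   unit speed.\<close>
 define u where "u = (\<Sum>b\<in>C. b)"
 have finC: "finite C" by (rule finite_subset[OF subset_trans[OF c(6,4)] finite_Basis])
 have ub: "u \<bullet> b = 1" if "b \<in> C" for b
 proof -
  have "i \<bullet> b = (if i = b then 1 else 0)" if "i \<in> C" for i
   by (rule inner_Basis) (use c(4,6) that \<open>b \<in> C\<close> in blast)+
  then have "u \<bullet> b = (\<Sum>i\<in>C. if i = b then 1 else 0)"
   unfolding u_def inner_sum_left by (rule sum.cong[OF refl])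
  then show ?thesis using that finC by simp
 qed
 have uB: "u \<in> span B" unfolding u_def using c(6) by (intro span_sum span_base) auto
 have "0 \<le> u \<bullet> b" if "b \<in> C" for b using ub[OF that] by simp
 from path[OF uB this] obtain e where e: "e > 0"
  "\<And>s. 0 \<le> s \<Longrightarrow> s < e \<Longrightarrow> x0 + s *\<^sub>R u \<in> V \<and> x0 + s *\<^sub>R u \<in> corner_model B C" by blast
 show thesis
 proof (rule that[of U0 \<phi> C "\<lambda>s. \<psi> (x0 + s *\<^sub>R u)" "\<D> \<psi> (at x0) u" e])
  show "Ck n U0 \<phi>" for n using \<psi>(2) by (rule Ck_subset) (auto simp: U0_def)
  show "C \<subseteq> Basis" using c(4,6) by blast
  have dl: "((\<lambda>s. x0 + s *\<^sub>R u) has_vector_derivative u) (at 0)"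
   unfolding has_vector_derivative_def by (auto intro!: derivative_eq_intros)
  show "((\<lambda>s. \<psi> (x0 + s *\<^sub>R u)) has_vector_derivative \<D> \<psi> (at x0) u) (at 0)"
   using has_vector_derivative_chain[OF dl, of \<psi>] d\<psi> by simp
  show "\<psi> (x0 + s *\<^sub>R u) \<in> Q" if "0 \<le> s" "s < e" for s using QV e(2)[OF that] by blast
  show "\<phi> (\<psi> (x0 + s *\<^sub>R u)) \<bullet> b = \<phi> q \<bullet> b + 1 * s" if "0 \<le> s" "s < e" "b \<in> C" for s b
   using e(2)[OF that(1,2)] \<psi>(7) ub[OF that(3)] by (simp add: inner_add_left x0_def)
 qed (use U0 qU0 mem x0(3) e(1) in auto)
qed

subsection \<open>Inward directions\<close>

text \<open>Base point, direction and step length all vary within \<open>r\<close>. This uniformity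
  makes the inward directions an open convex cone and lets the condition survive small changes of
  \<open>q\<close>.\<close>

definition inward :: "'a::euclidean_space set \<Rightarrow> 'a \<Rightarrow> 'a \<Rightarrow> real \<Rightarrow> bool" where
 "inward A q v r \<longleftrightarrow> 0 < r \<and> (\<forall>q'\<in>A. \<forall>v' t. dist q' q < r \<longrightarrow> dist v' v < r \<longrightarrow> 0 < t \<longrightarrow> t < r \<longrightarrow> q' + t *\<^sub>R v' \<in> A)"

lemma inwardD: "inward A q v r \<Longrightarrow> q' \<in> A \<Longrightarrow> dist q' q < r \<Longrightarrow> dist v' v < r \<Longrightarrow> 0 < t \<Longrightarrow> t < r \<Longrightarrow> q' + t *\<^sub>R v' \<in> A"
 by (simp add: inward_def)

lemma inward_pos: "inward A q v r \<Longrightarrow> r > 0"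
 by (simp add: inward_def)

lemma inward_mono: "inward A q v r \<Longrightarrow> 0 < r' \<Longrightarrow> r' \<le> r \<Longrightarrow> inward A q v r'"
 unfolding inward_def by (meson less_le_trans)

lemma semialgebraic_inward:
 assumes "semialgebraic A" "sa_fun f" "sa_fun g" "sa_fun h"
 shows "semialgebraic {x. inward A (f x) (g x) (h x)}"
 unfolding inward_def
 by (intro sa_intros semialgebraic_mem assms sa_fun_compose[OF assms(2)] sa_fun_compose[OF assms(3)] sa_fun_compose[OF assms(4)])

lemma inward_near:
 assumes r: "inward A q v r" and d: "dist q1 q < r / 2" "dist v1 v < r / 2"
 shows "inward A q1 v1 (r / 2)"
 unfolding inward_def
proof (intro conjI ballI allI impI)
 show "0 < r / 2" using inward_pos[OF r] by simp
 fix q' v' t assume q': "q' \<in> A" and h: "dist q' q1 < r / 2" "dist v' v1 < r / 2" "0 < t" "t < r / 2"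
 show "q' + t *\<^sub>R v' \<in> A"
 proof (rule inwardD[OF r q' _ _ h(3)])
  show "dist q' q < r" using dist_triangle[of q' q q1] h(1) d(1) by argo
  show "dist v' v < r" using dist_triangle[of v' v v1] h(2) d(2) by argo
  show "t < r" using h(4) inward_pos[OF r] by simp
 qed
qed

text \<open>Openness jointly in base point and direction makes the failure of a continuous selection
  a closed condition.\<close>

lemma open_inward: "open {z. \<exists>r. inward A (fst z) (snd z) r}"
proof (rule openI)
 fix z assume "z \<in> {z. \<exists>r. inward A (fst z) (snd z) r}"
 then obtain r where r: "inward A (fst z) (snd z) r" by blast
 have "\<exists>r. inward A (fst y) (snd y) r" if "y \<in> ball z (r / 2)" for y
  using inward_near[OF r, of "fst y" "snd y"] that dist_fst_le[of y z] dist_snd_le[of y z]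
  by (auto simp: dist_commute intro: le_less_trans)
 then show "\<exists>e>0. ball z e \<subseteq> {z. \<exists>r. inward A (fst z) (snd z) r}"
  using inward_pos[OF r] by (intro exI[of _ "r / 2"]) auto
qed

text \<open>A perturbed step along \<open>v1 + v2\<close> is split: first along
  \<open>v' - v2\<close>, which is near \<open>v1\<close>, then along \<open>v2\<close> itself. The
  intermediate point lies in \<open>A\<close>, so the second step may start there.\<close>

lemma inward_add:
 assumes 1: "inward A q v1 r1" and 2: "inward A q v2 r2" shows "\<exists>r. inward A q (v1 + v2) r"
proof -
 define r where "r = min r1 r2"
 have r: "r > 0" using inward_pos[OF 1] inward_pos[OF 2] by (simp add: r_def)
 have i1: "inward A q v1 r" and i2: "inward A q v2 r"
  using inward_mono[OF 1 r] inward_mono[OF 2 r] by (simp_all add: r_def)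
 define m where "m = norm v1 + r + 1"
 have m: "m \<ge> 1" using r by (simp add: m_def)
 \<comment> \<open>The bound \<open>s * m \<le> r / 2\<close> keeps the intermediate point within
   \<open>r\<close> of \<open>q\<close>.\<close>
 define s where "s = min (r / 2) (r / (2 * m))"
 have s: "s > 0" "s \<le> r / 2" "s * m \<le> r / 2"
 proof -
  show "s > 0" "s \<le> r / 2" using r m by (auto simp: s_def)
  have "s \<le> r / (2 * m)" by (simp add: s_def)
  then have "s * (2 * m) \<le> r" using m by (simp add: pos_le_divide_eq)
  then show "s * m \<le> r / 2" by simp
 qed
 have "inward A q (v1 + v2) s"
  unfolding inward_def
 proof (intro conjI ballI allI impI s(1))
  fix q' v' t assume q': "q' \<in> A" and h: "dist q' q < s" "dist v' (v1 + v2) < s" "0 < t" "t < s"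
  let ?u = "v' - v2"
  have u: "dist ?u v1 < s" using h(2) by (simp add: dist_norm algebra_simps)
  have tr: "t < r" using h(4) s(2) r by simp
  have in1: "q' + t *\<^sub>R ?u \<in> A"
   using h(1) u s(2) r by (intro inwardD[OF i1 q' _ _ h(3) tr]) linarith+
  have "norm ?u \<le> norm v1 + s" using u norm_triangle_sub[of ?u v1] by (simp add: dist_norm)
  then have "norm ?u \<le> m" using s(2) r by (simp add: m_def)
  then have "t * norm ?u \<le> s * m" using h(3,4) m by (intro mult_mono) auto
  then have "norm (t *\<^sub>R ?u) \<le> r / 2" using s(3) h(3) by simp
  then have "dist (q' + t *\<^sub>R ?u) q' \<le> r / 2" by (simp add: dist_norm)
  then have "dist (q' + t *\<^sub>R ?u) q < r" using dist_triangle[of "q' + t *\<^sub>R ?u" q q'] h(1) s(2) by argo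
  from inwardD[OF i2 in1 this _ h(3) tr, of v2] r have "q' + t *\<^sub>R ?u + t *\<^sub>R v2 \<in> A" by simp
  then show "q' + t *\<^sub>R v' \<in> A" by (simp add: scaleR_diff_right)
 qed
 then show ?thesis by blast
qed

lemma inward_scale:
 assumes r: "inward A q v r" and c: "c > 0" shows "\<exists>r. inward A q (c *\<^sub>R v) r"
proof -
 define s where "s = min r (min (r * c) (r / c))"
 have s: "s > 0" "s \<le> r" "s \<le> r * c" "s \<le> r / c" using inward_pos[OF r] c by (auto simp: s_def)
 have "inward A q (c *\<^sub>R v) s"
  unfolding inward_def
 proof (intro conjI ballI allI impI s(1))
  fix q' v' t assume q': "q' \<in> A" and h: "dist q' q < s" "dist v' (c *\<^sub>R v) < s" "0 < t" "t < s"
  have "q' + (t * c) *\<^sub>R (v' /\<^sub>R c) \<in> A"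
  proof (rule inwardD[OF r q'])
   show "dist q' q < r" using h(1) s(2) by simp
   have "v' - c *\<^sub>R v = c *\<^sub>R (v' /\<^sub>R c - v)" using c by (simp add: algebra_simps)
   then have "dist v' (c *\<^sub>R v) = c * dist (v' /\<^sub>R c) v" using c by (simp add: dist_norm)
   then have "c * dist (v' /\<^sub>R c) v < c * r" using h(2) s(3) by (simp add: mult.commute)
   then show "dist (v' /\<^sub>R c) v < r" using c by simp
   show "0 < t * c" using h(3) c by simp
   have "t < r / c" using h(4) s(4) by simp
   then show "t * c < r" using c by (simp add: pos_less_divide_eq)
  qed
  then show "q' + t *\<^sub>R v' \<in> A" using c by (simp add: mult.assoc)
 qed
 then show ?thesis by blast
qed

lemma convex_inward: "convex {v. \<exists>r. inward A q v r}"
proof (rule convexI)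
 fix x y and u v :: real
 assume h: "x \<in> {v. \<exists>r. inward A q v r}" "y \<in> {v. \<exists>r. inward A q v r}" "0 \<le> u" "0 \<le> v" "u + v = 1"
 obtain r1 r2 where r: "inward A q x r1" "inward A q y r2" using h by blast
 show "u *\<^sub>R x + v *\<^sub>R y \<in> {v. \<exists>r. inward A q v r}"
 proof (cases "u = 0 \<or> v = 0")
  case True
  then show ?thesis using h(1,2,5) by auto
 next
  case False
  then have "u > 0" "v > 0" using h by auto
  from inward_scale[OF r(1) this(1)] inward_scale[OF r(2) this(2)] show ?thesis using inward_add by blast
 qed
qed

text \<open>An open cone contains balls of every radius. Fixing the radius 1 gives
  \<open>convex_selection\<close> a closed set of centres and room for approximation.\<close>

lemma inward_unit_ball:
 assumes r: "inward A q v r" shows "\<exists>v. ball v 1 \<subseteq> {v. \<exists>r. inward A q v r}"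
proof -
 have p: "2 / r > 0" using inward_pos[OF r] by simp
 have "\<exists>r. inward A q u r" if u: "dist ((2 / r) *\<^sub>R v) u < 1" for u
 proof -
  have "u - (2 / r) *\<^sub>R v = (2 / r) *\<^sub>R ((r / 2) *\<^sub>R u - v)" using inward_pos[OF r] by (simp add: algebra_simps)
  then have "dist ((2 / r) *\<^sub>R v) u = (2 / r) * dist ((r / 2) *\<^sub>R u) v"
   using inward_pos[OF r] by (simp add: dist_norm norm_minus_commute[of _ u])
  then have "dist ((r / 2) *\<^sub>R u) v = (r / 2) * dist ((2 / r) *\<^sub>R v) u" using inward_pos[OF r] by simp
  also have "\<dots> < (r / 2) * 1" using u inward_pos[OF r] by (intro mult_strict_left_mono) auto
  finally have "dist ((r / 2) *\<^sub>R u) v < r / 2" by simp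
  with r have "inward A q ((r / 2) *\<^sub>R u) (r / 2)" using inward_pos[OF r] by (intro inward_near) auto
  from inward_scale[OF this p] show ?thesis using inward_pos[OF r] by simp
 qed
 then show ?thesis by (intro exI[of _ "(2 / r) *\<^sub>R v"]) auto
qed

lemma finite_common_radius:
 assumes "finite C" "\<And>b. b \<in> C \<Longrightarrow> \<exists>r>0. P b r" "\<And>b r s. P b r \<Longrightarrow> 0 < s \<Longrightarrow> s \<le> r \<Longrightarrow> P b s"
 shows "\<exists>r>0::real. \<forall>b\<in>C. P b r"
 using assms(1,2)
proof (induction rule: finite_induct)
 case empty
 show ?case by (intro exI[of _ 1]) simp
next
 case (insert b C)
 obtain r where r: "r > 0" "\<forall>b\<in>C. P b r" using insert by blast
 obtain s where s: "s > 0" "P b s" using insert.prems by blast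
 have "\<forall>b'\<in>insert b C. P b' (min r s)"
 proof
  fix b' assume "b' \<in> insert b C"
  then consider "P b' r" | "P b' s" using r(2) s(2) by blast
  then show "P b' (min r s)" by cases (rule assms(3), assumption, use r(1) s(1) in auto)+
 qed
 then show ?case using r(1) s(1) by (intro exI[of _ "min r s"]) auto
qed

text \<open>The velocity \<open>w\<close> of the corner path raises every constraint
  \<open>F b\<close> at unit speed. By strict differentiability short steps in nearby directions
  from nearby points still do not lower it.\<close>

lemma inward_exists:
 fixes M Q :: "'a::euclidean_space set"
 assumes M: "submanifold d M" "semialgebraic M" and Q: "submanifold_with_corners d Q" "Q \<subseteq> M" and q: "q \<in> Q"
 shows "\<exists>v r. inward {y \<in> retract_dom M. retract_map M y \<in> Q} q v r"
proof -
 let ?W = "retract_dom M" and ?\<pi> = "retract_map M"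
 let ?A = "{y \<in> ?W. ?\<pi> y \<in> Q}"
 obtain U \<phi> C \<gamma> w e where U: "open U" "q \<in> U" "\<And>n. Ck n U (\<phi> :: 'a \<Rightarrow> 'a)" "C \<subseteq> Basis"
  and mem: "\<And>y. y \<in> M \<Longrightarrow> y \<in> U \<Longrightarrow> y \<in> Q \<longleftrightarrow> (\<forall>b\<in>C. 0 \<le> \<phi> y \<bullet> b)"
  and \<gamma>: "(\<gamma> has_vector_derivative w) (at 0)" "\<gamma> 0 = q" "e > 0"
  "\<And>s. 0 \<le> s \<Longrightarrow> s < e \<Longrightarrow> \<gamma> s \<in> Q"
  "\<And>s b. 0 \<le> s \<Longrightarrow> s < e \<Longrightarrow> b \<in> C \<Longrightarrow> \<phi> (\<gamma> s) \<bullet> b = \<phi> q \<bullet> b + 1 * s"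
  by (rule corner_coordinates[OF M(1) Q q]) (rule that)
 have MW: "M \<subseteq> ?W" by (rule submanifold_subset_retract_dom[OF M(1)])
 have \<pi>M: "?\<pi> y = y" if "y \<in> M" for y by (rule retract_map_eq[OF near_pt_self[OF that]])
 have n\<pi>: "nash_on ?W ?\<pi>" by (rule nash_on_retract_map[OF M])
 have W: "open ?W" by (rule nash_on_open[OF n\<pi>])
 define N where "N = ?W \<inter> ?\<pi> -` U"
 have N: "open N" unfolding N_def by (rule continuous_open_preimage[OF nash_on_continuous_on[OF n\<pi>] W U(1)])
 have qM: "q \<in> M" using q Q(2) by blast
 then have qN: "q \<in> N" using MW \<pi>M U(2) by (auto simp: N_def)
 define F where "F b y = \<phi> (?\<pi> y) \<bullet> b" for b y
 have CF: "Ck n N (F b)" for n b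
 proof -
  have "Ck n N ?\<pi>" by (rule Ck_subset[OF nash_on_Ck[OF n\<pi>]]) (simp add: N_def)
  from Ck_compose[OF N U(1) U(3) this] have "Ck n N (\<lambda>y. \<phi> (?\<pi> y))" by (auto simp: N_def)
  from Ck_linear[OF N bounded_linear_inner_left this] show ?thesis by (simp add: F_def[abs_def])
 qed
 have memN: "y \<in> ?A \<longleftrightarrow> (\<forall>b\<in>C. 0 \<le> F b y)" if "y \<in> N" for y
 proof -
  have y: "y \<in> ?W" "?\<pi> y \<in> U" using that by (auto simp: N_def)
  then have "?\<pi> y \<in> M" using retract_map[of y M] by (simp add: near_pt_def)
  from mem[OF this y(2)] y(1) show ?thesis by (simp add: F_def)
 qed
 have dF: "(F b has_derivative \<D> (F b) (at q)) (at q)" for b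
  by (rule Ck_has_derivative[OF CF N qN])
 have D1: "\<D> (F b) (at q) w = 1" if b: "b \<in> C" for b
 proof (rule right_affine_derivative[OF _ \<gamma>(3)])
  show "((\<lambda>s. F b (\<gamma> s)) has_real_derivative \<D> (F b) (at q) w) (at 0)"
   using has_vector_derivative_chain[OF \<gamma>(1), of "F b"] dF[of b] \<gamma>(2)
   by (simp add: has_real_derivative_iff_has_vector_derivative)
  show "F b (\<gamma> s) = \<phi> q \<bullet> b + 1 * s" if "0 \<le> s" "s < e" for s
   using \<gamma>(5)[OF that b] \<pi>M \<gamma>(4)[OF that] Q(2) by (auto simp: F_def)
 qed
 \<comment> \<open>The moved point stays in the ball where the estimates hold.\<close>
 have near: "y + t *\<^sub>R v \<in> ball q r0 \<and> norm v \<le> norm w + 1"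
  if h: "dist y q < r" "dist v w < r" "0 < t" "t < r" and r: "r \<le> 1" "r \<le> r0 / (norm w + 2)" for y v t r r0
 proof
  have w2: "norm w + 2 > 0" by (simp add: add_nonneg_pos)
  show nv: "norm v \<le> norm w + 1" using h(2) r(1) norm_triangle_sub[of v w] by (simp add: dist_norm)
  have tv: "t * norm v \<le> r * (norm w + 1)" using nv h(3,4) by (intro mult_mono) auto
  have rr: "r + r * (norm w + 1) \<le> r0" using r(2) w2 by (simp add: pos_le_divide_eq algebra_simps)
  have "dist (y + t *\<^sub>R v) q \<le> dist (y + t *\<^sub>R v) y + dist y q" by (rule dist_triangle)
  also have "dist (y + t *\<^sub>R v) y = t * norm v" using h(3) by (simp add: dist_norm)
  finally show "y + t *\<^sub>R v \<in> ball q r0" using tv rr h(1) by (simp add: dist_commute)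
 qed
 have w2: "norm w + 2 \<ge> 1" "norm w + 2 > 0" by (simp_all add: add_nonneg_pos)
 define P where "P b r \<longleftrightarrow> (\<forall>y v t. y \<in> ?A \<longrightarrow> dist y q < r \<longrightarrow> dist v w < r \<longrightarrow> 0 < t \<longrightarrow> t < r \<longrightarrow>
   0 \<le> F b (y + t *\<^sub>R v))" for b r
 have "\<exists>r>0. P b r" if b: "b \<in> C" for b
 proof -
  \<comment> \<open>As \<open>norm v \<le> norm w + 1\<close>, the linearization error is at most
    \<open>t / 2\<close>, and the derivative along \<open>v\<close>, at least 1/2, makes up for
    it.\<close>
  define \<epsilon> where "\<epsilon> = 1 / (2 * (norm w + 1))"
  have w1: "norm w + 1 > 0" by (simp add: add_nonneg_pos)
  then have \<epsilon>: "\<epsilon> > 0" by (simp add: \<epsilon>_def)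
  let ?D = "\<D> (F b) (at q)"
  from Ck_strict_derivative[OF CF N qN \<epsilon>] obtain r0 where r0: "r0 > 0" "ball q r0 \<subseteq> N"
   "\<And>x y. x \<in> ball q r0 \<Longrightarrow> y \<in> ball q r0 \<Longrightarrow> norm (F b y - F b x - ?D (y - x)) \<le> \<epsilon> * norm (y - x)"
   by blast
  have blD: "bounded_linear ?D" using has_derivative_bounded_linear[OF dF] .
  obtain K where K: "K > 0" "\<And>h. norm (?D h) \<le> norm h * K" using bounded_linear.pos_bounded[OF blD] by blast
  define r where "r = min 1 (min (1 / (2 * K)) (r0 / (norm w + 2)))"
  have r: "r > 0" "r \<le> 1" "r \<le> 1 / (2 * K)" "r \<le> r0 / (norm w + 2)"
   using K(1) r0(1) divide_pos_pos[OF r0(1) w2(2)] by (auto simp: r_def)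
  have rK: "r * K \<le> 1/2" using r(3) K(1) by (simp add: pos_le_divide_eq)
  have "r * 1 \<le> r * (norm w + 2)" using w2 r(1) by (intro mult_left_mono) auto
  also have "\<dots> \<le> r0" using r(4) w2 by (simp add: pos_le_divide_eq)
  finally have rr: "r \<le> r0" by simp
  have "P b r" unfolding P_def
  proof (intro allI impI)
   fix y v t assume y: "y \<in> ?A" and h: "dist y q < r" "dist v w < r" "0 < t" "t < r"
   have yb: "y \<in> ball q r0" using h(1) rr by (simp add: dist_commute)
   have yt: "y + t *\<^sub>R v \<in> ball q r0" and nv: "norm v \<le> norm w + 1" using near[OF h r(2,4)] by blast+
   have "y \<in> N" using yb r0(2) by blast
   then have F0: "0 \<le> F b y" using memN y b by blast
   have "norm (?D (v - w)) \<le> norm (v - w) * K" by (rule K(2))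
   also have "\<dots> \<le> r * K" using h(2) K(1) by (intro mult_right_mono) (auto simp: dist_norm)
   finally have "\<bar>?D v - 1\<bar> \<le> 1/2"
    using rK linear_diff[OF bounded_linear.linear[OF blD], of v w] D1[OF b] by simp
   then have Dv: "1/2 \<le> ?D v" by argo
   have "\<epsilon> * norm (t *\<^sub>R v) \<le> t * (\<epsilon> * (norm w + 1))"
    using nv h(3) \<epsilon> by (simp add: mult_ac mult_left_mono)
   also have "\<epsilon> * (norm w + 1) = 1/2" using w1 by (simp add: \<epsilon>_def field_simps)
   finally have "norm (F b (y + t *\<^sub>R v) - F b y - t * ?D v) \<le> t * (1/2)"
    using r0(3)[OF yb yt] linear_scale[OF bounded_linear.linear[OF blD], of t v] by simp
   moreover have "t * (1/2) \<le> t * ?D v" using Dv h(3) by (intro mult_left_mono) auto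
   ultimately show "0 \<le> F b (y + t *\<^sub>R v)" using F0 unfolding real_norm_def by argo
  qed
  then show ?thesis using r(1) by blast
 qed
 moreover have "P b s" if "P b r" "0 < s" "s \<le> r" for b r s
  using that(1,3) unfolding P_def by (meson less_le_trans)
 moreover have "finite C" by (rule finite_subset[OF U(4) finite_Basis])
 ultimately obtain r where r: "r > 0" "\<forall>b\<in>C. P b r" using finite_common_radius[of C P] by blast
 obtain r0 where r0: "r0 > 0" "ball q r0 \<subseteq> N" using N qN open_contains_ball by blast
 define s where "s = min r (min 1 (r0 / (norm w + 2)))"
 have s: "s > 0" "s \<le> r" "s \<le> 1" "s \<le> r0 / (norm w + 2)" using r divide_pos_pos[OF r0(1) w2(2)] by (auto simp: s_def)
 have "inward ?A q w s" unfolding inward_def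
 proof (intro conjI ballI allI impI s(1))
  fix y v t assume y: "y \<in> ?A" and h: "dist y q < s" "dist v w < s" "0 < t" "t < s"
  have "y + t *\<^sub>R v \<in> N" using near[OF h s(3,4)] r0(2) by blast
  moreover have "0 \<le> F b (y + t *\<^sub>R v)" if "b \<in> C" for b
  proof -
   have "P b r" using r(2) that by blast
   then show ?thesis unfolding P_def using y h s(2) by (meson less_le_trans)
  qed
  ultimately show "y + t *\<^sub>R v \<in> ?A" using memN by blast
 qed
 then show ?thesis by blast
qed

section \<open>Continuous selections\<close>

lemma open_inner_balls_closed: "closed {v. ball v 1 \<subseteq> (K :: 'b::euclidean_space set)}"
proof -
 have "{v. ball v 1 \<subseteq> K} = - (\<Union>u\<in>- K. ball u 1)"
  by (auto simp: dist_commute)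
 also have "closed \<dots>" by (intro closed_Compl open_UN) auto
 finally show ?thesis .
qed

lemma convex_inner_balls:
 assumes K: "convex (K :: 'b::euclidean_space set)" shows "convex {v. ball v 1 \<subseteq> K}"
proof (rule convexI)
 fix x y and u v :: real
 assume h: "x \<in> {v. ball v 1 \<subseteq> K}" "y \<in> {v. ball v 1 \<subseteq> K}" "0 \<le> u" "0 \<le> v" "u + v = 1"
 have "z \<in> K" if "z \<in> ball (u *\<^sub>R x + v *\<^sub>R y) 1" for z
 proof -
  let ?h = "z - (u *\<^sub>R x + v *\<^sub>R y)"
  have "norm ?h < 1" using that by (simp add: dist_norm norm_minus_commute)
  moreover have b: "a + k \<in> ball a 1" if "norm k < 1" for a k :: 'b using that by (simp add: dist_norm)
  ultimately have "x + ?h \<in> K" "y + ?h \<in> K" using h(1,2) by blast+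
  then have "u *\<^sub>R (x + ?h) + v *\<^sub>R (y + ?h) \<in> K" using K h(3-5) by (intro convexD)
  also have "u *\<^sub>R (x + ?h) + v *\<^sub>R (y + ?h) = u *\<^sub>R x + v *\<^sub>R y + (u + v) *\<^sub>R ?h"
   by (simp add: scaleR_add_right scaleR_add_left)
  finally show ?thesis using h(5) by simp
 qed
 then show "u *\<^sub>R x + v *\<^sub>R y \<in> {v. ball v 1 \<subseteq> K}" by blast
qed

text \<open>The selection of least norm is semialgebraic, hence continuous on the pieces of a
 stratification; there it is approximated, and the pieces are glued by convexity.\<close>
lemma convex_selection:
 fixes S :: "'a::euclidean_space set" and K :: "'a \<Rightarrow> 'b::euclidean_space set"
 assumes S: "closed S" "semialgebraic S" and K: "semialgebraic {z. snd z \<in> K (fst z)}" "\<And>x. convex (K x)"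
  and ne: "\<And>x. x \<in> S \<Longrightarrow> \<exists>v. ball v 1 \<subseteq> K x"
  and cl: "\<And>w. continuous_on UNIV w \<Longrightarrow> closed {x\<in>S. w x \<notin> K x}"
 obtains w where "sa_fun w" "continuous_on UNIV w" "\<And>x. x \<in> S \<Longrightarrow> w x \<in> K x"
proof -
 have Ksa: "semialgebraic {z. v z \<in> K (u z)}" if "sa_fun u" "sa_fun v" for u and v :: "'c::euclidean_space \<Rightarrow> 'b"
  using semialgebraic_mem[OF sa_fun_Pair[OF that] K(1)] by simp
 \<comment> \<open>The centres of unit balls inside \<open>K x\<close> form a closed convex set, so
   there is exactly one of least norm when the set is nonempty. Any value at distance less than 1
   from it still lies in \<open>K x\<close>.\<close>
 define T where "T x = {v. ball v 1 \<subseteq> K x}" for x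
 have T: "v \<in> T x \<longleftrightarrow> (\<forall>u. dist v u < 1 \<longrightarrow> u \<in> K x)" for x v by (auto simp: T_def)
 define R where "R x v \<longleftrightarrow> v \<in> T x \<and> (\<forall>v'. v' \<in> T x \<longrightarrow> norm v \<le> norm v')" for x v
 have Rsa: "semialgebraic {z. R (u z) (v z)}" if "sa_fun u" "sa_fun v" for u and v :: "'c::euclidean_space \<Rightarrow> 'b"
  unfolding R_def T
  by (intro sa_intros Ksa sa_fun_compose[OF that(1)] sa_fun_compose[OF that(2)] that)
 have Run: "v = v'" if "R x v" "R x v'" for x v v'
  using that any_closest_point_unique[OF convex_inner_balls[OF K(2)[of x]] open_inner_balls_closed, of v v' 0]
  by (auto simp: R_def T_def)
 have Rex: "\<exists>v. R x v" if x: "x \<in> S" for x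
 proof -
  have "T x \<noteq> {}" using ne[OF x] by (auto simp: T_def)
  moreover have "closed (T x)" unfolding T_def by (rule open_inner_balls_closed)
  ultimately obtain v where "v \<in> T x" "\<And>y. y \<in> T x \<Longrightarrow> dist 0 v \<le> dist 0 y"
   using distance_attains_inf[of "T x" 0] by blast
  then show ?thesis by (auto simp: R_def)
 qed
 define sel where "sel x = (if \<exists>v. R x v then THE v. R x v else 0)" for x
 have seleq: "sel x = v" if "R x v" for x v
 proof -
  have "(THE v. R x v) = v" using that by (rule the_equality) (rule Run[OF _ that])
  then show ?thesis using that by (auto simp: sel_def)
 qed
 have selsa: "sa_fun sel"
 proof (rule sa_funI[where R="\<lambda>x v. R x v \<or> (\<not> (\<exists>v. R x v) \<and> v = 0)"])
  show "semialgebraic {z. R (fst z) (snd z) \<or> (\<not> (\<exists>v. R (fst z) v) \<and> snd z = 0)}"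
   by (intro sa_intros Rsa)
  show "(R x v \<or> (\<not> (\<exists>v. R x v) \<and> v = 0)) = (v = sel x)" for x v
  proof (cases "\<exists>v. R x v")
   case True
   then obtain v' where v': "R x v'" by blast
   show ?thesis unfolding seleq[OF v'] using Run v' by blast
  qed (simp add: sel_def)
 qed
 have selT: "ball (sel x) 1 \<subseteq> K x" if x: "x \<in> S" for x
  using Rex[OF x] seleq[of x] by (auto simp: R_def T_def)
 obtain Xs where Xs: "\<And>X. X \<in> set Xs \<Longrightarrow> semialgebraic X" "\<And>C. homogeneous Xs C \<Longrightarrow> continuous_on C sel"
  by (rule continuity_strata[OF selsa]) (rule that)
 \<comment> \<open>The selection is continuous on the whole space and only its membership is
   confined to \<open>C\<close>; so the set where it fails on a larger closed set is closed by
   \<open>cl\<close>.\<close>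
 define Prp where "Prp C \<longleftrightarrow> (\<exists>w. sa_fun w \<and> continuous_on UNIV w \<and> (\<forall>x\<in>C. w x \<in> K x))" for C
 have "Prp S"
 proof (rule stratify_list[where Prp=Prp and S0=S and Xs=Xs, OF _ Xs(1) S order_refl])
  fix S' A assume S': "closed S'" "semialgebraic S'" "S' \<subseteq> S" and A: "closed A" "semialgebraic A" "A \<subseteq> S'" "Prp A"
   and ind: "\<And>C. closed C \<Longrightarrow> semialgebraic C \<Longrightarrow> C \<subseteq> S' - A \<Longrightarrow> Prp C"
  have bad: "closed {x\<in>S'. w x \<notin> K x}" "semialgebraic {x\<in>S'. w x \<notin> K x}"
   if "sa_fun w" "continuous_on UNIV w" for w
  proof -
   have "{x\<in>S'. w x \<notin> K x} = S' \<inter> {x\<in>S. w x \<notin> K x}" using S'(3) by blast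
   then show "closed {x\<in>S'. w x \<notin> K x}" using closed_Int[OF S'(1) cl[OF that(2)]] by simp
   show "semialgebraic {x\<in>S'. w x \<notin> K x}" by (intro sa_intros semialgebraic_mem S' Ksa that)
  qed
  obtain w1 where w1: "sa_fun w1" "continuous_on UNIV w1" "\<forall>x\<in>A. w1 x \<in> K x" using A(4) by (auto simp: Prp_def)
  define C where "C = {x\<in>S'. w1 x \<notin> K x}"
  have C: "closed C" "semialgebraic C" unfolding C_def by (rule bad[OF w1(1,2)])+
  have "Prp C" using w1(3) by (intro ind C) (auto simp: C_def)
  then obtain w2 where w2: "sa_fun w2" "continuous_on UNIV w2" "\<forall>x\<in>C. w2 x \<in> K x" by (auto simp: Prp_def)
  define D where "D = {x\<in>S'. w2 x \<notin> K x}"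
  have D: "closed D" "semialgebraic D" unfolding D_def by (rule bad[OF w2(1,2)])+
  show "Prp S'"
  proof (cases "C = {} \<or> D = {}")
   case True
   then show ?thesis unfolding Prp_def using w1 w2 by (auto simp: C_def D_def)
  next
   case False
   then have ne: "C \<noteq> {}" "D \<noteq> {}" by auto
   have disj: "C \<inter> D = {}" using w2(3) by (auto simp: D_def)
   have z: "infdist x C = 0 \<longleftrightarrow> x \<in> C" "infdist x D = 0 \<longleftrightarrow> x \<in> D" for x
    using in_closed_iff_infdist_zero[OF C(1) ne(1)] in_closed_iff_infdist_zero[OF D(1) ne(2)] by blast+
   define s where "s x = infdist x D + infdist x C" for x
   have nn: "infdist x C \<ge> 0" "infdist x D \<ge> 0" for x by (rule infdist_nonneg)+
   have s: "s x > 0" for x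
   proof -
    have "infdist x C \<noteq> 0 \<or> infdist x D \<noteq> 0" using z disj by blast
    then show ?thesis using nn[of x] by (auto simp: s_def)
   qed
   \<comment> \<open>A continuous convex combination equal to \<open>w2\<close> on \<open>C\<close>,
     where \<open>w1\<close> fails, and to \<open>w1\<close> on \<open>D\<close>, where
     \<open>w2\<close> fails.\<close>
   define w where "w x = (infdist x D / s x) *\<^sub>R w2 x + (infdist x C / s x) *\<^sub>R w1 x" for x
   have "sa_fun w" unfolding w_def[abs_def] s_def
    by (intro sa_intros sa_fun_infdist C D w1 w2)
   moreover have "continuous_on UNIV w"
   proof -
    have "s x \<noteq> 0" for x using s[of x] by simp
    then show ?thesis unfolding w_def[abs_def] s_def using w1(2) w2(2)
     by (intro continuous_intros) auto
   qed
   moreover have "w x \<in> K x" if x: "x \<in> S'" for x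
   proof -
    have sum1: "infdist x D / s x + infdist x C / s x = 1"
     using s[of x] by (simp add: s_def flip: add_divide_distrib)
    consider "x \<in> C" | "x \<in> D" | "x \<notin> C" "x \<notin> D" by blast
    then show ?thesis
    proof cases
     case 1
     then have "infdist x C = 0" using z by blast
     then have "w x = w2 x" using sum1 by (simp add: w_def)
     then show ?thesis using w2(3) 1 by simp
    next
     case 2
     then have "infdist x D = 0" "x \<notin> C" using z disj by blast+
     then have "w x = w1 x" using sum1 by (simp add: w_def)
     then show ?thesis using \<open>x \<notin> C\<close> x by (simp add: C_def)
    next
     case 3
     then have "w1 x \<in> K x" "w2 x \<in> K x" using x by (auto simp: C_def D_def)
     then show ?thesis unfolding w_def
      by (intro convexD[OF K(2)] sum1) (use nn[of x] s[of x] in auto)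
    qed
   qed
   ultimately show ?thesis unfolding Prp_def by blast
  qed
 next
  fix C assume C: "closed C" "semialgebraic C" "C \<subseteq> S" and hom: "\<And>X. X \<in> set Xs \<Longrightarrow> C \<subseteq> X \<or> C \<inter> X = {}"
  have "homogeneous Xs C" using hom by (simp add: homogeneous_def)
  from nash_approximation[OF C(1,2) selsa Xs(2)[OF this], of 2]
  obtain h where h: "nash_on UNIV h" "\<And>x. x \<in> C \<Longrightarrow> norm (h x - sel x) \<le> wt 2 x" by (metis one_le_numeral)
  have "h x \<in> K x" if x: "x \<in> C" for x
  proof -
   have "wt (2 * 1) x \<le> wt 1 x / 2" using wt_scale[of 2 1 x] by simp
   also have "\<dots> \<le> 1 / 2" using wt_le1[of 1 x] by simp
   finally have "dist (sel x) (h x) < 1" using h(2)[OF x] by (simp add: dist_norm norm_minus_commute)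
   then show ?thesis using selT[of x] x C(3) by (auto simp: subset_eq)
  qed
  then show "Prp C" unfolding Prp_def
   using nash_on_sa_fun[OF h(1)] nash_on_UNIV_continuous_on[OF h(1)] by blast
 qed
 then show thesis using that by (auto simp: Prp_def)
qed

section \<open>Approximation with values in a manifold with corners\<close>

text \<open>The embedding \<open>x \<mapsto> (x, 1 / \<nu> x)\<close> makes a locally closed set closed.\<close>
lemma locally_closed_graph:
 fixes S :: "'a::euclidean_space set"
 assumes S: "semialgebraic S" "locally compact S"
 obtains K and \<nu> :: "'a \<Rightarrow> real" where "closed K" "semialgebraic K" "S \<inter> K = {}" "nash_on (- K) \<nu>"
  "\<And>x. x \<in> S \<Longrightarrow> \<nu> x > 0" "\<And>x. x \<notin> K \<Longrightarrow> \<nu> x > 0"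
  "closed {z. fst z \<in> S \<and> snd z * \<nu> (fst z) = 1}" "semialgebraic {z. fst z \<in> S \<and> snd z * \<nu> (fst z) = 1}"
proof -
 obtain T where T: "open T" "S = T \<inter> closure S" using locally_compact_open_Int_closure[OF S(2)] by metis
 define K where "K = closure S - S"
 have Keq: "K = closure S \<inter> - T" using T(2) closure_subset[of S] by (auto simp: K_def)
 have K: "closed K" unfolding Keq using T(1) by (intro closed_Int) auto
 have Ksa: "semialgebraic K"
  unfolding K_def set_diff_eq by (intro sa_intros semialgebraic_mem semialgebraic_closure S)
 have SK: "S \<inter> K = {}" by (auto simp: K_def)
 obtain \<nu> w where \<nu>: "nash_on (- K) \<nu>" "\<And>x. x \<notin> K \<Longrightarrow> \<nu> x > 0"
  and w: "continuous_on UNIV w" "\<And>x. x \<in> K \<Longrightarrow> w x \<le> (0::real)" "\<And>x. x \<notin> K \<Longrightarrow> \<nu> x \<le> w x"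
  by (rule nash_minorant[OF K Ksa]) (rule that)
 have \<nu>S: "\<nu> x > 0" if "x \<in> S" for x using \<nu>(2) SK that by blast
 let ?S' = "{z. fst z \<in> S \<and> snd z * \<nu> (fst z) = 1}"
 \<comment> \<open>A closed set on which \<nu> is continuous: over \<open>K\<close>, where
   \<open>w \<le> 0\<close>, the last condition fails. The graph is closed because it is cut out of
   this set by a continuous equation.\<close>
 define T where "T = {z. fst z \<in> closure S \<and> 0 \<le> snd z \<and> 1 \<le> snd z * w (fst z)}"
 have wf: "continuous_on UNIV (\<lambda>z::'a \<times> real. w (fst z))"
  by (rule continuous_on_compose2[OF w(1)]) (auto intro!: continuous_intros)
 have Tc: "closed T"
 proof -
  have "closed {z. (0::real) \<le> snd (z :: 'a \<times> real)}" by (intro closed_Collect_le continuous_intros)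
  moreover have "closed {z::'a \<times> real. 1 \<le> snd z * w (fst z)}" by (intro closed_Collect_le continuous_intros wf)
  moreover have "closed (fst -` closure S :: ('a \<times> real) set)" by (intro closed_vimage_fst closed_closure)
  moreover have "T = fst -` closure S \<inter> ({z. 0 \<le> snd z} \<inter> {z. 1 \<le> snd z * w (fst z)})" by (auto simp: T_def)
  ultimately show ?thesis by (simp add: closed_Int)
 qed
 have TK: "fst z \<notin> K" if "z \<in> T" for z
 proof
  assume "fst z \<in> K"
  then have "snd z * w (fst z) \<le> 0" using w(2) that by (intro mult_nonneg_nonpos) (auto simp: T_def)
  then show False using that by (simp add: T_def)
 qed
 have "continuous_on T (\<lambda>z. \<nu> (fst z))"
  by (rule continuous_on_compose2[OF nash_on_continuous_on[OF \<nu>(1)]]) (use TK in \<open>auto intro!: continuous_intros\<close>)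
 then have "continuous_on T (\<lambda>z. snd z * \<nu> (fst z))" by (intro continuous_intros)
 from continuous_closed_preimage[OF this Tc, of "{1}"]
 have "closed (T \<inter> (\<lambda>z. snd z * \<nu> (fst z)) -` {1})" by simp
 also have "T \<inter> (\<lambda>z. snd z * \<nu> (fst z)) -` {1} = ?S'"
 proof (intro set_eqI iffI)
  fix z assume z: "z \<in> T \<inter> (\<lambda>z. snd z * \<nu> (fst z)) -` {1}"
  then have "fst z \<in> S" using TK[of z] by (auto simp: T_def K_def)
  then show "z \<in> ?S'" using z by simp
 next
  fix z assume z: "z \<in> ?S'"
  then have p: "\<nu> (fst z) > 0" "fst z \<notin> K" using \<nu>S SK by auto
  have e: "snd z * \<nu> (fst z) = 1" using z by simp
  then have s0: "0 \<le> snd z" using p(1) by (metis mult_nonpos_nonneg less_imp_le linear not_one_le_zero)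
  have "snd z * \<nu> (fst z) \<le> snd z * w (fst z)" using w(3)[OF p(2)] s0 by (rule mult_left_mono)
  then show "z \<in> T \<inter> (\<lambda>z. snd z * \<nu> (fst z)) -` {1}"
   using e s0 z closure_subset[of S] by (auto simp: T_def)
 qed
 finally have 1: "closed ?S'" .
 have 2: "semialgebraic ?S'"
  by (intro sa_intros semialgebraic_mem S sa_fun_compose[OF nash_on_sa_fun[OF \<nu>(1)]])
 show thesis by (rule that[OF K Ksa SK \<nu>(1) \<nu>S \<nu>(2) 1 2])
qed

lemma approximation_on_closed:
 fixes M Q :: "'b::euclidean_space set" and S :: "'a::euclidean_space set"
 assumes M: "submanifold d M" "semialgebraic M" and Q: "submanifold_with_corners d Q" "Q \<subseteq> M" "semialgebraic Q"
  and S: "closed S" "semialgebraic S" and f: "sa_fun f" "continuous_on S f" "f ` S \<subseteq> Q"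
  and \<epsilon>: "sa_fun \<epsilon>" "continuous_on S \<epsilon>" "\<And>x. x \<in> S \<Longrightarrow> \<epsilon> x > 0"
 obtains g where "nash_on UNIV g" "\<And>x. x \<in> S \<Longrightarrow> g x \<in> retract_dom M \<and> retract_map M (g x) \<in> Q"
  "\<And>x. x \<in> S \<Longrightarrow> dist (g x) (f x) < \<epsilon> x"
proof -
 define A where "A = {y \<in> retract_dom M. retract_map M y \<in> Q}"
 have Asa: "semialgebraic A"
  unfolding A_def by (intro sa_intros semialgebraic_mem semialgebraic_retract_dom sa_fun_retract_map M Q)
 have QA: "Q \<subseteq> A"
 proof
  fix y assume y: "y \<in> Q"
  then have "y \<in> M" using Q(2) by blast
  then have "y \<in> retract_dom M" "retract_map M y = y"
   using submanifold_subset_retract_dom[OF M(1)] retract_map_eq[OF near_pt_self] by blast+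
  then show "y \<in> A" using y by (simp add: A_def)
 qed
 obtain w where w: "sa_fun w" "continuous_on UNIV w" "\<And>x. x \<in> S \<Longrightarrow> w x \<in> {v. \<exists>r. inward A (f x) v r}"
 proof (rule convex_selection[OF S, where K="\<lambda>x. {v. \<exists>r. inward A (f x) v r}"])
  show "semialgebraic {z. snd z \<in> {v. \<exists>r. inward A (f (fst z)) v r}}"
   unfolding mem_Collect_eq by (intro sa_intros semialgebraic_inward Asa sa_fun_compose[OF f(1)])
  show "convex {v. \<exists>r. inward A (f x) v r}" for x by (rule convex_inward)
  show "\<exists>v. ball v 1 \<subseteq> {v. \<exists>r. inward A (f x) v r}" if "x \<in> S" for x
  proof -
   have "f x \<in> Q" using f(3) that by blast
   from inward_exists[OF M Q(1,2) this] obtain v r where "inward A (f x) v r" unfolding A_def by blast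
   then show ?thesis by (rule inward_unit_ball)
  qed
  show "closed {x \<in> S. w x \<notin> {v. \<exists>r. inward A (f x) v r}}" if "continuous_on UNIV w" for w
  proof -
   have "continuous_on S (\<lambda>x. (f x, w x))"
    using f(2) continuous_on_subset[OF that] by (intro continuous_on_Pair) auto
   from continuous_closed_preimage[OF this S(1) closed_Compl[OF open_inward[of A]]]
   show ?thesis by (simp add: Int_def vimage_def)
  qed
 qed (rule that)
 have wS: "continuous_on S w" using w(2) continuous_on_subset by blast
 \<comment> \<open>The admissible radius is locally bounded below by \<open>inward_near\<close>, so
   it can be taken to be a weight.\<close>
 obtain k where k: "k \<ge> 1" "\<And>x. x \<in> S \<Longrightarrow> inward A (f x) (w x) (wt k x)"
 proof (rule threshold_wt[OF S, where P="\<lambda>x. inward A (f x) (w x)"])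
  show "semialgebraic {z. inward A (f (fst z)) (w (fst z)) (snd z)}"
   by (intro semialgebraic_inward Asa sa_fun_compose[OF f(1)] sa_fun_compose[OF w(1)] sa_intros)
  show "inward A (f x) (w x) r'" if "inward A (f x) (w x) r" "0 < r'" "r' \<le> r" for x r r'
   using that by (rule inward_mono)
  fix x assume x: "x \<in> S"
  obtain r where r: "inward A (f x) (w x) r" using w(3)[OF x] by blast
  have r2: "r / 2 > 0" using inward_pos[OF r] by simp
  obtain d1 where d1: "d1 > 0" "\<And>y. y \<in> S \<Longrightarrow> dist y x < d1 \<Longrightarrow> dist (f y) (f x) < r / 2"
   using f(2) x r2 unfolding continuous_on_iff by meson
  obtain d2 where d2: "d2 > 0" "\<And>y. y \<in> S \<Longrightarrow> dist y x < d2 \<Longrightarrow> dist (w y) (w x) < r / 2"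
   using wS x r2 unfolding continuous_on_iff by meson
  have "inward A (f y) (w y) (r / 2)" if "y \<in> S" "dist y x < min d1 d2" for y
   using d1(2)[of y] d2(2)[of y] that by (intro inward_near[OF r]) auto
  moreover have "min d1 d2 > 0" using d1(1) d2(1) by simp
  ultimately show "\<exists>\<delta>>0. \<exists>c>0. \<forall>y\<in>S. dist y x < \<delta> \<longrightarrow> inward A (f y) (w y) c" using r2 by blast
 qed (rule that)
 \<comment> \<open>Short enough for \<open>inward\<close>, and moving \<open>f\<close> by at most
   \<open>\<epsilon> / 8\<close>; the summand 1 keeps the denominator positive where
   \<open>w\<close> vanishes.\<close>
 define \<delta> where "\<delta> x = min (wt k x / 2) (\<epsilon> x / (8 * (1 + norm (w x))))" for x
 have w1: "1 + norm (w x) > 0" for x by (simp add: add_pos_nonneg)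
 have \<delta>: "\<delta> x > 0" "\<delta> x < wt k x" "\<delta> x * norm (w x) \<le> \<epsilon> x / 8" if x: "x \<in> S" for x
 proof -
  show p: "\<delta> x > 0" using wt_pos[OF k(1), of x] \<epsilon>(3)[OF x] w1[of x] by (simp add: \<delta>_def)
  show "\<delta> x < wt k x" using wt_pos[OF k(1), of x] by (simp add: \<delta>_def min_less_iff_disj)
  have "\<delta> x \<le> \<epsilon> x / (8 * (1 + norm (w x)))" by (simp add: \<delta>_def)
  then have "\<delta> x * (8 * (1 + norm (w x))) \<le> \<epsilon> x" using w1[of x] by (simp add: pos_le_divide_eq)
  then show "\<delta> x * norm (w x) \<le> \<epsilon> x / 8" using p by (simp add: algebra_simps)
 qed
 have wtc: "continuous_on S (wt k)" by (rule nash_on_UNIV_continuous_on[OF nash_on_wt[OF k(1)]])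
 have wtsa: "sa_fun (wt k)" by (rule nash_on_sa_fun[OF nash_on_wt[OF k(1)]])
 have \<delta>sa: "sa_fun \<delta>" unfolding \<delta>_def[abs_def] by (intro sa_intros w(1) \<epsilon>(1) wtsa)
 have \<delta>c: "continuous_on S \<delta>"
 proof -
  have "8 * (1 + norm (w x)) \<noteq> 0" for x using w1[of x] by simp
  then show ?thesis unfolding \<delta>_def[abs_def] by (intro continuous_intros wS \<epsilon>(2) wtc) auto
 qed
 define f1 where "f1 x = f x + \<delta> x *\<^sub>R w x" for x
 have f1sa: "sa_fun f1" unfolding f1_def[abs_def] by (intro sa_intros f(1) \<delta>sa w(1))
 have f1c: "continuous_on S f1" unfolding f1_def[abs_def] by (intro continuous_intros f(2) \<delta>c wS)
 \<comment> \<open>An error below \<open>\<delta> * wt k\<close> is, after division by \<delta>, a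
   change of the direction \<open>w\<close> by less than \<open>wt k\<close>.\<close>
 define \<eta> where "\<eta> x = min (\<delta> x * wt k x) (\<epsilon> x / 8) / 2" for x
 have \<eta>sa: "sa_fun \<eta>" unfolding \<eta>_def[abs_def] by (intro sa_intros \<delta>sa \<epsilon>(1) wtsa)
 have \<eta>c: "continuous_on S \<eta>" unfolding \<eta>_def[abs_def] by (intro continuous_intros \<delta>c \<epsilon>(2) wtc) auto
 have \<eta>pos: "\<eta> x > 0" if "x \<in> S" for x
  using \<delta>(1)[OF that] \<epsilon>(3)[OF that] wt_pos[OF k(1), of x] by (simp add: \<eta>_def)
 obtain l where l: "l \<ge> 1" "\<And>x. x \<in> S \<Longrightarrow> wt l x \<le> \<eta> x"
  by (rule lojasiewicz_continuous[OF S \<eta>sa \<eta>c \<eta>pos]) (assumption, rule that)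
 obtain g where g: "nash_on UNIV g" "\<And>x. x \<in> S \<Longrightarrow> norm (g x - f1 x) \<le> wt l x"
  by (rule nash_approximation[OF S f1sa f1c l(1)]) (rule that)
 show thesis
 proof (rule that[OF g(1)])
  fix x assume x: "x \<in> S"
  note \<delta>x = \<delta>[OF x]
  have s: "wt k x > 0" by (rule wt_pos[OF k(1)])
  have le: "norm (g x - f1 x) \<le> \<eta> x" using g(2)[OF x] l(2)[OF x] by linarith
  have p: "\<delta> x * wt k x > 0" using \<delta>x(1) s by simp
  have e1: "\<eta> x < \<delta> x * wt k x" "\<eta> x \<le> \<epsilon> x / 16"
   using p by (auto simp: \<eta>_def min_less_iff_disj)
  \<comment> \<open>\<open>g x\<close> is read as \<open>f x\<close> plus \<delta> times a perturbed
    direction, so the approximation error is absorbed by the freedom in \<open>v'\<close>.\<close>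
  let ?v = "w x + (g x - f1 x) /\<^sub>R \<delta> x"
  have "dist ?v (w x) = norm (g x - f1 x) / \<delta> x" using \<delta>x(1) by (simp add: dist_norm divide_inverse mult.commute)
  also have "\<dots> < wt k x" using le e1(1) \<delta>x(1) by (simp add: pos_divide_less_eq mult.commute)
  finally have dv: "dist ?v (w x) < wt k x" .
  have fA: "f x \<in> A" using f(3) x QA by blast
  have "f x + \<delta> x *\<^sub>R ?v \<in> A"
   by (rule inwardD[OF k(2)[OF x] fA _ dv \<delta>x(1,2)]) (use s in simp)
  also have "f x + \<delta> x *\<^sub>R ?v = g x" using \<delta>x(1) by (simp add: f1_def scaleR_add_right)
  finally show "g x \<in> retract_dom M \<and> retract_map M (g x) \<in> Q" by (simp add: A_def)
  have "dist (g x) (f x) \<le> dist (g x) (f1 x) + dist (f1 x) (f x)" by (rule dist_triangle)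
  also have "dist (f1 x) (f x) = \<delta> x * norm (w x)" using \<delta>x(1) by (simp add: f1_def dist_norm)
  also have "dist (g x) (f1 x) + \<delta> x * norm (w x) \<le> \<epsilon> x / 16 + \<epsilon> x / 8" using le e1(2) \<delta>x(3) by (intro add_mono) (auto simp: dist_norm)
  also have "\<dots> < \<epsilon> x" using \<epsilon>(3)[OF x] by simp
  finally show "dist (g x) (f x) < \<epsilon> x" .
 qed
qed

theorem theorem1p6:
 fixes S :: "(real^'m) set" and Q :: "(real^'n) set" and d :: nat
  and f :: "real^'m \<Rightarrow> real^'n" and \<epsilon> :: "real^'m \<Rightarrow> real"
 assumes "semialgebraic S" and "locally compact S"
  and "nash_manifold_with_corners d Q" and "divisorial_corners d Q"
  and "continuous_on S f" and "f ` S \<subseteq> Q" and "semialgebraic_map S f"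
  and "continuous_on S \<epsilon>" and "semialgebraic_map S \<epsilon>" and "\<forall>x\<in>S. \<epsilon> x > 0"
 shows "\<exists>g. nash_map_on S g \<and> g ` S \<subseteq> Q \<and> (\<forall>x\<in>S. norm (f x - g x) < \<epsilon> x)"
proof -
 have Q: "submanifold_with_corners d Q" "semialgebraic Q"
  using assms(3) by (simp_all add: nash_manifold_with_corners_def)
 obtain M where "nash_manifold d M" and QM: "Q \<subseteq> M"
  using assms(4) unfolding divisorial_corners_def by (elim exE conjE) (rule that)
 then have M: "submanifold d M" "semialgebraic M" by (simp_all add: nash_manifold_def)
 obtain K and \<nu> :: "real^'m \<Rightarrow> real" where K: "closed K" "semialgebraic K" "S \<inter> K = {}"
  and \<nu>: "nash_on (- K) \<nu>" "\<And>x. x \<in> S \<Longrightarrow> \<nu> x > 0" "\<And>x. x \<notin> K \<Longrightarrow> \<nu> x > 0"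
  and S': "closed {z. fst z \<in> S \<and> snd z * \<nu> (fst z) = 1}" "semialgebraic {z. fst z \<in> S \<and> snd z * \<nu> (fst z) = 1}"
  by (rule locally_closed_graph[OF assms(1,2)]) (rule that)
 let ?S' = "{z. fst z \<in> S \<and> snd z * \<nu> (fst z) = 1}"
 \<comment> \<open>Half of \<epsilon>, as the retraction at most doubles distances; the extensions
   by 0 give total semialgebraic functions.\<close>
 let ?f = "\<lambda>x. if x \<in> S then f x else 0" and ?\<epsilon> = "\<lambda>x. if x \<in> S then \<epsilon> x / 2 else 0"
 have fc: "continuous_on ?S' (\<lambda>z. ?f (fst z))"
 proof -
  have "continuous_on ?S' (\<lambda>z. f (fst z))"
   by (rule continuous_on_compose2[OF assms(5)]) (auto intro!: continuous_intros)
  then show ?thesis by (rule continuous_on_eq) simp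
 qed
 have \<epsilon>c: "continuous_on ?S' (\<lambda>z. \<epsilon> (fst z) / 2)"
  by (intro continuous_on_divide continuous_on_const continuous_on_compose2[OF assms(8)])
   (auto intro!: continuous_intros)
 have \<epsilon>c': "continuous_on ?S' (\<lambda>z. (if fst z \<in> S then \<epsilon> (fst z) else 0) / 2)"
  using \<epsilon>c by (rule continuous_on_eq) simp
 have fsa: "sa_fun (\<lambda>z::(real^'m) \<times> real. ?f (fst z))"
  by (rule sa_fun_compose[OF semialgebraic_map_zero_ext(2)[OF assms(7)] sa_fun_fst[OF sa_fun_id]])
 have "sa_fun (\<lambda>z::(real^'m) \<times> real. if fst z \<in> S then \<epsilon> (fst z) else 0)"
  by (rule sa_fun_compose[OF semialgebraic_map_zero_ext(2)[OF assms(9)] sa_fun_fst[OF sa_fun_id]])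
 then have \<epsilon>sa: "sa_fun (\<lambda>z::(real^'m) \<times> real. (if fst z \<in> S then \<epsilon> (fst z) else 0) / 2)"
  by (intro sa_intros)
 have fim: "(\<lambda>z. ?f (fst z)) ` ?S' \<subseteq> Q" using assms(6) by auto
 have \<epsilon>pos: "(if fst z \<in> S then \<epsilon> (fst z) else 0) / 2 > 0" if "z \<in> ?S'" for z
  using assms(10) that by auto
 obtain h where h: "nash_on UNIV h" "\<And>z. z \<in> ?S' \<Longrightarrow> h z \<in> retract_dom M \<and> retract_map M (h z) \<in> Q"
  "\<And>z. z \<in> ?S' \<Longrightarrow> dist (h z) (?f (fst z)) < (if fst z \<in> S then \<epsilon> (fst z) else 0) / 2"
  by (rule approximation_on_closed[OF M Q(1) QM Q(2) S' fsa fc fim \<epsilon>sa \<epsilon>c' \<epsilon>pos]) (assumption, rule that)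
 \<comment> \<open>Pullback along the embedding of \<open>S\<close> as a closed graph; it is Nash on
   the whole neighbourhood \<open>- K\<close> of \<open>S\<close>.\<close>
 define H where "H x = h (x, 1 / \<nu> x)" for x
 have oK: "open (- K)" using K(1) by auto
 have \<nu>0: "\<nu> x \<noteq> 0" if "x \<in> - K" for x using \<nu>(3)[of x] that by auto
 have nP: "nash_on (- K) (\<lambda>x. (x, 1 / \<nu> x))"
  by (intro nash_on_Pair nash_on_divide nash_on_const nash_on_ident oK \<nu>(1) \<nu>0)
 have nH: "nash_on (- K) H" unfolding H_def[abs_def]
  by (rule nash_on_compose[OF h(1) nP]) simp
 \<comment> \<open>The open semialgebraic neighbourhood that a Nash map requires: the points at
   which the retraction can be applied to \<open>H\<close>.\<close>
 define U where "U = - K \<inter> H -` retract_dom M"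
 have n\<pi>: "nash_on (retract_dom M) (retract_map M)" by (rule nash_on_retract_map[OF M])
 have U: "open U" unfolding U_def
  by (rule continuous_open_preimage[OF nash_on_continuous_on[OF nH] oK nash_on_open[OF n\<pi>]])
 have Usa: "semialgebraic U"
 proof -
  have "U = {x. \<not> x \<in> K \<and> H x \<in> retract_dom M}" by (auto simp: U_def)
  also have "semialgebraic \<dots>"
   by (intro sa_intros semialgebraic_mem K semialgebraic_retract_dom M nash_on_sa_fun[OF nH])
  finally show ?thesis .
 qed
 have nG: "nash_on U (\<lambda>x. retract_map M (H x))"
  by (rule nash_on_compose[OF n\<pi> nash_on_subset[OF nH _ U]]) (auto simp: U_def)
 have z: "(x, 1 / \<nu> x) \<in> ?S'" if "x \<in> S" for x using that \<nu>(2)[OF that] by simp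
 have HS: "H x \<in> retract_dom M" "retract_map M (H x) \<in> Q" "dist (H x) (f x) < \<epsilon> x / 2" if "x \<in> S" for x
  using h(2,3)[OF z[OF that]] that by (simp_all add: H_def)
 have SU: "S \<subseteq> U" using HS(1) K(3) by (auto simp: U_def)
 show ?thesis
 proof (intro exI conjI ballI)
  show "nash_map_on S (\<lambda>x. retract_map M (H x))" by (rule nash_map_on_nash_on[OF nG Usa SU refl])
  show "(\<lambda>x. retract_map M (H x)) ` S \<subseteq> Q" using HS(2) by blast
  fix x assume x: "x \<in> S"
  have "f x \<in> M" using assms(6) QM x by blast
  from near_pt_lipschitz[OF near_pt_self[OF this] retract_map[OF HS(1)[OF x]]]
  have "dist (f x) (retract_map M (H x)) \<le> 2 * dist (f x) (H x)" .
  then show "norm (f x - retract_map M (H x)) < \<epsilon> x"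
   using HS(3)[OF x] by (simp add: dist_norm norm_minus_commute)
 qed
qed

end
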